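(* Let $A$ be a commutative ring, let $n\ge1$ be an integer, and let $S$ be a multiplicatively closed subset, containing $1$, of the polynomial ring $A[X]$ in one variable over $A$. Let $Z_1,\dots,Z_n$ be independent variables over $A$ and let $c_i(Z)$ be the $i$-th elementary symmetric function in $Z_1,\dots,Z_n$. Then the functor $\mathcal{H}ilb^n_{S^{-1}A[X]/A}$ is represented by the $A$-algebra obtained from the polynomial ring $A[c_1(Z),\dots,c_n(Z)]$ by localizing in the elements $\prod_{i=1}^ns(Z_i)$ for all $s\in S$.
   Context: For a commutative $A$-algebra $R$, $\mathcal{H}ilb^n_{R/A}$ is the functor from commutative $A$-algebras to sets that to $B$ associates the set of surjective $B$-algebra homomorphisms $\varphi:B\otimes_AR\to Q$ with $Q$ a locally free $B$-module of rank $n$, two such being identified if they have the same kernel. The elements $\prod_{i=1}^ns(Z_i)$ are symmetric in $Z_1,\dots,Z_n$ and hence lie in $A[c_1(Z),\dots,c_n(Z)]$. *)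

theory Defs
  imports "HOL-Algebra.Algebra"
begin

text \<open>
  Commutative algebras over a commutative ring \<open>A\<close> are records \<open>B\<close> with \<open>algebra A B\<close>
  (theory \<^theory>\<open>HOL-Algebra.Module\<close>).
\<close>

section \<open>Algebras and their homomorphisms\<close>

definition algebra_via :: "('b, 'z) ring_scheme \<Rightarrow> ('a \<Rightarrow> 'b) \<Rightarrow> ('a, 'b) module"
  where "algebra_via R h =
    \<lparr>carrier = carrier R, monoid.mult = monoid.mult R, monoid.one = monoid.one R,
     ring.zero = ring.zero R, ring.add = ring.add R,
     smult = (\<lambda>a x. h a \<otimes>\<^bsub>R\<^esub> x)\<rparr>"

text \<open>Extensionality makes homomorphisms that agree on the carrier equal.\<close>

definition alg_hom ::
    "('a, 'y) ring_scheme \<Rightarrow> ('a, 'b, 'z) module_scheme \<Rightarrow> ('a, 'c, 'w) module_scheme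
      \<Rightarrow> ('b \<Rightarrow> 'c) set"
  where "alg_hom A B C =
    {h \<in> ring_hom B C \<inter> extensional (carrier B).
       \<forall>a\<in>carrier A. \<forall>x\<in>carrier B. h (a \<odot>\<^bsub>B\<^esub> x) = a \<odot>\<^bsub>C\<^esub> h x}"

section \<open>Localization\<close>

definition frac_rel :: "('s, 'm, 'z) module_scheme \<Rightarrow> 's set \<Rightarrow> (('m \<times> 's) \<times> ('m \<times> 's)) set"
  where "frac_rel M T =
    {((m, s), (m', s')). m \<in> carrier M \<and> s \<in> T \<and> m' \<in> carrier M \<and> s' \<in> T \<and>
       (\<exists>u\<in>T. u \<odot>\<^bsub>M\<^esub> (s' \<odot>\<^bsub>M\<^esub> m) = u \<odot>\<^bsub>M\<^esub> (s \<odot>\<^bsub>M\<^esub> m'))}"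

definition loc_frac :: "('s, 'm, 'z) module_scheme \<Rightarrow> 's set \<Rightarrow> 'm \<Rightarrow> 's \<Rightarrow> ('m \<times> 's) set"
  where "loc_frac M T m s = frac_rel M T `` {(m, s)}"

text \<open>In the next three definitions the set of denominators is a submonoid of the
  multiplicative monoid of the ring it is taken from.\<close>

definition loc_ring :: "('r, 'z) ring_scheme \<Rightarrow> 'r set \<Rightarrow> ('r \<times> 'r) set ring"
  where "loc_ring R T =
    (let F = loc_frac (algebra_via R (\<lambda>x. x)) T in
     \<lparr>carrier = (carrier R \<times> T) // frac_rel (algebra_via R (\<lambda>x. x)) T,
      monoid.mult = (\<lambda>x y. \<Union>(r, s)\<in>x. \<Union>(r', s')\<in>y. F (r \<otimes>\<^bsub>R\<^esub> r') (s \<otimes>\<^bsub>R\<^esub> s')),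
      monoid.one = F \<one>\<^bsub>R\<^esub> \<one>\<^bsub>R\<^esub>,
      ring.zero = F \<zero>\<^bsub>R\<^esub> \<one>\<^bsub>R\<^esub>,
      ring.add = (\<lambda>x y. \<Union>(r, s)\<in>x. \<Union>(r', s')\<in>y.
               F ((s' \<otimes>\<^bsub>R\<^esub> r) \<oplus>\<^bsub>R\<^esub> (s \<otimes>\<^bsub>R\<^esub> r')) (s \<otimes>\<^bsub>R\<^esub> s'))\<rparr>)"

definition loc_algebra :: "('a, 'r, 'z) module_scheme \<Rightarrow> 'r set \<Rightarrow> ('a, ('r \<times> 'r) set) module"
  where "loc_algebra R T =
    algebra_via (loc_ring R T) (\<lambda>a. loc_frac (algebra_via R (\<lambda>x. x)) T (a \<odot>\<^bsub>R\<^esub> \<one>\<^bsub>R\<^esub>) \<one>\<^bsub>R\<^esub>)"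

text \<open>The multiplicative fields of a \<^type>\<open>module_ext\<close> record play no role for a module.\<close>

definition loc_module ::
    "('b, 'y) ring_scheme \<Rightarrow> 'b set \<Rightarrow> ('b, 'm, 'z) module_scheme
      \<Rightarrow> (('b \<times> 'b) set, ('m \<times> 'b) set) module"
  where "loc_module B T M =
    \<lparr>carrier = (carrier M \<times> T) // frac_rel M T,
     monoid.mult = undefined,
     monoid.one = undefined,
     ring.zero = loc_frac M T \<zero>\<^bsub>M\<^esub> \<one>\<^bsub>B\<^esub>,
     ring.add = (\<lambda>x y. \<Union>(m, s)\<in>x. \<Union>(m', s')\<in>y.
              loc_frac M T ((s' \<odot>\<^bsub>M\<^esub> m) \<oplus>\<^bsub>M\<^esub> (s \<odot>\<^bsub>M\<^esub> m')) (s \<otimes>\<^bsub>B\<^esub> s')),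
     smult = (\<lambda>x y. \<Union>(b, s)\<in>x. \<Union>(m, t)\<in>y. loc_frac M T (b \<odot>\<^bsub>M\<^esub> m) (s \<otimes>\<^bsub>B\<^esub> t))\<rparr>"

section \<open>Locally free modules\<close>

definition free_of_rank :: "('b, 'y) ring_scheme \<Rightarrow> ('b, 'm, 'z) module_scheme \<Rightarrow> nat \<Rightarrow> bool"
  where "free_of_rank B M n \<longleftrightarrow>
    (\<exists>e \<in> {..<n} \<rightarrow> carrier M. \<forall>m\<in>carrier M.
       \<exists>!c. c \<in> {..<n} \<rightarrow>\<^sub>E carrier B \<and> m = (\<Oplus>\<^bsub>M\<^esub>i\<in>{..<n}. c i \<odot>\<^bsub>M\<^esub> e i))"

text \<open>Every point \<open>P\<close> of the spectrum of \<open>B\<close> has a basic open neighbourhood \<open>D(f)\<close> over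
  which \<open>M\<close> is free of rank \<open>n\<close>.\<close>

definition locally_free_of_rank ::
    "('b, 'y) ring_scheme \<Rightarrow> ('b, 'm, 'z) module_scheme \<Rightarrow> nat \<Rightarrow> bool"
  where "locally_free_of_rank B M n \<longleftrightarrow>
    (\<forall>P. primeideal P B \<longrightarrow>
       (\<exists>f \<in> carrier B - P.
          let T = range (\<lambda>k::nat. f [^]\<^bsub>B\<^esub> k)
          in free_of_rank (loc_ring B T) (loc_module B T M) n))"

section \<open>Monoid rings\<close>

definition monoid_ring :: "('k, 'y) ring_scheme \<Rightarrow> ('m, 'z) monoid_scheme \<Rightarrow> ('m \<Rightarrow> 'k) ring"
  where "monoid_ring K M =
    \<lparr>carrier = {p. range p \<subseteq> carrier K \<and> {x. p x \<noteq> \<zero>\<^bsub>K\<^esub>} \<subseteq> carrier M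
                  \<and> finite {x. p x \<noteq> \<zero>\<^bsub>K\<^esub>}},
     monoid.mult = (\<lambda>p q x. \<Oplus>\<^bsub>K\<^esub>yz\<in>{(y, z). p y \<noteq> \<zero>\<^bsub>K\<^esub> \<and> q z \<noteq> \<zero>\<^bsub>K\<^esub> \<and> y \<otimes>\<^bsub>M\<^esub> z = x}.
               p (fst yz) \<otimes>\<^bsub>K\<^esub> q (snd yz)),
     monoid.one = (\<lambda>x. if x = \<one>\<^bsub>M\<^esub> then \<one>\<^bsub>K\<^esub> else \<zero>\<^bsub>K\<^esub>),
     ring.zero = (\<lambda>x. \<zero>\<^bsub>K\<^esub>),
     ring.add = (\<lambda>p q x. p x \<oplus>\<^bsub>K\<^esub> q x)\<rparr>"

definition mterm :: "('k, 'y) ring_scheme \<Rightarrow> 'm \<Rightarrow> 'k \<Rightarrow> ('m \<Rightarrow> 'k)"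
  where "mterm K m a = (\<lambda>x. if x = m then a else \<zero>\<^bsub>K\<^esub>)"

section \<open>Tensor products of algebras\<close>

text \<open>
  As an abelian group, \<open>B \<otimes>\<^sub>A R\<close> is the free abelian group on \<open>B \<times> R\<close> modulo the subgroup
  generated by the relations below.  That free group is the integral monoid ring of the
  multiplicative monoid \<open>B \<times> R\<close>, and as the set of relations is stable under
  multiplication by basis elements, the subgroup is the ideal that the relations generate.
\<close>

definition tensor_free :: "('a, 'b, 'y) module_scheme \<Rightarrow> ('a, 'r, 'z) module_scheme
      \<Rightarrow> ('b \<times> 'r \<Rightarrow> int) ring"
  where "tensor_free B R = monoid_ring \<Z> (B \<times>\<times> R)"

definition tensor_rels :: "('a, 'x) ring_scheme \<Rightarrow> ('a, 'b, 'y) module_scheme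
      \<Rightarrow> ('a, 'r, 'z) module_scheme \<Rightarrow> ('b \<times> 'r \<Rightarrow> int) set"
  where "tensor_rels A B R =
    (let F = tensor_free B R; e = (\<lambda>b r. mterm \<Z> (b, r) 1) in
       {e (b \<oplus>\<^bsub>B\<^esub> b') r \<ominus>\<^bsub>F\<^esub> (e b r \<oplus>\<^bsub>F\<^esub> e b' r) | b b' r.
          b \<in> carrier B \<and> b' \<in> carrier B \<and> r \<in> carrier R}
     \<union> {e b (r \<oplus>\<^bsub>R\<^esub> r') \<ominus>\<^bsub>F\<^esub> (e b r \<oplus>\<^bsub>F\<^esub> e b r') | b r r'.
          b \<in> carrier B \<and> r \<in> carrier R \<and> r' \<in> carrier R}
     \<union> {e (a \<odot>\<^bsub>B\<^esub> b) r \<ominus>\<^bsub>F\<^esub> e b (a \<odot>\<^bsub>R\<^esub> r) | a b r.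
          a \<in> carrier A \<and> b \<in> carrier B \<and> r \<in> carrier R})"

definition tens :: "('a, 'x) ring_scheme \<Rightarrow> ('a, 'b, 'y) module_scheme
      \<Rightarrow> ('a, 'r, 'z) module_scheme \<Rightarrow> 'b \<Rightarrow> 'r \<Rightarrow> ('b \<times> 'r \<Rightarrow> int) set"
  where "tens A B R b r =
    Idl\<^bsub>tensor_free B R\<^esub> (tensor_rels A B R) +>\<^bsub>tensor_free B R\<^esub> mterm \<Z> (b, r) 1"

definition tensor :: "('a, 'x) ring_scheme \<Rightarrow> ('a, 'b, 'y) module_scheme
      \<Rightarrow> ('a, 'r, 'z) module_scheme \<Rightarrow> ('b, ('b \<times> 'r \<Rightarrow> int) set) module"
  where "tensor A B R =
    algebra_via (tensor_free B R Quot Idl\<^bsub>tensor_free B R\<^esub> (tensor_rels A B R))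
      (\<lambda>b. tens A B R b \<one>\<^bsub>R\<^esub>)"

section \<open>The Hilbert functor\<close>

text \<open>
  A class of surjections \<open>B \<otimes>\<^sub>A R \<rightarrow> Q\<close> with the same kernel is recorded by that kernel.
  HOL cannot quantify over the type of \<open>Q\<close>; the type chosen here is that of the quotients of
  \<open>B \<otimes>\<^sub>A R\<close>, so that every class has a representative.
\<close>

definition hilb :: "('a, 'x) ring_scheme \<Rightarrow> ('a, 'r, 'z) module_scheme \<Rightarrow> nat
      \<Rightarrow> ('a, 'b) module \<Rightarrow> ('b \<times> 'r \<Rightarrow> int) set set set"
  where "hilb A R n B =
    {a_kernel (tensor A B R) Q \<phi> | (Q :: ('b, ('b \<times> 'r \<Rightarrow> int) set set) module) \<phi>.
       algebra B Q \<and> locally_free_of_rank B Q n \<and>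
       \<phi> \<in> alg_hom B (tensor A B R) Q \<and> \<phi> ` carrier (tensor A B R) = carrier Q}"

text \<open>
  Along \<open>f : B \<rightarrow> B'\<close> the class of \<open>\<phi> : B \<otimes>\<^sub>A R \<rightarrow> Q\<close> is sent to the class of its base change
  \<open>B' \<otimes>\<^sub>A R = B' \<otimes>\<^sub>B (B \<otimes>\<^sub>A R) \<rightarrow> B' \<otimes>\<^sub>B Q\<close>, which takes \<open>b' \<otimes> r\<close> to \<open>b' \<otimes> \<phi>(1 \<otimes> r)\<close>.
  The representative used is the projection onto the quotient by the kernel.
\<close>

definition hilb_map :: "('a, 'x) ring_scheme \<Rightarrow> ('a, 'r, 'z) module_scheme
      \<Rightarrow> ('a, 'b) module \<Rightarrow> ('a, 'b) module \<Rightarrow> ('b \<Rightarrow> 'b)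
      \<Rightarrow> ('b \<times> 'r \<Rightarrow> int) set set \<Rightarrow> ('b \<times> 'r \<Rightarrow> int) set set"
  where "hilb_map A R B B' f I =
    (let T = tensor A B R;
         T' = tensor A B' R;
         Q = algebra_via (T Quot I) (\<lambda>b. I +>\<^bsub>T\<^esub> tens A B R b \<one>\<^bsub>R\<^esub>);
         fB' = algebra_via B' f;
         Q' = tensor B fB' Q;
         \<psi> = (THE \<psi>. \<psi> \<in> alg_hom B' T' Q' \<and>
               (\<forall>b'\<in>carrier B'. \<forall>r\<in>carrier R.
                  \<psi> (tens A B' R b' r) = tens B fB' Q b' (I +>\<^bsub>T\<^esub> tens A B R \<one>\<^bsub>B\<^esub> r)))
     in a_kernel T' Q' \<psi>)"

text \<open>
  \<open>F\<close> and \<open>Fmap\<close> are the object and arrow parts of a set-valued functor on the category of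
  commutative \<open>A\<close>-algebras with carrier in the type \<open>'b\<close>, which acts as the universe; \<open>H\<close> may
  live in another type.
\<close>

definition represented_by :: "('a, 'x) ring_scheme \<Rightarrow> (('a, 'b) module \<Rightarrow> 's set)
      \<Rightarrow> (('a, 'b) module \<Rightarrow> ('a, 'b) module \<Rightarrow> ('b \<Rightarrow> 'b) \<Rightarrow> 's \<Rightarrow> 's)
      \<Rightarrow> ('a, 'h) module \<Rightarrow> bool"
  where "represented_by A F Fmap H \<longleftrightarrow>
    algebra A H \<and>
    (\<exists>\<Phi>. (\<forall>B. algebra A B \<longrightarrow> bij_betw (\<Phi> B) (alg_hom A H B) (F B)) \<and>
         (\<forall>B B' f g. algebra A B \<longrightarrow> algebra A B' \<longrightarrow> f \<in> alg_hom A B B' \<longrightarrow>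
            g \<in> alg_hom A H B \<longrightarrow>
            \<Phi> B' (compose (carrier H) f g) = Fmap B B' f (\<Phi> B g)))"

section \<open>Polynomials in several variables and elementary symmetric functions\<close>

definition monomials :: "nat \<Rightarrow> nat multiset monoid"
  where "monomials n = \<lparr>carrier = {m. set_mset m \<subseteq> {1..n}}, monoid.mult = (+), monoid.one = {#}\<rparr>"

definition mpoly :: "('a, 'x) ring_scheme \<Rightarrow> nat \<Rightarrow> ('a, nat multiset \<Rightarrow> 'a) module"
  where "mpoly A n = algebra_via (monoid_ring A (monomials n)) (mterm A {#})"

definition Z_var :: "('a, 'x) ring_scheme \<Rightarrow> nat \<Rightarrow> (nat multiset \<Rightarrow> 'a)"
  where "Z_var A i = mterm A {#i#} \<one>\<^bsub>A\<^esub>"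

definition elem_sym :: "('a, 'x) ring_scheme \<Rightarrow> nat \<Rightarrow> nat \<Rightarrow> (nat multiset \<Rightarrow> 'a)"
  where "elem_sym A n i =
    (\<Oplus>\<^bsub>mpoly A n\<^esub>J\<in>{J. J \<subseteq> {1..n} \<and> card J = i}. \<Otimes>\<^bsub>mpoly A n\<^esub>j\<in>J. Z_var A j)"

definition elem_sym_algebra :: "('a, 'x) ring_scheme \<Rightarrow> nat \<Rightarrow> ('a, nat multiset \<Rightarrow> 'a) module"
  where "elem_sym_algebra A n =
    (mpoly A n)\<lparr>carrier :=
       generate_ring (mpoly A n) (mterm A {#} ` carrier A \<union> elem_sym A n ` {1..n})\<rparr>"

text \<open>The products of the \<open>s(Z\<^sub>i)\<close> for \<open>s\<close> in a submonoid form a submonoid, so it is a legitimate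
  set of denominators.\<close>

definition prod_eval :: "('a, 'x) ring_scheme \<Rightarrow> nat \<Rightarrow> (nat \<Rightarrow> 'a) \<Rightarrow> (nat multiset \<Rightarrow> 'a)"
  where "prod_eval A n s =
    (\<Otimes>\<^bsub>mpoly A n\<^esub>i\<in>{1..n}. eval A (mpoly A n) (mterm A {#}) (Z_var A i) s)"

end

theory Submission
  imports Defs "HOL-Library.Multiset_Order" "HOL-Combinatorics.Permutations"
begin

text \<open>
  A point of the Hilbert functor over \<open>B\<close> is a quotient \<open>Q\<close> of \<open>B \<otimes> S\<^bsup>-1\<^esup>A[X]\<close> that is locally
  free of rank \<open>n\<close>.  Write \<open>x\<close> for the image of \<open>X\<close>.  By Cayley-Hamilton, units of \<open>Q\<close> in the image
  of \<open>B[x]\<close> have their inverses there too, so \<open>B[x]\<close> maps onto \<open>Q\<close>, and the characteristic polynomial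
  of \<open>x\<close> shows that \<open>1, x, \<dots>, x\<^bsup>n-1\<^esup>\<close> generate \<open>Q\<close>; being \<open>n\<close> generators of a module of rank \<open>n\<close>, they
  form a basis.  Hence the points are the monic polynomials \<open>F\<close> of degree \<open>n\<close> over \<open>B\<close> such that
  every \<open>s \<in> S\<close> becomes a unit in \<open>B[x]/(F)\<close>, that is, has a norm that is a unit of \<open>B\<close>.  As
  \<open>A[c\<^sub>1(Z), \<dots>, c\<^sub>n(Z)]\<close> is a polynomial ring in the \<open>c\<^sub>i(Z)\<close>, its homomorphisms to \<open>B\<close> are the choices
  of \<open>F\<close>.  The norm of \<open>s\<close> is the image of \<open>\<Prod>\<^sub>i s(Z\<^sub>i)\<close>: the Vandermonde matrix of the \<open>Z\<^sub>i\<close>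
  intertwines multiplication by \<open>s\<close> modulo \<open>\<Prod>\<^sub>i (x - Z\<^sub>i)\<close> with the diagonal matrix of the \<open>s(Z\<^sub>i)\<close>, and its
  determinant can be cancelled, because its leading coefficient is \<open>1\<close>.
\<close>

section \<open>Finite sums\<close>

text \<open>Bases of \<open>Q\<close> exist only over basic open sets \<open>D(f)\<close>. The local
  arguments nevertheless take place in \<open>Q\<close> itself: each equation carries an explicit
  multiplier from the powers of \<open>f\<close>, and localized modules appear only where the
  definition of local freeness is unfolded or verified. For a given statement the admissible
  multipliers form an ideal of \<open>B\<close> that no maximal ideal contains, which makes it
  global. The ring \<open>A\<close> may have zero divisors and need not be reduced, so degrees and
  leading terms are handled as bounds together with one coefficient, and cancellation always goes
  through a coefficient \<open>1\<close>. In several variables the monomial order is the multiset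
  order on multisets of indices. Norms over different rings are compared through one universal
  matrix, computed over \<open>A[c_1(Z), ..., c_n(Z)]\<close> and specialized along homomorphisms.
  Points are compared as kernels: a quotient of \<open>B \<otimes> R\<close> is matched with
  \<open>B[x]/(F)\<close> by a map along which the powers of \<open>x\<close> below \<open>n\<close>
  stay independent. The same criterion settles base change.\<close>

lemma (in comm_monoid) finprod_fibre:
  assumes "finite P" "g \<in> P \<rightarrow> carrier G"
  shows "finprod G g P = (\<Otimes>x\<in>f ` P. \<Otimes>i\<in>{i \<in> P. f i = x}. g i)"
proof -
  have "P = (\<Union>x\<in>f ` P. {i \<in> P. f i = x})" by auto
  then have "finprod G g P = finprod G g (\<Union>x\<in>f ` P. {i \<in> P. f i = x})" by simp
  also have "\<dots> = (\<Otimes>x\<in>f ` P. \<Otimes>i\<in>{i \<in> P. f i = x}. g i)"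
    by (rule finprod_UN_disjoint) (use assms in \<open>auto simp: pairwise_def disjnt_def\<close>)
  finally show ?thesis .
qed

lemma (in comm_monoid) finprod_Sigma:
  assumes "finite A" "\<And>a. a \<in> A \<Longrightarrow> finite (B a)"
    and "\<And>a b. \<lbrakk>a \<in> A; b \<in> B a\<rbrakk> \<Longrightarrow> g (a, b) \<in> carrier G"
  shows "finprod G g (Sigma A B) = (\<Otimes>a\<in>A. \<Otimes>b\<in>B a. g (a, b))"
proof -
  have "Sigma A B = (\<Union>a\<in>A. Pair a ` B a)" by auto
  then have "finprod G g (Sigma A B) = finprod G g (\<Union>a\<in>A. Pair a ` B a)" by simp
  also have "\<dots> = (\<Otimes>a\<in>A. finprod G g (Pair a ` B a))"
    by (rule finprod_UN_disjoint) (use assms in \<open>auto simp: pairwise_def disjnt_def\<close>)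
  also have "\<dots> = (\<Otimes>a\<in>A. \<Otimes>b\<in>B a. g (a, b))"
    by (rule finprod_cong') (use assms in \<open>auto intro!: finprod_reindex simp: inj_on_def\<close>)
  finally show ?thesis .
qed

lemma (in comm_monoid) finprod_swap:
  assumes "finite A" "finite B"
    and "\<And>a b. \<lbrakk>a \<in> A; b \<in> B\<rbrakk> \<Longrightarrow> g a b \<in> carrier G"
  shows "(\<Otimes>a\<in>A. \<Otimes>b\<in>B. g a b) = (\<Otimes>b\<in>B. \<Otimes>a\<in>A. g a b)"
proof -
  have "(\<Otimes>a\<in>A. \<Otimes>b\<in>B. g a b) = finprod G (\<lambda>(a, b). g a b) (A \<times> B)"
    using assms by (subst finprod_Sigma) auto
  also have "A \<times> B = prod.swap ` (B \<times> A)" by auto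
  also have "finprod G (\<lambda>(a, b). g a b) (prod.swap ` (B \<times> A))
      = finprod G (\<lambda>x. (\<lambda>(a, b). g a b) (prod.swap x)) (B \<times> A)"
    by (rule finprod_reindex) (use assms in \<open>auto simp: inj_on_def\<close>)
  also have "\<dots> = (\<Otimes>b\<in>B. \<Otimes>a\<in>A. g a b)"
    using assms by (subst finprod_Sigma) auto
  finally show ?thesis .
qed

lemma (in comm_monoid) finprod_single:
  assumes "finite A" "i \<in> A" "f i \<in> carrier G" "\<And>j. \<lbrakk>j \<in> A; j \<noteq> i\<rbrakk> \<Longrightarrow> f j = \<one>"
  shows "finprod G f A = f i"
proof -
  have "finprod G f A = finprod G (\<lambda>j. if i = j then f j else \<one>) A"
    by (rule finprod_cong') (use assms in auto)
  also have "\<dots> = finprod G (\<lambda>j. if i = j then f i else \<one>) A"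
    by (rule finprod_cong') (use assms in auto)
  also have "\<dots> = f i" using finprod_singleton[of i A "\<lambda>_. f i"] assms by simp
  finally show ?thesis .
qed

lemmas (in abelian_monoid) finsum_fibre = add.finprod_fibre
lemmas (in abelian_monoid) finsum_Sigma = add.finprod_Sigma
lemmas (in abelian_monoid) finsum_swap = add.finprod_swap
lemmas (in abelian_monoid) finsum_single = add.finprod_single
lemmas (in abelian_monoid) finsum_mono_neutral_cong_left = add.finprod_mono_neutral_cong_left

lemma (in abelian_group) finsum_minus:
  assumes "f \<in> A \<rightarrow> carrier G" "finite A"
  shows "(\<Oplus>i\<in>A. \<ominus> f i) = \<ominus> (\<Oplus>i\<in>A. f i)"
  using assms(2,1)
proof (induction A rule: finite_induct)
  case empty
  have "\<ominus> \<zero> = \<zero>" by (rule minus_equality) auto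
  then show ?case by (simp only: finsum_empty)
next
  case (insert x F)
  then have "(\<Oplus>i\<in>F. f i) \<in> carrier G" by (auto intro: finsum_closed)
  moreover have "(\<Oplus>i\<in>insert x F. \<ominus> f i) = \<ominus> f x \<oplus> (\<Oplus>i\<in>F. \<ominus> f i)"
    using insert by (intro finsum_insert) auto
  ultimately show ?case using insert by (auto simp: minus_add)
qed

section \<open>Monoid rings\<close>

text \<open>Linear extension of \<open>w\<close> along \<open>h\<close>. Arbitrary \<open>w\<close>
  are allowed, not only multiplicative ones, because the ring laws of a monoid ring are checked by
  means of arbitrary functionals; multiplicative \<open>w\<close> give the homomorphisms of the
  universal property.\<close>

definition mr_eval ::
    "('k, 'y) ring_scheme \<Rightarrow> ('c, 'w) ring_scheme \<Rightarrow> ('k \<Rightarrow> 'c) \<Rightarrow> ('m \<Rightarrow> 'c) \<Rightarrow> ('m \<Rightarrow> 'k) \<Rightarrow> 'c"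
  where "mr_eval K C h w p = (\<Oplus>\<^bsub>C\<^esub>x\<in>{x. p x \<noteq> \<zero>\<^bsub>K\<^esub>}. h (p x) \<otimes>\<^bsub>C\<^esub> w x)"

locale mring = K?: cring K + M: comm_monoid M
  for K :: "('k, 'y) ring_scheme" (structure) and M :: "('m, 'z) monoid_scheme"
begin

abbreviation "KM \<equiv> monoid_ring K M"

lemma carrierD:
  assumes "p \<in> carrier KM"
  shows "p x \<in> carrier K" "finite {x. p x \<noteq> \<zero>}" "p x \<noteq> \<zero> \<Longrightarrow> x \<in> carrier M"
  using assms by (auto simp: monoid_ring_def)

lemma carrierI:
  assumes "\<And>x. p x \<in> carrier K" "{x. p x \<noteq> \<zero>} \<subseteq> Y" "finite Y" "Y \<subseteq> carrier M"
  shows "p \<in> carrier KM"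
  using assms finite_subset by (fastforce simp: monoid_ring_def)

lemma add_apply: "(p \<oplus>\<^bsub>KM\<^esub> q) x = p x \<oplus> q x"
  and zero_apply: "\<zero>\<^bsub>KM\<^esub> x = \<zero>"
  and one_apply: "\<one>\<^bsub>KM\<^esub> x = (if x = \<one>\<^bsub>M\<^esub> then \<one> else \<zero>)"
  by (simp_all add: monoid_ring_def)

lemma one_eq: "\<one>\<^bsub>KM\<^esub> = mterm K \<one>\<^bsub>M\<^esub> \<one>"
  by (simp add: monoid_ring_def mterm_def)

lemma mterm_closed: "\<lbrakk>x \<in> carrier M; a \<in> carrier K\<rbrakk> \<Longrightarrow> mterm K x a \<in> carrier KM"
  by (rule carrierI[where Y="{x}"]) (auto simp: mterm_def)

text \<open>Written as a part of the product of the two supports, the index set is visibly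
  finite.\<close>

lemma mult_apply:
  assumes p: "p \<in> carrier KM" and q: "q \<in> carrier KM"
  shows "(p \<otimes>\<^bsub>KM\<^esub> q) x = (\<Oplus>yz\<in>{yz \<in> {y. p y \<noteq> \<zero>} \<times> {z. q z \<noteq> \<zero>}. fst yz \<otimes>\<^bsub>M\<^esub> snd yz = x}.
               p (fst yz) \<otimes> q (snd yz))"
proof -
  have "{(y, z). p y \<noteq> \<zero> \<and> q z \<noteq> \<zero> \<and> y \<otimes>\<^bsub>M\<^esub> z = x}
     = {yz \<in> {y. p y \<noteq> \<zero>} \<times> {z. q z \<noteq> \<zero>}. fst yz \<otimes>\<^bsub>M\<^esub> snd yz = x}" by auto
  then show ?thesis by (simp add: monoid_ring_def)
qed

lemma mult_supp:
  assumes p: "p \<in> carrier KM" and q: "q \<in> carrier KM"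
  shows "{x. (p \<otimes>\<^bsub>KM\<^esub> q) x \<noteq> \<zero>}
      \<subseteq> (\<lambda>yz. fst yz \<otimes>\<^bsub>M\<^esub> snd yz) ` ({y. p y \<noteq> \<zero>} \<times> {z. q z \<noteq> \<zero>})"
proof clarify
  fix x assume nz: "(p \<otimes>\<^bsub>KM\<^esub> q) x \<noteq> \<zero>"
  have "\<exists>yz \<in> {y. p y \<noteq> \<zero>} \<times> {z. q z \<noteq> \<zero>}. fst yz \<otimes>\<^bsub>M\<^esub> snd yz = x"
  proof (rule ccontr)
    assume "\<not> ?thesis"
    then have "{yz \<in> {y. p y \<noteq> \<zero>} \<times> {z. q z \<noteq> \<zero>}. fst yz \<otimes>\<^bsub>M\<^esub> snd yz = x} = {}" by blast
    then have "(p \<otimes>\<^bsub>KM\<^esub> q) x = \<zero>"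
      by (simp only: mult_apply[OF p q] finsum_empty)
    then show False using nz by simp
  qed
  then show "x \<in> (\<lambda>yz. fst yz \<otimes>\<^bsub>M\<^esub> snd yz) ` ({y. p y \<noteq> \<zero>} \<times> {z. q z \<noteq> \<zero>})" by blast
qed

lemma mult_closed:
  assumes p: "p \<in> carrier KM" and q: "q \<in> carrier KM"
  shows "p \<otimes>\<^bsub>KM\<^esub> q \<in> carrier KM"
proof (rule carrierI[OF _ mult_supp[OF p q]])
  show "(p \<otimes>\<^bsub>KM\<^esub> q) x \<in> carrier K" for x
    unfolding mult_apply[OF p q] by (rule finsum_closed) (auto simp: carrierD[OF p] carrierD[OF q])
qed (use carrierD[OF p] carrierD[OF q] in auto)

text \<open>Sums over different supports become comparable over a common finite index set; the terms
  added are zero.\<close>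

lemma eval_superset:
  assumes "ring_hom_cring K C h" and p: "p \<in> carrier KM" and w: "w \<in> carrier M \<rightarrow> carrier C"
    and Y: "finite Y" "{x. p x \<noteq> \<zero>} \<subseteq> Y" "Y \<subseteq> carrier M"
  shows "mr_eval K C h w p = (\<Oplus>\<^bsub>C\<^esub>x\<in>Y. h (p x) \<otimes>\<^bsub>C\<^esub> w x)"
proof -
  interpret h: ring_hom_cring K C h by fact
  show ?thesis unfolding mr_eval_def
    by (rule h.S.finsum_mono_neutral_cong_left)
      (use Y w carrierD[OF p] in \<open>auto simp: subset_iff Pi_iff\<close>)
qed

lemma eval_closed:
  assumes "ring_hom_cring K C h" and p: "p \<in> carrier KM" and w: "w \<in> carrier M \<rightarrow> carrier C"
  shows "mr_eval K C h w p \<in> carrier C"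
proof -
  interpret h: ring_hom_cring K C h by fact
  show ?thesis unfolding mr_eval_def
    by (rule h.S.finsum_closed) (use w carrierD[OF p] in auto)
qed

lemma add_closed:
  assumes "p \<in> carrier KM" "q \<in> carrier KM"
  shows "p \<oplus>\<^bsub>KM\<^esub> q \<in> carrier KM"
  by (rule carrierI[where Y="{x. p x \<noteq> \<zero>} \<union> {x. q x \<noteq> \<zero>}"])
    (auto simp: add_apply carrierD[OF assms(1)] carrierD[OF assms(2)])

lemma eval_add:
  assumes h: "ring_hom_cring K C h" and p: "p \<in> carrier KM" and q: "q \<in> carrier KM"
    and w: "w \<in> carrier M \<rightarrow> carrier C"
  shows "mr_eval K C h w (p \<oplus>\<^bsub>KM\<^esub> q) = mr_eval K C h w p \<oplus>\<^bsub>C\<^esub> mr_eval K C h w q"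
proof -
  interpret h: ring_hom_cring K C h by fact
  let ?Y = "{x. p x \<noteq> \<zero>} \<union> {x. q x \<noteq> \<zero>}"
  have Y: "finite ?Y" "?Y \<subseteq> carrier M" "{x. (p \<oplus>\<^bsub>KM\<^esub> q) x \<noteq> \<zero>} \<subseteq> ?Y"
    using carrierD[OF p] carrierD[OF q] by (auto simp: add_apply)
  have wx: "w x \<in> carrier C" if "x \<in> ?Y" for x using that Y w by auto
  have "mr_eval K C h w (p \<oplus>\<^bsub>KM\<^esub> q) = (\<Oplus>\<^bsub>C\<^esub>x\<in>?Y. h (p x \<oplus> q x) \<otimes>\<^bsub>C\<^esub> w x)"
    by (subst eval_superset[OF h add_closed[OF p q] w Y(1,3,2)]) (simp add: add_apply)
  also have "\<dots> = (\<Oplus>\<^bsub>C\<^esub>x\<in>?Y. h (p x) \<otimes>\<^bsub>C\<^esub> w x \<oplus>\<^bsub>C\<^esub> h (q x) \<otimes>\<^bsub>C\<^esub> w x)"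
    using wx carrierD(1)[OF p] carrierD(1)[OF q]
    by (intro h.S.finsum_cong') (auto simp: h.S.l_distr)
  also have "\<dots> = (\<Oplus>\<^bsub>C\<^esub>x\<in>?Y. h (p x) \<otimes>\<^bsub>C\<^esub> w x) \<oplus>\<^bsub>C\<^esub> (\<Oplus>\<^bsub>C\<^esub>x\<in>?Y. h (q x) \<otimes>\<^bsub>C\<^esub> w x)"
    using wx carrierD(1)[OF p] carrierD(1)[OF q] by (intro h.S.finsum_addf) auto
  also have "\<dots> = mr_eval K C h w p \<oplus>\<^bsub>C\<^esub> mr_eval K C h w q"
    using eval_superset[OF h p w Y(1) _ Y(2)] eval_superset[OF h q w Y(1) _ Y(2)] by simp
  finally show ?thesis .
qed

text \<open>The double sum over both supports is grouped by the value of the product in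
  \<open>M\<close>. As \<open>w\<close> is arbitrary, this turns convolution into iterated
  evaluation, in which a ring law becomes a law of \<open>M\<close> inside the argument of
  \<open>w\<close>.\<close>

lemma eval_mult:
  assumes h: "ring_hom_cring K C h" and p: "p \<in> carrier KM" and q: "q \<in> carrier KM"
    and w: "w \<in> carrier M \<rightarrow> carrier C"
  shows "mr_eval K C h w (p \<otimes>\<^bsub>KM\<^esub> q)
    = mr_eval K C h (\<lambda>y. mr_eval K C h (\<lambda>z. w (y \<otimes>\<^bsub>M\<^esub> z)) q) p"
proof -
  interpret h: ring_hom_cring K C h by fact
  let ?P = "{y. p y \<noteq> \<zero>}" and ?Q = "{z. q z \<noteq> \<zero>}"
  let ?m = "\<lambda>yz. fst yz \<otimes>\<^bsub>M\<^esub> snd yz"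
  let ?Y = "?m ` (?P \<times> ?Q)"
  have fin: "finite ?P" "finite ?Q" and PM: "?P \<subseteq> carrier M" and QM: "?Q \<subseteq> carrier M"
    using carrierD[OF p] carrierD[OF q] by auto
  have Y: "finite ?Y" "?Y \<subseteq> carrier M" using fin PM QM by (auto simp: subset_iff)
  have pc: "h (p y) \<in> carrier C" "h (q y) \<in> carrier C" for y
    using carrierD(1)[OF p] carrierD(1)[OF q] by auto
  have wc: "w (y \<otimes>\<^bsub>M\<^esub> z) \<in> carrier C" if "y \<in> ?P" "z \<in> ?Q" for y z
    using that PM QM w by auto
  have "mr_eval K C h w (p \<otimes>\<^bsub>KM\<^esub> q) = (\<Oplus>\<^bsub>C\<^esub>x\<in>?Y. h ((p \<otimes>\<^bsub>KM\<^esub> q) x) \<otimes>\<^bsub>C\<^esub> w x)"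
    by (rule eval_superset[OF h mult_closed[OF p q] w Y(1) mult_supp[OF p q] Y(2)])
  also have "\<dots> = (\<Oplus>\<^bsub>C\<^esub>x\<in>?Y. \<Oplus>\<^bsub>C\<^esub>yz\<in>{yz \<in> ?P \<times> ?Q. ?m yz = x}.
      h (p (fst yz)) \<otimes>\<^bsub>C\<^esub> (h (q (snd yz)) \<otimes>\<^bsub>C\<^esub> w (?m yz)))"
  proof (rule h.S.finsum_cong')
    show "(\<lambda>x. \<Oplus>\<^bsub>C\<^esub>yz\<in>{yz \<in> ?P \<times> ?Q. ?m yz = x}.
      h (p (fst yz)) \<otimes>\<^bsub>C\<^esub> (h (q (snd yz)) \<otimes>\<^bsub>C\<^esub> w (?m yz))) \<in> ?Y \<rightarrow> carrier C"
      by (intro Pi_I h.S.finsum_closed) (use pc wc in auto)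
    fix x assume x: "x \<in> ?Y"
    have wx: "w x \<in> carrier C" using x Y w by auto
    let ?F = "{yz \<in> ?P \<times> ?Q. ?m yz = x}"
    have F: "finite ?F" using fin by auto
    have "h ((p \<otimes>\<^bsub>KM\<^esub> q) x) = (\<Oplus>\<^bsub>C\<^esub>yz\<in>?F. h (p (fst yz) \<otimes> q (snd yz)))"
      unfolding mult_apply[OF p q]
      by (subst h.hom_finsum) (auto simp: carrierD(1)[OF p] carrierD(1)[OF q] comp_def)
    also have "\<dots> = (\<Oplus>\<^bsub>C\<^esub>yz\<in>?F. h (p (fst yz)) \<otimes>\<^bsub>C\<^esub> h (q (snd yz)))"
      by (rule h.S.finsum_cong') (use pc carrierD(1)[OF p] carrierD(1)[OF q] in auto)
    finally have "h ((p \<otimes>\<^bsub>KM\<^esub> q) x) \<otimes>\<^bsub>C\<^esub> w x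
       = (\<Oplus>\<^bsub>C\<^esub>yz\<in>?F. h (p (fst yz)) \<otimes>\<^bsub>C\<^esub> h (q (snd yz)) \<otimes>\<^bsub>C\<^esub> w x)"
      using F wx pc by (simp add: h.S.finsum_ldistr Pi_iff)
    also have "\<dots> = (\<Oplus>\<^bsub>C\<^esub>yz\<in>?F. h (p (fst yz)) \<otimes>\<^bsub>C\<^esub> (h (q (snd yz)) \<otimes>\<^bsub>C\<^esub> w (?m yz)))"
      by (rule h.S.finsum_cong') (use pc wx in \<open>auto simp: h.S.m_assoc\<close>)
    finally show "h ((p \<otimes>\<^bsub>KM\<^esub> q) x) \<otimes>\<^bsub>C\<^esub> w x
      = (\<Oplus>\<^bsub>C\<^esub>yz\<in>?F. h (p (fst yz)) \<otimes>\<^bsub>C\<^esub> (h (q (snd yz)) \<otimes>\<^bsub>C\<^esub> w (?m yz)))" .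
  qed simp
  \<comment> \<open>The inner sums run over the fibres of the multiplication of \<open>M\<close> on
    the two supports.\<close>
  also have "\<dots> = (\<Oplus>\<^bsub>C\<^esub>yz\<in>?P \<times> ?Q. h (p (fst yz)) \<otimes>\<^bsub>C\<^esub> (h (q (snd yz)) \<otimes>\<^bsub>C\<^esub> w (?m yz)))"
    by (rule h.S.finsum_fibre[symmetric]) (use fin pc wc in auto)
  also have "\<dots> = (\<Oplus>\<^bsub>C\<^esub>y\<in>?P. \<Oplus>\<^bsub>C\<^esub>z\<in>?Q. h (p y) \<otimes>\<^bsub>C\<^esub> (h (q z) \<otimes>\<^bsub>C\<^esub> w (y \<otimes>\<^bsub>M\<^esub> z)))"
    using fin pc wc by (subst h.S.finsum_Sigma) auto
  also have "\<dots> = (\<Oplus>\<^bsub>C\<^esub>y\<in>?P. h (p y) \<otimes>\<^bsub>C\<^esub> (\<Oplus>\<^bsub>C\<^esub>z\<in>?Q. h (q z) \<otimes>\<^bsub>C\<^esub> w (y \<otimes>\<^bsub>M\<^esub> z)))"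
    by (rule h.S.finsum_cong') (use fin pc wc in \<open>auto simp: h.S.finsum_rdistr Pi_iff\<close>)
  finally show ?thesis by (simp add: mr_eval_def)
qed

lemma eval_mterm:
  assumes h: "ring_hom_cring K C h" and "x \<in> carrier M" "a \<in> carrier K" "w \<in> carrier M \<rightarrow> carrier C"
  shows "mr_eval K C h w (mterm K x a) = h a \<otimes>\<^bsub>C\<^esub> w x"
proof -
  interpret h: ring_hom_cring K C h by fact
  have "mr_eval K C h w (mterm K x a) = (\<Oplus>\<^bsub>C\<^esub>y\<in>{x}. h (mterm K x a y) \<otimes>\<^bsub>C\<^esub> w y)"
    by (rule eval_superset[OF h mterm_closed assms(4)]) (use assms in \<open>auto simp: mterm_def\<close>)
  also have "\<dots> = h (mterm K x a x) \<otimes>\<^bsub>C\<^esub> w x"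
    by (rule h.S.finsum_single) (use assms in \<open>auto simp: mterm_def\<close>)
  finally show ?thesis by (simp add: mterm_def)
qed

lemma id_hom: "ring_hom_cring K K (\<lambda>x. x)"
  by unfold_locales (auto simp: ring_hom_def)

text \<open>The indicator function of \<open>x\<close> extracts the coefficient at \<open>x\<close>;
  hence the functionals with values in \<open>K\<close> separate elements.\<close>

lemma coeff_eq_eval:
  assumes "p \<in> carrier KM"
  shows "p x = mr_eval K K (\<lambda>x. x) (\<lambda>y. if y = x then \<one> else \<zero>) p"
proof -
  have "mr_eval K K (\<lambda>x. x) (\<lambda>y. if y = x then \<one> else \<zero>) p = p x"
  proof (cases "p x = \<zero>")
    case True
    then show ?thesis unfolding mr_eval_def
      using add.finprod_one_eqI[of "{y. p y \<noteq> \<zero>}" "\<lambda>y. p y \<otimes> (if y = x then \<one> else \<zero>)"]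
        carrierD[OF assms] by auto
  next
    case False
    then show ?thesis unfolding mr_eval_def
      by (subst finsum_single[of _ x]) (use carrierD[OF assms] in auto)
  qed
  then show ?thesis by simp
qed

lemma eqI:
  assumes "p \<in> carrier KM" "q \<in> carrier KM"
    and "\<And>w. w \<in> carrier M \<rightarrow> carrier K \<Longrightarrow> mr_eval K K (\<lambda>x. x) w p = mr_eval K K (\<lambda>x. x) w q"
  shows "p = q"
  using assms by (intro ext) (simp add: coeff_eq_eval)

lemma eval_cong:
  assumes "ring_hom_cring K C h" "p \<in> carrier KM" "w' \<in> carrier M \<rightarrow> carrier C"
    and "\<And>x. x \<in> carrier M \<Longrightarrow> w x = w' x"
  shows "mr_eval K C h w p = mr_eval K C h w' p"
proof -
  interpret h: ring_hom_cring K C h by fact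
  show ?thesis unfolding mr_eval_def
    by (rule h.S.finsum_cong') (use assms carrierD[OF assms(2)] in \<open>auto simp: Pi_iff\<close>)
qed

lemma eval_smult_fun:
  assumes "ring_hom_cring K C h" "p \<in> carrier KM"
    and "w \<in> carrier M \<rightarrow> carrier C" "c \<in> carrier C"
  shows "mr_eval K C h (\<lambda>x. c \<otimes>\<^bsub>C\<^esub> w x) p = c \<otimes>\<^bsub>C\<^esub> mr_eval K C h w p"
proof -
  interpret h: ring_hom_cring K C h by fact
  have *: "h (p x) \<in> carrier C" "p x \<noteq> \<zero> \<Longrightarrow> w x \<in> carrier C" for x
    using assms carrierD[OF assms(2)] by (auto simp: Pi_iff)
  show ?thesis unfolding mr_eval_def
    using * assms(4) carrierD(2)[OF assms(2)]
    by (subst h.S.finsum_rdistr) (auto intro!: h.S.finsum_cong' simp: h.S.m_lcomm)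
qed

lemma eval_comm:
  assumes "ring_hom_cring K C h" "p \<in> carrier KM" "q \<in> carrier KM"
    and w: "\<And>x y. \<lbrakk>x \<in> carrier M; y \<in> carrier M\<rbrakk> \<Longrightarrow> w x y \<in> carrier C"
  shows "mr_eval K C h (\<lambda>x. mr_eval K C h (\<lambda>y. w x y) q) p
    = mr_eval K C h (\<lambda>y. mr_eval K C h (\<lambda>x. w x y) p) q"
proof -
  interpret h: ring_hom_cring K C h by fact
  let ?P = "{y. p y \<noteq> \<zero>}" and ?Q = "{z. q z \<noteq> \<zero>}"
  note c = carrierD[OF assms(2)] carrierD[OF assms(3)]
  have "mr_eval K C h (\<lambda>x. mr_eval K C h (\<lambda>y. w x y) q) p
     = (\<Oplus>\<^bsub>C\<^esub>x\<in>?P. \<Oplus>\<^bsub>C\<^esub>y\<in>?Q. h (p x) \<otimes>\<^bsub>C\<^esub> (h (q y) \<otimes>\<^bsub>C\<^esub> w x y))"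
    unfolding mr_eval_def
    by (rule h.S.finsum_cong') (use c w in \<open>auto intro!: h.S.finsum_rdistr\<close>)
  also have "\<dots> = (\<Oplus>\<^bsub>C\<^esub>y\<in>?Q. \<Oplus>\<^bsub>C\<^esub>x\<in>?P. h (p x) \<otimes>\<^bsub>C\<^esub> (h (q y) \<otimes>\<^bsub>C\<^esub> w x y))"
    by (rule h.S.finsum_swap) (use c w in auto)
  also have "\<dots> = (\<Oplus>\<^bsub>C\<^esub>y\<in>?Q. \<Oplus>\<^bsub>C\<^esub>x\<in>?P. h (q y) \<otimes>\<^bsub>C\<^esub> (h (p x) \<otimes>\<^bsub>C\<^esub> w x y))"
    by (intro h.S.finsum_cong') (use c w in \<open>auto simp: h.S.m_lcomm\<close>)
  also have "\<dots> = mr_eval K C h (\<lambda>y. mr_eval K C h (\<lambda>x. w x y) p) q"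
    unfolding mr_eval_def
    by (rule h.S.finsum_cong') (use c w in \<open>auto intro!: h.S.finsum_rdistr[symmetric]\<close>)
  finally show ?thesis .
qed

text \<open>Both sides of each multiplicative law are compared under an arbitrary functional. After
  \<open>eval_mult\<close>, unit, commutativity and associativity are those of \<open>M\<close>, up
  to exchanging the order of summation.\<close>

lemma monoid_ring_cring: "cring KM"
proof (rule cringI)
  note ev = eval_add[OF id_hom] eval_mult[OF id_hom]
  note cl = add_closed mult_closed eval_closed[OF id_hom]
  note shift = eval_cong[OF id_hom]
  show "abelian_group KM"
  proof (rule abelian_groupI)
    show "\<zero>\<^bsub>KM\<^esub> \<in> carrier KM" by (rule carrierI[where Y="{}"]) (auto simp: zero_apply)
    fix p assume p: "p \<in> carrier KM"
    show "\<exists>q\<in>carrier KM. q \<oplus>\<^bsub>KM\<^esub> p = \<zero>\<^bsub>KM\<^esub>"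
    proof
      show "(\<lambda>x. \<ominus> p x) \<in> carrier KM"
        by (rule carrierI[where Y="{x. p x \<noteq> \<zero>}"]) (use carrierD[OF p] in auto)
      show "(\<lambda>x. \<ominus> p x) \<oplus>\<^bsub>KM\<^esub> p = \<zero>\<^bsub>KM\<^esub>"
        using carrierD(1)[OF p] by (auto simp: fun_eq_iff add_apply zero_apply l_neg)
    qed
  qed (auto simp: fun_eq_iff add_apply zero_apply carrierD(1) add_closed a_ac)
  show "comm_monoid KM"
  proof (rule comm_monoidI)
    show one: "\<one>\<^bsub>KM\<^esub> \<in> carrier KM" unfolding one_eq by (rule mterm_closed) auto
    fix p q assume p: "p \<in> carrier KM" and q: "q \<in> carrier KM"
    show "\<one>\<^bsub>KM\<^esub> \<otimes>\<^bsub>KM\<^esub> p = p"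
    proof (rule eqI)
      fix w assume w: "w \<in> carrier M \<rightarrow> carrier K"
      have "mr_eval K K (\<lambda>x. x) w (\<one>\<^bsub>KM\<^esub> \<otimes>\<^bsub>KM\<^esub> p)
          = mr_eval K K (\<lambda>x. x) (\<lambda>y. mr_eval K K (\<lambda>x. x) (\<lambda>z. w (y \<otimes>\<^bsub>M\<^esub> z)) p) (mterm K \<one>\<^bsub>M\<^esub> \<one>)"
        using eval_mult[OF id_hom one p w] by (simp add: one_eq)
      also have "\<dots> = mr_eval K K (\<lambda>x. x) (\<lambda>z. w (\<one>\<^bsub>M\<^esub> \<otimes>\<^bsub>M\<^esub> z)) p"
        by (subst eval_mterm[OF id_hom])
          (use w p in \<open>auto intro!: eval_closed[OF id_hom] l_one simp: Pi_iff\<close>)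
      also have "\<dots> = mr_eval K K (\<lambda>x. x) w p"
        by (rule eval_cong[OF id_hom p w]) auto
      finally show "mr_eval K K (\<lambda>x. x) w (\<one>\<^bsub>KM\<^esub> \<otimes>\<^bsub>KM\<^esub> p) = mr_eval K K (\<lambda>x. x) w p" .
    qed (auto intro: cl one p)
    show "p \<otimes>\<^bsub>KM\<^esub> q = q \<otimes>\<^bsub>KM\<^esub> p"
    proof (rule eqI)
      fix w assume w: "w \<in> carrier M \<rightarrow> carrier K"
      have "mr_eval K K (\<lambda>x. x) w (p \<otimes>\<^bsub>KM\<^esub> q)
          = mr_eval K K (\<lambda>x. x) (\<lambda>y. mr_eval K K (\<lambda>x. x) (\<lambda>z. w (y \<otimes>\<^bsub>M\<^esub> z)) q) p"
        by (rule eval_mult[OF id_hom p q w])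
      also have "\<dots> = mr_eval K K (\<lambda>x. x) (\<lambda>z. mr_eval K K (\<lambda>x. x) (\<lambda>y. w (y \<otimes>\<^bsub>M\<^esub> z)) p) q"
        by (rule eval_comm[OF id_hom p q]) (use w in auto)
      also have "\<dots> = mr_eval K K (\<lambda>x. x) (\<lambda>z. mr_eval K K (\<lambda>x. x) (\<lambda>y. w (z \<otimes>\<^bsub>M\<^esub> y)) p) q"
        by (intro eval_cong[OF id_hom q]) (use w p in \<open>auto intro!: eval_closed[OF id_hom] eval_cong[OF id_hom] simp: M.m_comm Pi_iff\<close>)
      also have "\<dots> = mr_eval K K (\<lambda>x. x) w (q \<otimes>\<^bsub>KM\<^esub> p)"
        by (rule eval_mult[OF id_hom q p w, symmetric])
      finally show "mr_eval K K (\<lambda>x. x) w (p \<otimes>\<^bsub>KM\<^esub> q) = mr_eval K K (\<lambda>x. x) w (q \<otimes>\<^bsub>KM\<^esub> p)" .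
    qed (auto intro: cl p q)
    fix r assume r: "r \<in> carrier KM"
    show "p \<otimes>\<^bsub>KM\<^esub> q \<otimes>\<^bsub>KM\<^esub> r = p \<otimes>\<^bsub>KM\<^esub> (q \<otimes>\<^bsub>KM\<^esub> r)"
    proof (rule eqI)
      fix w assume w: "w \<in> carrier M \<rightarrow> carrier K"
      have w2: "(\<lambda>z. mr_eval K K (\<lambda>x. x) (\<lambda>z'. w (z \<otimes>\<^bsub>M\<^esub> z')) r) \<in> carrier M \<rightarrow> carrier K"
        using w r by (auto intro!: eval_closed[OF id_hom])
      have "mr_eval K K (\<lambda>x. x) w (p \<otimes>\<^bsub>KM\<^esub> q \<otimes>\<^bsub>KM\<^esub> r)
          = mr_eval K K (\<lambda>x. x) (\<lambda>x. mr_eval K K (\<lambda>x. x) (\<lambda>y. mr_eval K K (\<lambda>x. x) (\<lambda>z. w (x \<otimes>\<^bsub>M\<^esub> y \<otimes>\<^bsub>M\<^esub> z)) r) q) p"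
        by (simp add: eval_mult[OF id_hom mult_closed[OF p q] r w] eval_mult[OF id_hom p q w2])
      also have "\<dots> = mr_eval K K (\<lambda>x. x) (\<lambda>x. mr_eval K K (\<lambda>x. x) (\<lambda>z. w (x \<otimes>\<^bsub>M\<^esub> z)) (q \<otimes>\<^bsub>KM\<^esub> r)) p"
      proof (rule eval_cong[OF id_hom p])
        fix x assume x: "x \<in> carrier M"
        have "mr_eval K K (\<lambda>x. x) (\<lambda>z. w (x \<otimes>\<^bsub>M\<^esub> z)) (q \<otimes>\<^bsub>KM\<^esub> r)
            = mr_eval K K (\<lambda>x. x) (\<lambda>y. mr_eval K K (\<lambda>x. x) (\<lambda>z. w (x \<otimes>\<^bsub>M\<^esub> (y \<otimes>\<^bsub>M\<^esub> z))) r) q"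
          by (rule eval_mult[OF id_hom q r]) (use x w in auto)
        also have "\<dots> = mr_eval K K (\<lambda>x. x) (\<lambda>y. mr_eval K K (\<lambda>x. x) (\<lambda>z. w (x \<otimes>\<^bsub>M\<^esub> y \<otimes>\<^bsub>M\<^esub> z)) r) q"
          by (intro eval_cong[OF id_hom q])
            (use w x r in \<open>auto intro!: eval_closed[OF id_hom] eval_cong[OF id_hom] simp: M.m_assoc\<close>)
        finally show "mr_eval K K (\<lambda>x. x) (\<lambda>y. mr_eval K K (\<lambda>x. x) (\<lambda>z. w (x \<otimes>\<^bsub>M\<^esub> y \<otimes>\<^bsub>M\<^esub> z)) r) q
           = mr_eval K K (\<lambda>x. x) (\<lambda>z. w (x \<otimes>\<^bsub>M\<^esub> z)) (q \<otimes>\<^bsub>KM\<^esub> r)" by simp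
      qed (use w q r in \<open>auto intro!: eval_closed[OF id_hom] mult_closed\<close>)
      also have "\<dots> = mr_eval K K (\<lambda>x. x) w (p \<otimes>\<^bsub>KM\<^esub> (q \<otimes>\<^bsub>KM\<^esub> r))"
        by (rule eval_mult[OF id_hom p mult_closed[OF q r] w, symmetric])
      finally show "mr_eval K K (\<lambda>x. x) w (p \<otimes>\<^bsub>KM\<^esub> q \<otimes>\<^bsub>KM\<^esub> r)
        = mr_eval K K (\<lambda>x. x) w (p \<otimes>\<^bsub>KM\<^esub> (q \<otimes>\<^bsub>KM\<^esub> r))" .
    qed (auto intro: cl p q r)
  qed (rule mult_closed)
  fix p q r assume p: "p \<in> carrier KM" and q: "q \<in> carrier KM" and r: "r \<in> carrier KM"
  show "(p \<oplus>\<^bsub>KM\<^esub> q) \<otimes>\<^bsub>KM\<^esub> r = p \<otimes>\<^bsub>KM\<^esub> r \<oplus>\<^bsub>KM\<^esub> q \<otimes>\<^bsub>KM\<^esub> r"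
  proof (rule eqI)
    fix w assume w: "w \<in> carrier M \<rightarrow> carrier K"
    have "(\<lambda>y. mr_eval K K (\<lambda>x. x) (\<lambda>z. w (y \<otimes>\<^bsub>M\<^esub> z)) r) \<in> carrier M \<rightarrow> carrier K"
      using w r by (auto intro!: eval_closed[OF id_hom])
    then show "mr_eval K K (\<lambda>x. x) w ((p \<oplus>\<^bsub>KM\<^esub> q) \<otimes>\<^bsub>KM\<^esub> r)
       = mr_eval K K (\<lambda>x. x) w (p \<otimes>\<^bsub>KM\<^esub> r \<oplus>\<^bsub>KM\<^esub> q \<otimes>\<^bsub>KM\<^esub> r)"
      using p q r w by (simp add: ev cl)
  qed (auto intro: cl p q r)
qed

text \<open>For multiplicative \<open>w\<close> the inner evaluation of \<open>eval_mult\<close> is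
  the value of \<open>q\<close> times \<open>w y\<close>, and the value of \<open>q\<close> comes
  out of the outer sum.\<close>

lemma eval_hom:
  assumes h: "ring_hom_cring K C h"
    and w: "w \<in> carrier M \<rightarrow> carrier C" "w \<one>\<^bsub>M\<^esub> = \<one>\<^bsub>C\<^esub>"
      "\<And>x y. \<lbrakk>x \<in> carrier M; y \<in> carrier M\<rbrakk> \<Longrightarrow> w (x \<otimes>\<^bsub>M\<^esub> y) = w x \<otimes>\<^bsub>C\<^esub> w y"
  shows "ring_hom_cring KM C (mr_eval K C h w)"
proof -
  interpret h: ring_hom_cring K C h by fact
  interpret KM: cring KM by (rule monoid_ring_cring)
  have wc: "x \<in> carrier M \<Longrightarrow> w x \<in> carrier C" for x using w(1) by auto
  show ?thesis
  proof (intro ring_hom_cring.intro ring_hom_cring_axioms.intro ring_hom_memI)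
    fix p q assume p: "p \<in> carrier KM" and q: "q \<in> carrier KM"
    have evc: "mr_eval K C h w q \<in> carrier C" by (rule eval_closed[OF h q w(1)])
    have "mr_eval K C h w (p \<otimes>\<^bsub>KM\<^esub> q)
        = mr_eval K C h (\<lambda>y. mr_eval K C h (\<lambda>z. w (y \<otimes>\<^bsub>M\<^esub> z)) q) p"
      by (rule eval_mult[OF h p q w(1)])
    also have "\<dots> = mr_eval K C h (\<lambda>y. mr_eval K C h w q \<otimes>\<^bsub>C\<^esub> w y) p"
    proof (rule eval_cong[OF h p])
      fix y assume y: "y \<in> carrier M"
      have "mr_eval K C h (\<lambda>z. w (y \<otimes>\<^bsub>M\<^esub> z)) q = mr_eval K C h (\<lambda>z. w y \<otimes>\<^bsub>C\<^esub> w z) q"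
        by (rule eval_cong[OF h q]) (use y w wc in auto)
      also have "\<dots> = mr_eval K C h w q \<otimes>\<^bsub>C\<^esub> w y"
        using y wc w(1) eval_smult_fun[OF h q w(1), of "w y"] evc by (simp add: h.S.m_comm)
      finally show "mr_eval K C h (\<lambda>z. w (y \<otimes>\<^bsub>M\<^esub> z)) q = mr_eval K C h w q \<otimes>\<^bsub>C\<^esub> w y" .
    qed (use evc wc in auto)
    also have "\<dots> = mr_eval K C h w q \<otimes>\<^bsub>C\<^esub> mr_eval K C h w p"
      by (rule eval_smult_fun[OF h p w(1) evc])
    finally show "mr_eval K C h w (p \<otimes>\<^bsub>KM\<^esub> q) = mr_eval K C h w p \<otimes>\<^bsub>C\<^esub> mr_eval K C h w q"
      using evc eval_closed[OF h p w(1)] by (simp add: h.S.m_comm)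
  next
    show "mr_eval K C h w \<one>\<^bsub>KM\<^esub> = \<one>\<^bsub>C\<^esub>" using w by (simp add: one_eq eval_mterm[OF h])
  qed (auto intro: eval_closed[OF h _ w(1)] eval_add[OF h _ _ w(1)] monoid_ring_cring h.S.is_cring)
qed

end

section \<open>Localization\<close>

lemma algebra_via_simps [simp]:
  "carrier (algebra_via R h) = carrier R" "monoid.mult (algebra_via R h) = monoid.mult R"
  "monoid.one (algebra_via R h) = monoid.one R" "ring.zero (algebra_via R h) = ring.zero R"
  "ring.add (algebra_via R h) = ring.add R"
  "a \<odot>\<^bsub>algebra_via R h\<^esub> x = h a \<otimes>\<^bsub>R\<^esub> x"
  by (simp_all add: algebra_via_def)

text \<open>\<open>algebra_via\<close> keeps the ring operations but produces a new record, so the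
  laws are transferred field by field.\<close>

lemma cring_algebra_via:
  assumes "cring R" shows "cring (algebra_via R h)"
proof -
  interpret cring R by fact
  have "abelian_group (algebra_via R h)"
    by (rule abelian_groupI) (auto simp: a_ac intro!: bexI[of _ "\<ominus>\<^bsub>R\<^esub> _"] l_neg)
  moreover have "comm_monoid (algebra_via R h)"
    by (rule comm_monoidI) (auto simp: m_ac)
  ultimately show ?thesis by (rule cringI) (auto simp: l_distr)
qed

lemma algebra_algebra_via:
  assumes "cring A" "cring R" "h \<in> ring_hom A R"
  shows "algebra A (algebra_via R h)"
proof -
  interpret h: ring_hom_cring A R h
    using assms by (simp add: ring_hom_cring_def ring_hom_cring_axioms_def)
  show ?thesis
    by (rule algebraI) (auto simp: assms cring_algebra_via h.S.m_assoc h.S.l_distr h.S.r_distr)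
qed

text \<open>Operations on fractions are unions over all representatives. Such a union collapses once
  every representative gives the same class, which is how well-definedness enters.\<close>

lemma Union_pairs_const:
  "\<lbrakk>\<And>a b. (a, b) \<in> Y \<Longrightarrow> g a b = c; Y \<noteq> {}\<rbrakk> \<Longrightarrow> (\<Union>(a, b)\<in>Y. g a b) = c"
  by fastforce

lemma ex1_unique: "\<lbrakk>\<exists>!x. P x; P a; P b\<rbrakk> \<Longrightarrow> a = b"
  by blast

section \<open>Fractions of a module\<close>

locale frac = module R M for R :: "('r, 'x) ring_scheme" (structure)
    and M :: "('r, 'm, 'z) module_scheme" (structure) +
  fixes T :: "'r set"
  assumes T: "submonoid T R"
begin

abbreviation "fr \<equiv> loc_frac M T"

lemma T_carr [simp]: "t \<in> T \<Longrightarrow> t \<in> carrier R"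
  and T_one [simp]: "\<one> \<in> T"
  and T_mult [simp]: "\<lbrakk>s \<in> T; t \<in> T\<rbrakk> \<Longrightarrow> s \<otimes> t \<in> T"
  using T by (auto simp: submonoid_def)

lemma T_prod: "\<lbrakk>finite I; \<And>i. i \<in> I \<Longrightarrow> g i \<in> T\<rbrakk> \<Longrightarrow> finprod R g I \<in> T"
proof (induction I rule: finite_induct)
  case (insert x F)
  then have "finprod R g (insert x F) = g x \<otimes> finprod R g F"
    by (intro R.finprod_insert) auto
  then show ?case using insert by auto
qed auto

lemma frac_relI:
  assumes "m \<in> carrier M" "s \<in> T" "m' \<in> carrier M" "s' \<in> T" "u \<in> T"
    "u \<odot>\<^bsub>M\<^esub> (s' \<odot>\<^bsub>M\<^esub> m) = u \<odot>\<^bsub>M\<^esub> (s \<odot>\<^bsub>M\<^esub> m')"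
  shows "((m, s), (m', s')) \<in> frac_rel M T"
  using assms by (auto simp: frac_rel_def)

lemma smult_comm:
  "\<lbrakk>a \<in> carrier R; b \<in> carrier R; x \<in> carrier M\<rbrakk> \<Longrightarrow> a \<odot>\<^bsub>M\<^esub> (b \<odot>\<^bsub>M\<^esub> x) = b \<odot>\<^bsub>M\<^esub> (a \<odot>\<^bsub>M\<^esub> x)"
  by (metis smult_assoc1 R.m_comm)

lemma equiv_frac: "equiv (carrier M \<times> T) (frac_rel M T)"
proof (rule equivI)
  show "refl_on (carrier M \<times> T) (frac_rel M T)"
    by (auto simp: refl_on_def intro!: frac_relI[of _ _ _ _ \<one>])
  show "sym (frac_rel M T)" by (auto simp: sym_def frac_rel_def) metis
  show "trans (frac_rel M T)"
  proof (rule transI)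
    fix x y z assume "(x, y) \<in> frac_rel M T" "(y, z) \<in> frac_rel M T"
    then obtain m s m' s' m'' s'' u v where xyz: "x = (m, s)" "y = (m', s')" "z = (m'', s'')"
      and c: "m \<in> carrier M" "m' \<in> carrier M" "m'' \<in> carrier M" "s \<in> T" "s' \<in> T" "s'' \<in> T"
        "u \<in> T" "v \<in> T"
      and u: "u \<odot>\<^bsub>M\<^esub> (s' \<odot>\<^bsub>M\<^esub> m) = u \<odot>\<^bsub>M\<^esub> (s \<odot>\<^bsub>M\<^esub> m')"
      and v: "v \<odot>\<^bsub>M\<^esub> (s'' \<odot>\<^bsub>M\<^esub> m') = v \<odot>\<^bsub>M\<^esub> (s' \<odot>\<^bsub>M\<^esub> m'')"
      by (auto simp: frac_rel_def)
    \<comment> \<open>The middle denominator \<open>s'\<close> joins the multiplier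
      \<open>u v\<close>, since it need not be cancellable.\<close>
    have "(u \<otimes> v \<otimes> s') \<odot>\<^bsub>M\<^esub> (s'' \<odot>\<^bsub>M\<^esub> m) = (v \<otimes> s'') \<odot>\<^bsub>M\<^esub> (u \<odot>\<^bsub>M\<^esub> (s' \<odot>\<^bsub>M\<^esub> m))"
      using c by (simp add: smult_assoc1[symmetric] R.m_ac)
    also have "\<dots> = (u \<otimes> s) \<odot>\<^bsub>M\<^esub> (v \<odot>\<^bsub>M\<^esub> (s'' \<odot>\<^bsub>M\<^esub> m'))"
      unfolding u using c by (simp add: smult_assoc1[symmetric] R.m_ac)
    also have "\<dots> = (u \<otimes> v \<otimes> s') \<odot>\<^bsub>M\<^esub> (s \<odot>\<^bsub>M\<^esub> m'')"
      unfolding v using c by (simp add: smult_assoc1[symmetric] R.m_ac)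
    finally show "(x, z) \<in> frac_rel M T"
      unfolding xyz using c by (intro frac_relI[where u="u \<otimes> v \<otimes> s'"]) auto
  qed
qed (auto simp: frac_rel_def)

lemma fr_eq_iff:
  assumes "m \<in> carrier M" "s \<in> T" "m' \<in> carrier M" "s' \<in> T"
  shows "fr m s = fr m' s' \<longleftrightarrow> (\<exists>u\<in>T. u \<odot>\<^bsub>M\<^esub> (s' \<odot>\<^bsub>M\<^esub> m) = u \<odot>\<^bsub>M\<^esub> (s \<odot>\<^bsub>M\<^esub> m'))"
proof -
  have "fr m s = fr m' s' \<longleftrightarrow> ((m, s), (m', s')) \<in> frac_rel M T"
    unfolding loc_frac_def using assms
    by (intro eq_equiv_class_iff[OF equiv_frac]) auto
  then show ?thesis using assms by (auto simp: frac_rel_def)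
qed

lemma fr_mem: "(m', s') \<in> fr m s \<Longrightarrow> m' \<in> carrier M \<and> s' \<in> T \<and> m \<in> carrier M \<and> s \<in> T \<and> fr m' s' = fr m s"
proof -
  assume "(m', s') \<in> fr m s"
  then have r: "((m, s), (m', s')) \<in> frac_rel M T" by (simp add: loc_frac_def)
  then have "fr m s = fr m' s'" unfolding loc_frac_def by (rule equiv_class_eq[OF equiv_frac])
  with r show ?thesis by (simp add: frac_rel_def)
qed

lemma fr_nonempty: "\<lbrakk>m \<in> carrier M; s \<in> T\<rbrakk> \<Longrightarrow> fr m s \<noteq> {}"
  using equiv_class_self[OF equiv_frac, of "(m, s)"] by (auto simp: loc_frac_def)

lemma fr_cancel:
  assumes "m \<in> carrier M" "s \<in> T" "t \<in> T"
  shows "fr (t \<odot>\<^bsub>M\<^esub> m) (t \<otimes> s) = fr m s"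
  by (subst fr_eq_iff) (use assms in \<open>auto intro!: bexI[of _ \<one>] simp: smult_assoc1 smult_comm\<close>)

lemma fr_quotient: "(carrier M \<times> T) // frac_rel M T = {fr m s | m s. m \<in> carrier M \<and> s \<in> T}"
  by (auto simp: quotient_def loc_frac_def)

lemma fr_add_cong:
  assumes "fr m s = fr n t" "fr m' s' = fr n' t'"
    and c: "m \<in> carrier M" "s \<in> T" "m' \<in> carrier M" "s' \<in> T" "n \<in> carrier M" "t \<in> T" "n' \<in> carrier M" "t' \<in> T"
  shows "fr ((s' \<odot>\<^bsub>M\<^esub> m) \<oplus>\<^bsub>M\<^esub> (s \<odot>\<^bsub>M\<^esub> m')) (s \<otimes> s') = fr ((t' \<odot>\<^bsub>M\<^esub> n) \<oplus>\<^bsub>M\<^esub> (t \<odot>\<^bsub>M\<^esub> n')) (t \<otimes> t')"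
proof -
  obtain u where u: "u \<in> T" "u \<odot>\<^bsub>M\<^esub> (t \<odot>\<^bsub>M\<^esub> m) = u \<odot>\<^bsub>M\<^esub> (s \<odot>\<^bsub>M\<^esub> n)"
    using assms by (auto simp: fr_eq_iff)
  obtain v where v: "v \<in> T" "v \<odot>\<^bsub>M\<^esub> (t' \<odot>\<^bsub>M\<^esub> m') = v \<odot>\<^bsub>M\<^esub> (s' \<odot>\<^bsub>M\<^esub> n')"
    using assms by (auto simp: fr_eq_iff)
  have "(u \<otimes> v) \<odot>\<^bsub>M\<^esub> ((t \<otimes> t') \<odot>\<^bsub>M\<^esub> ((s' \<odot>\<^bsub>M\<^esub> m) \<oplus>\<^bsub>M\<^esub> (s \<odot>\<^bsub>M\<^esub> m')))
     = (v \<otimes> t' \<otimes> s') \<odot>\<^bsub>M\<^esub> (u \<odot>\<^bsub>M\<^esub> (t \<odot>\<^bsub>M\<^esub> m)) \<oplus>\<^bsub>M\<^esub> (u \<otimes> t \<otimes> s) \<odot>\<^bsub>M\<^esub> (v \<odot>\<^bsub>M\<^esub> (t' \<odot>\<^bsub>M\<^esub> m'))"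
    using c u(1) v(1) by (simp add: smult_r_distr smult_assoc1[symmetric] R.m_ac)
  also have "\<dots> = (u \<otimes> v) \<odot>\<^bsub>M\<^esub> ((s \<otimes> s') \<odot>\<^bsub>M\<^esub> ((t' \<odot>\<^bsub>M\<^esub> n) \<oplus>\<^bsub>M\<^esub> (t \<odot>\<^bsub>M\<^esub> n')))"
    unfolding u(2) v(2) using c u(1) v(1) by (simp add: smult_r_distr smult_assoc1[symmetric] R.m_ac)
  finally show ?thesis using c u(1) v(1) by (subst fr_eq_iff) (auto intro!: bexI[of _ "u \<otimes> v"])
qed

end

section \<open>Localization of a ring\<close>

locale locring = R?: cring R for R :: "('r, 'x) ring_scheme" (structure) +
  fixes T :: "'r set"
  assumes T: "submonoid T R"

text \<open>The ring acts on itself, so equality and addition of its fractions are instances of the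
  module case.\<close>

sublocale locring \<subseteq> self: frac R "algebra_via R (\<lambda>x. x)" T
proof -
  have "algebra R (algebra_via R (\<lambda>x. x))"
    by (rule algebra_algebra_via) (auto simp: ring_hom_def R.is_cring)
  then show "frac R (algebra_via R (\<lambda>x. x)) T"
    using T by (simp add: frac_def frac_axioms_def algebra_def)
qed

context locring
begin

abbreviation "f0 \<equiv> loc_frac (algebra_via R (\<lambda>x. x)) T"
abbreviation "L \<equiv> loc_ring R T"

lemma f0_eq_iff:
  assumes "m \<in> carrier R" "s \<in> T" "m' \<in> carrier R" "s' \<in> T"
  shows "f0 m s = f0 m' s' \<longleftrightarrow> (\<exists>u\<in>T. u \<otimes> (s' \<otimes> m) = u \<otimes> (s \<otimes> m'))"
  using self.fr_eq_iff[of m s m' s'] assms by simp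

lemma f0_cancel:
  assumes "m \<in> carrier R" "s \<in> T" "t \<in> T"
  shows "f0 (t \<otimes> m) (t \<otimes> s) = f0 m s"
  using self.fr_cancel[of m s t] assms by simp

lemma carrier_L: "carrier L = {f0 m s | m s. m \<in> carrier R \<and> s \<in> T}"
  using self.fr_quotient by (simp add: loc_ring_def Let_def)

lemma L_closed [simp]: "\<lbrakk>m \<in> carrier R; s \<in> T\<rbrakk> \<Longrightarrow> f0 m s \<in> carrier L"
  by (auto simp: carrier_L)

lemma L_cases: "x \<in> carrier L \<Longrightarrow> (\<And>m s. \<lbrakk>x = f0 m s; m \<in> carrier R; s \<in> T\<rbrakk> \<Longrightarrow> P) \<Longrightarrow> P"
  by (auto simp: carrier_L)

lemma f0_mult_cong:
  assumes "f0 m s = f0 n t" "f0 m' s' = f0 n' t'"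
    and c: "m \<in> carrier R" "s \<in> T" "m' \<in> carrier R" "s' \<in> T" "n \<in> carrier R" "t \<in> T" "n' \<in> carrier R" "t' \<in> T"
  shows "f0 (m \<otimes> m') (s \<otimes> s') = f0 (n \<otimes> n') (t \<otimes> t')"
proof -
  obtain u where u: "u \<in> T" "u \<otimes> (t \<otimes> m) = u \<otimes> (s \<otimes> n)"
    using assms by (auto simp: f0_eq_iff)
  obtain v where v: "v \<in> T" "v \<otimes> (t' \<otimes> m') = v \<otimes> (s' \<otimes> n')"
    using assms by (auto simp: f0_eq_iff)
  have "(u \<otimes> v) \<otimes> ((t \<otimes> t') \<otimes> (m \<otimes> m')) = (u \<otimes> (t \<otimes> m)) \<otimes> (v \<otimes> (t' \<otimes> m'))"
    using c u(1) v(1) by (simp add: m_ac)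
  also have "\<dots> = (u \<otimes> v) \<otimes> ((s \<otimes> s') \<otimes> (n \<otimes> n'))"
    unfolding u(2) v(2) using c u(1) v(1) by (simp add: m_ac)
  finally show ?thesis using c u(1) v(1) by (subst f0_eq_iff) (auto intro!: bexI[of _ "u \<otimes> v"])
qed

lemma L_mult:
  assumes c: "m \<in> carrier R" "s \<in> T" "m' \<in> carrier R" "s' \<in> T"
  shows "f0 m s \<otimes>\<^bsub>L\<^esub> f0 m' s' = f0 (m \<otimes> m') (s \<otimes> s')"
  unfolding loc_ring_def Let_def monoid.simps
proof (rule Union_pairs_const)
  fix n t assume "(n, t) \<in> f0 m s"
  then have n: "n \<in> carrier R" "t \<in> T" "f0 n t = f0 m s" using self.fr_mem[of n t m s] by auto
  show "(\<Union>(n', t')\<in>f0 m' s'. f0 (n \<otimes> n') (t \<otimes> t')) = f0 (m \<otimes> m') (s \<otimes> s')"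
  proof (rule Union_pairs_const)
    fix n' t' assume "(n', t') \<in> f0 m' s'"
    then have n': "n' \<in> carrier R" "t' \<in> T" "f0 n' t' = f0 m' s'"
      using self.fr_mem[of n' t' m' s'] by auto
    show "f0 (n \<otimes> n') (t \<otimes> t') = f0 (m \<otimes> m') (s \<otimes> s')"
      by (rule f0_mult_cong) (use n n' c in auto)
  qed (use c self.fr_nonempty in auto)
qed (use c self.fr_nonempty in auto)

lemma L_add:
  assumes c: "m \<in> carrier R" "s \<in> T" "m' \<in> carrier R" "s' \<in> T"
  shows "f0 m s \<oplus>\<^bsub>L\<^esub> f0 m' s' = f0 (s' \<otimes> m \<oplus> s \<otimes> m') (s \<otimes> s')"
  unfolding loc_ring_def Let_def ring_record_simps
proof (rule Union_pairs_const)
  fix n t assume "(n, t) \<in> f0 m s"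
  then have n: "n \<in> carrier R" "t \<in> T" "f0 n t = f0 m s" using self.fr_mem[of n t m s] by auto
  show "(\<Union>(n', t')\<in>f0 m' s'. f0 (t' \<otimes> n \<oplus> t \<otimes> n') (t \<otimes> t')) = f0 (s' \<otimes> m \<oplus> s \<otimes> m') (s \<otimes> s')"
  proof (rule Union_pairs_const)
    fix n' t' assume "(n', t') \<in> f0 m' s'"
    then have n': "n' \<in> carrier R" "t' \<in> T" "f0 n' t' = f0 m' s'"
      using self.fr_mem[of n' t' m' s'] by auto
    show "f0 (t' \<otimes> n \<oplus> t \<otimes> n') (t \<otimes> t') = f0 (s' \<otimes> m \<oplus> s \<otimes> m') (s \<otimes> s')"
      using self.fr_add_cong[of n t m s n' t' m' s'] n n' c by simp
  qed (use c self.fr_nonempty in auto)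
qed (use c self.fr_nonempty in auto)

lemma L_one: "\<one>\<^bsub>L\<^esub> = f0 \<one> \<one>" and L_zero: "\<zero>\<^bsub>L\<^esub> = f0 \<zero> \<one>"
  by (simp_all add: loc_ring_def Let_def)

lemma L_self: "s \<in> T \<Longrightarrow> f0 s s = \<one>\<^bsub>L\<^esub>"
  using f0_cancel[of \<one> \<one> s] by (simp add: L_one)

lemma L_zero_s: "s \<in> T \<Longrightarrow> f0 \<zero> s = \<zero>\<^bsub>L\<^esub>"
  using f0_cancel[of \<zero> \<one> s] by (simp add: L_zero)

lemma L_cring: "cring L"
proof (rule cringI)
  show "abelian_group L"
  proof (rule abelian_groupI)
    fix x y assume "x \<in> carrier L" "y \<in> carrier L"
    then show "x \<oplus>\<^bsub>L\<^esub> y \<in> carrier L"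
      by (elim L_cases) (simp add: L_add)
  next
    fix x y z assume "x \<in> carrier L" "y \<in> carrier L" "z \<in> carrier L"
    then show "x \<oplus>\<^bsub>L\<^esub> y \<oplus>\<^bsub>L\<^esub> z = x \<oplus>\<^bsub>L\<^esub> (y \<oplus>\<^bsub>L\<^esub> z)"
      by (elim L_cases) (simp add: L_add r_distr m_ac a_ac)
  next
    fix x y assume "x \<in> carrier L" "y \<in> carrier L"
    then show "x \<oplus>\<^bsub>L\<^esub> y = y \<oplus>\<^bsub>L\<^esub> x"
      by (elim L_cases) (simp add: L_add m_ac a_ac)
  next
    fix x assume "x \<in> carrier L"
    then show "\<zero>\<^bsub>L\<^esub> \<oplus>\<^bsub>L\<^esub> x = x"
      by (elim L_cases) (simp add: L_add L_zero)
  next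
    fix x assume "x \<in> carrier L"
    then obtain m s where x: "x = f0 m s" "m \<in> carrier R" "s \<in> T" by (auto elim: L_cases)
    show "\<exists>y\<in>carrier L. y \<oplus>\<^bsub>L\<^esub> x = \<zero>\<^bsub>L\<^esub>"
    proof
      show "f0 (\<ominus> m) s \<oplus>\<^bsub>L\<^esub> x = \<zero>\<^bsub>L\<^esub>"
        using x by (simp add: L_add r_minus l_neg L_zero_s)
    qed (use x in simp)
  qed (simp add: L_zero)
  show "comm_monoid L"
  proof (rule comm_monoidI)
    fix x y assume "x \<in> carrier L" "y \<in> carrier L"
    then show "x \<otimes>\<^bsub>L\<^esub> y \<in> carrier L"
      by (elim L_cases) (simp add: L_mult)
  next
    fix x y z assume "x \<in> carrier L" "y \<in> carrier L" "z \<in> carrier L"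
    then show "x \<otimes>\<^bsub>L\<^esub> y \<otimes>\<^bsub>L\<^esub> z = x \<otimes>\<^bsub>L\<^esub> (y \<otimes>\<^bsub>L\<^esub> z)"
      by (elim L_cases) (simp add: L_mult m_ac)
  next
    fix x y assume "x \<in> carrier L" "y \<in> carrier L"
    then show "x \<otimes>\<^bsub>L\<^esub> y = y \<otimes>\<^bsub>L\<^esub> x"
      by (elim L_cases) (simp add: L_mult m_ac)
  next
    fix x assume "x \<in> carrier L"
    then show "\<one>\<^bsub>L\<^esub> \<otimes>\<^bsub>L\<^esub> x = x"
      by (elim L_cases) (simp add: L_mult L_one)
  qed (simp add: L_one)
  fix x y z assume "x \<in> carrier L" "y \<in> carrier L" "z \<in> carrier L"
  then obtain m s m' s' n t where xyz: "x = f0 m s" "y = f0 m' s'" "z = f0 n t"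
    and c: "m \<in> carrier R" "s \<in> T" "m' \<in> carrier R" "s' \<in> T" "n \<in> carrier R" "t \<in> T"
    by (metis L_cases)
  have "(x \<oplus>\<^bsub>L\<^esub> y) \<otimes>\<^bsub>L\<^esub> z = f0 ((s' \<otimes> m \<oplus> s \<otimes> m') \<otimes> n) (s \<otimes> s' \<otimes> t)"
    unfolding xyz using c by (simp add: L_add L_mult)
  \<comment> \<open>The right-hand side carries the denominator \<open>t\<close> twice, so the
    fraction is expanded by \<open>t\<close>.\<close>
  also have "\<dots> = f0 (t \<otimes> ((s' \<otimes> m \<oplus> s \<otimes> m') \<otimes> n)) (t \<otimes> (s \<otimes> s' \<otimes> t))"
    using c by (intro f0_cancel[symmetric]) auto
  also have "\<dots> = x \<otimes>\<^bsub>L\<^esub> z \<oplus>\<^bsub>L\<^esub> y \<otimes>\<^bsub>L\<^esub> z"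
    unfolding xyz using c by (simp add: L_add L_mult l_distr r_distr m_ac)
  finally show "(x \<oplus>\<^bsub>L\<^esub> y) \<otimes>\<^bsub>L\<^esub> z = x \<otimes>\<^bsub>L\<^esub> z \<oplus>\<^bsub>L\<^esub> y \<otimes>\<^bsub>L\<^esub> z" .
qed

lemma L_hom: "ring_hom_cring R L (\<lambda>r. f0 r \<one>)"
  by (intro ring_hom_cring.intro ring_hom_cring_axioms.intro L_cring R.is_cring ring_hom_memI)
    (auto simp: L_mult L_add L_one)

lemma L_inverse: "s \<in> T \<Longrightarrow> f0 s \<one> \<otimes>\<^bsub>L\<^esub> f0 \<one> s = \<one>\<^bsub>L\<^esub>"
  by (simp add: L_mult L_self)

lemma L_Units: "s \<in> T \<Longrightarrow> f0 s \<one> \<in> Units L"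
proof -
  assume s: "s \<in> T"
  interpret L: cring L by (rule L_cring)
  show ?thesis unfolding Units_def
    using s L_inverse[OF s] L.m_comm[of "f0 s \<one>" "f0 \<one> s"] by auto
qed

lemma L_split: "\<lbrakk>m \<in> carrier R; s \<in> T\<rbrakk> \<Longrightarrow> f0 m s = f0 m \<one> \<otimes>\<^bsub>L\<^esub> f0 \<one> s"
  by (simp add: L_mult)

text \<open>The image of \<open>1/s\<close> is the inverse of the image of \<open>s\<close>, and
  inverses are unique.\<close>

lemma L_hom_unique:
  assumes g: "ring_hom_cring L C g" and g': "ring_hom_cring L C g'"
    and eq: "\<And>r. r \<in> carrier R \<Longrightarrow> g (f0 r \<one>) = g' (f0 r \<one>)"
    and x: "x \<in> carrier L"
  shows "g x = g' x"
proof -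
  interpret g: ring_hom_cring L C g by fact
  interpret g': ring_hom_cring L C g' by fact
  from x obtain m s where x: "x = f0 m s" and m: "m \<in> carrier R" and s: "s \<in> T"
    by (auto elim: L_cases)
  have c: "f0 s \<one> \<in> carrier L" "f0 \<one> s \<in> carrier L" "f0 m \<one> \<in> carrier L" using m s by auto
  have 1: "g (f0 s \<one>) \<otimes>\<^bsub>C\<^esub> g (f0 \<one> s) = \<one>\<^bsub>C\<^esub>"
    using L_inverse[OF s] g.hom_mult[OF c(1,2)] by simp
  have 2: "g (f0 s \<one>) \<otimes>\<^bsub>C\<^esub> g' (f0 \<one> s) = \<one>\<^bsub>C\<^esub>"
    using L_inverse[OF s] g'.hom_mult[OF c(1,2)] eq[of s] s by simp
  have "g (f0 \<one> s) = g' (f0 \<one> s)"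
    using 1 2 c g.S.inv_unique[of "g (f0 \<one> s)" "g (f0 s \<one>)" "g' (f0 \<one> s)"]
    by (simp add: g.S.m_comm)
  then show ?thesis unfolding x L_split[OF m s] using c eq[OF m] by simp
qed

lemma L_universal:
  assumes h: "ring_hom_cring R C h" and u: "\<And>s. s \<in> T \<Longrightarrow> h s \<in> Units C"
  shows "\<exists>g. ring_hom_cring L C g \<and> (\<forall>r\<in>carrier R. g (f0 r \<one>) = h r)"
proof -
  interpret h: ring_hom_cring R C h by fact
  interpret L: cring L by (rule L_cring)
  define q where "q = (\<lambda>r s. h r \<otimes>\<^bsub>C\<^esub> inv\<^bsub>C\<^esub> (h s))"
  have ic [simp]: "inv\<^bsub>C\<^esub> (h s) \<in> carrier C" if "s \<in> T" for s using u[OF that] by auto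
  have qc: "q r s \<in> carrier C" if "r \<in> carrier R" "s \<in> T" for r s
    unfolding q_def using that by auto
  \<comment> \<open>\<open>q r s\<close> is characterized as the solution \<open>c\<close> of
    \<open>h r = h s \<otimes> c\<close>. Each law then follows by cancelling units instead of
    computing with inverses.\<close>
  have qeq: "q r s = c \<longleftrightarrow> h r = h s \<otimes>\<^bsub>C\<^esub> c" if "r \<in> carrier R" "s \<in> T" "c \<in> carrier C" for r s c
  proof -
    have hs: "h s \<in> carrier C" using that by auto
    have [simp]: "h s \<otimes>\<^bsub>C\<^esub> (inv\<^bsub>C\<^esub> (h s)) = \<one>\<^bsub>C\<^esub>" using u that by auto
    have "h s \<otimes>\<^bsub>C\<^esub> (h r \<otimes>\<^bsub>C\<^esub> inv\<^bsub>C\<^esub> (h s)) = h r \<otimes>\<^bsub>C\<^esub> (h s \<otimes>\<^bsub>C\<^esub> inv\<^bsub>C\<^esub> (h s))"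
      using that hs by (intro h.S.m_lcomm) auto
    then have 1: "h s \<otimes>\<^bsub>C\<^esub> q r s = h r" unfolding q_def using that by simp
    have "h s \<otimes>\<^bsub>C\<^esub> q r s = h s \<otimes>\<^bsub>C\<^esub> c \<Longrightarrow> q r s = c"
      using h.S.Units_l_cancel[OF u[OF that(2)] qc[OF that(1,2)] that(3)] by simp
    with 1 show ?thesis by auto
  qed
  have wd: "q r s = q r' s'" if c: "r \<in> carrier R" "s \<in> T" "r' \<in> carrier R" "s' \<in> T" and e: "f0 r s = f0 r' s'"
    for r s r' s'
  proof -
    obtain v where v: "v \<in> T" "v \<otimes> (s' \<otimes> r) = v \<otimes> (s \<otimes> r')"
      using e c by (auto simp: f0_eq_iff)
    then have "h (v \<otimes> (s' \<otimes> r)) = h (v \<otimes> (s \<otimes> r'))" by simp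
    then have "h v \<otimes>\<^bsub>C\<^esub> (h s' \<otimes>\<^bsub>C\<^esub> h r) = h v \<otimes>\<^bsub>C\<^esub> (h s \<otimes>\<^bsub>C\<^esub> h r')"
      using c v(1) by simp
    then have 1: "h s' \<otimes>\<^bsub>C\<^esub> h r = h s \<otimes>\<^bsub>C\<^esub> h r'"
      using h.S.Units_l_cancel[OF u[OF v(1)]] c by simp
    have 2: "h r' = h s' \<otimes>\<^bsub>C\<^esub> q r' s'" using qeq[of r' s' "q r' s'"] qc c by simp
    have "h s' \<otimes>\<^bsub>C\<^esub> h r = h s' \<otimes>\<^bsub>C\<^esub> (h s \<otimes>\<^bsub>C\<^esub> q r' s')"
      unfolding 1 by (subst 2) (use c qc in \<open>simp add: h.S.m_lcomm\<close>)
    then have "h r = h s \<otimes>\<^bsub>C\<^esub> q r' s'"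
      using h.S.Units_l_cancel[OF u[OF c(4)], of "h r" "h s \<otimes>\<^bsub>C\<^esub> q r' s'"] c qc by simp
    then show ?thesis using qeq[of r s "q r' s'"] c qc by simp
  qed
  \<comment> \<open>A fraction comes as a class without a preferred representative;
    \<open>wd\<close> makes the choice immaterial.\<close>
  define g where "g = (\<lambda>x. SOME c. \<exists>r s. r \<in> carrier R \<and> s \<in> T \<and> x = f0 r s \<and> c = q r s)"
  have g: "g (f0 r s) = q r s" if "r \<in> carrier R" "s \<in> T" for r s
  proof -
    have "\<exists>c r' s'. r' \<in> carrier R \<and> s' \<in> T \<and> f0 r s = f0 r' s' \<and> c = q r' s'" using that by blast
    from someI_ex[OF this] obtain r' s' where "r' \<in> carrier R" "s' \<in> T" "f0 r s = f0 r' s'" "g (f0 r s) = q r' s'"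
      unfolding g_def by blast
    then show ?thesis using wd that by metis
  qed
  have hq: "h r = h s \<otimes>\<^bsub>C\<^esub> q r s" if "r \<in> carrier R" "s \<in> T" for r s
    using qeq[of r s "q r s"] qc that by simp
  have "ring_hom_cring L C g"
  proof (intro ring_hom_cring.intro ring_hom_cring_axioms.intro ring_hom_memI)
    fix x assume "x \<in> carrier L" then show "g x \<in> carrier C" by (elim L_cases) (simp add: g qc)
  next
    fix x y assume "x \<in> carrier L" "y \<in> carrier L"
    then obtain m s m' s' where xy: "x = f0 m s" "y = f0 m' s'"
      and c: "m \<in> carrier R" "s \<in> T" "m' \<in> carrier R" "s' \<in> T" by (metis L_cases)
    have cc: "h s \<in> carrier C" "h s' \<in> carrier C" "q m s \<in> carrier C" "q m' s' \<in> carrier C"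
      using c qc by auto
    have "q (m \<otimes> m') (s \<otimes> s') = q m s \<otimes>\<^bsub>C\<^esub> q m' s'"
      using c qc by (subst qeq) (auto simp: hq[of m s] hq[of m' s'] h.S.m_ac)
    then show "g (x \<otimes>\<^bsub>L\<^esub> y) = g x \<otimes>\<^bsub>C\<^esub> g y" unfolding xy using c by (simp add: L_mult g)
    have "q (s' \<otimes> m \<oplus> s \<otimes> m') (s \<otimes> s') = q m s \<oplus>\<^bsub>C\<^esub> q m' s'"
      using c qc by (subst qeq) (auto simp: hq[of m s] hq[of m' s'] h.S.m_ac h.S.r_distr)
    then show "g (x \<oplus>\<^bsub>L\<^esub> y) = g x \<oplus>\<^bsub>C\<^esub> g y" unfolding xy using c by (simp add: L_add g)
  next
    show "g \<one>\<^bsub>L\<^esub> = \<one>\<^bsub>C\<^esub>" using qeq[of \<one> \<one> "\<one>\<^bsub>C\<^esub>"] by (simp add: L_one g)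
  qed (auto intro: L_cring h.S.is_cring)
  moreover have "g (f0 r \<one>) = h r" if "r \<in> carrier R" for r
    using g[of r \<one>] qeq[of r \<one> "h r"] that by simp
  ultimately show ?thesis by blast
qed

end

section \<open>Localization of a module\<close>

context frac
begin

interpretation lr: locring R T
  using T by (simp add: locring_def locring_axioms_def R.is_cring)

abbreviation "LM \<equiv> loc_module R T M"
abbreviation "rfr \<equiv> loc_frac (algebra_via R (\<lambda>x. x)) T"

lemma carrier_LM: "carrier LM = {fr m s | m s. m \<in> carrier M \<and> s \<in> T}"
  using fr_quotient by (simp add: loc_module_def Let_def)

lemma LM_closed [simp]: "\<lbrakk>m \<in> carrier M; s \<in> T\<rbrakk> \<Longrightarrow> fr m s \<in> carrier LM"
  by (auto simp: carrier_LM)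

lemma LM_cases: "x \<in> carrier LM \<Longrightarrow> (\<And>m s. \<lbrakk>x = fr m s; m \<in> carrier M; s \<in> T\<rbrakk> \<Longrightarrow> P) \<Longrightarrow> P"
  by (auto simp: carrier_LM)

lemma LM_add:
  assumes c: "m \<in> carrier M" "s \<in> T" "m' \<in> carrier M" "s' \<in> T"
  shows "fr m s \<oplus>\<^bsub>LM\<^esub> fr m' s' = fr ((s' \<odot>\<^bsub>M\<^esub> m) \<oplus>\<^bsub>M\<^esub> (s \<odot>\<^bsub>M\<^esub> m')) (s \<otimes> s')"
  unfolding loc_module_def Let_def ring_record_simps
proof (rule Union_pairs_const)
  fix n t assume "(n, t) \<in> fr m s"
  then have n: "n \<in> carrier M" "t \<in> T" "fr n t = fr m s" using fr_mem[of n t m s] by auto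
  show "(\<Union>(n', t')\<in>fr m' s'. fr ((t' \<odot>\<^bsub>M\<^esub> n) \<oplus>\<^bsub>M\<^esub> (t \<odot>\<^bsub>M\<^esub> n')) (t \<otimes> t'))
    = fr ((s' \<odot>\<^bsub>M\<^esub> m) \<oplus>\<^bsub>M\<^esub> (s \<odot>\<^bsub>M\<^esub> m')) (s \<otimes> s')"
  proof (rule Union_pairs_const)
    fix n' t' assume "(n', t') \<in> fr m' s'"
    then have n': "n' \<in> carrier M" "t' \<in> T" "fr n' t' = fr m' s'"
      using fr_mem[of n' t' m' s'] by auto
    show "fr ((t' \<odot>\<^bsub>M\<^esub> n) \<oplus>\<^bsub>M\<^esub> (t \<odot>\<^bsub>M\<^esub> n')) (t \<otimes> t')
      = fr ((s' \<odot>\<^bsub>M\<^esub> m) \<oplus>\<^bsub>M\<^esub> (s \<odot>\<^bsub>M\<^esub> m')) (s \<otimes> s')"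
      using fr_add_cong[of n t m s n' t' m' s'] n n' c by simp
  qed (use c fr_nonempty in auto)
qed (use c fr_nonempty in auto)

lemma LM_smult:
  assumes c: "b \<in> carrier R" "s \<in> T" "m' \<in> carrier M" "s' \<in> T"
  shows "rfr b s \<odot>\<^bsub>LM\<^esub> fr m' s' = fr (b \<odot>\<^bsub>M\<^esub> m') (s \<otimes> s')"
  unfolding loc_module_def Let_def module.simps
proof (rule Union_pairs_const)
  fix n t assume "(n, t) \<in> rfr b s"
  then have n: "n \<in> carrier R" "t \<in> T" "rfr n t = rfr b s"
    using lr.self.fr_mem[of n t b s] by auto
  show "(\<Union>(n', t')\<in>fr m' s'. fr (n \<odot>\<^bsub>M\<^esub> n') (t \<otimes> t')) = fr (b \<odot>\<^bsub>M\<^esub> m') (s \<otimes> s')"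
  proof (rule Union_pairs_const)
    fix n' t' assume "(n', t') \<in> fr m' s'"
    then have n': "n' \<in> carrier M" "t' \<in> T" "fr n' t' = fr m' s'"
      using fr_mem[of n' t' m' s'] by auto
    obtain u where u: "u \<in> T" "u \<otimes> (s \<otimes> n) = u \<otimes> (t \<otimes> b)"
      using n c by (auto simp: lr.f0_eq_iff)
    obtain v where v: "v \<in> T" "v \<odot>\<^bsub>M\<^esub> (s' \<odot>\<^bsub>M\<^esub> n') = v \<odot>\<^bsub>M\<^esub> (t' \<odot>\<^bsub>M\<^esub> m')"
      using n' c by (auto simp: fr_eq_iff)
    have "(u \<otimes> v) \<odot>\<^bsub>M\<^esub> ((s \<otimes> s') \<odot>\<^bsub>M\<^esub> (n \<odot>\<^bsub>M\<^esub> n')) = (u \<otimes> (s \<otimes> n)) \<odot>\<^bsub>M\<^esub> (v \<odot>\<^bsub>M\<^esub> (s' \<odot>\<^bsub>M\<^esub> n'))"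
      using c n n' u(1) v(1) by (simp add: smult_assoc1[symmetric] R.m_ac)
    also have "\<dots> = (u \<otimes> v) \<odot>\<^bsub>M\<^esub> ((t \<otimes> t') \<odot>\<^bsub>M\<^esub> (b \<odot>\<^bsub>M\<^esub> m'))"
      unfolding u(2) v(2) using c n n' u(1) v(1) by (simp add: smult_assoc1[symmetric] R.m_ac)
    finally show "fr (n \<odot>\<^bsub>M\<^esub> n') (t \<otimes> t') = fr (b \<odot>\<^bsub>M\<^esub> m') (s \<otimes> s')"
      using c n n' u(1) v(1) by (subst fr_eq_iff) (auto intro!: bexI[of _ "u \<otimes> v"])
  qed (use c fr_nonempty in auto)
qed (use c lr.self.fr_nonempty in auto)

lemma LM_zero: "\<zero>\<^bsub>LM\<^esub> = fr \<zero>\<^bsub>M\<^esub> \<one>" by (simp add: loc_module_def)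

lemma LM_abelian_monoid: "abelian_monoid LM"
proof (rule abelian_monoidI)
  fix x y assume "x \<in> carrier LM" "y \<in> carrier LM"
  then show "x \<oplus>\<^bsub>LM\<^esub> y \<in> carrier LM" by (elim LM_cases) (simp add: LM_add)
next
  fix x y z assume "x \<in> carrier LM" "y \<in> carrier LM" "z \<in> carrier LM"
  then show "x \<oplus>\<^bsub>LM\<^esub> y \<oplus>\<^bsub>LM\<^esub> z = x \<oplus>\<^bsub>LM\<^esub> (y \<oplus>\<^bsub>LM\<^esub> z)"
    by (elim LM_cases) (simp add: LM_add smult_r_distr smult_assoc1[symmetric] R.m_ac M.a_ac)
next
  fix x y assume "x \<in> carrier LM" "y \<in> carrier LM"
  then show "x \<oplus>\<^bsub>LM\<^esub> y = y \<oplus>\<^bsub>LM\<^esub> x"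
    by (elim LM_cases) (simp add: LM_add R.m_ac M.a_ac)
next
  fix x assume "x \<in> carrier LM"
  then show "\<zero>\<^bsub>LM\<^esub> \<oplus>\<^bsub>LM\<^esub> x = x" by (elim LM_cases) (simp add: LM_add LM_zero)
qed (simp add: LM_zero)

lemma LM_finsum_one:
  assumes "finite I" "\<And>i. i \<in> I \<Longrightarrow> v i \<in> carrier M"
  shows "(\<Oplus>\<^bsub>LM\<^esub>i\<in>I. fr (v i) \<one>) = fr (\<Oplus>\<^bsub>M\<^esub>i\<in>I. v i) \<one>"
  using assms
proof (induction I rule: finite_induct)
  interpret LM: abelian_monoid LM by (rule LM_abelian_monoid)
  { case empty then show ?case by (simp add: LM_zero) }
  { case (insert x F)
    then have "(\<Oplus>\<^bsub>LM\<^esub>i\<in>insert x F. fr (v i) \<one>) = fr (v x) \<one> \<oplus>\<^bsub>LM\<^esub> (\<Oplus>\<^bsub>LM\<^esub>i\<in>F. fr (v i) \<one>)"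
      by (intro LM.finsum_insert) auto
    moreover have "(\<Oplus>\<^bsub>M\<^esub>i\<in>insert x F. v i) = v x \<oplus>\<^bsub>M\<^esub> (\<Oplus>\<^bsub>M\<^esub>i\<in>F. v i)"
      using insert by (intro M.finsum_insert) auto
    moreover have "(\<Oplus>\<^bsub>M\<^esub>i\<in>F. v i) \<in> carrier M" using insert by (intro M.finsum_closed) auto
    ultimately show ?case using insert by (simp add: LM_add) }
qed

text \<open>Passing to a common denominator changes the coefficients only. The vectors
  \<open>q i\<close> stay, so that they can serve as fixed generators.\<close>

lemma LM_finsum:
  assumes "finite I" "\<And>i. i \<in> I \<Longrightarrow> q i \<in> carrier M" "\<And>i. i \<in> I \<Longrightarrow> b i \<in> carrier R" "\<And>i. i \<in> I \<Longrightarrow> r i \<in> T"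
  shows "\<exists>t\<in>T. \<exists>c\<in>I \<rightarrow> carrier R. (\<Oplus>\<^bsub>LM\<^esub>i\<in>I. fr (b i \<odot>\<^bsub>M\<^esub> q i) (r i)) = fr (\<Oplus>\<^bsub>M\<^esub>i\<in>I. c i \<odot>\<^bsub>M\<^esub> q i) t"
  using assms
proof (induction I rule: finite_induct)
  interpret LM: abelian_monoid LM by (rule LM_abelian_monoid)
  { case empty then show ?case by (auto intro!: bexI[of _ \<one>] simp: LM_zero) }
  { case (insert x F)
    then obtain t c where t: "t \<in> T" and c: "c \<in> F \<rightarrow> carrier R"
      and eq: "(\<Oplus>\<^bsub>LM\<^esub>i\<in>F. fr (b i \<odot>\<^bsub>M\<^esub> q i) (r i)) = fr (\<Oplus>\<^bsub>M\<^esub>i\<in>F. c i \<odot>\<^bsub>M\<^esub> q i) t" by auto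
    have sc: "(\<Oplus>\<^bsub>M\<^esub>i\<in>F. c i \<odot>\<^bsub>M\<^esub> q i) \<in> carrier M"
      using insert c by (intro M.finsum_closed) auto
    have cF: "c i \<in> carrier R" if "i \<in> F" for i using c that by auto
    have 1: "(\<Oplus>\<^bsub>LM\<^esub>i\<in>insert x F. fr (b i \<odot>\<^bsub>M\<^esub> q i) (r i))
      = fr (t \<odot>\<^bsub>M\<^esub> (b x \<odot>\<^bsub>M\<^esub> q x) \<oplus>\<^bsub>M\<^esub> r x \<odot>\<^bsub>M\<^esub> (\<Oplus>\<^bsub>M\<^esub>i\<in>F. c i \<odot>\<^bsub>M\<^esub> q i)) (r x \<otimes> t)"
      using insert t sc by (subst LM.finsum_insert) (auto simp: eq LM_add)
    let ?c = "\<lambda>i. if i = x then t \<otimes> b x else r x \<otimes> c i"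
    have "(\<Oplus>\<^bsub>M\<^esub>i\<in>insert x F. ?c i \<odot>\<^bsub>M\<^esub> q i) = (t \<otimes> b x) \<odot>\<^bsub>M\<^esub> q x \<oplus>\<^bsub>M\<^esub> (\<Oplus>\<^bsub>M\<^esub>i\<in>F. ?c i \<odot>\<^bsub>M\<^esub> q i)"
      using insert cF t by (subst M.finsum_insert) auto
    also have "(\<Oplus>\<^bsub>M\<^esub>i\<in>F. ?c i \<odot>\<^bsub>M\<^esub> q i) = (\<Oplus>\<^bsub>M\<^esub>i\<in>F. r x \<odot>\<^bsub>M\<^esub> (c i \<odot>\<^bsub>M\<^esub> q i))"
      by (rule M.finsum_cong') (use insert c in \<open>auto simp: smult_assoc1 Pi_iff\<close>)
    also have "\<dots> = r x \<odot>\<^bsub>M\<^esub> (\<Oplus>\<^bsub>M\<^esub>i\<in>F. c i \<odot>\<^bsub>M\<^esub> q i)"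
      using insert c by (intro finsum_smult_ldistr[symmetric]) auto
    finally have 2: "(\<Oplus>\<^bsub>M\<^esub>i\<in>insert x F. ?c i \<odot>\<^bsub>M\<^esub> q i)
      = t \<odot>\<^bsub>M\<^esub> (b x \<odot>\<^bsub>M\<^esub> q x) \<oplus>\<^bsub>M\<^esub> r x \<odot>\<^bsub>M\<^esub> (\<Oplus>\<^bsub>M\<^esub>i\<in>F. c i \<odot>\<^bsub>M\<^esub> q i)"
      using insert t by (simp add: smult_assoc1)
    show ?case unfolding 1 2[symmetric]
      by (rule bexI[of _ "r x \<otimes> t"], rule bexI[of _ ?c]) (use insert t cF in auto) }
qed

text \<open>Freeness of the localized module with all denominators cleared: the \<open>q i\<close>
  span up to a multiplier from \<open>T\<close> and are independent up to \<open>T\<close>-torsion.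
  In this form local freeness of a given quotient enters the proof.\<close>

lemma free_of_rank_locD:
  assumes "free_of_rank (loc_ring R T) LM n"
  obtains q where "\<And>i. i < n \<Longrightarrow> q i \<in> carrier M"
    and "\<And>m. m \<in> carrier M \<Longrightarrow>
      \<exists>t\<in>T. \<exists>c\<in>{..<n} \<rightarrow> carrier R. t \<odot>\<^bsub>M\<^esub> m = (\<Oplus>\<^bsub>M\<^esub>i\<in>{..<n}. c i \<odot>\<^bsub>M\<^esub> q i)"
    and "\<And>c. \<lbrakk>c \<in> {..<n} \<rightarrow> carrier R; (\<Oplus>\<^bsub>M\<^esub>i\<in>{..<n}. c i \<odot>\<^bsub>M\<^esub> q i) = \<zero>\<^bsub>M\<^esub>\<rbrakk>
      \<Longrightarrow> \<exists>t\<in>T. \<forall>i<n. t \<otimes> c i = \<zero>"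
proof -
  interpret LM: abelian_monoid LM by (rule LM_abelian_monoid)
  from assms have "\<exists>e\<in>{..<n} \<rightarrow> carrier LM. \<forall>m\<in>carrier LM.
       \<exists>!c. c \<in> {..<n} \<rightarrow>\<^sub>E carrier (loc_ring R T) \<and> m = (\<Oplus>\<^bsub>LM\<^esub>i\<in>{..<n}. c i \<odot>\<^bsub>LM\<^esub> e i)"
    unfolding free_of_rank_def .
  then obtain e where e: "e \<in> {..<n} \<rightarrow> carrier LM"
    and un': "\<forall>m\<in>carrier LM.
       \<exists>!c. c \<in> {..<n} \<rightarrow>\<^sub>E carrier (loc_ring R T) \<and> m = (\<Oplus>\<^bsub>LM\<^esub>i\<in>{..<n}. c i \<odot>\<^bsub>LM\<^esub> e i)"
    by (rule bexE)
  have un: "\<And>m. m \<in> carrier LM \<Longrightarrow>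
       \<exists>!c. c \<in> {..<n} \<rightarrow>\<^sub>E carrier (loc_ring R T) \<and> m = (\<Oplus>\<^bsub>LM\<^esub>i\<in>{..<n}. c i \<odot>\<^bsub>LM\<^esub> e i)"
    using un' by (rule bspec)
  have "\<forall>i\<in>{..<n}. \<exists>qs. fst qs \<in> carrier M \<and> snd qs \<in> T \<and> e i = fr (fst qs) (snd qs)"
  proof
    fix i assume "i \<in> {..<n}"
    then have "e i \<in> carrier LM" using e by auto
    then show "\<exists>qs. fst qs \<in> carrier M \<and> snd qs \<in> T \<and> e i = fr (fst qs) (snd qs)"
      by (elim LM_cases) auto
  qed
  then obtain qs where "\<forall>i\<in>{..<n}. fst (qs i) \<in> carrier M \<and> snd (qs i) \<in> T \<and> e i = fr (fst (qs i)) (snd (qs i))"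
    by (rule bchoice[THEN exE])
  moreover define q where "q = (\<lambda>i. fst (qs i))"
  moreover define s where "s = (\<lambda>i. snd (qs i))"
  ultimately have q: "\<And>i. i < n \<Longrightarrow> q i \<in> carrier M" and s: "\<And>i. i < n \<Longrightarrow> s i \<in> T"
    and eq: "\<And>i. i < n \<Longrightarrow> e i = fr (q i) (s i)" by auto
  show ?thesis
  proof (rule that[of q])
    fix m assume m: "m \<in> carrier M"
    then obtain c where c: "c \<in> {..<n} \<rightarrow>\<^sub>E carrier (loc_ring R T)" and mc: "fr m \<one> = (\<Oplus>\<^bsub>LM\<^esub>i\<in>{..<n}. c i \<odot>\<^bsub>LM\<^esub> e i)"
      using un[of "fr m \<one>"] by auto
    have "\<forall>i\<in>{..<n}. \<exists>bt. fst bt \<in> carrier R \<and> snd bt \<in> T \<and> c i = rfr (fst bt) (snd bt)"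
    proof
      fix i assume "i \<in> {..<n}"
      then have "c i \<in> carrier (loc_ring R T)" using c by auto
      then show "\<exists>bt. fst bt \<in> carrier R \<and> snd bt \<in> T \<and> c i = rfr (fst bt) (snd bt)"
        by (elim lr.L_cases) auto
    qed
    then obtain bt where "\<forall>i\<in>{..<n}. fst (bt i) \<in> carrier R \<and> snd (bt i) \<in> T \<and> c i = rfr (fst (bt i)) (snd (bt i))"
      by (rule bchoice[THEN exE])
    moreover define b where "b = (\<lambda>i. fst (bt i))"
    moreover define t where "t = (\<lambda>i. snd (bt i))"
    ultimately have b: "\<And>i. i < n \<Longrightarrow> b i \<in> carrier R" and t: "\<And>i. i < n \<Longrightarrow> t i \<in> T"
      and ceq: "\<And>i. i < n \<Longrightarrow> c i = rfr (b i) (t i)" by auto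
    have "fr m \<one> = (\<Oplus>\<^bsub>LM\<^esub>i\<in>{..<n}. fr (b i \<odot>\<^bsub>M\<^esub> q i) (t i \<otimes> s i))"
      unfolding mc by (rule LM.finsum_cong') (use b t q s eq ceq in \<open>auto simp: LM_smult\<close>)
    moreover obtain t' c' where t': "t' \<in> T" and c': "c' \<in> {..<n} \<rightarrow> carrier R"
      and "(\<Oplus>\<^bsub>LM\<^esub>i\<in>{..<n}. fr (b i \<odot>\<^bsub>M\<^esub> q i) (t i \<otimes> s i)) = fr (\<Oplus>\<^bsub>M\<^esub>i\<in>{..<n}. c' i \<odot>\<^bsub>M\<^esub> q i) t'"
      using LM_finsum[of "{..<n}" q b "\<lambda>i. t i \<otimes> s i"] b t q s by auto
    moreover have cc: "(\<Oplus>\<^bsub>M\<^esub>i\<in>{..<n}. c' i \<odot>\<^bsub>M\<^esub> q i) \<in> carrier M"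
      using c' q by (intro M.finsum_closed) auto
    \<comment> \<open>Equality of fractions holds only after a further multiplier \<open>u\<close>,
      which is absorbed into the coefficients.\<close>
    ultimately obtain u where u: "u \<in> T" "u \<odot>\<^bsub>M\<^esub> (t' \<odot>\<^bsub>M\<^esub> m) = u \<odot>\<^bsub>M\<^esub> (\<one> \<odot>\<^bsub>M\<^esub> (\<Oplus>\<^bsub>M\<^esub>i\<in>{..<n}. c' i \<odot>\<^bsub>M\<^esub> q i))"
      using m by (auto simp: fr_eq_iff)
    have "(u \<otimes> t') \<odot>\<^bsub>M\<^esub> m = u \<odot>\<^bsub>M\<^esub> (\<Oplus>\<^bsub>M\<^esub>i\<in>{..<n}. c' i \<odot>\<^bsub>M\<^esub> q i)"
      using u t' m cc by (simp add: smult_assoc1)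
    also have "\<dots> = (\<Oplus>\<^bsub>M\<^esub>i\<in>{..<n}. u \<odot>\<^bsub>M\<^esub> (c' i \<odot>\<^bsub>M\<^esub> q i))"
      using u c' q by (intro finsum_smult_ldistr) auto
    also have "\<dots> = (\<Oplus>\<^bsub>M\<^esub>i\<in>{..<n}. (u \<otimes> c' i) \<odot>\<^bsub>M\<^esub> q i)"
      by (rule M.finsum_cong') (use u c' q in \<open>auto simp: smult_assoc1 Pi_iff\<close>)
    finally show "\<exists>t\<in>T. \<exists>c\<in>{..<n} \<rightarrow> carrier R. t \<odot>\<^bsub>M\<^esub> m = (\<Oplus>\<^bsub>M\<^esub>i\<in>{..<n}. c i \<odot>\<^bsub>M\<^esub> q i)"
      using u t' c' by (intro bexI[of _ "u \<otimes> t'"] bexI[of _ "\<lambda>i. u \<otimes> c' i"]) auto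
  next
    fix c assume c: "c \<in> {..<n} \<rightarrow> carrier R" and z: "(\<Oplus>\<^bsub>M\<^esub>i\<in>{..<n}. c i \<odot>\<^bsub>M\<^esub> q i) = \<zero>\<^bsub>M\<^esub>"
    have cR: "c i \<in> carrier R" if "i < n" for i using c that by auto
    \<comment> \<open>The basis vector \<open>e i\<close> is \<open>q i / s i\<close>, so the
      coefficient \<open>s i c i\<close> produces \<open>c i q i\<close>. Both \<open>c1\<close> and
      the zero family \<open>c0\<close> represent zero, and uniqueness makes them equal.\<close>
    define c1 where "c1 = (\<lambda>i\<in>{..<n}. rfr (s i \<otimes> c i) \<one>)"
    define c0 where "c0 = (\<lambda>i\<in>{..<n}. rfr \<zero> \<one>)"
    have "(\<Oplus>\<^bsub>LM\<^esub>i\<in>{..<n}. c1 i \<odot>\<^bsub>LM\<^esub> e i) = (\<Oplus>\<^bsub>LM\<^esub>i\<in>{..<n}. fr (c i \<odot>\<^bsub>M\<^esub> q i) \<one>)"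
    proof (rule LM.finsum_cong')
      fix i assume "i \<in> {..<n}"
      then have i: "i < n" by simp
      have "c1 i \<odot>\<^bsub>LM\<^esub> e i = fr (s i \<odot>\<^bsub>M\<^esub> (c i \<odot>\<^bsub>M\<^esub> q i)) (s i \<otimes> \<one>)"
        using i q s cR by (simp add: c1_def eq LM_smult smult_assoc1)
      also have "\<dots> = fr (c i \<odot>\<^bsub>M\<^esub> q i) \<one>" by (rule fr_cancel) (use i q s cR in auto)
      finally show "c1 i \<odot>\<^bsub>LM\<^esub> e i = fr (c i \<odot>\<^bsub>M\<^esub> q i) \<one>" .
    qed (use q cR in auto)
    also have "\<dots> = fr (\<Oplus>\<^bsub>M\<^esub>i\<in>{..<n}. c i \<odot>\<^bsub>M\<^esub> q i) \<one>"
      by (rule LM_finsum_one) (use q cR in auto)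
    finally have 1: "(\<Oplus>\<^bsub>LM\<^esub>i\<in>{..<n}. c1 i \<odot>\<^bsub>LM\<^esub> e i) = \<zero>\<^bsub>LM\<^esub>" by (simp add: z LM_zero)
    have "(\<Oplus>\<^bsub>LM\<^esub>i\<in>{..<n}. c0 i \<odot>\<^bsub>LM\<^esub> e i) = (\<Oplus>\<^bsub>LM\<^esub>i\<in>{..<n}. \<zero>\<^bsub>LM\<^esub>)"
    proof (rule LM.finsum_cong')
      fix i assume "i \<in> {..<n}"
      then have i: "i < n" by simp
      have "c0 i \<odot>\<^bsub>LM\<^esub> e i = fr (s i \<odot>\<^bsub>M\<^esub> \<zero>\<^bsub>M\<^esub>) (s i \<otimes> \<one>)"
        using i q s by (simp add: c0_def eq LM_smult)
      also have "\<dots> = fr \<zero>\<^bsub>M\<^esub> \<one>" by (rule fr_cancel) (use i s in auto)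
      finally show "c0 i \<odot>\<^bsub>LM\<^esub> e i = \<zero>\<^bsub>LM\<^esub>" by (simp add: LM_zero)
    qed auto
    also have "\<dots> = \<zero>\<^bsub>LM\<^esub>" by (rule LM.finsum_zero)
    finally have 2: "(\<Oplus>\<^bsub>LM\<^esub>i\<in>{..<n}. c0 i \<odot>\<^bsub>LM\<^esub> e i) = \<zero>\<^bsub>LM\<^esub>" .
    have c1: "c1 \<in> {..<n} \<rightarrow>\<^sub>E carrier (loc_ring R T)" unfolding c1_def
      using cR s by (intro restrict_PiE_iff[THEN iffD2] ballI lr.L_closed) auto
    have c0: "c0 \<in> {..<n} \<rightarrow>\<^sub>E carrier (loc_ring R T)" unfolding c0_def
      by (intro restrict_PiE_iff[THEN iffD2] ballI lr.L_closed) auto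
    have "c1 = c0"
      by (rule ex1_unique[OF un[OF LM.zero_closed]]) (intro conjI c1 c0 1[symmetric] 2[symmetric])+
    have "\<exists>u\<in>T. u \<otimes> c i = \<zero>" if i: "i < n" for i
    proof -
      have "rfr (s i \<otimes> c i) \<one> = rfr \<zero> \<one>" using fun_cong[OF \<open>c1 = c0\<close>, of i] i by (simp add: c1_def c0_def)
      then obtain u where "u \<in> T" "u \<otimes> (s i \<otimes> c i) = \<zero>"
        using i s cR by (auto simp: lr.f0_eq_iff)
      then have "(u \<otimes> s i) \<otimes> c i = \<zero>" "u \<otimes> s i \<in> T" using i s cR by (auto simp: R.m_assoc)
      then show ?thesis by blast
    qed
    then have "\<forall>i\<in>{..<n}. \<exists>v. v \<in> T \<and> v \<otimes> c i = \<zero>" by blast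
    then have "\<exists>u. \<forall>i\<in>{..<n}. u i \<in> T \<and> u i \<otimes> c i = \<zero>" by (rule bchoice)
    then obtain u where u: "\<And>i. i < n \<Longrightarrow> u i \<in> T" "\<And>i. i < n \<Longrightarrow> u i \<otimes> c i = \<zero>" by auto
    \<comment> \<open>One multiplier for all \<open>i\<close>: the product of the individual ones,
      each of which divides it.\<close>
    show "\<exists>t\<in>T. \<forall>i<n. t \<otimes> c i = \<zero>"
    proof (intro bexI[of _ "finprod R u {..<n}"] allI impI)
      show "finprod R u {..<n} \<in> T" using u by (intro T_prod) auto
      fix i assume i: "i < n"
      have "finprod R u {..<n} = finprod R u (insert i ({..<n} - {i}))" using i by (simp add: insert_absorb)
      also have "\<dots> = u i \<otimes> finprod R u ({..<n} - {i})" using u i by (intro R.finprod_insert) auto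
      finally have e: "finprod R u {..<n} = u i \<otimes> finprod R u ({..<n} - {i})" .
      have "finprod R u ({..<n} - {i}) \<in> carrier R" using u by (intro R.finprod_closed) auto
      then show "finprod R u {..<n} \<otimes> c i = \<zero>" unfolding e
        using u[OF i] cR[OF i] R.m_comm[of "u i" "finprod R u ({..<n} - {i})"] by (simp add: R.m_assoc)
    qed
  qed (use q in auto)
qed

end

text \<open>With \<open>1\<close> as the only denominator, fractions are equal only if their
  numerators are. This turns a global basis into a witness of local freeness over
  \<open>D(1)\<close>, a neighbourhood of every prime.\<close>

lemma (in module) free_of_rank_loc_one:
  assumes v: "\<And>i. i < n \<Longrightarrow> v i \<in> carrier M"
    and b: "\<And>m. m \<in> carrier M \<Longrightarrow> \<exists>!c. c \<in> {..<n} \<rightarrow>\<^sub>E carrier R \<and> m = (\<Oplus>\<^bsub>M\<^esub>i\<in>{..<n}. c i \<odot>\<^bsub>M\<^esub> v i)"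
  shows "free_of_rank (loc_ring R {\<one>}) (loc_module R {\<one>} M) n"
proof -
  interpret frac R M "{\<one>}" by unfold_locales (auto simp: submonoid_def)
  interpret lr: locring R "{\<one>}" by unfold_locales (auto simp: submonoid_def)
  interpret LM: abelian_monoid LM by (rule LM_abelian_monoid)
  have Mi: "fr m \<one> = fr m' \<one> \<longleftrightarrow> m = m'" if "m \<in> carrier M" "m' \<in> carrier M" for m m'
    using that by (simp add: fr_eq_iff)
  have Ri: "rfr m \<one> = rfr m' \<one> \<longleftrightarrow> m = m'" if "m \<in> carrier R" "m' \<in> carrier R" for m m'
    using that by (simp add: lr.f0_eq_iff)
  have sum: "(\<Oplus>\<^bsub>LM\<^esub>i\<in>{..<n}. c i \<odot>\<^bsub>LM\<^esub> fr (v i) \<one>) = fr (\<Oplus>\<^bsub>M\<^esub>i\<in>{..<n}. d i \<odot>\<^bsub>M\<^esub> v i) \<one>"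
    if "\<And>i. i < n \<Longrightarrow> d i \<in> carrier R" "\<And>i. i < n \<Longrightarrow> c i = rfr (d i) \<one>" for c d
  proof -
    have "(\<Oplus>\<^bsub>LM\<^esub>i\<in>{..<n}. c i \<odot>\<^bsub>LM\<^esub> fr (v i) \<one>) = (\<Oplus>\<^bsub>LM\<^esub>i\<in>{..<n}. fr (d i \<odot>\<^bsub>M\<^esub> v i) \<one>)"
      by (rule LM.finsum_cong') (use that v in \<open>auto simp: LM_smult\<close>)
    also have "\<dots> = fr (\<Oplus>\<^bsub>M\<^esub>i\<in>{..<n}. d i \<odot>\<^bsub>M\<^esub> v i) \<one>"
      by (rule LM_finsum_one) (use that v in auto)
    finally show ?thesis .
  qed
  show ?thesis unfolding free_of_rank_def
  proof (intro bexI[of _ "\<lambda>i. fr (v i) \<one>"] ballI)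
    fix y assume "y \<in> carrier LM"
    then obtain m where y: "y = fr m \<one>" and m: "m \<in> carrier M" by (auto elim!: LM_cases)
    from b[OF m] obtain c where c: "c \<in> {..<n} \<rightarrow>\<^sub>E carrier R" "m = (\<Oplus>\<^bsub>M\<^esub>i\<in>{..<n}. c i \<odot>\<^bsub>M\<^esub> v i)"
      by blast
    have cR: "c i \<in> carrier R" if "i < n" for i using c that by auto
    show "\<exists>!c. c \<in> {..<n} \<rightarrow>\<^sub>E carrier (loc_ring R {\<one>}) \<and> y = (\<Oplus>\<^bsub>LM\<^esub>i\<in>{..<n}. c i \<odot>\<^bsub>LM\<^esub> fr (v i) \<one>)"
    proof (rule ex1I[of _ "\<lambda>i\<in>{..<n}. rfr (c i) \<one>"], intro conjI)
      show "y = (\<Oplus>\<^bsub>LM\<^esub>i\<in>{..<n}. (\<lambda>i\<in>{..<n}. rfr (c i) \<one>) i \<odot>\<^bsub>LM\<^esub> fr (v i) \<one>)"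
        using sum[of c "\<lambda>i\<in>{..<n}. rfr (c i) \<one>"] cR c(2) y by simp
      fix d assume d: "d \<in> {..<n} \<rightarrow>\<^sub>E carrier (loc_ring R {\<one>}) \<and> y = (\<Oplus>\<^bsub>LM\<^esub>i\<in>{..<n}. d i \<odot>\<^bsub>LM\<^esub> fr (v i) \<one>)"
      have "\<forall>i\<in>{..<n}. \<exists>b. b \<in> carrier R \<and> d i = rfr b \<one>"
      proof
        fix i assume "i \<in> {..<n}"
        then have "d i \<in> carrier (loc_ring R {\<one>})" using d by auto
        then show "\<exists>b. b \<in> carrier R \<and> d i = rfr b \<one>" by (elim lr.L_cases) auto
      qed
      then obtain b' where "\<forall>i\<in>{..<n}. b' i \<in> carrier R \<and> d i = rfr (b' i) \<one>"
        by (rule bchoice[THEN exE])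
      then have b': "\<And>i. i < n \<Longrightarrow> b' i \<in> carrier R" "\<And>i. i < n \<Longrightarrow> d i = rfr (b' i) \<one>" by auto
      have "fr m \<one> = fr (\<Oplus>\<^bsub>M\<^esub>i\<in>{..<n}. b' i \<odot>\<^bsub>M\<^esub> v i) \<one>"
        using sum[of b' d] b' d y by simp
      then have "m = (\<Oplus>\<^bsub>M\<^esub>i\<in>{..<n}. b' i \<odot>\<^bsub>M\<^esub> v i)"
        using m b' v by (subst (asm) Mi) (auto intro!: M.finsum_closed)
      also have "\<dots> = (\<Oplus>\<^bsub>M\<^esub>i\<in>{..<n}. restrict b' {..<n} i \<odot>\<^bsub>M\<^esub> v i)"
        by (rule M.finsum_cong') (use b' v in auto)
      finally have "m = (\<Oplus>\<^bsub>M\<^esub>i\<in>{..<n}. restrict b' {..<n} i \<odot>\<^bsub>M\<^esub> v i)" .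
      moreover have "restrict b' {..<n} \<in> {..<n} \<rightarrow>\<^sub>E carrier R" using b' by auto
      ultimately have rb: "restrict b' {..<n} = c" using b[OF m] c by blast
      have "b' i = c i" if "i < n" for i using fun_cong[OF rb, of i] that by simp
      then show "d = (\<lambda>i\<in>{..<n}. rfr (c i) \<one>)"
        using b' d by (intro ext) (auto simp: PiE_def extensional_def restrict_def)
    qed (use cR in auto)
  qed (use v in auto)
qed

section \<open>Determinants\<close>

definition psign :: "('a, 'x) ring_scheme \<Rightarrow> (nat \<Rightarrow> nat) \<Rightarrow> 'a"
  where "psign R p = (if evenperm p then \<one>\<^bsub>R\<^esub> else \<ominus>\<^bsub>R\<^esub> \<one>\<^bsub>R\<^esub>)"

definition mdet :: "('a, 'x) ring_scheme \<Rightarrow> nat \<Rightarrow> (nat \<Rightarrow> nat \<Rightarrow> 'a) \<Rightarrow> 'a"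
  where "mdet R n M = (\<Oplus>\<^bsub>R\<^esub>p\<in>{p. p permutes {..<n}}. psign R p \<otimes>\<^bsub>R\<^esub> (\<Otimes>\<^bsub>R\<^esub>i\<in>{..<n}. M i (p i)))"

context cring
begin

lemma finprod_finsum_distrib:
  assumes "finite I" "finite J" "\<And>i l. \<lbrakk>i \<in> I; l \<in> J\<rbrakk> \<Longrightarrow> a i l \<in> carrier R"
  shows "(\<Otimes>i\<in>I. \<Oplus>l\<in>J. a i l) = (\<Oplus>f\<in>I \<rightarrow>\<^sub>E J. \<Otimes>i\<in>I. a i (f i))"
  using assms(1,3)
proof (induction I rule: finite_induct)
  case empty
  show ?case by (simp add: PiE_empty_domain)
next
  case (insert x I)
  have fin: "finite (I \<rightarrow>\<^sub>E J)" using insert assms by (intro finite_PiE) auto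
  have c1: "(\<Otimes>i\<in>I. a i (f i)) \<in> carrier R" if "f \<in> I \<rightarrow>\<^sub>E J" for f
    by (rule finprod_closed) (use insert that in auto)
  have c2: "(\<Oplus>f\<in>I \<rightarrow>\<^sub>E J. \<Otimes>i\<in>I. a i (f i)) \<in> carrier R"
    by (rule finsum_closed) (use c1 in auto)
  let ?u = "\<lambda>(y, g). g(x := y)"
  have "(\<Otimes>i\<in>insert x I. \<Oplus>l\<in>J. a i l) = (\<Oplus>l\<in>J. a x l) \<otimes> (\<Otimes>i\<in>I. \<Oplus>l\<in>J. a i l)"
    using insert by (intro finprod_insert) (auto intro!: finsum_closed)
  also have "(\<Otimes>i\<in>I. \<Oplus>l\<in>J. a i l) = (\<Oplus>f\<in>I \<rightarrow>\<^sub>E J. \<Otimes>i\<in>I. a i (f i))"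
    using insert by auto
  also have "(\<Oplus>l\<in>J. a x l) \<otimes> (\<Oplus>f\<in>I \<rightarrow>\<^sub>E J. \<Otimes>i\<in>I. a i (f i))
    = (\<Oplus>l\<in>J. a x l \<otimes> (\<Oplus>f\<in>I \<rightarrow>\<^sub>E J. \<Otimes>i\<in>I. a i (f i)))"
    using insert assms(2) c2 by (intro finsum_ldistr) auto
  also have "\<dots> = (\<Oplus>l\<in>J. \<Oplus>f\<in>I \<rightarrow>\<^sub>E J. a x l \<otimes> (\<Otimes>i\<in>I. a i (f i)))"
    by (rule finsum_cong') (use insert fin c1 in \<open>auto intro!: finsum_rdistr finsum_closed\<close>)
  also have "\<dots> = (\<Oplus>yg\<in>J \<times> (I \<rightarrow>\<^sub>E J). a x (fst yg) \<otimes> (\<Otimes>i\<in>I. a i (snd yg i)))"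
    using insert fin c1 assms(2) by (subst finsum_Sigma) auto
  also have "\<dots> = (\<Oplus>yg\<in>J \<times> (I \<rightarrow>\<^sub>E J). \<Otimes>i\<in>insert x I. a i (?u yg i))"
  proof (rule finsum_cong')
    fix yg assume yg: "yg \<in> J \<times> (I \<rightarrow>\<^sub>E J)"
    then obtain y g where [simp]: "yg = (y, g)" and y: "y \<in> J" and g: "g \<in> I \<rightarrow>\<^sub>E J" by auto
    have ag: "a i (g i) \<in> carrier R" if "i \<in> I" for i
      using PiE_mem[OF g that] insert.prems that by blast
    have "(\<Otimes>i\<in>insert x I. a i (?u yg i)) = a x y \<otimes> (\<Otimes>i\<in>I. a i (?u yg i))"
      using insert y ag by (subst finprod_insert) auto
    also have "(\<Otimes>i\<in>I. a i (?u yg i)) = (\<Otimes>i\<in>I. a i (g i))"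
    proof (rule finprod_cong')
      show "(\<lambda>i. a i (g i)) \<in> I \<rightarrow> carrier R"
        using PiE_mem[OF g] insert.prems by (intro Pi_I) blast
    qed (use insert in auto)
    finally show "a x (fst yg) \<otimes> (\<Otimes>i\<in>I. a i (snd yg i)) = (\<Otimes>i\<in>insert x I. a i (?u yg i))" by simp
  qed (use insert in \<open>auto intro!: finprod_closed simp: PiE_def Pi_def\<close>)
  also have "\<dots> = (\<Oplus>f\<in>?u ` (J \<times> (I \<rightarrow>\<^sub>E J)). \<Otimes>i\<in>insert x I. a i (f i))"
  proof (rule finsum_reindex[symmetric])
    show "inj_on ?u (J \<times> (I \<rightarrow>\<^sub>E J))"
      using inj_combinator[OF insert(2), of "\<lambda>_. J"] by simp
  qed (use insert in \<open>auto intro!: finprod_closed simp: PiE_def Pi_def\<close>)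
  also have "?u ` (J \<times> (I \<rightarrow>\<^sub>E J)) = insert x I \<rightarrow>\<^sub>E J"
    by (simp add: PiE_insert_eq)
  finally show ?case .
qed

lemma psign_closed [simp]: "psign R p \<in> carrier R"
  by (simp add: psign_def)

lemma psign_comp:
  assumes "p permutes {..<n}" "q permutes {..<n}"
  shows "psign R (p \<circ> q) = psign R p \<otimes> psign R q"
proof -
  have "permutation p" "permutation q" using assms by (auto intro: permutation_permutes[THEN iffD2])
  then show ?thesis by (auto simp: psign_def evenperm_comp l_minus)
qed

lemma psign_id [simp]: "psign R id = \<one>" by (simp add: psign_def)

lemma finite_perms: "finite {p. p permutes {..<n::nat}}" by (simp add: finite_permutations)

lemma perm_lt: "\<lbrakk>p permutes {..<n::nat}; i < n\<rbrakk> \<Longrightarrow> p i < n"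
  using permutes_in_image[of p "{..<n}" i] by simp

lemma mdet_term_closed:
  assumes "\<And>i j. \<lbrakk>i < (n::nat); j < n\<rbrakk> \<Longrightarrow> M i j \<in> carrier R" "p permutes {..<n}"
  shows "(\<Otimes>i\<in>{..<n}. M i (p i)) \<in> carrier R"
  by (intro finprod_closed Pi_I assms(1) perm_lt[OF assms(2)]) auto

lemma mdet_closed:
  assumes "\<And>i j. \<lbrakk>i < n; j < n\<rbrakk> \<Longrightarrow> M i j \<in> carrier R"
  shows "mdet R n M \<in> carrier R"
  unfolding mdet_def by (intro finsum_closed Pi_I m_closed psign_closed mdet_term_closed assms) auto

lemma mdet_cong:
  assumes "\<And>i j. \<lbrakk>i < n; j < n\<rbrakk> \<Longrightarrow> M i j = N i j"
    and "\<And>i j. \<lbrakk>i < n; j < n\<rbrakk> \<Longrightarrow> N i j \<in> carrier R"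
  shows "mdet R n M = mdet R n N"
  unfolding mdet_def
proof (rule finsum_cong')
  fix p assume p: "p \<in> {p. p permutes {..<n}}"
  have "(\<Otimes>i\<in>{..<n}. M i (p i)) = (\<Otimes>i\<in>{..<n}. N i (p i))"
    by (rule finprod_cong') (use assms p perm_lt in auto)
  then show "psign R p \<otimes> (\<Otimes>i\<in>{..<n}. M i (p i)) = psign R p \<otimes> (\<Otimes>i\<in>{..<n}. N i (p i))" by simp
next
  show "(\<lambda>p. psign R p \<otimes> (\<Otimes>i\<in>{..<n}. N i (p i))) \<in> {p. p permutes {..<n}} \<rightarrow> carrier R"
    by (intro Pi_I m_closed psign_closed mdet_term_closed assms(2)) auto
qed simp

lemma prod_perm:
  assumes "q permutes {..<n::nat}" "\<And>i. i < n \<Longrightarrow> g i \<in> carrier R"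
  shows "(\<Otimes>i\<in>{..<n}. g (q i)) = (\<Otimes>i\<in>{..<n}. g i)"
proof -
  have "finprod R g (q ` {..<n}) = finprod R (\<lambda>i. g (q i)) {..<n}"
    by (rule finprod_reindex) (use assms permutes_image[OF assms(1)] in \<open>auto intro: permutes_inj_on[OF assms(1)]\<close>)
  then show ?thesis by (simp add: permutes_image[OF assms(1)])
qed

text \<open>Composition with the transposition of \<open>a\<close> and \<open>b\<close> matches even
  with odd permutations, and matched terms cancel. Exchanging the rows and comparing signs would
  only show that twice the determinant vanishes.\<close>

lemma mdet_equal_rows:
  assumes M: "\<And>i j. \<lbrakk>i < n; j < n\<rbrakk> \<Longrightarrow> M i j \<in> carrier R"
    and ab: "a < n" "b < n" "a \<noteq> b" and eq: "\<And>j. j < n \<Longrightarrow> M a j = M b j"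
  shows "mdet R n M = \<zero>"
proof -
  let ?t = "Transposition.transpose a b"
  let ?P = "{p. p permutes {..<n}}"
  let ?E = "{p \<in> ?P. evenperm p}" and ?O = "{p \<in> ?P. \<not> evenperm p}"
  define x where "x = (\<lambda>p. \<Otimes>i\<in>{..<n}. M i (p i))"
  have xc: "x p \<in> carrier R" if "p \<in> ?P" for p
    unfolding x_def using mdet_term_closed[OF M] that by auto
  have t: "?t permutes {..<n}" using ab by (intro permutes_swap_id) auto
  have ct: "p \<circ> ?t permutes {..<n}" if "p permutes {..<n}" for p
    using permutes_compose[OF t that] .
  have tt: "p \<circ> ?t \<circ> ?t = p" for p by (simp add: comp_assoc)
  have ev: "evenperm (p \<circ> ?t) \<longleftrightarrow> \<not> evenperm p" if "p permutes {..<n}" for p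
  proof -
    have "permutation p" using that by (auto intro: permutation_permutes[THEN iffD2])
    then show ?thesis using ab by (subst evenperm_comp) (auto simp: evenperm_swap permutation_swap_id)
  qed
  have O: "?O = (\<lambda>p. p \<circ> ?t) ` ?E"
  proof
    show "?O \<subseteq> (\<lambda>p. p \<circ> ?t) ` ?E"
    proof
      fix p assume "p \<in> ?O"
      then have "p \<circ> ?t \<in> ?E" "p = p \<circ> ?t \<circ> ?t" using ct ev tt by auto
      then show "p \<in> (\<lambda>p. p \<circ> ?t) ` ?E" by blast
    qed
  qed (use ct ev in auto)
  have inj: "inj_on (\<lambda>p. p \<circ> ?t) ?E" by (rule inj_onI) (metis tt)
  have xt: "x (p \<circ> ?t) = x p" if "p \<in> ?P" for p
  proof -
    have "x (p \<circ> ?t) = (\<Otimes>i\<in>{..<n}. M (?t (?t i)) (p (?t i)))" by (simp add: x_def)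
    also have "\<dots> = (\<Otimes>i\<in>{..<n}. M (?t i) (p i))"
      by (rule prod_perm[OF t]) (use M that perm_lt t in auto)
    also have "\<dots> = x p" unfolding x_def
    proof (rule finprod_cong')
      fix i assume "i \<in> {..<n}"
      then have "p i < n" using that perm_lt by auto
      then show "M (?t i) (p i) = M i (p i)" using eq by (auto simp: Transposition.transpose_def)
    qed (use M that perm_lt in auto)
    finally show ?thesis .
  qed
  have fin: "finite ?E" "finite ?O" by (auto simp: finite_perms)
  have "mdet R n M = finsum R (\<lambda>p. psign R p \<otimes> x p) (?E \<union> ?O)"
    unfolding mdet_def x_def by (rule arg_cong[of _ _ "finsum R _"]) auto
  also have "\<dots> = finsum R (\<lambda>p. psign R p \<otimes> x p) ?E \<oplus> finsum R (\<lambda>p. psign R p \<otimes> x p) ?O"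
    by (rule finsum_Un_disjoint) (use fin xc in auto)
  also have "finsum R (\<lambda>p. psign R p \<otimes> x p) ?E = finsum R x ?E"
    by (rule finsum_cong') (use xc in \<open>auto simp: psign_def\<close>)
  also have "finsum R (\<lambda>p. psign R p \<otimes> x p) ?O = finsum R (\<lambda>p. \<ominus> x p) ?O"
    by (rule finsum_cong') (use xc in \<open>auto simp: psign_def l_minus\<close>)
  also have "\<dots> = finsum R (\<lambda>p. \<ominus> x (p \<circ> ?t)) ?E"
    unfolding O by (rule finsum_reindex[OF _ inj]) (use xc ct in auto)
  also have "\<dots> = finsum R (\<lambda>p. \<ominus> x p) ?E"
    by (rule finsum_cong') (use xc xt in auto)
  also have "\<dots> = \<ominus> finsum R x ?E"
    by (rule finsum_minus) (use xc fin in auto)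
  also have "finsum R x ?E \<oplus> \<ominus> finsum R x ?E = \<zero>"
    by (rule r_neg) (use xc in \<open>auto intro!: finsum_closed\<close>)
  finally show ?thesis .
qed

lemma mdet_permute_rows:
  assumes M: "\<And>i j. \<lbrakk>i < n; j < n\<rbrakk> \<Longrightarrow> M i j \<in> carrier R" and q: "q permutes {..<n}"
  shows "mdet R n (\<lambda>i. M (q i)) = psign R q \<otimes> mdet R n M"
proof -
  let ?P = "{p. p permutes {..<n}}"
  define x where "x = (\<lambda>p. \<Otimes>i\<in>{..<n}. M i (p i))"
  have xc: "x p \<in> carrier R" if "p \<in> ?P" for p
    unfolding x_def using mdet_term_closed[OF M] that by auto
  have P: "?P = (\<lambda>p. p \<circ> q) ` ?P"
  proof
    show "?P \<subseteq> (\<lambda>p. p \<circ> q) ` ?P"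
    proof
      fix p assume "p \<in> ?P"
      then have "p \<circ> Hilbert_Choice.inv q \<in> ?P" "p = (p \<circ> Hilbert_Choice.inv q) \<circ> q"
        using permutes_compose[OF permutes_inv[OF q]] permutes_inv_o(2)[OF q] by (auto simp: comp_assoc)
      then show "p \<in> (\<lambda>p. p \<circ> q) ` ?P" by blast
    qed
  qed (use permutes_compose[OF q] in auto)
  have inj: "inj_on (\<lambda>p. p \<circ> q) ?P"
    by (rule inj_onI) (metis comp_assoc comp_id permutes_inv_o(1)[OF q])
  have "mdet R n (\<lambda>i. M (q i)) = finsum R (\<lambda>p. psign R p \<otimes> (\<Otimes>i\<in>{..<n}. M (q i) (p i))) ((\<lambda>p. p \<circ> q) ` ?P)"
    unfolding mdet_def using P by simp
  also have "\<dots> = finsum R (\<lambda>p. psign R (p \<circ> q) \<otimes> (\<Otimes>i\<in>{..<n}. M (q i) ((p \<circ> q) i))) ?P"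
  proof (rule finsum_reindex[OF _ inj])
    show "(\<lambda>p. psign R p \<otimes> (\<Otimes>i\<in>{..<n}. M (q i) (p i))) \<in> (\<lambda>p. p \<circ> q) ` ?P \<rightarrow> carrier R"
      unfolding P[symmetric] using mdet_term_closed[of n "\<lambda>i. M (q i)"] M perm_lt[OF q] by auto
  qed
  also have "\<dots> = finsum R (\<lambda>p. psign R q \<otimes> (psign R p \<otimes> x p)) ?P"
  proof (rule finsum_cong')
    fix p assume p: "p \<in> ?P"
    have "(\<Otimes>i\<in>{..<n}. M (q i) (p (q i))) = x p"
      unfolding x_def by (rule prod_perm[OF q]) (use M p perm_lt in auto)
    then show "psign R (p \<circ> q) \<otimes> (\<Otimes>i\<in>{..<n}. M (q i) ((p \<circ> q) i)) = psign R q \<otimes> (psign R p \<otimes> x p)"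
      using p q xc[OF p] by (simp add: psign_comp m_ac)
  qed (use xc in auto)
  also have "\<dots> = psign R q \<otimes> mdet R n M"
  proof -
    have "mdet R n M = (\<Oplus>p\<in>?P. psign R p \<otimes> x p)" by (simp add: mdet_def x_def)
    then show ?thesis using xc finite_perms by (simp add: finsum_rdistr Pi_iff)
  qed
  finally show ?thesis .
qed

text \<open>Expanding every row of the product gives a sum over functions \<open>f\<close> that
  choose a row of \<open>N\<close> for each row of \<open>M\<close>. A choice that is not injective
  contributes a determinant with two equal rows; the other choices are permutations.\<close>

lemma mdet_mult:
  assumes M: "\<And>i j. \<lbrakk>i < n; j < n\<rbrakk> \<Longrightarrow> M i j \<in> carrier R"
    and N: "\<And>i j. \<lbrakk>i < n; j < n\<rbrakk> \<Longrightarrow> N i j \<in> carrier R"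
  shows "mdet R n (\<lambda>i j. \<Oplus>l\<in>{..<n}. M i l \<otimes> N l j) = mdet R n M \<otimes> mdet R n N"
proof -
  let ?P = "{p. p permutes {..<n}}" and ?F = "{..<n} \<rightarrow>\<^sub>E {..<n}"
  have finF: "finite ?F" by (intro finite_PiE) auto
  have fl: "f i < n" if "f \<in> ?F" "i < n" for f i using that by auto
  have Mf: "(\<Otimes>i\<in>{..<n}. M i (f i)) \<in> carrier R" if "f \<in> ?F" for f
    by (rule finprod_closed) (use M fl that in auto)
  have Nf: "(\<Otimes>i\<in>{..<n}. N (f i) (p i)) \<in> carrier R" if "f \<in> ?F" "p \<in> ?P" for f p
    by (rule finprod_closed) (use N fl that perm_lt in auto)
  have "mdet R n (\<lambda>i j. \<Oplus>l\<in>{..<n}. M i l \<otimes> N l j)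
    = (\<Oplus>p\<in>?P. \<Oplus>f\<in>?F. (\<Otimes>i\<in>{..<n}. M i (f i)) \<otimes> (psign R p \<otimes> (\<Otimes>i\<in>{..<n}. N (f i) (p i))))"
    unfolding mdet_def
  proof (rule finsum_cong')
    fix p assume p: "p \<in> ?P"
    have "(\<Otimes>i\<in>{..<n}. \<Oplus>l\<in>{..<n}. M i l \<otimes> N l (p i)) = (\<Oplus>f\<in>?F. \<Otimes>i\<in>{..<n}. M i (f i) \<otimes> N (f i) (p i))"
      by (rule finprod_finsum_distrib) (use M N p perm_lt in auto)
    also have "\<dots> = (\<Oplus>f\<in>?F. (\<Otimes>i\<in>{..<n}. M i (f i)) \<otimes> (\<Otimes>i\<in>{..<n}. N (f i) (p i)))"
    proof (rule finsum_cong')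
      fix f assume f: "f \<in> ?F"
      show "(\<Otimes>i\<in>{..<n}. M i (f i) \<otimes> N (f i) (p i)) = (\<Otimes>i\<in>{..<n}. M i (f i)) \<otimes> (\<Otimes>i\<in>{..<n}. N (f i) (p i))"
        by (rule finprod_multf) (use f p M N fl perm_lt in auto)
    qed (use Mf Nf p in auto)
    finally have "psign R p \<otimes> (\<Otimes>i\<in>{..<n}. \<Oplus>l\<in>{..<n}. M i l \<otimes> N l (p i))
       = (\<Oplus>f\<in>?F. psign R p \<otimes> ((\<Otimes>i\<in>{..<n}. M i (f i)) \<otimes> (\<Otimes>i\<in>{..<n}. N (f i) (p i))))"
      using finF Mf Nf p by (simp add: finsum_rdistr Pi_iff)
    also have "\<dots> = (\<Oplus>f\<in>?F. (\<Otimes>i\<in>{..<n}. M i (f i)) \<otimes> (psign R p \<otimes> (\<Otimes>i\<in>{..<n}. N (f i) (p i))))"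
      by (rule finsum_cong') (use Mf Nf p in \<open>auto simp: m_lcomm\<close>)
    finally show "psign R p \<otimes> (\<Otimes>i\<in>{..<n}. \<Oplus>l\<in>{..<n}. M i l \<otimes> N l (p i))
       = (\<Oplus>f\<in>?F. (\<Otimes>i\<in>{..<n}. M i (f i)) \<otimes> (psign R p \<otimes> (\<Otimes>i\<in>{..<n}. N (f i) (p i))))" .
  qed (use Mf Nf in \<open>auto intro!: finsum_closed\<close>)
  also have "\<dots> = (\<Oplus>f\<in>?F. \<Oplus>p\<in>?P. (\<Otimes>i\<in>{..<n}. M i (f i)) \<otimes> (psign R p \<otimes> (\<Otimes>i\<in>{..<n}. N (f i) (p i))))"
    by (rule finsum_swap) (use Mf Nf finF finite_perms in auto)
  also have "\<dots> = (\<Oplus>f\<in>?F. (\<Otimes>i\<in>{..<n}. M i (f i)) \<otimes> mdet R n (\<lambda>i. N (f i)))"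
    unfolding mdet_def
    by (rule finsum_cong') (use Mf Nf finite_perms in \<open>auto intro!: finsum_rdistr[symmetric] finsum_closed\<close>)
  \<comment> \<open>Permutations are the identity outside \<open>{..<n}\<close>, members of the
    extensional function space are \<open>undefined\<close> there; \<open>restrict\<close> mediates
    between the two.\<close>
  also have "\<dots> = (\<Oplus>f\<in>(\<lambda>q. restrict q {..<n}) ` ?P. (\<Otimes>i\<in>{..<n}. M i (f i)) \<otimes> mdet R n (\<lambda>i. N (f i)))"
  proof (rule finsum_mono_neutral_cong_left[symmetric])
    show "(\<lambda>q. restrict q {..<n}) ` ?P \<subseteq> ?F"
      by (simp add: image_subset_iff restrict_PiE_iff perm_lt)
    show "(\<lambda>f. (\<Otimes>i\<in>{..<n}. M i (f i)) \<otimes> mdet R n (\<lambda>i. N (f i))) \<in> ?F \<rightarrow> carrier R"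
      using Mf N fl by (auto intro!: mdet_closed)
    fix f assume f: "f \<in> ?F - (\<lambda>q. restrict q {..<n}) ` ?P"
    have "\<not> inj_on f {..<n}"
    proof
      assume inj: "inj_on f {..<n}"
      define q where "q = (\<lambda>i. if i < n then f i else i)"
      have "f ` {..<n} = {..<n}"
        by (rule endo_inj_surj[OF _ _ inj]) (use f fl in auto)
      then have "bij_betw q {..<n} {..<n}"
        using inj by (auto simp: bij_betw_def q_def inj_on_def image_def)
      then have "q permutes {..<n}"
        by (rule bij_imp_permutes) (simp add: q_def)
      moreover have "f = restrict q {..<n}"
        using f by (auto simp: q_def restrict_def fun_eq_iff PiE_def extensional_def)
      ultimately show False using f by blast
    qed
    then obtain a b where "a < n" "b < n" "a \<noteq> b" "f a = f b" by (auto simp: inj_on_def)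
    then have "mdet R n (\<lambda>i. N (f i)) = \<zero>"
      using N f fl by (intro mdet_equal_rows[of n _ a b]) auto
    then show "(\<Otimes>i\<in>{..<n}. M i (f i)) \<otimes> mdet R n (\<lambda>i. N (f i)) = \<zero>" using Mf f by auto
  qed (use finF in auto)
  also have "\<dots> = (\<Oplus>q\<in>?P. (\<Otimes>i\<in>{..<n}. M i (restrict q {..<n} i)) \<otimes> mdet R n (\<lambda>i. N (restrict q {..<n} i)))"
  proof (rule finsum_reindex)
    show "(\<lambda>f. (\<Otimes>i\<in>{..<n}. M i (f i)) \<otimes> mdet R n (\<lambda>i. N (f i))) \<in> (\<lambda>q. restrict q {..<n}) ` ?P \<rightarrow> carrier R"
      using Mf N fl perm_lt by (auto intro!: mdet_closed finprod_closed M)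
    show "inj_on (\<lambda>q. restrict q {..<n}) ?P"
    proof (rule inj_onI, rule ext)
      fix p q i assume *: "p \<in> ?P" "q \<in> ?P" "restrict p {..<n} = restrict q {..<n}"
      show "p i = q i"
        using fun_cong[OF *(3), of i] *(1,2) by (cases "i < n") (auto simp: permutes_def)
    qed
  qed
  also have "\<dots> = (\<Oplus>q\<in>?P. psign R q \<otimes> (\<Otimes>i\<in>{..<n}. M i (q i)) \<otimes> mdet R n N)"
  proof (rule finsum_cong')
    fix q assume q: "q \<in> ?P"
    have "(\<Otimes>i\<in>{..<n}. M i (restrict q {..<n} i)) = (\<Otimes>i\<in>{..<n}. M i (q i))"
      by (rule finprod_cong') (use q M perm_lt in auto)
    moreover have "mdet R n (\<lambda>i. N (restrict q {..<n} i)) = mdet R n (\<lambda>i. N (q i))"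
      by (rule mdet_cong) (use q N perm_lt in auto)
    moreover have "mdet R n (\<lambda>i. N (q i)) = psign R q \<otimes> mdet R n N"
      by (rule mdet_permute_rows) (use q N in auto)
    moreover have "(\<Otimes>i\<in>{..<n}. M i (q i)) \<in> carrier R" "mdet R n N \<in> carrier R"
      using q mdet_term_closed[OF M] mdet_closed[OF N] by auto
    ultimately show "(\<Otimes>i\<in>{..<n}. M i (restrict q {..<n} i)) \<otimes> mdet R n (\<lambda>i. N (restrict q {..<n} i))
       = psign R q \<otimes> (\<Otimes>i\<in>{..<n}. M i (q i)) \<otimes> mdet R n N"
      by (simp add: m_ac)
  next
    show "(\<lambda>q. psign R q \<otimes> (\<Otimes>i\<in>{..<n}. M i (q i)) \<otimes> mdet R n N) \<in> ?P \<rightarrow> carrier R"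
      by (intro Pi_I m_closed psign_closed mdet_term_closed mdet_closed M N) auto
  qed simp
  also have "\<dots> = mdet R n M \<otimes> mdet R n N"
    unfolding mdet_def[of R n M]
    by (rule finsum_ldistr[symmetric]) (use mdet_term_closed[of n M] M mdet_closed[of n N] N finite_perms in auto)
  finally show ?thesis .
qed

lemma mdet_row_sum:
  assumes M: "\<And>i j. \<lbrakk>i < n; j < n\<rbrakk> \<Longrightarrow> M i j \<in> carrier R" and k: "k < n"
    and J: "finite J" and e: "\<And>l. l \<in> J \<Longrightarrow> e l \<in> carrier R"
    and v: "\<And>l j. \<lbrakk>l \<in> J; j < n\<rbrakk> \<Longrightarrow> v l j \<in> carrier R"
  shows "mdet R n (M(k := \<lambda>j. \<Oplus>l\<in>J. e l \<otimes> v l j)) = (\<Oplus>l\<in>J. e l \<otimes> mdet R n (M(k := v l)))"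
proof -
  let ?P = "{p. p permutes {..<n}}"
  have split: "(\<Otimes>i\<in>{..<n}. (M(k := w)) i (p i)) = w (p k) \<otimes> (\<Otimes>i\<in>{..<n} - {k}. M i (p i))"
    if p: "p \<in> ?P" and w: "\<And>j. j < n \<Longrightarrow> w j \<in> carrier R" for p w
  proof -
    have "(\<Otimes>i\<in>{..<n}. (M(k := w)) i (p i)) = (\<Otimes>i\<in>insert k ({..<n} - {k}). (M(k := w)) i (p i))"
      using k by (simp add: insert_absorb)
    also have "\<dots> = (M(k := w)) k (p k) \<otimes> (\<Otimes>i\<in>{..<n} - {k}. (M(k := w)) i (p i))"
      by (rule finprod_insert) (use k p w M perm_lt in auto)
    also have "(\<Otimes>i\<in>{..<n} - {k}. (M(k := w)) i (p i)) = (\<Otimes>i\<in>{..<n} - {k}. M i (p i))"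
      by (rule finprod_cong') (use p M perm_lt in auto)
    finally show ?thesis by simp
  qed
  define y where "y = (\<lambda>p. \<Otimes>i\<in>{..<n} - {k}. M i (p i))"
  have yc: "y p \<in> carrier R" if "p \<in> ?P" for p
    unfolding y_def by (rule finprod_closed) (use that M perm_lt in auto)
  have pk: "p k < n" if "p \<in> ?P" for p using that k perm_lt by auto
  have "mdet R n (M(k := \<lambda>j. \<Oplus>l\<in>J. e l \<otimes> v l j))
    = (\<Oplus>p\<in>?P. \<Oplus>l\<in>J. e l \<otimes> (psign R p \<otimes> (v l (p k) \<otimes> y p)))"
    unfolding mdet_def
  proof (rule finsum_cong')
    fix p assume p: "p \<in> ?P"
    have "(\<Otimes>i\<in>{..<n}. (M(k := \<lambda>j. \<Oplus>l\<in>J. e l \<otimes> v l j)) i (p i)) = (\<Oplus>l\<in>J. e l \<otimes> v l (p k)) \<otimes> y p"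
      unfolding y_def by (rule split[OF p]) (use e v in \<open>auto intro!: finsum_closed\<close>)
    then have "psign R p \<otimes> (\<Otimes>i\<in>{..<n}. (M(k := \<lambda>j. \<Oplus>l\<in>J. e l \<otimes> v l j)) i (p i))
       = psign R p \<otimes> (\<Oplus>l\<in>J. e l \<otimes> v l (p k) \<otimes> y p)"
      using J e v pk[OF p] yc[OF p] by (simp add: finsum_ldistr Pi_iff)
    also have "\<dots> = (\<Oplus>l\<in>J. psign R p \<otimes> (e l \<otimes> v l (p k) \<otimes> y p))"
      by (rule finsum_rdistr) (use J e v pk[OF p] yc[OF p] in auto)
    also have "\<dots> = (\<Oplus>l\<in>J. e l \<otimes> (psign R p \<otimes> (v l (p k) \<otimes> y p)))"
      by (rule finsum_cong') (use J e v pk[OF p] yc[OF p] in \<open>auto simp: m_ac\<close>)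
    finally show "psign R p \<otimes> (\<Otimes>i\<in>{..<n}. (M(k := \<lambda>j. \<Oplus>l\<in>J. e l \<otimes> v l j)) i (p i))
      = (\<Oplus>l\<in>J. e l \<otimes> (psign R p \<otimes> (v l (p k) \<otimes> y p)))" .
  qed (use J e v pk yc in \<open>auto intro!: finsum_closed\<close>)
  also have "\<dots> = (\<Oplus>l\<in>J. \<Oplus>p\<in>?P. e l \<otimes> (psign R p \<otimes> (v l (p k) \<otimes> y p)))"
    by (rule finsum_swap) (use J e v pk yc finite_perms in auto)
  also have "\<dots> = (\<Oplus>l\<in>J. e l \<otimes> mdet R n (M(k := v l)))"
  proof (rule finsum_cong')
    fix l assume l: "l \<in> J"
    have "mdet R n (M(k := v l)) = (\<Oplus>p\<in>?P. psign R p \<otimes> (v l (p k) \<otimes> y p))"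
      unfolding mdet_def y_def
    proof (rule finsum_cong')
      fix p assume p: "p \<in> ?P"
      show "psign R p \<otimes> (\<Otimes>i\<in>{..<n}. (M(k := v l)) i (p i))
        = psign R p \<otimes> (v l (p k) \<otimes> (\<Otimes>i\<in>{..<n} - {k}. M i (p i)))"
        by (subst split[OF p]) (use l v in auto)
    qed (use l v pk yc in \<open>auto simp: y_def\<close>)
    then show "(\<Oplus>p\<in>?P. e l \<otimes> (psign R p \<otimes> (v l (p k) \<otimes> y p))) = e l \<otimes> mdet R n (M(k := v l))"
      using l e v pk yc finite_perms by (simp add: finsum_rdistr Pi_iff)
  qed (use e v M in \<open>auto intro!: mdet_closed\<close>)
  finally show ?thesis .
qed

lemma mdet_row_smult:
  assumes M: "\<And>i j. \<lbrakk>i < n; j < n\<rbrakk> \<Longrightarrow> M i j \<in> carrier R" and k: "k < n"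
    and s: "s \<in> carrier R" and v: "\<And>j. j < n \<Longrightarrow> v j \<in> carrier R"
  shows "mdet R n (M(k := \<lambda>j. s \<otimes> v j)) = s \<otimes> mdet R n (M(k := v))"
proof -
  have one: "finsum R f {()} = f ()" if "f () \<in> carrier R" for f using that by (simp add: Pi_iff)
  \<comment> \<open>A scalar multiple is a combination over the one-element index set
    \<open>{()}\<close>.\<close>
  have "mdet R n (M(k := \<lambda>j. s \<otimes> v j)) = mdet R n (M(k := \<lambda>j. \<Oplus>l\<in>{()}. s \<otimes> v j))"
    by (rule mdet_cong) (use M s v in \<open>auto simp: one\<close>)
  also have "\<dots> = (\<Oplus>l\<in>{()}. s \<otimes> mdet R n (M(k := v)))"
    by (rule mdet_row_sum[OF M k]) (use s v in auto)
  also have "\<dots> = s \<otimes> mdet R n (M(k := v))"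
    by (rule one) (use M s v in \<open>auto intro!: mdet_closed\<close>)
  finally show ?thesis .
qed

text \<open>By linearity in row \<open>k\<close> only the term of row \<open>k\<close> itself
  survives, as any other row would occur twice. Stated without division, the rule has two uses: for
  \<open>w = 0\<close> the determinant annihilates \<open>e k\<close>, and for a row
  \<open>w\<close> with a common factor the determinant acquires that factor.\<close>

lemma cramer:
  assumes M: "\<And>i j. \<lbrakk>i < n; j < n\<rbrakk> \<Longrightarrow> M i j \<in> carrier R" and k: "k < n"
    and e: "\<And>l. l < n \<Longrightarrow> e l \<in> carrier R"
    and w: "\<And>j. j < n \<Longrightarrow> w j = (\<Oplus>l\<in>{..<n}. e l \<otimes> M l j)"
  shows "e k \<otimes> mdet R n M = mdet R n (M(k := w))"
proof -
  have "mdet R n (M(k := w)) = mdet R n (M(k := \<lambda>j. \<Oplus>l\<in>{..<n}. e l \<otimes> M l j))"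
    by (rule mdet_cong) (use M e w in \<open>auto intro!: finsum_closed\<close>)
  also have "\<dots> = (\<Oplus>l\<in>{..<n}. e l \<otimes> mdet R n (M(k := M l)))"
    by (rule mdet_row_sum[OF M k]) (use M e in auto)
  also have "\<dots> = e k \<otimes> mdet R n (M(k := M k))"
  proof (rule finsum_single)
    fix l assume l: "l \<in> {..<n}" "l \<noteq> k"
    have "mdet R n (M(k := M l)) = \<zero>"
      by (rule mdet_equal_rows[of n _ k l]) (use M k l in auto)
    then show "e l \<otimes> mdet R n (M(k := M l)) = \<zero>" using e l by auto
  qed (use M k e in \<open>auto intro!: mdet_closed\<close>)
  finally show ?thesis by simp
qed

lemma mdet_diag:
  assumes d: "\<And>i. i < n \<Longrightarrow> d i \<in> carrier R"
  shows "mdet R n (\<lambda>i j. if i = j then d i else \<zero>) = (\<Otimes>i\<in>{..<n}. d i)"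
proof -
  let ?P = "{p. p permutes {..<n}}"
  have dc: "(\<Otimes>i\<in>{..<n}. d i) \<in> carrier R" using d by (intro finprod_closed) auto
  have "mdet R n (\<lambda>i j. if i = j then d i else \<zero>)
     = psign R id \<otimes> (\<Otimes>i\<in>{..<n}. if i = id i then d i else \<zero>)"
    unfolding mdet_def
  proof (rule finsum_single)
    fix p assume p: "p \<in> ?P" "p \<noteq> id"
    then obtain i where i: "p i \<noteq> i" by (auto simp: fun_eq_iff)
    then have "i < n" using p by (auto simp: permutes_def)
    have "(\<Otimes>i\<in>{..<n}. if i = p i then d i else \<zero>)
      = (\<Otimes>i\<in>insert i ({..<n} - {i}). if i = p i then d i else \<zero>)"
      using \<open>i < n\<close> by (simp add: insert_absorb)
    also have "\<dots> = \<zero> \<otimes> (\<Otimes>i\<in>{..<n} - {i}. if i = p i then d i else \<zero>)"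
      using i d by (subst finprod_insert) auto
    also have "\<dots> = \<zero>" by (rule l_null) (use d in \<open>auto intro!: finprod_closed\<close>)
    finally show "psign R p \<otimes> (\<Otimes>i\<in>{..<n}. if i = p i then d i else \<zero>) = \<zero>" by simp
  qed (use finite_perms dc permutes_id in auto)
  then show ?thesis using dc by simp
qed

text \<open>Scaling the columns is multiplication by a diagonal matrix on the right.\<close>

lemma mdet_scale_columns:
  assumes M: "\<And>i j. \<lbrakk>i < n; j < n\<rbrakk> \<Longrightarrow> M i j \<in> carrier R" and d: "\<And>i. i < n \<Longrightarrow> d i \<in> carrier R"
  shows "mdet R n (\<lambda>i j. M i j \<otimes> d j) = mdet R n M \<otimes> (\<Otimes>i\<in>{..<n}. d i)"
proof -
  have "mdet R n (\<lambda>i j. M i j \<otimes> d j)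
    = mdet R n (\<lambda>i j. \<Oplus>l\<in>{..<n}. M i l \<otimes> (if l = j then d l else \<zero>))"
  proof (rule mdet_cong)
    fix i j assume ij: "i < n" "j < n"
    have "(\<Oplus>l\<in>{..<n}. M i l \<otimes> (if l = j then d l else \<zero>)) = M i j \<otimes> (if j = j then d j else \<zero>)"
      by (rule finsum_single) (use M d ij in auto)
    then show "M i j \<otimes> d j = (\<Oplus>l\<in>{..<n}. M i l \<otimes> (if l = j then d l else \<zero>))" by simp
  qed (use M d in \<open>auto intro!: finsum_closed\<close>)
  also have "\<dots> = mdet R n M \<otimes> mdet R n (\<lambda>i j. if i = j then d i else \<zero>)"
    by (rule mdet_mult) (use M d in auto)
  finally show ?thesis using mdet_diag[OF d] by simp
qed

end

lemma (in ring_hom_cring) hom_psign: "h (psign R p) = psign S p"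
  by (simp add: psign_def)

lemma (in ring_hom_cring) hom_mdet:
  assumes M: "\<And>i j. \<lbrakk>i < n; j < n\<rbrakk> \<Longrightarrow> M i j \<in> carrier R"
  shows "h (mdet R n M) = mdet S n (\<lambda>i j. h (M i j))"
proof -
  have t: "(\<Otimes>i\<in>{..<n}. M i (p i)) \<in> carrier R" if "p permutes {..<n}" for p
    using R.mdet_term_closed[of n M p] M that by auto
  have "h (mdet R n M) = (\<Oplus>\<^bsub>S\<^esub>p\<in>{p. p permutes {..<n}}. h (psign R p \<otimes> (\<Otimes>i\<in>{..<n}. M i (p i))))"
    unfolding mdet_def by (subst hom_finsum) (use t in \<open>auto simp: comp_def\<close>)
  also have "\<dots> = mdet S n (\<lambda>i j. h (M i j))"
    unfolding mdet_def
  proof (rule S.finsum_cong')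
    fix p assume "p \<in> {p. p permutes {..<n}}"
    then have p: "p permutes {..<n}" by simp
    have "h (\<Otimes>i\<in>{..<n}. M i (p i)) = (\<Otimes>\<^bsub>S\<^esub>i\<in>{..<n}. h (M i (p i)))"
      by (subst hom_finprod) (use p M R.perm_lt in \<open>auto simp: comp_def\<close>)
    then show "h (psign R p \<otimes> (\<Otimes>i\<in>{..<n}. M i (p i))) = psign S p \<otimes>\<^bsub>S\<^esub> (\<Otimes>\<^bsub>S\<^esub>i\<in>{..<n}. h (M i (p i)))"
      using t[OF p] by (simp add: hom_psign)
  qed (use M S.mdet_term_closed[of n "\<lambda>i j. h (M i j)"] in auto)
  finally show ?thesis .
qed

section \<open>The characteristic polynomial\<close>

context UP_cring
begin

text \<open>The bounds \<open>a\<close> and \<open>b\<close> may exceed the degrees. Among zero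
  divisors the degree of a product is not determined by the degrees of its factors, while this
  formula holds for any bounds and passes to products.\<close>

lemma coeff_mult_top:
  assumes p: "p \<in> carrier P" "deg R p \<le> a" and q: "q \<in> carrier P" "deg R q \<le> b"
  shows "up_ring.coeff P (p \<otimes>\<^bsub>P\<^esub> q) (a + b) = up_ring.coeff P p a \<otimes> up_ring.coeff P q b"
proof -
  have "up_ring.coeff P (p \<otimes>\<^bsub>P\<^esub> q) (a + b) = (\<Oplus>i\<in>{..a + b}. up_ring.coeff P p i \<otimes> up_ring.coeff P q (a + b - i))"
    using p q by simp
  also have "\<dots> = up_ring.coeff P p a \<otimes> up_ring.coeff P q (a + b - a)"
  proof (rule R.finsum_single)
    fix i assume i: "i \<in> {..a + b}" "i \<noteq> a"
    then consider "a < i" | "b < a + b - i" by force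
    then show "up_ring.coeff P p i \<otimes> up_ring.coeff P q (a + b - i) = \<zero>"
    proof cases
      case 1
      then have "up_ring.coeff P p i = \<zero>" using p by (intro deg_aboveD) auto
      then show ?thesis using q by simp
    next
      case 2
      then have "up_ring.coeff P q (a + b - i) = \<zero>" using q by (intro deg_aboveD) auto
      then show ?thesis using p by simp
    qed
  qed (use p q in auto)
  finally show ?thesis by simp
qed

lemma deg_mult_le:
  assumes "p \<in> carrier P" "deg R p \<le> a" "q \<in> carrier P" "deg R q \<le> b"
  shows "deg R (p \<otimes>\<^bsub>P\<^esub> q) \<le> a + b"
  using deg_mult_ring[OF assms(1,3)] assms(2,4) by linarith

lemma deg_finprod_le:
  assumes "finite I" "\<And>i. i \<in> I \<Longrightarrow> f i \<in> carrier P" "\<And>i. i \<in> I \<Longrightarrow> deg R (f i) \<le> d i"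
  shows "deg R (\<Otimes>\<^bsub>P\<^esub>i\<in>I. f i) \<le> sum d I"
  using assms
proof (induction I rule: finite_induct)
  case (insert x F)
  have c: "(\<Otimes>\<^bsub>P\<^esub>i\<in>F. f i) \<in> carrier P" using insert by (intro P.finprod_closed) auto
  have "(\<Otimes>\<^bsub>P\<^esub>i\<in>insert x F. f i) = f x \<otimes>\<^bsub>P\<^esub> (\<Otimes>\<^bsub>P\<^esub>i\<in>F. f i)"
    using insert by (intro P.finprod_insert) auto
  then show ?case using insert c deg_mult_le[of "f x" "d x" "\<Otimes>\<^bsub>P\<^esub>i\<in>F. f i" "sum d F"] by simp
qed simp

lemma coeff_finprod_top:
  assumes "finite I" "\<And>i. i \<in> I \<Longrightarrow> f i \<in> carrier P" "\<And>i. i \<in> I \<Longrightarrow> deg R (f i) \<le> 1"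
    and "\<And>i. i \<in> I \<Longrightarrow> up_ring.coeff P (f i) 1 = \<one>"
  shows "up_ring.coeff P (\<Otimes>\<^bsub>P\<^esub>i\<in>I. f i) (card I) = \<one>"
  using assms
proof (induction I rule: finite_induct)
  case (insert x F)
  have c: "(\<Otimes>\<^bsub>P\<^esub>i\<in>F. f i) \<in> carrier P" using insert by (intro P.finprod_closed) auto
  have d: "deg R (\<Otimes>\<^bsub>P\<^esub>i\<in>F. f i) \<le> card F" using deg_finprod_le[of F f "\<lambda>_. 1"] insert by simp
  have "(\<Otimes>\<^bsub>P\<^esub>i\<in>insert x F. f i) = f x \<otimes>\<^bsub>P\<^esub> (\<Otimes>\<^bsub>P\<^esub>i\<in>F. f i)"
    using insert by (intro P.finprod_insert) auto
  then show ?case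
    using insert c coeff_mult_top[of "f x" 1 "\<Otimes>\<^bsub>P\<^esub>i\<in>F. f i" "card F"] d by simp
qed simp

text \<open>A permutation contributes degree at most its number of fixed points. Only the identity
  reaches degree \<open>n\<close>, with a product of monic linear entries.\<close>

lemma char_poly_monic:
  fixes m :: "nat \<Rightarrow> nat \<Rightarrow> 'a"
  assumes m: "\<And>i j. \<lbrakk>i < n; j < n\<rbrakk> \<Longrightarrow> m i j \<in> carrier R"
  defines "E \<equiv> \<lambda>i j. (if i = j then up_ring.monom P \<one> 1 else \<zero>\<^bsub>P\<^esub>) \<ominus>\<^bsub>P\<^esub> up_ring.monom P (m i j) 0"
  shows "deg R (mdet P n E) \<le> n" "up_ring.coeff P (mdet P n E) n = \<one>"
proof -
  let ?P = "{p. p permutes {..<n}}"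
  have Ec: "E i j \<in> carrier P" if "i < n" "j < n" for i j using m that by (auto simp: E_def)
  have dE: "deg R (E i j) \<le> (if i = j then 1 else 0)" if "i < n" "j < n" for i j
    using m[OF that] by (intro deg_aboveI) (auto simp: E_def)
  have tc: "psign P p \<otimes>\<^bsub>P\<^esub> (\<Otimes>\<^bsub>P\<^esub>i\<in>{..<n}. E i (p i)) \<in> carrier P" if "p \<in> ?P" for p
    using that P.mdet_term_closed[of n E p] Ec by auto
  have dp: "deg R (\<Otimes>\<^bsub>P\<^esub>i\<in>{..<n}. E i (p i)) \<le> card {i \<in> {..<n}. i = p i}" if "p \<in> ?P" for p
  proof -
    have "deg R (\<Otimes>\<^bsub>P\<^esub>i\<in>{..<n}. E i (p i)) \<le> (\<Sum>i\<in>{..<n}. if i = p i then 1 else 0)"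
      by (rule deg_finprod_le) (use that Ec dE P.perm_lt in auto)
    then show ?thesis by (simp add: sum.If_cases Int_def)
  qed
  have sg: "deg R (psign P p) \<le> 0" for p by (simp add: psign_def)
  have dt: "deg R (psign P p \<otimes>\<^bsub>P\<^esub> (\<Otimes>\<^bsub>P\<^esub>i\<in>{..<n}. E i (p i))) \<le> card {i \<in> {..<n}. i = p i}"
    if "p \<in> ?P" for p
    using deg_mult_le[OF P.psign_closed[of p] sg[of p] _ dp[OF that]] that P.mdet_term_closed[of n E p] Ec by auto
  have cz: "up_ring.coeff P (psign P p \<otimes>\<^bsub>P\<^esub> (\<Otimes>\<^bsub>P\<^esub>i\<in>{..<n}. E i (p i))) k = \<zero>"
    if "p \<in> ?P" "card {i \<in> {..<n}. i = p i} < k" for p k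
    using dt[OF that(1)] that tc by (intro deg_aboveD) auto
  have cd: "up_ring.coeff P (mdet P n E) k
     = (\<Oplus>p\<in>?P. up_ring.coeff P (psign P p \<otimes>\<^bsub>P\<^esub> (\<Otimes>\<^bsub>P\<^esub>i\<in>{..<n}. E i (p i))) k)" for k
    unfolding mdet_def by (rule coeff_finsum) (use finite_permutations[of "{..<n}"] tc in auto)
  have cle: "card {i \<in> {..<n}. i = p i} \<le> n" for p
    using card_mono[of "{..<n}" "{i \<in> {..<n}. i = p i}"] by auto
  show "deg R (mdet P n E) \<le> n"
  proof (rule deg_aboveI)
    fix k assume "n < k"
    then have "up_ring.coeff P (psign P p \<otimes>\<^bsub>P\<^esub> (\<Otimes>\<^bsub>P\<^esub>i\<in>{..<n}. E i (p i))) k = \<zero>" if "p \<in> ?P" for p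
      using cz[OF that, of k] cle[of p] by linarith
    then show "up_ring.coeff P (mdet P n E) k = \<zero>" unfolding cd
      by (intro R.add.finprod_one_eqI)
  qed (use Ec in \<open>auto intro: P.mdet_closed\<close>)
  have "up_ring.coeff P (mdet P n E) n = up_ring.coeff P (psign P id \<otimes>\<^bsub>P\<^esub> (\<Otimes>\<^bsub>P\<^esub>i\<in>{..<n}. E i (id i))) n"
    unfolding cd
  proof (rule R.finsum_single)
    fix p assume p: "p \<in> ?P" "p \<noteq> id"
    then obtain i where i: "p i \<noteq> i" by (auto simp: fun_eq_iff)
    then have "i < n" using p by (auto simp: permutes_def)
    have "card {i \<in> {..<n}. i = p i} < card {..<n}"
      by (intro psubset_card_mono psubsetI) (use i \<open>i < n\<close> in \<open>auto simp: set_eq_iff eq_commute[of _ "p _"]\<close>)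
    then show "up_ring.coeff P (psign P p \<otimes>\<^bsub>P\<^esub> (\<Otimes>\<^bsub>P\<^esub>i\<in>{..<n}. E i (p i))) n = \<zero>"
      using cz[OF p(1), of n] by simp
  qed (use finite_permutations[of "{..<n}"] tc permutes_id P.mdet_term_closed[of n E] Ec in auto)
  also have "\<dots> = up_ring.coeff P (\<Otimes>\<^bsub>P\<^esub>i\<in>{..<n}. E i i) (card {..<n})"
    using Ec by (simp add: P.finprod_closed Pi_iff)
  also have "\<dots> = \<one>"
  proof (rule coeff_finprod_top)
    fix i assume "i \<in> {..<n}"
    then have i: "i < n" by simp
    show "E i i \<in> carrier P" "deg R (E i i) \<le> 1" using Ec[OF i i] dE[OF i i] by auto
    show "up_ring.coeff P (E i i) 1 = \<one>" using m[OF i i] by (simp add: E_def R.minus_eq)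
  qed simp
  finally show "up_ring.coeff P (mdet P n E) n = \<one>" .
qed

end

section \<open>Power bases\<close>

definition lincomb ::
    "('s, 'y) ring_scheme \<Rightarrow> ('r \<Rightarrow> 's) \<Rightarrow> 's \<Rightarrow> nat \<Rightarrow> (nat \<Rightarrow> 'r) \<Rightarrow> 's"
  where "lincomb S h x n c = (\<Oplus>\<^bsub>S\<^esub>i\<in>{..<n}. h (c i) \<otimes>\<^bsub>S\<^esub> x [^]\<^bsub>S\<^esub> i)"

definition power_basis ::
    "('r, 'x) ring_scheme \<Rightarrow> ('s, 'y) ring_scheme \<Rightarrow> ('r \<Rightarrow> 's) \<Rightarrow> 's \<Rightarrow> nat \<Rightarrow> bool"
  where "power_basis R S h x n \<longleftrightarrow>
    (\<forall>y\<in>carrier S. \<exists>c\<in>{..<n} \<rightarrow> carrier R. y = lincomb S h x n c) \<and>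
    (\<forall>c\<in>{..<n} \<rightarrow> carrier R. lincomb S h x n c = \<zero>\<^bsub>S\<^esub> \<longrightarrow> (\<forall>i<n. c i = \<zero>\<^bsub>R\<^esub>))"

text \<open>An \<open>R\<close>-algebra with a distinguished element, given by its structure map
  \<open>h\<close>. As \<open>h\<close> is a parameter, one ring can be viewed over several bases,
  such as the quotient by the universal polynomial over \<open>A\<close> and over the symmetric
  functions.\<close>

locale pring = ring_hom_cring +
  fixes x assumes x_closed [simp]: "x \<in> carrier S"
begin

abbreviation "lin \<equiv> lincomb S h x"

lemma lin_closed [simp]: "(\<And>i. i < n \<Longrightarrow> c i \<in> carrier R) \<Longrightarrow> lin n c \<in> carrier S"
  unfolding lincomb_def by (intro S.finsum_closed) auto

lemma lin_cong:
  "(\<And>i. i < n \<Longrightarrow> c i = d i) \<Longrightarrow> (\<And>i. i < n \<Longrightarrow> d i \<in> carrier R) \<Longrightarrow> lin n c = lin n d"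
  unfolding lincomb_def by (intro S.finsum_cong') auto

lemma lin_add:
  assumes "\<And>i. i < n \<Longrightarrow> c i \<in> carrier R" "\<And>i. i < n \<Longrightarrow> d i \<in> carrier R"
  shows "lin n (\<lambda>i. c i \<oplus> d i) = lin n c \<oplus>\<^bsub>S\<^esub> lin n d"
proof -
  have "lin n (\<lambda>i. c i \<oplus> d i) = (\<Oplus>\<^bsub>S\<^esub>i\<in>{..<n}. h (c i) \<otimes>\<^bsub>S\<^esub> x [^]\<^bsub>S\<^esub> i \<oplus>\<^bsub>S\<^esub> h (d i) \<otimes>\<^bsub>S\<^esub> x [^]\<^bsub>S\<^esub> i)"
    unfolding lincomb_def by (rule S.finsum_cong') (use assms in \<open>auto simp: S.l_distr\<close>)
  then show ?thesis unfolding lincomb_def using assms by (simp add: S.finsum_addf Pi_iff)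
qed

lemma lin_smult:
  assumes "\<And>i. i < n \<Longrightarrow> c i \<in> carrier R" "b \<in> carrier R"
  shows "lin n (\<lambda>i. b \<otimes> c i) = h b \<otimes>\<^bsub>S\<^esub> lin n c"
proof -
  have "h b \<otimes>\<^bsub>S\<^esub> lin n c = (\<Oplus>\<^bsub>S\<^esub>i\<in>{..<n}. h b \<otimes>\<^bsub>S\<^esub> (h (c i) \<otimes>\<^bsub>S\<^esub> x [^]\<^bsub>S\<^esub> i))"
    unfolding lincomb_def by (rule S.finsum_rdistr) (use assms in auto)
  also have "\<dots> = lin n (\<lambda>i. b \<otimes> c i)"
    unfolding lincomb_def by (rule S.finsum_cong') (use assms in \<open>auto simp: S.m_assoc\<close>)
  finally show ?thesis by simp
qed

lemma lin_minus:
  assumes "\<And>i. i < n \<Longrightarrow> c i \<in> carrier R"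
  shows "lin n (\<lambda>i. \<ominus> c i) = \<ominus>\<^bsub>S\<^esub> lin n c"
proof -
  have "lin n (\<lambda>i. \<ominus> c i) = lin n (\<lambda>i. \<ominus> \<one> \<otimes> c i)"
    by (rule lin_cong) (use assms in \<open>auto simp: R.l_minus\<close>)
  then show ?thesis using assms lin_closed[of n c] by (simp add: lin_smult S.l_minus)
qed

lemma lin_diff:
  assumes "\<And>i. i < n \<Longrightarrow> c i \<in> carrier R" "\<And>i. i < n \<Longrightarrow> d i \<in> carrier R"
  shows "lin n (\<lambda>i. c i \<ominus> d i) = lin n c \<ominus>\<^bsub>S\<^esub> lin n d"
  unfolding R.minus_eq S.minus_eq using assms by (simp add: lin_add lin_minus)

lemma lin_zero: "lin n (\<lambda>i. \<zero>) = \<zero>\<^bsub>S\<^esub>"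
proof -
  have "lin n (\<lambda>i. \<zero>) = (\<Oplus>\<^bsub>S\<^esub>i\<in>{..<n}. \<zero>\<^bsub>S\<^esub>)"
    unfolding lincomb_def by (rule S.finsum_cong') auto
  then show ?thesis by simp
qed

lemma lin_single: "\<lbrakk>k < n; b \<in> carrier R\<rbrakk> \<Longrightarrow> lin n (\<lambda>i. if i = k then b else \<zero>) = h b \<otimes>\<^bsub>S\<^esub> x [^]\<^bsub>S\<^esub> k"
  unfolding lincomb_def
  by (subst S.finsum_single[of _ k]) auto

lemma lin_finsum:
  assumes "finite J" "\<And>i j. \<lbrakk>i < n; j \<in> J\<rbrakk> \<Longrightarrow> c j i \<in> carrier R"
  shows "lin n (\<lambda>i. \<Oplus>j\<in>J. c j i) = (\<Oplus>\<^bsub>S\<^esub>j\<in>J. lin n (c j))"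
proof -
  have "lin n (\<lambda>i. \<Oplus>j\<in>J. c j i) = (\<Oplus>\<^bsub>S\<^esub>i\<in>{..<n}. \<Oplus>\<^bsub>S\<^esub>j\<in>J. h (c j i) \<otimes>\<^bsub>S\<^esub> x [^]\<^bsub>S\<^esub> i)"
    unfolding lincomb_def
  proof (rule S.finsum_cong')
    fix i assume i: "i \<in> {..<n}"
    have "h (\<Oplus>j\<in>J. c j i) = (\<Oplus>\<^bsub>S\<^esub>j\<in>J. h (c j i))"
      by (subst hom_finsum) (use assms i in \<open>auto simp: comp_def\<close>)
    then show "h (\<Oplus>j\<in>J. c j i) \<otimes>\<^bsub>S\<^esub> x [^]\<^bsub>S\<^esub> i = (\<Oplus>\<^bsub>S\<^esub>j\<in>J. h (c j i) \<otimes>\<^bsub>S\<^esub> x [^]\<^bsub>S\<^esub> i)"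
      using assms i by (simp add: S.finsum_ldistr Pi_iff)
  qed (use assms in \<open>auto intro!: S.finsum_closed\<close>)
  also have "\<dots> = (\<Oplus>\<^bsub>S\<^esub>j\<in>J. lin n (c j))"
    unfolding lincomb_def by (rule S.finsum_swap) (use assms in auto)
  finally show ?thesis .
qed

sublocale U: UP_pre_univ_prop R S h "UP R" by unfold_locales

abbreviation "ev \<equiv> UnivPoly.eval R S h x"

lemma ev_hom: "ring_hom_cring (UP R) S ev"
  by (intro ring_hom_cring.intro ring_hom_cring_axioms.intro U.UP_cring S.is_cring)
    (rule U.eval_ring_hom[OF x_closed])

lemma ev_closed [simp]: "p \<in> carrier (UP R) \<Longrightarrow> ev p \<in> carrier S"
  using ring_hom_cring.homh[OF ev_hom] ring_hom_closed by metis

lemma ev_bound: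
  assumes p: "p \<in> carrier (UP R)" and d: "deg R p < n"
  shows "ev p = lin n (up_ring.coeff (UP R) p)"
proof -
  have "ev p = (\<Oplus>\<^bsub>S\<^esub>i\<in>{..deg R p}. h (up_ring.coeff (UP R) p i) \<otimes>\<^bsub>S\<^esub> x [^]\<^bsub>S\<^esub> i)"
    using p by (simp add: U.eval_on_carrier)
  also have "\<dots> = lin n (up_ring.coeff (UP R) p)"
    unfolding lincomb_def
    by (rule S.finsum_mono_neutral_cong_left)
      (use p d in \<open>auto simp: U.deg_aboveD\<close>)
  finally show ?thesis .
qed

lemma lin_Suc:
  assumes "\<And>i. i < Suc n \<Longrightarrow> c i \<in> carrier R"
  shows "lin (Suc n) c = lin n c \<oplus>\<^bsub>S\<^esub> h (c n) \<otimes>\<^bsub>S\<^esub> x [^]\<^bsub>S\<^esub> n"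
proof -
  have "lin (Suc n) c = h (c n) \<otimes>\<^bsub>S\<^esub> x [^]\<^bsub>S\<^esub> n \<oplus>\<^bsub>S\<^esub> lin n c"
    unfolding lincomb_def lessThan_Suc by (rule S.finsum_insert) (use assms in auto)
  then show ?thesis using assms by (simp add: S.a_comm)
qed

text \<open>The determinant trick: the vector of the \<open>e k\<close> is killed by the matrix
  \<open>x - m\<close>, hence each entry by its determinant, which is the characteristic polynomial
  evaluated at \<open>x\<close>.\<close>

lemma char_poly_relation:
  assumes e: "\<And>l. l < n \<Longrightarrow> e l \<in> carrier S"
    and m: "\<And>i j. \<lbrakk>i < n; j < n\<rbrakk> \<Longrightarrow> m i j \<in> carrier R"
    and rel: "\<And>i. i < n \<Longrightarrow> x \<otimes>\<^bsub>S\<^esub> e i = (\<Oplus>\<^bsub>S\<^esub>j\<in>{..<n}. h (m i j) \<otimes>\<^bsub>S\<^esub> e j)"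
  shows "\<exists>c\<in>{..<n} \<rightarrow> carrier R. \<forall>k<n. e k \<otimes>\<^bsub>S\<^esub> (x [^]\<^bsub>S\<^esub> n \<ominus>\<^bsub>S\<^esub> lin n c) = \<zero>\<^bsub>S\<^esub>"
proof -
  interpret ev: ring_hom_cring "UP R" S ev by (rule ev_hom)
  let ?P = "UP R"
  \<comment> \<open>The transpose \<open>m j i\<close> appears because \<open>cramer\<close>
    combines rows, while the relation for \<open>x e_j\<close> runs along row \<open>j\<close> of
    \<open>m\<close>.\<close>
  define E where "E = (\<lambda>i j. (if i = j then up_ring.monom ?P \<one> 1 else \<zero>\<^bsub>?P\<^esub>) \<ominus>\<^bsub>?P\<^esub> up_ring.monom ?P (m j i) 0)"
  define M where "M = (\<lambda>i j. (if i = j then x else \<zero>\<^bsub>S\<^esub>) \<ominus>\<^bsub>S\<^esub> h (m j i))"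
  let ?q = "mdet ?P n E"
  have Ec: "E i j \<in> carrier ?P" if "i < n" "j < n" for i j using m that by (auto simp: E_def)
  have Mc: "M i j \<in> carrier S" if "i < n" "j < n" for i j using m that by (auto simp: M_def)
  have qc: "?q \<in> carrier ?P" using Ec by (intro U.P.mdet_closed)
  have dq: "deg R ?q \<le> n" and cq: "up_ring.coeff ?P ?q n = \<one>"
    using U.char_poly_monic[of n "\<lambda>i j. m j i"] m unfolding E_def by auto
  have EM: "ev (E i j) = M i j" if "i < n" "j < n" for i j
  proof -
    have "ev (up_ring.monom ?P (m j i) 0) = h (m j i)" using m that by (intro U.eval_const) auto
    moreover have "ev (up_ring.monom ?P \<one> 1) = x" by (rule U.eval_monom1) simp
    ultimately show ?thesis unfolding E_def M_def using m[OF that(2,1)] by (auto simp: S.minus_eq U.P.minus_eq)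
  qed
  have evq: "ev ?q = mdet S n M"
  proof -
    have "ev ?q = mdet S n (\<lambda>i j. ev (E i j))" by (rule ev.hom_mdet) (use Ec in auto)
    also have "\<dots> = mdet S n M" by (rule S.mdet_cong) (use EM Mc in auto)
    finally show ?thesis .
  qed
  \<comment> \<open>The lower coefficients are negated so that the value of the polynomial reads
    \<open>x^n - lin n c\<close>, the convention for all monic polynomials below.\<close>
  define c where "c = (\<lambda>i. \<ominus> up_ring.coeff ?P ?q i)"
  have cc: "c i \<in> carrier R" for i using qc by (simp add: c_def)
  have "ev ?q = lin (Suc n) (up_ring.coeff ?P ?q)" by (rule ev_bound) (use qc dq in auto)
  also have "\<dots> = lin n (up_ring.coeff ?P ?q) \<oplus>\<^bsub>S\<^esub> x [^]\<^bsub>S\<^esub> n" using qc by (simp add: lin_Suc cq)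
  also have "\<dots> = x [^]\<^bsub>S\<^esub> n \<ominus>\<^bsub>S\<^esub> lin n c"
    unfolding c_def using qc by (simp add: lin_minus S.minus_eq S.a_comm)
  finally have evq': "ev ?q = x [^]\<^bsub>S\<^esub> n \<ominus>\<^bsub>S\<^esub> lin n c" .
  have "e k \<otimes>\<^bsub>S\<^esub> mdet S n M = \<zero>\<^bsub>S\<^esub>" if k: "k < n" for k
  proof -
    have "e k \<otimes>\<^bsub>S\<^esub> mdet S n M = mdet S n (M(k := \<lambda>j. \<zero>\<^bsub>S\<^esub>))"
    proof (rule S.cramer[OF Mc k e])
      fix j assume j: "j < n"
      have "(\<Oplus>\<^bsub>S\<^esub>l\<in>{..<n}. e l \<otimes>\<^bsub>S\<^esub> M l j)
        = (\<Oplus>\<^bsub>S\<^esub>l\<in>{..<n}. e l \<otimes>\<^bsub>S\<^esub> (if l = j then x else \<zero>\<^bsub>S\<^esub>) \<oplus>\<^bsub>S\<^esub> \<ominus>\<^bsub>S\<^esub> (h (m j l) \<otimes>\<^bsub>S\<^esub> e l))"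
        by (rule S.finsum_cong')
          (use e m j in \<open>auto simp: M_def S.minus_eq S.r_distr S.r_minus S.m_comm\<close>)
      also have "\<dots> = (\<Oplus>\<^bsub>S\<^esub>l\<in>{..<n}. e l \<otimes>\<^bsub>S\<^esub> (if l = j then x else \<zero>\<^bsub>S\<^esub>))
          \<oplus>\<^bsub>S\<^esub> (\<Oplus>\<^bsub>S\<^esub>l\<in>{..<n}. \<ominus>\<^bsub>S\<^esub> (h (m j l) \<otimes>\<^bsub>S\<^esub> e l))"
        by (rule S.finsum_addf) (use e m j in auto)
      also have "(\<Oplus>\<^bsub>S\<^esub>l\<in>{..<n}. e l \<otimes>\<^bsub>S\<^esub> (if l = j then x else \<zero>\<^bsub>S\<^esub>)) = e j \<otimes>\<^bsub>S\<^esub> (if j = j then x else \<zero>\<^bsub>S\<^esub>)"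
        by (rule S.finsum_single) (use e j in auto)
      also have "(\<Oplus>\<^bsub>S\<^esub>l\<in>{..<n}. \<ominus>\<^bsub>S\<^esub> (h (m j l) \<otimes>\<^bsub>S\<^esub> e l)) = \<ominus>\<^bsub>S\<^esub> (x \<otimes>\<^bsub>S\<^esub> e j)"
        unfolding rel[OF j] by (rule S.finsum_minus) (use e m j in auto)
      finally show "\<zero>\<^bsub>S\<^esub> = (\<Oplus>\<^bsub>S\<^esub>l\<in>{..<n}. e l \<otimes>\<^bsub>S\<^esub> M l j)"
        using e[OF j] by (simp add: S.m_comm[of "e j" x] S.r_neg)
    qed
    \<comment> \<open>A zero row is \<open>0\<close> times a row, so the factor \<open>0\<close>
      comes out of the determinant.\<close>
    also have "\<dots> = mdet S n (M(k := \<lambda>j. \<zero>\<^bsub>S\<^esub> \<otimes>\<^bsub>S\<^esub> \<zero>\<^bsub>S\<^esub>))" by simp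
    also have "\<dots> = \<zero>\<^bsub>S\<^esub> \<otimes>\<^bsub>S\<^esub> mdet S n (M(k := \<lambda>j. \<zero>\<^bsub>S\<^esub>))"
      by (rule S.mdet_row_smult[OF Mc k]) auto
    also have "\<dots> = \<zero>\<^bsub>S\<^esub>" using Mc k by (intro S.l_null S.mdet_closed) auto
    finally show ?thesis .
  qed
  then show ?thesis using evq evq' cc by (intro bexI[of _ c]) auto
qed

end

section \<open>From local to global\<close>

lemma (in cring) T_prod_closed:
  assumes "submonoid T R" "finite I" "\<And>i. i \<in> I \<Longrightarrow> t i \<in> T"
  shows "(\<Otimes>i\<in>I. t i) \<in> T"
  using assms(2,3)
proof (induction I rule: finite_induct)
  case empty then show ?case using assms(1) by (simp add: submonoid_def)
next
  case (insert i I)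
  have "t j \<in> carrier R" if "j \<in> insert i I" for j
    using insert that assms(1) by (auto simp: submonoid_def)
  then have "(\<Otimes>i\<in>insert i I. t i) = t i \<otimes> (\<Otimes>i\<in>I. t i)" using insert by (intro finprod_insert) auto
  then show ?case using insert assms(1) by (simp add: submonoid_def)
qed

lemma (in cring) prod_dvd_split:
  assumes "finite I" "i \<in> I" "\<And>j. j \<in> I \<Longrightarrow> t j \<in> carrier R"
  shows "(\<Otimes>j\<in>I. t j) = t i \<otimes> (\<Otimes>j\<in>I - {i}. t j)" "(\<Otimes>j\<in>I - {i}. t j) \<in> carrier R"
proof -
  have "(\<Otimes>j\<in>insert i (I - {i}). t j) = t i \<otimes> (\<Otimes>j\<in>I - {i}. t j)"
    using assms by (intro finprod_insert) auto
  then show "(\<Otimes>j\<in>I. t j) = t i \<otimes> (\<Otimes>j\<in>I - {i}. t j)" using assms by (simp add: insert_absorb)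
  show "(\<Otimes>j\<in>I - {i}. t j) \<in> carrier R" using assms by (intro finprod_closed) auto
qed

text \<open>Since the property passes to multiples, finitely many multipliers can be replaced by
  their product.\<close>

lemma (in cring) common_multiple:
  assumes T: "submonoid T R" and I: "finite I"
    and ex: "\<And>i. i \<in> I \<Longrightarrow> \<exists>t\<in>T. P i t"
    and mul: "\<And>i s t. \<lbrakk>i \<in> I; P i t; t \<in> T; s \<in> carrier R\<rbrakk> \<Longrightarrow> P i (s \<otimes> t)"
  shows "\<exists>t\<in>T. \<forall>i\<in>I. P i t"
proof -
  have "\<forall>i\<in>I. \<exists>t. t \<in> T \<and> P i t" using ex by blast
  then obtain t where t: "\<forall>i\<in>I. t i \<in> T \<and> P i (t i)" by (rule bchoice[THEN exE])
  have tc: "t i \<in> carrier R" if "i \<in> I" for i using t that T by (auto simp: submonoid_def)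
  have "P i (\<Otimes>i\<in>I. t i)" if i: "i \<in> I" for i
    using prod_dvd_split[OF I i tc] mul[OF i, of "t i" "\<Otimes>j\<in>I - {i}. t j"] t i tc[OF i]
    by (simp add: m_comm)
  then show ?thesis using T_prod_closed[OF T I, of t] t by blast
qed

lemma (in cring) exists_maximalideal:
  assumes J: "ideal J R" and one: "\<one> \<notin> J"
  shows "\<exists>P. maximalideal P R \<and> J \<subseteq> P"
proof -
  define \<A> where "\<A> = {I. ideal I R \<and> J \<subseteq> I \<and> \<one> \<notin> I}"
  have "\<exists>P\<in>\<A>. \<forall>I\<in>\<A>. P \<subseteq> I \<longrightarrow> I = P"
  proof (rule subset_Zorn_nonempty)
    show "\<A> \<noteq> {}" using assms by (auto simp: \<A>_def)
    fix \<C> assume ne: "\<C> \<noteq> {}" and ch: "subset.chain \<A> \<C>"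
    have id: "ideal I R" "J \<subseteq> I" "\<one> \<notin> I" if "I \<in> \<C>" for I
      using ch that by (auto simp: \<A>_def subset.chain_def)
    have two: "\<exists>K\<in>\<C>. a \<in> K \<and> b \<in> K" if "a \<in> \<Union>\<C>" "b \<in> \<Union>\<C>" for a b
    proof -
      obtain I K where I: "I \<in> \<C>" "a \<in> I" and K: "K \<in> \<C>" "b \<in> K" using \<open>a \<in> \<Union>\<C>\<close> \<open>b \<in> \<Union>\<C>\<close> by auto
      have "I \<subseteq> K \<or> K \<subseteq> I" using ch I K by (auto simp: subset.chain_def)
      then show ?thesis using I K by blast
    qed
    have "ideal (\<Union>\<C>) R"
    proof (rule idealI)
      show "subgroup (\<Union>\<C>) (add_monoid R)"
      proof (rule add.subgroupI)
        show "\<Union>\<C> \<subseteq> carrier R" using ideal.Icarr[OF id(1)] by blast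
        show "\<Union>\<C> \<noteq> {}"
        proof -
          from ne obtain I where I: "I \<in> \<C>" by blast
          interpret I: ideal I R by (rule id(1)[OF I])
          show ?thesis using I I.zero_closed by blast
        qed
        fix a assume a: "a \<in> \<Union>\<C>"
        then obtain I where I: "I \<in> \<C>" "a \<in> I" by blast
        interpret I: ideal I R by (rule id(1)[OF I(1)])
        show "\<ominus> a \<in> \<Union>\<C>" using I I.a_inv_closed[of a] by blast
        fix b assume "b \<in> \<Union>\<C>"
        with a obtain K where K: "K \<in> \<C>" "a \<in> K" "b \<in> K" using two by blast
        interpret K: ideal K R by (rule id(1)[OF K(1)])
        have "a \<oplus> b \<in> K" using K K.a_closed by simp
        then show "a \<oplus> b \<in> \<Union>\<C>" using K by blast
      qed
    next
      fix a y assume "a \<in> \<Union>\<C>" and y: "y \<in> carrier R"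
      then obtain I where I: "I \<in> \<C>" "a \<in> I" by blast
      interpret I: ideal I R by (rule id(1)[OF I(1)])
      show "y \<otimes> a \<in> \<Union>\<C>" "a \<otimes> y \<in> \<Union>\<C>"
        using I y I.I_l_closed[of a y] I.I_r_closed[of a y] by blast+
    qed (rule ring_axioms)
    moreover have "J \<subseteq> \<Union>\<C>" using ne id(2) by blast
    ultimately show "\<Union>\<C> \<in> \<A>" using id(3) by (auto simp: \<A>_def)
  qed
  then obtain P where P: "P \<in> \<A>" and mx: "\<And>I. \<lbrakk>I \<in> \<A>; P \<subseteq> I\<rbrakk> \<Longrightarrow> I = P" by blast
  have "maximalideal P R"
  proof (rule maximalidealI)
    show "ideal P R" "carrier R \<noteq> P" using P by (auto simp: \<A>_def)
    fix I assume I: "ideal I R" "P \<subseteq> I" "I \<subseteq> carrier R"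
    show "I = P \<or> I = carrier R"
    proof (cases "\<one> \<in> I")
      case True then show ?thesis using ideal.one_imp_carrier[OF I(1)] by simp
    next
      case False then show ?thesis using mx[of I] I P by (auto simp: \<A>_def)
    qed
  qed
  then show ?thesis using P by (auto simp: \<A>_def)
qed

text \<open>Otherwise a maximal ideal contains \<open>J\<close>; it is prime, so it would contain a
  power of an \<open>f\<close> that lies outside it.\<close>

lemma (in cring) ideal_local_eq_carrier:
  assumes J: "ideal J R"
    and loc: "\<And>P. primeideal P R \<Longrightarrow> \<exists>f\<in>carrier R - P. \<exists>k::nat. f [^] k \<in> J"
  shows "\<one> \<in> J"
proof (rule ccontr)
  assume "\<one> \<notin> J"
  then obtain P where P: "maximalideal P R" "J \<subseteq> P" using exists_maximalideal[OF J] by blast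
  then interpret P: primeideal P R using maximalideal_prime by blast
  obtain f k where f: "f \<in> carrier R" "f \<notin> P" and k: "f [^] (k::nat) \<in> P"
    using loc[OF P.primeideal] P(2) by blast
  have one: "\<one> \<notin> P" using P.I_notcarr P.one_imp_carrier by blast
  have "f [^] (k::nat) \<notin> P" for k
  proof (induction k)
    case (Suc k)
    then show ?case using P.I_prime[of "f [^] k" f] f by auto
  qed (use one in simp)
  then show False using k by blast
qed

lemma (in cring) powers_submonoid: "f \<in> carrier R \<Longrightarrow> submonoid (range (\<lambda>k::nat. f [^] k)) R"
  by (intro submonoid.intro) (auto simp: nat_pow_mult intro: range_eqI[of _ _ 0])

context pring
begin

text \<open>The situation over one \<open>D(f)\<close>, with localization replaced by multipliers
  from \<open>T\<close>. The assumptions \<open>span\<close> and \<open>indep\<close> say that the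
  \<open>q i\<close> become a basis, and \<open>gen\<close> says that every element is a fraction of
  elements of \<open>R[x]\<close> with unit denominator. The basis property is transferred from the
  \<open>q i\<close> to the powers of \<open>x\<close>.\<close>

lemma local_power_basis:
  assumes T: "submonoid T R"
    and q: "\<And>i. i < n \<Longrightarrow> q i \<in> carrier S"
    and span: "\<And>y. y \<in> carrier S \<Longrightarrow>
      \<exists>t\<in>T. \<exists>c\<in>{..<n} \<rightarrow> carrier R. h t \<otimes>\<^bsub>S\<^esub> y = (\<Oplus>\<^bsub>S\<^esub>i\<in>{..<n}. h (c i) \<otimes>\<^bsub>S\<^esub> q i)"
    and indep: "\<And>c. \<lbrakk>c \<in> {..<n} \<rightarrow> carrier R; (\<Oplus>\<^bsub>S\<^esub>i\<in>{..<n}. h (c i) \<otimes>\<^bsub>S\<^esub> q i) = \<zero>\<^bsub>S\<^esub>\<rbrakk>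
      \<Longrightarrow> \<exists>t\<in>T. \<forall>i<n. t \<otimes> c i = \<zero>"
    and gen: "\<And>y. y \<in> carrier S \<Longrightarrow> \<exists>p\<in>carrier (UP R). \<exists>w\<in>carrier (UP R). ev w \<in> Units S \<and> ev w \<otimes>\<^bsub>S\<^esub> y = ev p"
  shows "\<And>y. y \<in> carrier S \<Longrightarrow> \<exists>t\<in>T. \<exists>c\<in>{..<n} \<rightarrow> carrier R. h t \<otimes>\<^bsub>S\<^esub> y = lin n c"
    and "\<And>c. \<lbrakk>c \<in> {..<n} \<rightarrow> carrier R; lin n c = \<zero>\<^bsub>S\<^esub>\<rbrakk> \<Longrightarrow> \<exists>t\<in>T. \<forall>i<n. t \<otimes> c i = \<zero>"
proof -
  interpret ev: ring_hom_cring "UP R" S ev by (rule ev_hom)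
  have Tc [simp]: "t \<in> T \<Longrightarrow> t \<in> carrier R" for t using T by (auto simp: submonoid_def)
  have T1 [simp]: "\<one> \<in> T" and Tm [simp]: "\<And>s t. \<lbrakk>s \<in> T; t \<in> T\<rbrakk> \<Longrightarrow> s \<otimes> t \<in> T"
    using T by (auto simp: submonoid_def)
  have Tp: "t [^] (k::nat) \<in> T" if "t \<in> T" for t k by (induction k) (use that in auto)
  define comb where "comb = (\<lambda>c. \<Oplus>\<^bsub>S\<^esub>i\<in>{..<n}. h (c i) \<otimes>\<^bsub>S\<^esub> q i)"
  have comb_smult: "comb (\<lambda>i. b \<otimes> c i) = h b \<otimes>\<^bsub>S\<^esub> comb c"
    if "c \<in> {..<n} \<rightarrow> carrier R" "b \<in> carrier R" for b c
  proof -
    have ci: "c i \<in> carrier R" if "i < n" for i using that \<open>c \<in> _\<close> by auto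
    have "h b \<otimes>\<^bsub>S\<^esub> comb c = (\<Oplus>\<^bsub>S\<^esub>i\<in>{..<n}. h b \<otimes>\<^bsub>S\<^esub> (h (c i) \<otimes>\<^bsub>S\<^esub> q i))"
      unfolding comb_def by (rule S.finsum_rdistr) (use ci that q in auto)
    also have "\<dots> = comb (\<lambda>i. b \<otimes> c i)" unfolding comb_def
      by (rule S.finsum_cong') (use ci that q in \<open>auto simp: S.m_assoc\<close>)
    finally show ?thesis by simp
  qed
  have comb_closed: "comb c \<in> carrier S" if "c \<in> {..<n} \<rightarrow> carrier R" for c
    unfolding comb_def using that q by (intro S.finsum_closed) auto
  \<comment> \<open>Up to a multiplier from \<open>T\<close>, every element satisfies a monic
    equation of degree \<open>n\<close> over \<open>R\<close>. The determinant trick is applied to a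
    multiple \<open>t y\<close>, because only \<open>t y q_i\<close> is known to lie in the span of
    the \<open>q i\<close>.\<close>
  have integral: "\<exists>t\<in>T. \<exists>c\<in>{..<n} \<rightarrow> carrier R. h t \<otimes>\<^bsub>S\<^esub> y [^]\<^bsub>S\<^esub> n = lincomb S h y n c"
    if y: "y \<in> carrier S" for y
  proof -
    have "\<exists>t\<in>T. \<forall>i\<in>{..<n}. \<exists>c\<in>{..<n} \<rightarrow> carrier R. h t \<otimes>\<^bsub>S\<^esub> (y \<otimes>\<^bsub>S\<^esub> q i) = comb c"
    proof (rule R.common_multiple[OF T])
      fix i s t assume i: "i \<in> {..<n}" and *: "\<exists>c\<in>{..<n} \<rightarrow> carrier R. h t \<otimes>\<^bsub>S\<^esub> (y \<otimes>\<^bsub>S\<^esub> q i) = comb c"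
        and t: "t \<in> T" and s: "s \<in> carrier R"
      then obtain c where c: "c \<in> {..<n} \<rightarrow> carrier R" "h t \<otimes>\<^bsub>S\<^esub> (y \<otimes>\<^bsub>S\<^esub> q i) = comb c" by blast
      have "h (s \<otimes> t) \<otimes>\<^bsub>S\<^esub> (y \<otimes>\<^bsub>S\<^esub> q i) = comb (\<lambda>i. s \<otimes> c i)"
        unfolding comb_smult[OF c(1) s] c(2)[symmetric] using i s t y q by (simp add: S.m_assoc)
      then show "\<exists>c\<in>{..<n} \<rightarrow> carrier R. h (s \<otimes> t) \<otimes>\<^bsub>S\<^esub> (y \<otimes>\<^bsub>S\<^esub> q i) = comb c"
        using c s by (intro bexI[of _ "\<lambda>i. s \<otimes> c i"]) auto
    qed (use span y q in \<open>auto simp: comb_def\<close>)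
    then obtain t where t: "t \<in> T"
      and ex: "\<forall>i\<in>{..<n}. \<exists>c. c \<in> {..<n} \<rightarrow> carrier R \<and> h t \<otimes>\<^bsub>S\<^esub> (y \<otimes>\<^bsub>S\<^esub> q i) = comb c" by blast
    from bchoice[OF ex] obtain m where
      m: "\<forall>i\<in>{..<n}. m i \<in> {..<n} \<rightarrow> carrier R \<and> h t \<otimes>\<^bsub>S\<^esub> (y \<otimes>\<^bsub>S\<^esub> q i) = comb (m i)" by blast
    have mc: "m i j \<in> carrier R" if "i < n" "j < n" for i j using m that by blast
    interpret ty: pring R S h "h t \<otimes>\<^bsub>S\<^esub> y" by unfold_locales (use t y in simp)
    have "\<exists>c\<in>{..<n} \<rightarrow> carrier R. \<forall>k<n. q k \<otimes>\<^bsub>S\<^esub> ((h t \<otimes>\<^bsub>S\<^esub> y) [^]\<^bsub>S\<^esub> n \<ominus>\<^bsub>S\<^esub> ty.lin n c) = \<zero>\<^bsub>S\<^esub>"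
    proof (rule ty.char_poly_relation[of n q m])
      fix i assume i: "i < n"
      then have "h t \<otimes>\<^bsub>S\<^esub> (y \<otimes>\<^bsub>S\<^esub> q i) = comb (m i)" using m by blast
      then show "h t \<otimes>\<^bsub>S\<^esub> y \<otimes>\<^bsub>S\<^esub> q i = (\<Oplus>\<^bsub>S\<^esub>j\<in>{..<n}. h (m i j) \<otimes>\<^bsub>S\<^esub> q j)"
        using t y q[OF i] by (simp add: S.m_assoc comb_def)
    qed (use q mc in auto)
    then obtain c where c: "c \<in> {..<n} \<rightarrow> carrier R"
      and z: "\<And>k. k < n \<Longrightarrow> q k \<otimes>\<^bsub>S\<^esub> ((h t \<otimes>\<^bsub>S\<^esub> y) [^]\<^bsub>S\<^esub> n \<ominus>\<^bsub>S\<^esub> ty.lin n c) = \<zero>\<^bsub>S\<^esub>" by blast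
    have ci: "c i \<in> carrier R" if "i < n" for i using c that by auto
    define g where "g = (h t \<otimes>\<^bsub>S\<^esub> y) [^]\<^bsub>S\<^esub> n \<ominus>\<^bsub>S\<^esub> ty.lin n c"
    have gc: "g \<in> carrier S" unfolding g_def using t y ci by auto
    \<comment> \<open>The value \<open>g\<close> kills every \<open>q i\<close>. A multiple
      \<open>s\<close> of \<open>1\<close> is a combination of the \<open>q i\<close>, so
      \<open>s g = 0\<close>.\<close>
    obtain s b where s: "s \<in> T" and b: "b \<in> {..<n} \<rightarrow> carrier R" and sb: "h s \<otimes>\<^bsub>S\<^esub> \<one>\<^bsub>S\<^esub> = comb b"
      using span[of "\<one>\<^bsub>S\<^esub>"] unfolding comb_def by auto
    have bi: "b i \<in> carrier R" if "i < n" for i using b that by auto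
    have "h s \<otimes>\<^bsub>S\<^esub> g = comb b \<otimes>\<^bsub>S\<^esub> g" using sb s by simp
    also have "\<dots> = (\<Oplus>\<^bsub>S\<^esub>i\<in>{..<n}. h (b i) \<otimes>\<^bsub>S\<^esub> q i \<otimes>\<^bsub>S\<^esub> g)"
      unfolding comb_def by (rule S.finsum_ldistr) (use bi q gc in auto)
    also have "\<dots> = (\<Oplus>\<^bsub>S\<^esub>i\<in>{..<n}. \<zero>\<^bsub>S\<^esub>)"
      by (rule S.finsum_cong') (use bi q gc z in \<open>auto simp: S.m_assoc g_def\<close>)
    finally have "h s \<otimes>\<^bsub>S\<^esub> g = \<zero>\<^bsub>S\<^esub>" by simp
    then have "h s \<otimes>\<^bsub>S\<^esub> (h t \<otimes>\<^bsub>S\<^esub> y) [^]\<^bsub>S\<^esub> n = h s \<otimes>\<^bsub>S\<^esub> ty.lin n c"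
      unfolding g_def using s t y ci
      by (simp add: S.minus_eq S.r_distr S.r_minus) (metis S.minus_equality S.minus_minus S.a_inv_closed S.m_closed hom_closed S.nat_pow_closed ty.lin_closed ty.x_closed Tc)
    \<comment> \<open>The powers of \<open>t\<close> inside \<open>(t y)^n\<close> go into the
      multiplier, those inside \<open>(t y)^i\<close> into the coefficients.\<close>
    moreover have "h s \<otimes>\<^bsub>S\<^esub> (h t \<otimes>\<^bsub>S\<^esub> y) [^]\<^bsub>S\<^esub> n = h (s \<otimes> t [^] n) \<otimes>\<^bsub>S\<^esub> y [^]\<^bsub>S\<^esub> n"
      using s t y by (simp add: S.nat_pow_distrib S.m_assoc)
    moreover have "h s \<otimes>\<^bsub>S\<^esub> ty.lin n c = lincomb S h y n (\<lambda>i. s \<otimes> (c i \<otimes> t [^] i))"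
    proof -
      have "h s \<otimes>\<^bsub>S\<^esub> ty.lin n c = (\<Oplus>\<^bsub>S\<^esub>i\<in>{..<n}. h s \<otimes>\<^bsub>S\<^esub> (h (c i) \<otimes>\<^bsub>S\<^esub> (h t \<otimes>\<^bsub>S\<^esub> y) [^]\<^bsub>S\<^esub> i))"
        unfolding lincomb_def by (rule S.finsum_rdistr) (use ci s t y in auto)
      also have "\<dots> = lincomb S h y n (\<lambda>i. s \<otimes> (c i \<otimes> t [^] i))"
        unfolding lincomb_def
        by (rule S.finsum_cong') (use ci s t y in \<open>auto simp: S.nat_pow_distrib S.m_assoc\<close>)
      finally show ?thesis .
    qed
    ultimately show ?thesis using s t ci Tp
      by (intro bexI[of _ "s \<otimes> t [^] n"] bexI[of _ "\<lambda>i. s \<otimes> (c i \<otimes> t [^] i)"]) auto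
  qed
  \<comment> \<open>The image of \<open>R[x]\<close>. Inverses of units from \<open>Bx\<close> lie
    in \<open>Bx\<close> up to a multiplier; together with \<open>gen\<close> this extends to all
    elements of \<open>S\<close>.\<close>
  define Bx where "Bx = ev ` carrier (UP R)"
  have Bx_h: "h b \<in> Bx" if "b \<in> carrier R" for b
  proof -
    have "h b = ev (up_ring.monom (UP R) b 0)" using U.eval_const[OF x_closed that] by simp
    moreover have "up_ring.monom (UP R) b 0 \<in> carrier (UP R)" using that by simp
    ultimately show ?thesis unfolding Bx_def by blast
  qed
  have Bx_add: "y \<oplus>\<^bsub>S\<^esub> z \<in> Bx" if "y \<in> Bx" "z \<in> Bx" for y z
  proof -
    from that obtain p r where "p \<in> carrier (UP R)" "r \<in> carrier (UP R)" "y = ev p" "z = ev r"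
      unfolding Bx_def by blast
    then have "y \<oplus>\<^bsub>S\<^esub> z = ev (p \<oplus>\<^bsub>UP R\<^esub> r)" "p \<oplus>\<^bsub>UP R\<^esub> r \<in> carrier (UP R)" by auto
    then show ?thesis unfolding Bx_def by blast
  qed
  have Bx_mult: "y \<otimes>\<^bsub>S\<^esub> z \<in> Bx" if "y \<in> Bx" "z \<in> Bx" for y z
  proof -
    from that obtain p r where "p \<in> carrier (UP R)" "r \<in> carrier (UP R)" "y = ev p" "z = ev r"
      unfolding Bx_def by blast
    then have "y \<otimes>\<^bsub>S\<^esub> z = ev (p \<otimes>\<^bsub>UP R\<^esub> r)" "p \<otimes>\<^bsub>UP R\<^esub> r \<in> carrier (UP R)" by auto
    then show ?thesis unfolding Bx_def by blast
  qed
  have Bx_pow: "y [^]\<^bsub>S\<^esub> (k::nat) \<in> Bx" if "y \<in> Bx" for y k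
    by (induction k) (use that Bx_h[of \<one>] Bx_mult in auto)
  have Bx_sum: "(\<Oplus>\<^bsub>S\<^esub>i\<in>I. g i) \<in> Bx" if "finite I" "\<And>i. i \<in> I \<Longrightarrow> g i \<in> Bx" for I g
    using that
  proof (induction I rule: finite_induct)
    case (insert i I)
    have "g j \<in> carrier S" if "j \<in> insert i I" for j
      using insert.prems[OF that] unfolding Bx_def by auto
    then have "(\<Oplus>\<^bsub>S\<^esub>i\<in>insert i I. g i) = g i \<oplus>\<^bsub>S\<^esub> (\<Oplus>\<^bsub>S\<^esub>i\<in>I. g i)"
      using insert by (intro S.finsum_insert) auto
    then show ?case using insert Bx_add by auto
  qed (use Bx_h[of \<zero>] in auto)
  have Bx_all: "\<exists>t\<in>T. h t \<otimes>\<^bsub>S\<^esub> y \<in> Bx" if y: "y \<in> carrier S" for y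
  proof -
    obtain p w where p: "p \<in> carrier (UP R)" and w: "w \<in> carrier (UP R)" and wu: "ev w \<in> Units S"
      and wy: "ev w \<otimes>\<^bsub>S\<^esub> y = ev p" using gen[OF y] by blast
    define z where "z = inv\<^bsub>S\<^esub> (ev w)"
    have zc: "z \<in> carrier S" and zw: "ev w \<otimes>\<^bsub>S\<^esub> z = \<one>\<^bsub>S\<^esub>" unfolding z_def using wu by auto
    have wc: "ev w \<in> carrier S" using w by simp
    obtain t c where t: "t \<in> T" and c: "c \<in> {..<n} \<rightarrow> carrier R"
      and eq: "h t \<otimes>\<^bsub>S\<^esub> z [^]\<^bsub>S\<^esub> n = lincomb S h z n c" using integral[OF zc] by blast
    have ci: "c i \<in> carrier R" if "i < n" for i using c that by auto
    have zwp: "z [^]\<^bsub>S\<^esub> (i::nat) \<otimes>\<^bsub>S\<^esub> ev w [^]\<^bsub>S\<^esub> i = \<one>\<^bsub>S\<^esub>" for i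
      using S.nat_pow_distrib[OF zc wc, of i] zw zc wc by (simp add: S.m_comm)
    have "h t \<otimes>\<^bsub>S\<^esub> z \<in> Bx"
    proof (cases n)
      \<comment> \<open>The combination is empty, so the equation for \<open>z\<close> says that the
        multiplier \<open>t\<close> vanishes in \<open>S\<close>.\<close>
      case 0
      then have "h t = \<zero>\<^bsub>S\<^esub>" using eq t by (simp add: lincomb_def)
      then show ?thesis using zc Bx_h[of \<zero>] by simp
    next
      case (Suc k)
      \<comment> \<open>Here \<open>z\<close> is the inverse of \<open>w\<close>. Multiplying the
        equation for \<open>z^n\<close> by \<open>w^k\<close>, where \<open>k = n - 1\<close>,
        leaves \<open>t z\<close> on one side and nonnegative powers of \<open>w\<close> on the
        other.\<close>
      have "h t \<otimes>\<^bsub>S\<^esub> z = h t \<otimes>\<^bsub>S\<^esub> z [^]\<^bsub>S\<^esub> n \<otimes>\<^bsub>S\<^esub> ev w [^]\<^bsub>S\<^esub> k"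
      proof -
        have "h t \<otimes>\<^bsub>S\<^esub> z [^]\<^bsub>S\<^esub> n \<otimes>\<^bsub>S\<^esub> ev w [^]\<^bsub>S\<^esub> k
          = h t \<otimes>\<^bsub>S\<^esub> z \<otimes>\<^bsub>S\<^esub> (z [^]\<^bsub>S\<^esub> k \<otimes>\<^bsub>S\<^esub> ev w [^]\<^bsub>S\<^esub> k)"
          using Suc t zc wc by (simp add: S.m_ac)
        then show ?thesis using t zc by (simp add: zwp)
      qed
      also have "\<dots> = (\<Oplus>\<^bsub>S\<^esub>i\<in>{..<n}. h (c i) \<otimes>\<^bsub>S\<^esub> z [^]\<^bsub>S\<^esub> i \<otimes>\<^bsub>S\<^esub> ev w [^]\<^bsub>S\<^esub> k)"
        unfolding eq lincomb_def by (rule S.finsum_ldistr) (use ci zc wc in auto)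
      also have "\<dots> = (\<Oplus>\<^bsub>S\<^esub>i\<in>{..<n}. h (c i) \<otimes>\<^bsub>S\<^esub> ev w [^]\<^bsub>S\<^esub> (k - i))"
      proof (rule S.finsum_cong')
        fix i assume i: "i \<in> {..<n}"
        then have "ev w [^]\<^bsub>S\<^esub> k = ev w [^]\<^bsub>S\<^esub> i \<otimes>\<^bsub>S\<^esub> ev w [^]\<^bsub>S\<^esub> (k - i)"
          using Suc wc by (simp add: S.nat_pow_mult)
        then have "h (c i) \<otimes>\<^bsub>S\<^esub> z [^]\<^bsub>S\<^esub> i \<otimes>\<^bsub>S\<^esub> ev w [^]\<^bsub>S\<^esub> k
          = h (c i) \<otimes>\<^bsub>S\<^esub> (z [^]\<^bsub>S\<^esub> i \<otimes>\<^bsub>S\<^esub> ev w [^]\<^bsub>S\<^esub> i) \<otimes>\<^bsub>S\<^esub> ev w [^]\<^bsub>S\<^esub> (k - i)"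
          using i ci zc wc by (simp add: S.m_assoc)
        then show "h (c i) \<otimes>\<^bsub>S\<^esub> z [^]\<^bsub>S\<^esub> i \<otimes>\<^bsub>S\<^esub> ev w [^]\<^bsub>S\<^esub> k = h (c i) \<otimes>\<^bsub>S\<^esub> ev w [^]\<^bsub>S\<^esub> (k - i)"
          using i ci by (simp add: zwp)
      qed (use ci wc in auto)
      also have "\<dots> \<in> Bx"
        by (rule Bx_sum) (use ci w Bx_h Bx_mult Bx_pow in \<open>auto simp: Bx_def\<close>)
      finally show ?thesis .
    qed
    moreover have "h t \<otimes>\<^bsub>S\<^esub> y = (h t \<otimes>\<^bsub>S\<^esub> z) \<otimes>\<^bsub>S\<^esub> ev p"
    proof -
      have "(h t \<otimes>\<^bsub>S\<^esub> z) \<otimes>\<^bsub>S\<^esub> ev p = h t \<otimes>\<^bsub>S\<^esub> (ev w \<otimes>\<^bsub>S\<^esub> z) \<otimes>\<^bsub>S\<^esub> y"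
        unfolding wy[symmetric] using t zc wc y by (simp add: S.m_ac)
      then show ?thesis using zw t y by simp
    qed
    moreover have "ev p \<in> Bx" using p by (simp add: Bx_def)
    ultimately have "h t \<otimes>\<^bsub>S\<^esub> y \<in> Bx" using Bx_mult by simp
    then show ?thesis using t by blast
  qed
  \<comment> \<open>The span of the powers of \<open>x\<close> below \<open>n\<close>, up to
    multipliers. It is closed under division by elements of \<open>T\<close>
    (\<open>Sp_div\<close>), so multipliers may be inserted freely from here on.\<close>
  define Sp where "Sp = {y \<in> carrier S. \<exists>t\<in>T. \<exists>c\<in>{..<n} \<rightarrow> carrier R. h t \<otimes>\<^bsub>S\<^esub> y = lin n c}"
  have Sp_mul: "h b \<otimes>\<^bsub>S\<^esub> y \<in> Sp" if b: "b \<in> carrier R" and y: "y \<in> Sp" for b y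
  proof -
    obtain t c where t: "t \<in> T" and c: "c \<in> {..<n} \<rightarrow> carrier R" and eq: "h t \<otimes>\<^bsub>S\<^esub> y = lin n c"
      and yc: "y \<in> carrier S" using y unfolding Sp_def by blast
    have "h t \<otimes>\<^bsub>S\<^esub> (h b \<otimes>\<^bsub>S\<^esub> y) = h b \<otimes>\<^bsub>S\<^esub> lin n c"
      unfolding eq[symmetric] using b t yc by (simp add: S.m_lcomm)
    also have "\<dots> = lin n (\<lambda>i. b \<otimes> c i)" by (rule lin_smult[symmetric]) (use b c in auto)
    finally show ?thesis unfolding Sp_def using t b c yc by auto
  qed
  have Sp_add: "y \<oplus>\<^bsub>S\<^esub> z \<in> Sp" if y: "y \<in> Sp" and z: "z \<in> Sp" for y z
  proof -
    obtain t c where t: "t \<in> T" and c: "c \<in> {..<n} \<rightarrow> carrier R" and eq: "h t \<otimes>\<^bsub>S\<^esub> y = lin n c"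
      and yc: "y \<in> carrier S" using y unfolding Sp_def by blast
    obtain s d where s: "s \<in> T" and d: "d \<in> {..<n} \<rightarrow> carrier R" and eq': "h s \<otimes>\<^bsub>S\<^esub> z = lin n d"
      and zc: "z \<in> carrier S" using z unfolding Sp_def by blast
    have cd: "c i \<in> carrier R" "d i \<in> carrier R" if "i < n" for i using c d that by auto
    have "h (s \<otimes> t) \<otimes>\<^bsub>S\<^esub> (y \<oplus>\<^bsub>S\<^esub> z) = h s \<otimes>\<^bsub>S\<^esub> (h t \<otimes>\<^bsub>S\<^esub> y) \<oplus>\<^bsub>S\<^esub> h t \<otimes>\<^bsub>S\<^esub> (h s \<otimes>\<^bsub>S\<^esub> z)"
      using s t yc zc by (simp add: S.r_distr S.m_ac)
    also have "\<dots> = lin n (\<lambda>i. s \<otimes> c i \<oplus> t \<otimes> d i)"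
      unfolding eq eq' using cd s t by (simp add: lin_add lin_smult)
    finally have "h (s \<otimes> t) \<otimes>\<^bsub>S\<^esub> (y \<oplus>\<^bsub>S\<^esub> z) = lin n (\<lambda>i. s \<otimes> c i \<oplus> t \<otimes> d i)" .
    moreover have "(\<lambda>i. s \<otimes> c i \<oplus> t \<otimes> d i) \<in> {..<n} \<rightarrow> carrier R" using cd s t by auto
    moreover have "s \<otimes> t \<in> T" using s t by simp
    ultimately show ?thesis unfolding Sp_def using yc zc by blast
  qed
  have Sp_I: "lin n c \<in> Sp" if "c \<in> {..<n} \<rightarrow> carrier R" for c
  proof -
    have "lin n c \<in> carrier S" using that by (intro lin_closed) auto
    moreover from this have "h \<one> \<otimes>\<^bsub>S\<^esub> lin n c = lin n c" by simp
    ultimately show ?thesis unfolding Sp_def using that T1 by blast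
  qed
  have Sp_zero: "\<zero>\<^bsub>S\<^esub> \<in> Sp" using Sp_I[of "\<lambda>i. \<zero>"] by (simp add: lin_zero)
  have Sp_sum: "(\<Oplus>\<^bsub>S\<^esub>i\<in>I. g i) \<in> Sp" if "finite I" "\<And>i. i \<in> I \<Longrightarrow> g i \<in> Sp" for I g
    using that
  proof (induction I rule: finite_induct)
    case (insert i I)
    have "g j \<in> carrier S" if "j \<in> insert i I" for j
      using insert.prems[OF that] unfolding Sp_def by auto
    then have "(\<Oplus>\<^bsub>S\<^esub>i\<in>insert i I. g i) = g i \<oplus>\<^bsub>S\<^esub> (\<Oplus>\<^bsub>S\<^esub>i\<in>I. g i)"
      using insert by (intro S.finsum_insert) auto
    then show ?case using insert Sp_add by auto
  qed (use Sp_zero in auto)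
  have Sp_div: "y \<in> Sp" if y: "y \<in> carrier S" and t: "t \<in> T" and ty: "h t \<otimes>\<^bsub>S\<^esub> y \<in> Sp" for t y
  proof -
    obtain s c where s: "s \<in> T" and c: "c \<in> {..<n} \<rightarrow> carrier R" and eq: "h s \<otimes>\<^bsub>S\<^esub> (h t \<otimes>\<^bsub>S\<^esub> y) = lin n c"
      using ty unfolding Sp_def by blast
    then have "h (s \<otimes> t) \<otimes>\<^bsub>S\<^esub> y = lin n c" using s t y by (simp add: S.m_assoc)
    then show ?thesis unfolding Sp_def using s t c y Tm by blast
  qed
  have Sp_low: "x [^]\<^bsub>S\<^esub> i \<in> Sp" if "i < n" for i
    using lin_single[OF that R.one_closed] Sp_I[of "\<lambda>j. if j = i then \<one> else \<zero>"] by simp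
  have Sp_n: "x [^]\<^bsub>S\<^esub> n \<in> Sp" unfolding Sp_def using integral[OF x_closed] by auto
  have Sp_pow: "x [^]\<^bsub>S\<^esub> (k::nat) \<in> Sp" for k
  proof (induction k)
    \<comment> \<open>There are no powers below \<open>n\<close> when \<open>n = 0\<close>, but then
      \<open>x^0\<close> is \<open>x^n\<close>.\<close>
    case 0
    show ?case using Sp_low[of 0] Sp_n by (cases n) auto
  next
    case (Suc k)
    then obtain t c where t: "t \<in> T" and c: "c \<in> {..<n} \<rightarrow> carrier R"
      and eq: "h t \<otimes>\<^bsub>S\<^esub> x [^]\<^bsub>S\<^esub> k = lin n c" unfolding Sp_def by blast
    have ci: "c i \<in> carrier R" if "i < n" for i using c that by auto
    have "h t \<otimes>\<^bsub>S\<^esub> x [^]\<^bsub>S\<^esub> Suc k = lin n c \<otimes>\<^bsub>S\<^esub> x"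
      unfolding eq[symmetric] using t by (simp add: S.m_assoc)
    also have "\<dots> = (\<Oplus>\<^bsub>S\<^esub>i\<in>{..<n}. h (c i) \<otimes>\<^bsub>S\<^esub> x [^]\<^bsub>S\<^esub> i \<otimes>\<^bsub>S\<^esub> x)"
      unfolding lincomb_def by (rule S.finsum_ldistr) (use ci in auto)
    also have "\<dots> \<in> Sp"
    proof (rule Sp_sum)
      fix i assume i: "i \<in> {..<n}"
      \<comment> \<open>Only \<open>x^n\<close> leaves the range of powers below \<open>n\<close>;
        it is covered by the integral equation of \<open>x\<close>.\<close>
      then have "x [^]\<^bsub>S\<^esub> Suc i \<in> Sp" using Sp_low[of "Suc i"] Sp_n by (cases "Suc i = n") auto
      then have "h (c i) \<otimes>\<^bsub>S\<^esub> x [^]\<^bsub>S\<^esub> Suc i \<in> Sp" using i ci by (intro Sp_mul) auto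
      then show "h (c i) \<otimes>\<^bsub>S\<^esub> x [^]\<^bsub>S\<^esub> i \<otimes>\<^bsub>S\<^esub> x \<in> Sp" using i ci by (simp add: S.m_assoc)
    qed simp
    finally have st: "h t \<otimes>\<^bsub>S\<^esub> x [^]\<^bsub>S\<^esub> Suc k \<in> Sp" .
    show ?case by (rule Sp_div[OF _ t st]) (rule S.nat_pow_closed[OF x_closed])
  qed
  have Sp_Bx: "y \<in> Sp" if y: "y \<in> Bx" for y
  proof -
    obtain p where p: "p \<in> carrier (UP R)" and y: "y = ev p" using y by (auto simp: Bx_def)
    have "y = lin (Suc (deg R p)) (up_ring.coeff (UP R) p)" unfolding y by (rule ev_bound) (use p in auto)
    also have "\<dots> \<in> Sp" unfolding lincomb_def by (rule Sp_sum) (use p Sp_pow Sp_mul in auto)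
    finally show ?thesis .
  qed
  have Sp_all: "y \<in> Sp" if "y \<in> carrier S" for y
    using Bx_all[OF that] Sp_Bx Sp_div[OF that] by blast
  show sp: "\<exists>t\<in>T. \<exists>c\<in>{..<n} \<rightarrow> carrier R. h t \<otimes>\<^bsub>S\<^esub> y = lin n c" if "y \<in> carrier S" for y
    using Sp_all[OF that] unfolding Sp_def by blast
  fix c assume c: "c \<in> {..<n} \<rightarrow> carrier R" and z: "lin n c = \<zero>\<^bsub>S\<^esub>"
  have ci: "c i \<in> carrier R" if "i < n" for i using c that by auto
  \<comment> \<open>Independence compares two changes of generators: \<open>p\<close> writes
    \<open>t q_j\<close> in the powers of \<open>x\<close>, and \<open>k\<close> writes
    \<open>t' x^i\<close> in the \<open>q_l\<close>. As the \<open>q_l\<close> are independent up to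
    torsion, \<open>p k\<close> is the scalar matrix \<open>t' t\<close> up to torsion, which makes
    the determinant of \<open>k\<close> invertible after localizing.\<close>
  have "\<exists>t\<in>T. \<forall>j\<in>{..<n}. \<exists>d\<in>{..<n} \<rightarrow> carrier R. h t \<otimes>\<^bsub>S\<^esub> q j = lin n d"
  proof (rule R.common_multiple[OF T])
    fix i s t assume i: "i \<in> {..<n}" and *: "\<exists>c\<in>{..<n} \<rightarrow> carrier R. h t \<otimes>\<^bsub>S\<^esub> q i = lin n c"
      and t: "t \<in> T" and s: "s \<in> carrier R"
    then obtain c where c: "c \<in> {..<n} \<rightarrow> carrier R" "h t \<otimes>\<^bsub>S\<^esub> q i = lin n c" by blast
    have "h (s \<otimes> t) \<otimes>\<^bsub>S\<^esub> q i = h s \<otimes>\<^bsub>S\<^esub> lin n c"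
      unfolding c(2)[symmetric] using i s t q by (simp add: S.m_assoc)
    also have "\<dots> = lin n (\<lambda>i. s \<otimes> c i)" by (rule lin_smult[symmetric]) (use s c in auto)
    finally show "\<exists>c\<in>{..<n} \<rightarrow> carrier R. h (s \<otimes> t) \<otimes>\<^bsub>S\<^esub> q i = lin n c"
      using c s by (intro bexI[of _ "\<lambda>i. s \<otimes> c i"]) auto
  qed (use sp q in auto)
  then obtain t where t: "t \<in> T"
    and ex: "\<forall>j\<in>{..<n}. \<exists>d. d \<in> {..<n} \<rightarrow> carrier R \<and> h t \<otimes>\<^bsub>S\<^esub> q j = lin n d" by blast
  from bchoice[OF ex] obtain p where
    p: "\<forall>j\<in>{..<n}. p j \<in> {..<n} \<rightarrow> carrier R \<and> h t \<otimes>\<^bsub>S\<^esub> q j = lin n (p j)" by blast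
  have pc: "p i j \<in> carrier R" if "i < n" "j < n" for i j using p that by blast
  have "\<exists>t\<in>T. \<forall>i\<in>{..<n}. \<exists>d\<in>{..<n} \<rightarrow> carrier R. h t \<otimes>\<^bsub>S\<^esub> x [^]\<^bsub>S\<^esub> i = comb d"
  proof (rule R.common_multiple[OF T])
    fix i s t assume i: "i \<in> {..<n}" and *: "\<exists>c\<in>{..<n} \<rightarrow> carrier R. h t \<otimes>\<^bsub>S\<^esub> x [^]\<^bsub>S\<^esub> i = comb c"
      and t: "t \<in> T" and s: "s \<in> carrier R"
    then obtain c where c: "c \<in> {..<n} \<rightarrow> carrier R" "h t \<otimes>\<^bsub>S\<^esub> x [^]\<^bsub>S\<^esub> i = comb c" by blast
    have "h (s \<otimes> t) \<otimes>\<^bsub>S\<^esub> x [^]\<^bsub>S\<^esub> i = comb (\<lambda>i. s \<otimes> c i)"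
      unfolding comb_smult[OF c(1) s] c(2)[symmetric] using i s t by (simp add: S.m_assoc)
    then show "\<exists>c\<in>{..<n} \<rightarrow> carrier R. h (s \<otimes> t) \<otimes>\<^bsub>S\<^esub> x [^]\<^bsub>S\<^esub> i = comb c"
      using c s by (intro bexI[of _ "\<lambda>i. s \<otimes> c i"]) auto
  qed (use span in \<open>auto simp: comb_def\<close>)
  then obtain t' where t': "t' \<in> T"
    and ex: "\<forall>i\<in>{..<n}. \<exists>d. d \<in> {..<n} \<rightarrow> carrier R \<and> h t' \<otimes>\<^bsub>S\<^esub> x [^]\<^bsub>S\<^esub> i = comb d" by blast
  from bchoice[OF ex] obtain k where
    k: "\<forall>i\<in>{..<n}. k i \<in> {..<n} \<rightarrow> carrier R \<and> h t' \<otimes>\<^bsub>S\<^esub> x [^]\<^bsub>S\<^esub> i = comb (k i)" by blast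
  have kc: "k i j \<in> carrier R" if "i < n" "j < n" for i j using k that by blast
  have lin_comb: "h t' \<otimes>\<^bsub>S\<^esub> lin n d = comb (\<lambda>l. \<Oplus>i\<in>{..<n}. d i \<otimes> k i l)"
    if d: "\<And>i. i < n \<Longrightarrow> d i \<in> carrier R" for d
  proof -
    have "h t' \<otimes>\<^bsub>S\<^esub> lin n d = (\<Oplus>\<^bsub>S\<^esub>i\<in>{..<n}. h t' \<otimes>\<^bsub>S\<^esub> (h (d i) \<otimes>\<^bsub>S\<^esub> x [^]\<^bsub>S\<^esub> i))"
      unfolding lincomb_def by (rule S.finsum_rdistr) (use d t' in auto)
    also have "\<dots> = (\<Oplus>\<^bsub>S\<^esub>i\<in>{..<n}. \<Oplus>\<^bsub>S\<^esub>l\<in>{..<n}. h (d i \<otimes> k i l) \<otimes>\<^bsub>S\<^esub> q l)"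
    proof (rule S.finsum_cong')
      fix i assume i: "i \<in> {..<n}"
      have "h t' \<otimes>\<^bsub>S\<^esub> (h (d i) \<otimes>\<^bsub>S\<^esub> x [^]\<^bsub>S\<^esub> i) = h (d i) \<otimes>\<^bsub>S\<^esub> (h t' \<otimes>\<^bsub>S\<^esub> x [^]\<^bsub>S\<^esub> i)"
        using d i t' by (intro S.m_lcomm) auto
      also have "\<dots> = comb (\<lambda>l. d i \<otimes> k i l)"
        using comb_smult[of "k i" "d i"] k i d by auto
      finally show "h t' \<otimes>\<^bsub>S\<^esub> (h (d i) \<otimes>\<^bsub>S\<^esub> x [^]\<^bsub>S\<^esub> i) = (\<Oplus>\<^bsub>S\<^esub>l\<in>{..<n}. h (d i \<otimes> k i l) \<otimes>\<^bsub>S\<^esub> q l)"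
        by (simp add: comb_def)
    qed (use d kc q in \<open>auto intro!: S.finsum_closed\<close>)
    also have "\<dots> = (\<Oplus>\<^bsub>S\<^esub>l\<in>{..<n}. \<Oplus>\<^bsub>S\<^esub>i\<in>{..<n}. h (d i \<otimes> k i l) \<otimes>\<^bsub>S\<^esub> q l)"
      by (rule S.finsum_swap) (use d kc q in auto)
    also have "\<dots> = comb (\<lambda>l. \<Oplus>i\<in>{..<n}. d i \<otimes> k i l)"
      unfolding comb_def
    proof (rule S.finsum_cong')
      fix l assume l: "l \<in> {..<n}"
      have "h (\<Oplus>i\<in>{..<n}. d i \<otimes> k i l) = (\<Oplus>\<^bsub>S\<^esub>i\<in>{..<n}. h (d i \<otimes> k i l))"
        by (subst hom_finsum) (use d kc l in \<open>auto simp: comp_def\<close>)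
      also have "\<dots> \<otimes>\<^bsub>S\<^esub> q l = (\<Oplus>\<^bsub>S\<^esub>i\<in>{..<n}. h (d i \<otimes> k i l) \<otimes>\<^bsub>S\<^esub> q l)"
        by (rule S.finsum_ldistr) (use d kc q l in auto)
      finally show "(\<Oplus>\<^bsub>S\<^esub>i\<in>{..<n}. h (d i \<otimes> k i l) \<otimes>\<^bsub>S\<^esub> q l) = h (\<Oplus>i\<in>{..<n}. d i \<otimes> k i l) \<otimes>\<^bsub>S\<^esub> q l"
        by simp
    qed (use d kc q in \<open>auto intro!: R.finsum_closed\<close>)
    finally show ?thesis .
  qed
  have comb_diff: "comb (\<lambda>l. c l \<oplus> (\<ominus> d l)) = comb c \<ominus>\<^bsub>S\<^esub> comb d"
    if c: "\<And>i. i < n \<Longrightarrow> c i \<in> carrier R" and d: "\<And>i. i < n \<Longrightarrow> d i \<in> carrier R" for c d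
  proof -
    have "comb (\<lambda>l. c l \<oplus> (\<ominus> d l)) = (\<Oplus>\<^bsub>S\<^esub>i\<in>{..<n}. h (c i) \<otimes>\<^bsub>S\<^esub> q i \<oplus>\<^bsub>S\<^esub> \<ominus>\<^bsub>S\<^esub> (h (d i) \<otimes>\<^bsub>S\<^esub> q i))"
      unfolding comb_def by (rule S.finsum_cong') (use c d q in \<open>auto simp: S.l_distr S.l_minus\<close>)
    also have "\<dots> = comb c \<oplus>\<^bsub>S\<^esub> (\<Oplus>\<^bsub>S\<^esub>i\<in>{..<n}. \<ominus>\<^bsub>S\<^esub> (h (d i) \<otimes>\<^bsub>S\<^esub> q i))"
      unfolding comb_def by (rule S.finsum_addf) (use c d q in auto)
    also have "(\<Oplus>\<^bsub>S\<^esub>i\<in>{..<n}. \<ominus>\<^bsub>S\<^esub> (h (d i) \<otimes>\<^bsub>S\<^esub> q i)) = \<ominus>\<^bsub>S\<^esub> comb d"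
      unfolding comb_def by (rule S.finsum_minus) (use d q in auto)
    finally show ?thesis by (simp add: S.minus_eq)
  qed
  let ?pk = "\<lambda>j l. \<Oplus>i\<in>{..<n}. p j i \<otimes> k i l"
  let ?dl = "\<lambda>j l. if j = l then t' \<otimes> t else \<zero>"
  have pkc: "?pk j l \<in> carrier R" if "j < n" "l < n" for j l
    using that pc kc by (intro R.finsum_closed) auto
  have dlc: "?dl j l \<in> carrier R" for j l using t t' by auto
  \<comment> \<open>Both \<open>p k\<close> and the scalar matrix describe \<open>t' t q_j\<close>;
    a single \<open>u\<close> kills the torsion in all entries of their difference.\<close>
  have "\<exists>u\<in>T. \<forall>j\<in>{..<n}. \<forall>l<n. u \<otimes> (?pk j l \<oplus> (\<ominus> ?dl j l)) = \<zero>"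
  proof (rule R.common_multiple[OF T])
    fix j assume j: "j \<in> {..<n}"
    have "h t' \<otimes>\<^bsub>S\<^esub> (h t \<otimes>\<^bsub>S\<^esub> q j) = comb (?pk j)"
      using lin_comb[of "p j"] p pc j by auto
    moreover have "h t' \<otimes>\<^bsub>S\<^esub> (h t \<otimes>\<^bsub>S\<^esub> q j) = comb (?dl j)"
    proof -
      have "comb (?dl j) = h (?dl j j) \<otimes>\<^bsub>S\<^esub> q j"
        unfolding comb_def by (rule S.finsum_single) (use j q t t' in auto)
      then show ?thesis using j q t t' by (simp add: S.m_assoc)
    qed
    ultimately have pd: "comb (?pk j) = comb (?dl j)" by simp
    have cdl: "comb (?dl j) \<in> carrier S" by (intro comb_closed Pi_I dlc)
    have "comb (\<lambda>l. ?pk j l \<oplus> (\<ominus> ?dl j l)) = comb (?pk j) \<ominus>\<^bsub>S\<^esub> comb (?dl j)"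
      by (rule comb_diff) (rule pkc, use j in simp, assumption, rule dlc)
    then have "comb (\<lambda>l. ?pk j l \<oplus> (\<ominus> ?dl j l)) = \<zero>\<^bsub>S\<^esub>"
      unfolding pd using cdl by (simp only: S.minus_eq S.r_neg)
    then show "\<exists>u\<in>T. \<forall>l<n. u \<otimes> (?pk j l \<oplus> (\<ominus> ?dl j l)) = \<zero>"
      unfolding comb_def
    proof (rule indep[rotated])
      show "(\<lambda>l. ?pk j l \<oplus> (\<ominus> ?dl j l)) \<in> {..<n} \<rightarrow> carrier R"
        by (intro Pi_I R.a_closed R.a_inv_closed pkc dlc) (use j in auto)
    qed
  next
    fix j s u assume "j \<in> {..<n}" "\<forall>l<n. u \<otimes> (?pk j l \<oplus> (\<ominus> ?dl j l)) = \<zero>" "u \<in> T" "s \<in> carrier R"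
    then show "\<forall>l<n. s \<otimes> u \<otimes> (?pk j l \<oplus> (\<ominus> ?dl j l)) = \<zero>"
    proof (intro allI impI)
      fix l assume l: "l < n"
      let ?y = "?pk j l \<oplus> (\<ominus> ?dl j l)"
      have "?y \<in> carrier R"
        by (intro R.a_closed R.a_inv_closed pkc dlc l) (use \<open>j \<in> {..<n}\<close> in simp)
      then have "s \<otimes> u \<otimes> ?y = s \<otimes> (u \<otimes> ?y)" using \<open>u \<in> T\<close> \<open>s \<in> carrier R\<close> by (intro R.m_assoc) auto
      also have "u \<otimes> ?y = \<zero>" using \<open>\<forall>l<n. _\<close> l by blast
      finally show "s \<otimes> u \<otimes> ?y = \<zero>" using \<open>s \<in> carrier R\<close> by simp
    qed
  qed simp
  then obtain u where u: "u \<in> T" and uz: "\<And>j l. \<lbrakk>j < n; l < n\<rbrakk> \<Longrightarrow> u \<otimes> (?pk j l \<oplus> (\<ominus> ?dl j l)) = \<zero>"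
    by blast
  have upk: "?pk j l \<otimes> u = (if j = l then u \<otimes> (t' \<otimes> t) else \<zero>)" if "j < n" "l < n" for j l
  proof -
    have "u \<otimes> ?pk j l \<oplus> \<ominus> (u \<otimes> ?dl j l) = \<zero>"
      using uz[OF that] pkc[OF that] dlc[of j l] u by (simp add: R.r_distr R.r_minus)
    then have "u \<otimes> ?pk j l = \<ominus> (\<ominus> (u \<otimes> ?dl j l))"
      by (rule R.sum_zero_eq_neg[rotated 2]) (intro R.m_closed R.a_inv_closed pkc[OF that] dlc Tc u)+
    also have "\<dots> = u \<otimes> ?dl j l"
      by (rule R.minus_minus) (intro R.m_closed dlc Tc u)
    finally have "u \<otimes> ?pk j l = u \<otimes> ?dl j l" .
    then show ?thesis using pkc[OF that] u t t' by (auto simp: R.m_comm)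
  qed
  have detk: "mdet R n k \<in> carrier R" "mdet R n p \<in> carrier R" using kc pc by (auto intro!: R.mdet_closed)
  \<comment> \<open>The determinant of \<open>u p k\<close>, a diagonal matrix with entries
    \<open>u t' t\<close>. So \<open>\<tau>\<close> lies in \<open>T\<close>, and by construction it
    is a multiple of the determinant of \<open>k\<close>.\<close>
  define \<tau> where "\<tau> = (\<Otimes>i\<in>{..<n}. u) \<otimes> mdet R n p \<otimes> mdet R n k"
  have "(\<Otimes>i\<in>{..<n}. u) \<in> carrier R" using u by (intro R.finprod_closed) auto
  then have "\<tau> = mdet R n ?pk \<otimes> (\<Otimes>i\<in>{..<n}. u)"
    using R.mdet_mult[of n p k] pc kc detk unfolding \<tau>_def by (simp add: R.m_ac)
  also have "\<dots> = mdet R n (\<lambda>j l. ?pk j l \<otimes> u)"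
    by (rule R.mdet_scale_columns[symmetric]) (use pkc u in auto)
  also have "\<dots> = mdet R n (\<lambda>j l. if j = l then u \<otimes> (t' \<otimes> t) else \<zero>)"
    by (rule R.mdet_cong) (use upk u t t' in auto)
  also have "\<dots> = (\<Otimes>i\<in>{..<n}. u \<otimes> (t' \<otimes> t))"
    by (rule R.mdet_diag) (use u t t' in auto)
  also have "\<dots> \<in> T" by (rule R.T_prod_closed[OF T]) (use u t t' in auto)
  finally have tauT: "\<tau> \<in> T" .
  have "comb (\<lambda>l. \<Oplus>i\<in>{..<n}. c i \<otimes> k i l) = \<zero>\<^bsub>S\<^esub>"
    using lin_comb[of c] z ci t' by simp
  then obtain v where v: "v \<in> T" and vz: "\<And>l. l < n \<Longrightarrow> v \<otimes> (\<Oplus>i\<in>{..<n}. c i \<otimes> k i l) = \<zero>"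
    using indep[of "\<lambda>l. \<Oplus>i\<in>{..<n}. c i \<otimes> k i l"] ci kc unfolding comb_def
    by (auto intro!: R.finsum_closed)
  have "v \<otimes> \<tau> \<otimes> c i = \<zero>" if i: "i < n" for i
  proof -
    \<comment> \<open>The row of the \<open>v c_i\<close> is killed by the matrix \<open>k\<close>,
      hence each entry by its determinant and by the multiple \<open>\<tau>\<close> of it.\<close>
    have "(v \<otimes> c i) \<otimes> mdet R n k = mdet R n (k(i := \<lambda>j. \<zero>))"
    proof (rule R.cramer[OF kc i])
      fix l assume l: "l < n"
      have "(\<Oplus>j\<in>{..<n}. v \<otimes> c j \<otimes> k j l) = (\<Oplus>j\<in>{..<n}. v \<otimes> (c j \<otimes> k j l))"
        by (rule R.finsum_cong') (use ci kc l v in \<open>auto simp: R.m_assoc\<close>)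
      also have "\<dots> = v \<otimes> (\<Oplus>i\<in>{..<n}. c i \<otimes> k i l)"
        by (rule R.finsum_rdistr[symmetric]) (use ci kc l v in auto)
      finally show "\<zero> = (\<Oplus>j\<in>{..<n}. v \<otimes> c j \<otimes> k j l)" using vz[OF l] by simp
    qed (use ci v in auto)
    also have "\<dots> = mdet R n (k(i := \<lambda>j. \<zero> \<otimes> \<zero>))" by simp
    also have "\<dots> = \<zero> \<otimes> mdet R n (k(i := \<lambda>j. \<zero>))"
      by (rule R.mdet_row_smult[OF kc i]) auto
    also have "\<dots> = \<zero>" using kc i by (intro R.l_null R.mdet_closed) auto
    finally have z: "(v \<otimes> c i) \<otimes> mdet R n k = \<zero>" .
    have "v \<otimes> \<tau> \<otimes> c i = (\<Otimes>i\<in>{..<n}. u) \<otimes> mdet R n p \<otimes> ((v \<otimes> c i) \<otimes> mdet R n k)"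
      unfolding \<tau>_def using \<open>(\<Otimes>i\<in>{..<n}. u) \<in> carrier R\<close> detk v ci[OF i] by (simp add: R.m_ac)
    then show ?thesis unfolding z using \<open>(\<Otimes>i\<in>{..<n}. u) \<in> carrier R\<close> detk by simp
  qed
  then show "\<exists>t\<in>T. \<forall>i<n. t \<otimes> c i = \<zero>" using v tauT by (intro bexI[of _ "v \<otimes> \<tau>"]) auto
qed

text \<open>The \<open>b\<close> with \<open>b y\<close> in the span, and the \<open>b\<close> that
  annihilate all \<open>c i\<close>, form two ideals. Each prime misses some \<open>f\<close> of
  which a power lies in them, so both contain \<open>1\<close>.\<close>

lemma power_basis_from_local:
  assumes loc: "\<And>P. primeideal P R \<Longrightarrow> \<exists>f\<in>carrier R - P.
      (\<forall>y\<in>carrier S. \<exists>t\<in>range (\<lambda>k::nat. f [^] k). \<exists>c\<in>{..<n} \<rightarrow> carrier R. h t \<otimes>\<^bsub>S\<^esub> y = lin n c) \<and>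
      (\<forall>c\<in>{..<n} \<rightarrow> carrier R. lin n c = \<zero>\<^bsub>S\<^esub> \<longrightarrow> (\<exists>t\<in>range (\<lambda>k::nat. f [^] k). \<forall>i<n. t \<otimes> c i = \<zero>))"
  shows "power_basis R S h x n"
  unfolding power_basis_def
proof (intro conjI ballI impI)
  fix y assume y: "y \<in> carrier S"
  let ?J = "{b \<in> carrier R. \<exists>c\<in>{..<n} \<rightarrow> carrier R. h b \<otimes>\<^bsub>S\<^esub> y = lin n c}"
  have mul: "b \<otimes> a \<in> ?J" if a: "a \<in> ?J" and b: "b \<in> carrier R" for a b
  proof -
    obtain c where ac: "a \<in> carrier R" and c: "c \<in> {..<n} \<rightarrow> carrier R" "h a \<otimes>\<^bsub>S\<^esub> y = lin n c" using a by blast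
    have "h (b \<otimes> a) \<otimes>\<^bsub>S\<^esub> y = h b \<otimes>\<^bsub>S\<^esub> lin n c" unfolding c(2)[symmetric] using ac b y by (simp add: S.m_assoc)
    also have "\<dots> = lin n (\<lambda>i. b \<otimes> c i)" by (rule lin_smult[symmetric]) (use b c in auto)
    finally show ?thesis using ac b c by auto
  qed
  have "ideal ?J R"
  proof (rule idealI)
    show "subgroup ?J (add_monoid R)"
    proof (rule R.add.subgroupI)
      show "?J \<noteq> {}" using y by (auto intro!: exI[of _ \<zero>] bexI[of _ "\<lambda>i. \<zero>"] simp: lin_zero)
      fix a assume a: "a \<in> ?J"
      show "\<ominus> a \<in> ?J" using mul[OF a, of "\<ominus> \<one>"] a by (simp add: R.l_minus)
      fix b assume b: "b \<in> ?J"
      obtain c where ac: "a \<in> carrier R" and c: "c \<in> {..<n} \<rightarrow> carrier R" "h a \<otimes>\<^bsub>S\<^esub> y = lin n c" using a by blast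
      obtain d where bc: "b \<in> carrier R" and d: "d \<in> {..<n} \<rightarrow> carrier R" "h b \<otimes>\<^bsub>S\<^esub> y = lin n d" using b by blast
      have "h (a \<oplus> b) \<otimes>\<^bsub>S\<^esub> y = lin n c \<oplus>\<^bsub>S\<^esub> lin n d"
        unfolding c(2)[symmetric] d(2)[symmetric] using ac bc y by (simp add: S.l_distr)
      also have "\<dots> = lin n (\<lambda>i. c i \<oplus> d i)" by (rule lin_add[symmetric]) (use c d in auto)
      finally have "h (a \<oplus> b) \<otimes>\<^bsub>S\<^esub> y = lin n (\<lambda>i. c i \<oplus> d i)" .
      moreover have "(\<lambda>i. c i \<oplus> d i) \<in> {..<n} \<rightarrow> carrier R" using c d by auto
      ultimately show "a \<oplus> b \<in> ?J" using ac bc by blast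
    qed auto
    fix a b assume a: "a \<in> ?J" and b: "b \<in> carrier R"
    show "b \<otimes> a \<in> ?J" by (rule mul[OF a b])
    show "a \<otimes> b \<in> ?J" using mul[OF a b] a b by (simp add: R.m_comm[of a b])
  qed (rule R.ring_axioms)
  then have "\<one> \<in> ?J"
  proof (rule R.ideal_local_eq_carrier)
    fix P assume "primeideal P R"
    from loc[OF this] y show "\<exists>f\<in>carrier R - P. \<exists>k::nat. f [^] k \<in> ?J"
      by (smt (verit, ccfv_threshold) DiffD1 R.nat_pow_closed mem_Collect_eq rangeE)
  qed
  then show "\<exists>c\<in>{..<n} \<rightarrow> carrier R. y = lin n c" using y by simp
next
  fix c assume c: "c \<in> {..<n} \<rightarrow> carrier R" and z: "lin n c = \<zero>\<^bsub>S\<^esub>"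
  have ci: "c i \<in> carrier R" if "i < n" for i using c that by auto
  let ?J = "{b \<in> carrier R. \<forall>i<n. b \<otimes> c i = \<zero>}"
  have "ideal ?J R"
  proof (rule idealI)
    show "subgroup ?J (add_monoid R)"
      by (rule R.add.subgroupI) (use ci in \<open>auto simp: R.l_distr R.l_minus simp flip: a_inv_def intro: exI[of _ \<zero>]\<close>)
    fix a b assume a: "a \<in> ?J" and b: "b \<in> carrier R"
    show *: "b \<otimes> a \<in> ?J" using a b ci by (auto simp: R.m_assoc)
    show "a \<otimes> b \<in> ?J" using * a b by (simp add: R.m_comm[of a b])
  qed (rule R.ring_axioms)
  then have "\<one> \<in> ?J"
  proof (rule R.ideal_local_eq_carrier)
    fix P assume "primeideal P R"
    from loc[OF this] obtain f where f: "f \<in> carrier R - P"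
      and "\<exists>t\<in>range (\<lambda>k::nat. f [^] k). \<forall>i<n. t \<otimes> c i = \<zero>" using c z by blast
    then obtain k :: nat where "\<forall>i<n. f [^] k \<otimes> c i = \<zero>" by blast
    then show "\<exists>f\<in>carrier R - P. \<exists>k::nat. f [^] k \<in> ?J" using f by auto
  qed
  then show "\<forall>i<n. c i = \<zero>" using ci by simp
qed

end

section \<open>Monogenic extensions\<close>

lemma ring_hom_cringI':
  assumes "cring R" "cring S" "h \<in> ring_hom R S" shows "ring_hom_cring R S h"
  using assms by (simp add: ring_hom_cring_def ring_hom_cring_axioms_def)

lemma ring_hom_cring_compose:
  assumes "ring_hom_cring R S f" "ring_hom_cring S T g"
  shows "ring_hom_cring R T (\<lambda>x. g (f x))"
proof -
  interpret f: ring_hom_cring R S f by fact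
  interpret g: ring_hom_cring S T g by fact
  show ?thesis by (rule ring_hom_cringI') (auto intro!: f.R.is_cring g.S.is_cring ring_hom_memI)
qed

lemma (in cring) quot_lift:
  assumes I: "ideal I R" and \<phi>: "ring_hom_cring R C \<phi>" and z: "\<And>i. i \<in> I \<Longrightarrow> \<phi> i = \<zero>\<^bsub>C\<^esub>"
  shows "\<exists>g. ring_hom_cring (R Quot I) C g \<and> (\<forall>r\<in>carrier R. g (I +> r) = \<phi> r)"
proof -
  have surj: "\<exists>r\<in>carrier R. Z = I +> r" if "Z \<in> carrier (R Quot I)" for Z
    using that by (auto simp: FactRing_def A_RCOSETS_def')
  interpret I: ideal I R by fact
  interpret \<phi>: ring_hom_cring R C \<phi> by fact
  have Qc: "cring (R Quot I)" by (rule I.quotient_is_cring) (rule is_cring)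
  define g where "g = (\<lambda>Z. SOME c. \<exists>r\<in>carrier R. Z = I +> r \<and> c = \<phi> r)"
  have g: "g (I +> r) = \<phi> r" if r: "r \<in> carrier R" for r
  proof -
    have "\<exists>c. \<exists>r'\<in>carrier R. I +> r = I +> r' \<and> c = \<phi> r'" using r by blast
    from someI_ex[OF this] obtain r' where r': "r' \<in> carrier R" "I +> r = I +> r'" "g (I +> r) = \<phi> r'"
      unfolding g_def by blast
    then have "r' \<ominus> r \<in> I" using quotient_eq_iff_same_a_r_cos[OF I r'(1) r] by simp
    then have "\<phi> (r' \<ominus> r) = \<zero>\<^bsub>C\<^esub>" by (rule z)
    then have "\<phi> r' \<ominus>\<^bsub>C\<^esub> \<phi> r = \<zero>\<^bsub>C\<^esub>" using r r'(1) by (simp add: minus_eq \<phi>.S.minus_eq)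
    then show ?thesis using r r' by (simp add: \<phi>.S.r_right_minus_eq)
  qed
  have "ring_hom_cring (R Quot I) C g"
  proof (rule ring_hom_cringI'[OF Qc \<phi>.S.is_cring], rule ring_hom_memI)
    fix Z assume "Z \<in> carrier (R Quot I)"
    then obtain r where r: "r \<in> carrier R" "Z = I +> r" using surj by blast
    then show "g Z \<in> carrier C" by (simp add: g)
    fix Y assume "Y \<in> carrier (R Quot I)"
    then obtain s where s: "s \<in> carrier R" "Y = I +> s" using surj by blast
    show "g (Z \<otimes>\<^bsub>R Quot I\<^esub> Y) = g Z \<otimes>\<^bsub>C\<^esub> g Y"
    proof -
      have "Z \<otimes>\<^bsub>R Quot I\<^esub> Y = I +> (r \<otimes> s)"
        unfolding r(2) s(2) by (rule ring_hom_mult[OF I.rcos_ring_hom r(1) s(1), symmetric])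
      then show ?thesis using r s by (simp add: g)
    qed
    show "g (Z \<oplus>\<^bsub>R Quot I\<^esub> Y) = g Z \<oplus>\<^bsub>C\<^esub> g Y"
    proof -
      have "Z \<oplus>\<^bsub>R Quot I\<^esub> Y = I +> (r \<oplus> s)"
        unfolding r(2) s(2) by (rule ring_hom_add[OF I.rcos_ring_hom r(1) s(1), symmetric])
      then show ?thesis using r s by (simp add: g)
    qed
  next
    show "g \<one>\<^bsub>R Quot I\<^esub> = \<one>\<^bsub>C\<^esub>" using ring_hom_one[OF I.rcos_ring_hom] g[OF one_closed] by simp
  qed
  with g show ?thesis by blast
qed

section \<open>Reduction by a monic relation and multiplication matrices\<close>

context pring
begin

lemma reduce_pow:
  assumes a: "\<And>i. i < n \<Longrightarrow> a i \<in> carrier R" and xn: "x [^]\<^bsub>S\<^esub> n = lin n a"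
  shows "\<exists>c\<in>{..<n} \<rightarrow> carrier R. x [^]\<^bsub>S\<^esub> (k::nat) = lin n c"
proof (induction k)
  case 0
  show ?case
  proof (cases n)
    \<comment> \<open>For \<open>n = 0\<close> the relation itself is an expression for
      \<open>x^0\<close>.\<close>
    case 0 then show ?thesis using xn a by auto
  next
    case (Suc m)
    then show ?thesis using lin_single[of 0 n \<one>] by (intro bexI[of _ "\<lambda>i. if i = 0 then \<one> else \<zero>"]) auto
  qed
next
  case (Suc k)
  then obtain c where "c \<in> {..<n} \<rightarrow> carrier R" and eq: "x [^]\<^bsub>S\<^esub> k = lin n c" by blast
  then have c: "c i \<in> carrier R" if "i < n" for i using that by auto
  \<comment> \<open>\<open>d i\<close> holds the coordinates of \<open>x^(i+1)\<close>: the relation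
    \<open>a\<close> for \<open>i = n - 1\<close>, a unit vector otherwise.\<close>
  define d where "d = (\<lambda>i. if Suc i = n then a else (\<lambda>l. if l = Suc i then \<one> else \<zero>))"
  have d: "d i l \<in> carrier R" if "l < n" for i l using a that by (auto simp: d_def)
  have xd: "x [^]\<^bsub>S\<^esub> Suc i = lin n (d i)" if "i < n" for i
    using that xn lin_single[of "Suc i" n \<one>] by (auto simp: d_def)
  have "x [^]\<^bsub>S\<^esub> Suc k = lin n c \<otimes>\<^bsub>S\<^esub> x" using eq by simp
  also have "\<dots> = (\<Oplus>\<^bsub>S\<^esub>i\<in>{..<n}. h (c i) \<otimes>\<^bsub>S\<^esub> x [^]\<^bsub>S\<^esub> i \<otimes>\<^bsub>S\<^esub> x)"
    unfolding lincomb_def by (rule S.finsum_ldistr) (use c in auto)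
  also have "\<dots> = (\<Oplus>\<^bsub>S\<^esub>i\<in>{..<n}. lin n (\<lambda>l. c i \<otimes> d i l))"
  proof (rule S.finsum_cong')
    fix i assume i: "i \<in> {..<n}"
    have "h (c i) \<otimes>\<^bsub>S\<^esub> x [^]\<^bsub>S\<^esub> i \<otimes>\<^bsub>S\<^esub> x = h (c i) \<otimes>\<^bsub>S\<^esub> x [^]\<^bsub>S\<^esub> Suc i"
      using c i by (simp add: S.m_assoc)
    also have "\<dots> = lin n (\<lambda>l. c i \<otimes> d i l)"
      using xd c d i by (simp add: lin_smult)
    finally show "h (c i) \<otimes>\<^bsub>S\<^esub> x [^]\<^bsub>S\<^esub> i \<otimes>\<^bsub>S\<^esub> x = lin n (\<lambda>l. c i \<otimes> d i l)" .
  qed (use c d in auto)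
  also have "\<dots> = lin n (\<lambda>l. \<Oplus>i\<in>{..<n}. c i \<otimes> d i l)"
    by (rule lin_finsum[symmetric]) (use c d in auto)
  finally show ?case
    using c d by (intro bexI[of _ "\<lambda>l. \<Oplus>i\<in>{..<n}. c i \<otimes> d i l"]) (auto intro!: R.finsum_closed)
qed

text \<open>Division with remainder by a monic polynomial, carried out on values: each power is
  reduced separately and the coordinates are added.\<close>

lemma reduce_ev:
  assumes a: "\<And>i. i < n \<Longrightarrow> a i \<in> carrier R" and xn: "x [^]\<^bsub>S\<^esub> n = lin n a"
    and p: "p \<in> carrier (UP R)"
  shows "\<exists>c\<in>{..<n} \<rightarrow> carrier R. ev p = lin n c"
proof -
  let ?c = "up_ring.coeff (UP R) p"
  have "\<forall>k. \<exists>d. d \<in> {..<n} \<rightarrow> carrier R \<and> x [^]\<^bsub>S\<^esub> (k::nat) = lin n d"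
    using reduce_pow[OF a xn] by blast
  from choice[OF this] obtain d where
    dd: "\<And>k. d k \<in> {..<n} \<rightarrow> carrier R" and xd: "\<And>k. x [^]\<^bsub>S\<^esub> (k::nat) = lin n (d k)" by blast
  have d: "d k i \<in> carrier R" if "i < n" for i k using dd[of k] that by auto
  have "ev p = lin (Suc (deg R p)) ?c" by (rule ev_bound) (use p in auto)
  also have "\<dots> = (\<Oplus>\<^bsub>S\<^esub>i\<in>{..<Suc (deg R p)}. lin n (\<lambda>l. ?c i \<otimes> d i l))"
    unfolding lincomb_def[of S h x "Suc _"]
    by (rule S.finsum_cong') (use p d xd in \<open>auto simp: lin_smult\<close>)
  also have "\<dots> = lin n (\<lambda>l. \<Oplus>i\<in>{..<Suc (deg R p)}. ?c i \<otimes> d i l)"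
    by (rule lin_finsum[symmetric]) (use p d in auto)
  finally show ?thesis
    using p d by (intro bexI[of _ "\<lambda>l. \<Oplus>i\<in>{..<Suc (deg R p)}. ?c i \<otimes> d i l"]) (auto intro!: R.finsum_closed)
qed

lemma mult_matrix_exists:
  assumes "power_basis R S h x n" "y \<in> carrier S"
  obtains K where "\<And>l j. \<lbrakk>l < n; j < n\<rbrakk> \<Longrightarrow> K l j \<in> carrier R"
    "\<And>j. j < n \<Longrightarrow> y \<otimes>\<^bsub>S\<^esub> x [^]\<^bsub>S\<^esub> j = lin n (\<lambda>l. K l j)"
proof -
  have "\<forall>j. \<exists>c. c \<in> {..<n} \<rightarrow> carrier R \<and> y \<otimes>\<^bsub>S\<^esub> x [^]\<^bsub>S\<^esub> (j::nat) = lin n c"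
    using assms unfolding power_basis_def by (metis S.m_closed S.nat_pow_closed x_closed)
  from choice[OF this] obtain c where
    c: "\<forall>j. c j \<in> {..<n} \<rightarrow> carrier R \<and> y \<otimes>\<^bsub>S\<^esub> x [^]\<^bsub>S\<^esub> (j::nat) = lin n (c j)" by blast
  show ?thesis by (rule that[of "\<lambda>l j. c j l"]) (use c in auto)
qed

text \<open>Cramer's rule for row \<open>0\<close>, where the coefficient is \<open>x^0 = 1\<close>:
  the new row consists of the \<open>y x^j\<close>, so \<open>y\<close> comes out as a factor. Row
  \<open>0\<close> exists because \<open>0 < n\<close>.\<close>

lemma det_mult_matrix_dvd:
  assumes K: "\<And>l j. \<lbrakk>l < n; j < n\<rbrakk> \<Longrightarrow> K l j \<in> carrier R" and n: "0 < n" and y: "y \<in> carrier S"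
    and eq: "\<And>j. j < n \<Longrightarrow> y \<otimes>\<^bsub>S\<^esub> x [^]\<^bsub>S\<^esub> j = lin n (\<lambda>l. K l j)"
  shows "\<exists>z\<in>carrier S. h (mdet R n K) = y \<otimes>\<^bsub>S\<^esub> z"
proof -
  let ?M = "\<lambda>l j. h (K l j)"
  have M: "?M l j \<in> carrier S" if "l < n" "j < n" for l j using K that by auto
  have "x [^]\<^bsub>S\<^esub> (0::nat) \<otimes>\<^bsub>S\<^esub> mdet S n ?M = mdet S n (?M(0 := \<lambda>j. y \<otimes>\<^bsub>S\<^esub> x [^]\<^bsub>S\<^esub> j))"
  proof (rule S.cramer[OF M n])
    fix j assume j: "j < n"
    show "y \<otimes>\<^bsub>S\<^esub> x [^]\<^bsub>S\<^esub> j = (\<Oplus>\<^bsub>S\<^esub>l\<in>{..<n}. x [^]\<^bsub>S\<^esub> l \<otimes>\<^bsub>S\<^esub> ?M l j)"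
      unfolding eq[OF j] lincomb_def by (rule S.finsum_cong') (use K j in \<open>auto simp: S.m_comm\<close>)
  qed auto
  also have "\<dots> = y \<otimes>\<^bsub>S\<^esub> mdet S n (?M(0 := \<lambda>j. x [^]\<^bsub>S\<^esub> j))"
    by (rule S.mdet_row_smult[OF M n y]) auto
  finally have "mdet S n ?M = y \<otimes>\<^bsub>S\<^esub> mdet S n (?M(0 := \<lambda>j. x [^]\<^bsub>S\<^esub> j))"
    using M by (simp add: S.mdet_closed)
  moreover have "mdet S n (?M(0 := \<lambda>j. x [^]\<^bsub>S\<^esub> j)) \<in> carrier S"
    by (rule S.mdet_closed) (use M in auto)
  ultimately show ?thesis using hom_mdet[of n K] K by auto
qed

lemma power_basis_unique:
  assumes "power_basis R S h x n" "\<And>i. i < n \<Longrightarrow> c i \<in> carrier R" "\<And>i. i < n \<Longrightarrow> d i \<in> carrier R"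
    and "lin n c = lin n d" "i < n"
  shows "c i = d i"
proof -
  have "lin n (\<lambda>i. c i \<ominus> d i) = \<zero>\<^bsub>S\<^esub>" using assms(2,3,4) by (simp add: lin_diff S.minus_eq S.r_neg)
  then have "c i \<ominus> d i = \<zero>"
  proof -
    have "(\<lambda>i. c i \<ominus> d i) \<in> {..<n} \<rightarrow> carrier R" using assms(2,3) by auto
    then show ?thesis using assms(1,5) \<open>lin n (\<lambda>i. c i \<ominus> d i) = \<zero>\<^bsub>S\<^esub>\<close>
      unfolding power_basis_def by blast
  qed
  then show ?thesis using assms(2,3,5) by (simp add: R.r_right_minus_eq)
qed

lemma lin_matrix_compose:
  assumes K: "\<And>l j. \<lbrakk>l < n; j < n\<rbrakk> \<Longrightarrow> K l j \<in> carrier R" and L: "\<And>l j. \<lbrakk>l < n; j < n\<rbrakk> \<Longrightarrow> L l j \<in> carrier R"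
    and t: "t \<in> carrier S" "\<And>j. j < n \<Longrightarrow> t \<otimes>\<^bsub>S\<^esub> x [^]\<^bsub>S\<^esub> j = lin n (\<lambda>l. L l j)" and j: "j < n"
  shows "t \<otimes>\<^bsub>S\<^esub> lin n (\<lambda>l. K l j) = lin n (\<lambda>i. \<Oplus>l\<in>{..<n}. L i l \<otimes> K l j)"
proof -
  have "t \<otimes>\<^bsub>S\<^esub> lin n (\<lambda>l. K l j) = (\<Oplus>\<^bsub>S\<^esub>l\<in>{..<n}. t \<otimes>\<^bsub>S\<^esub> (h (K l j) \<otimes>\<^bsub>S\<^esub> x [^]\<^bsub>S\<^esub> l))"
    unfolding lincomb_def by (rule S.finsum_rdistr) (use K t j in auto)
  also have "\<dots> = (\<Oplus>\<^bsub>S\<^esub>l\<in>{..<n}. lin n (\<lambda>i. L i l \<otimes> K l j))"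
  proof (rule S.finsum_cong')
    fix l assume l: "l \<in> {..<n}"
    have "t \<otimes>\<^bsub>S\<^esub> (h (K l j) \<otimes>\<^bsub>S\<^esub> x [^]\<^bsub>S\<^esub> l) = h (K l j) \<otimes>\<^bsub>S\<^esub> lin n (\<lambda>i. L i l)"
    proof -
      have "K l j \<in> carrier R" using K l j by auto
      then have "t \<otimes>\<^bsub>S\<^esub> (h (K l j) \<otimes>\<^bsub>S\<^esub> x [^]\<^bsub>S\<^esub> l) = h (K l j) \<otimes>\<^bsub>S\<^esub> (t \<otimes>\<^bsub>S\<^esub> x [^]\<^bsub>S\<^esub> l)"
        using t(1) by (intro S.m_lcomm) auto
      then show ?thesis using t(2)[of l] l by simp
    qed
    also have "\<dots> = lin n (\<lambda>i. K l j \<otimes> L i l)" by (rule lin_smult[symmetric]) (use L K l j in auto)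
    also have "\<dots> = lin n (\<lambda>i. L i l \<otimes> K l j)" by (rule lin_cong) (use L K l j in \<open>auto simp: R.m_comm\<close>)
    finally show "t \<otimes>\<^bsub>S\<^esub> (h (K l j) \<otimes>\<^bsub>S\<^esub> x [^]\<^bsub>S\<^esub> l) = lin n (\<lambda>i. L i l \<otimes> K l j)" .
  qed (use L K j in auto)
  also have "\<dots> = lin n (\<lambda>i. \<Oplus>l\<in>{..<n}. L i l \<otimes> K l j)"
    by (rule lin_finsum[symmetric]) (use L K j in auto)
  finally show ?thesis .
qed

text \<open>Multiplication by the inverse of \<open>y\<close> has a matrix \<open>L\<close> as well,
  and by uniqueness of coordinates \<open>L K\<close> is the identity matrix.\<close>

lemma det_mult_matrix_unit:
  assumes pb: "power_basis R S h x n"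
    and K: "\<And>l j. \<lbrakk>l < n; j < n\<rbrakk> \<Longrightarrow> K l j \<in> carrier R" and y: "y \<in> Units S"
    and eq: "\<And>j. j < n \<Longrightarrow> y \<otimes>\<^bsub>S\<^esub> x [^]\<^bsub>S\<^esub> j = lin n (\<lambda>l. K l j)"
  shows "mdet R n K \<in> Units R"
proof -
  define t where "t = inv\<^bsub>S\<^esub> y"
  have tc: "t \<in> carrier S" and yc: "y \<in> carrier S" and ty: "t \<otimes>\<^bsub>S\<^esub> y = \<one>\<^bsub>S\<^esub>"
    unfolding t_def using y by auto
  obtain L where L: "\<And>l j. \<lbrakk>l < n; j < n\<rbrakk> \<Longrightarrow> L l j \<in> carrier R"
    and Leq: "\<And>j. j < n \<Longrightarrow> t \<otimes>\<^bsub>S\<^esub> x [^]\<^bsub>S\<^esub> j = lin n (\<lambda>l. L l j)"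
    using mult_matrix_exists[OF pb tc] by blast
  let ?LK = "\<lambda>i j. \<Oplus>l\<in>{..<n}. L i l \<otimes> K l j"
  have LKc: "?LK i j \<in> carrier R" if "i < n" "j < n" for i j using that L K by (auto intro!: R.finsum_closed)
  have LK: "?LK i j = (if i = j then \<one> else \<zero>)" if ij: "i < n" "j < n" for i j
  proof -
    have "lin n (\<lambda>i. ?LK i j) = t \<otimes>\<^bsub>S\<^esub> (y \<otimes>\<^bsub>S\<^esub> x [^]\<^bsub>S\<^esub> j)"
      unfolding eq[OF ij(2)] by (rule lin_matrix_compose[OF K L tc Leq ij(2), symmetric])
    also have "\<dots> = x [^]\<^bsub>S\<^esub> j" using tc yc ty by (simp add: S.m_assoc[symmetric])
    also have "\<dots> = lin n (\<lambda>i. if i = j then \<one> else \<zero>)" using lin_single[OF ij(2) R.one_closed] by simp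
    finally show ?thesis
      by (rule power_basis_unique[OF pb _ _ _ ij(1), rotated 2]) (use LKc ij in auto)
  qed
  have "mdet R n L \<otimes> mdet R n K = mdet R n ?LK" by (rule R.mdet_mult[symmetric]) (use L K in auto)
  also have "\<dots> = mdet R n (\<lambda>i j. if i = j then \<one> else \<zero>)" by (rule R.mdet_cong) (use LK in auto)
  also have "\<dots> = \<one>" by (subst R.mdet_diag) auto
  finally have "mdet R n L \<otimes> mdet R n K = \<one>" .
  moreover have "mdet R n L \<in> carrier R" "mdet R n K \<in> carrier R" using L K by (auto intro!: R.mdet_closed)
  ultimately show ?thesis unfolding Units_def
    using R.m_comm[of "mdet R n L" "mdet R n K"] by auto
qed

end

text \<open>The assumption \<open>eq\<close> says that \<open>(1, z_l, z_l^2, ...)\<close> is a left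
  eigenvector of \<open>M\<close> with eigenvalue \<open>s l\<close>. Collecting these rows gives
  \<open>V M = diag(s) V\<close>, and determinants are taken; cancelling \<open>det V\<close> is
  left to the application.\<close>

lemma (in cring) vandermonde_intertwine:
  assumes M: "\<And>i j. \<lbrakk>i < n; j < n\<rbrakk> \<Longrightarrow> M i j \<in> carrier R"
    and z: "\<And>l. l < n \<Longrightarrow> z l \<in> carrier R" and s: "\<And>l. l < n \<Longrightarrow> s l \<in> carrier R"
    and eq: "\<And>l j. \<lbrakk>l < n; j < n\<rbrakk> \<Longrightarrow> s l \<otimes> z l [^] j = (\<Oplus>i\<in>{..<n}. M i j \<otimes> z l [^] i)"
  shows "mdet R n (\<lambda>l j. z l [^] j) \<otimes> mdet R n M = (\<Otimes>l\<in>{..<n}. s l) \<otimes> mdet R n (\<lambda>l j. z l [^] j)"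
proof -
  let ?V = "\<lambda>l j. z l [^] (j::nat)"
  have V: "?V l j \<in> carrier R" if "l < n" "j < n" for l j using z that by auto
  have "mdet R n ?V \<otimes> mdet R n M = mdet R n (\<lambda>l j. \<Oplus>i\<in>{..<n}. ?V l i \<otimes> M i j)"
    by (rule mdet_mult[symmetric]) (use V M in auto)
  also have "\<dots> = mdet R n (\<lambda>l j. \<Oplus>i\<in>{..<n}. (if l = i then s l else \<zero>) \<otimes> ?V i j)"
  proof (rule mdet_cong)
    fix l j assume lj: "l < n" "j < n"
    have "(\<Oplus>i\<in>{..<n}. ?V l i \<otimes> M i j) = (\<Oplus>i\<in>{..<n}. M i j \<otimes> z l [^] i)"
      by (rule finsum_cong') (use lj z M in \<open>auto simp: m_comm\<close>)
    also have "\<dots> = s l \<otimes> ?V l j" using eq lj by simp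
    also have "\<dots> = (\<Oplus>i\<in>{..<n}. (if l = i then s l else \<zero>) \<otimes> ?V i j)"
      by (subst finsum_single[of _ l]) (use lj z s in auto)
    finally show "(\<Oplus>i\<in>{..<n}. ?V l i \<otimes> M i j) = (\<Oplus>i\<in>{..<n}. (if l = i then s l else \<zero>) \<otimes> ?V i j)" .
  qed (use z s in \<open>auto intro!: finsum_closed\<close>)
  also have "\<dots> = mdet R n (\<lambda>l i. if l = i then s l else \<zero>) \<otimes> mdet R n ?V"
    by (rule mdet_mult) (use V s in auto)
  finally show ?thesis using mdet_diag[OF s] by simp
qed

section \<open>Monic polynomials\<close>

context UP_cring
begin

definition lowpoly :: "nat \<Rightarrow> (nat \<Rightarrow> 'a) \<Rightarrow> (nat \<Rightarrow> 'a)"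
  where "lowpoly n c = (\<Oplus>\<^bsub>P\<^esub>i\<in>{..<n}. up_ring.monom P (c i) i)"

text \<open>The lower coefficients are subtracted, so that in the quotient the relation reads
  \<open>x^n = lin n a\<close>.\<close>

definition monicpoly :: "nat \<Rightarrow> (nat \<Rightarrow> 'a) \<Rightarrow> (nat \<Rightarrow> 'a)"
  where "monicpoly n a = up_ring.monom P \<one> n \<ominus>\<^bsub>P\<^esub> lowpoly n a"

lemma lowpoly_closed: "(\<And>i. i < n \<Longrightarrow> c i \<in> carrier R) \<Longrightarrow> lowpoly n c \<in> carrier P"
  unfolding lowpoly_def by (intro P.finsum_closed) auto

lemma coeff_lowpoly:
  assumes "\<And>i. i < n \<Longrightarrow> c i \<in> carrier R"
  shows "up_ring.coeff P (lowpoly n c) k = (if k < n then c k else \<zero>)"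
proof -
  have "up_ring.coeff P (lowpoly n c) k = (\<Oplus>i\<in>{..<n}. up_ring.coeff P (up_ring.monom P (c i) i) k)"
    unfolding lowpoly_def by (rule coeff_finsum) (use assms in auto)
  also have "\<dots> = (if k < n then c k else \<zero>)"
  proof (cases "k < n")
    case True
    then show ?thesis using assms by (subst R.finsum_single[of _ k]) auto
  next
    case False
    have "(\<Oplus>i\<in>{..<n}. up_ring.coeff P (up_ring.monom P (c i) i) k) = (\<Oplus>i\<in>{..<n}. \<zero>)"
      by (rule R.finsum_cong') (use False assms in auto)
    then show ?thesis using False by simp
  qed
  finally show ?thesis .
qed

lemma monicpoly_closed: "(\<And>i. i < n \<Longrightarrow> a i \<in> carrier R) \<Longrightarrow> monicpoly n a \<in> carrier P"
  unfolding monicpoly_def by (intro P.minus_closed lowpoly_closed) auto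

text \<open>The leading coefficient of a nonzero \<open>q\<close> survives multiplication by a monic
  polynomial, even among zero divisors, and sits in degree at least \<open>n\<close>.\<close>

lemma monicpoly_multiple_low:
  assumes a: "\<And>i. i < n \<Longrightarrow> a i \<in> carrier R" and c: "\<And>i. i < n \<Longrightarrow> c i \<in> carrier R"
    and q: "q \<in> carrier P" and eq: "lowpoly n c = q \<otimes>\<^bsub>P\<^esub> monicpoly n a" and i: "i < n"
  shows "c i = \<zero>"
proof -
  have Fc: "monicpoly n a \<in> carrier P" by (rule monicpoly_closed) (rule a)
  have dF: "deg R (monicpoly n a) \<le> n"
    by (rule deg_aboveI) (use a lowpoly_closed[of n a] in \<open>auto simp: monicpoly_def coeff_lowpoly R.minus_eq\<close>)
  have cF: "up_ring.coeff P (monicpoly n a) n = \<one>"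
    using a lowpoly_closed[of n a] by (simp add: monicpoly_def coeff_lowpoly R.minus_eq)
  have "q = \<zero>\<^bsub>P\<^esub>"
  proof (rule ccontr)
    assume "q \<noteq> \<zero>\<^bsub>P\<^esub>"
    then have "up_ring.coeff P q (deg R q) \<noteq> \<zero>" using q by (rule lcoeff_nonzero)
    moreover have "up_ring.coeff P (q \<otimes>\<^bsub>P\<^esub> monicpoly n a) (deg R q + n) = up_ring.coeff P q (deg R q)"
      using coeff_mult_top[OF q le_refl Fc dF] cF q by simp
    ultimately show False using eq[symmetric] coeff_lowpoly[of n c, OF c] by simp
  qed
  then have "lowpoly n c = \<zero>\<^bsub>P\<^esub>" using eq Fc by simp
  then show ?thesis using coeff_lowpoly[of n c i, OF c] i by simp
qed

end

lemma (in pring) ev_lowpoly: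
  assumes "\<And>i. i < n \<Longrightarrow> c i \<in> carrier R"
  shows "ev (U.lowpoly n c) = lin n c"
proof -
  interpret ev: ring_hom_cring "UP R" S ev by (rule ev_hom)
  have "ev (U.lowpoly n c) = (\<Oplus>\<^bsub>S\<^esub>i\<in>{..<n}. ev (up_ring.monom (UP R) (c i) i))"
    unfolding U.lowpoly_def by (subst ev.hom_finsum) (use assms in \<open>auto simp: comp_def\<close>)
  also have "\<dots> = lin n c" unfolding lincomb_def
    by (rule S.finsum_cong') (use assms in \<open>auto simp: U.eval_monom\<close>)
  finally show ?thesis .
qed

lemma (in pring) ev_monicpoly:
  assumes "\<And>i. i < n \<Longrightarrow> a i \<in> carrier R"
  shows "ev (U.monicpoly n a) = x [^]\<^bsub>S\<^esub> n \<ominus>\<^bsub>S\<^esub> lin n a"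
proof -
  interpret ev: ring_hom_cring "UP R" S ev by (rule ev_hom)
  have "ev (up_ring.monom (UP R) \<one> n) = x [^]\<^bsub>S\<^esub> n" by (subst U.eval_monom) auto
  then show ?thesis unfolding U.monicpoly_def
    using ev_lowpoly[OF assms] U.lowpoly_closed[OF assms] by (simp add: U.P.minus_eq S.minus_eq)
qed

section \<open>The quotient by a monic polynomial\<close>

definition mq_ideal :: "('a, 'x) ring_scheme \<Rightarrow> nat \<Rightarrow> (nat \<Rightarrow> 'a) \<Rightarrow> (nat \<Rightarrow> 'a) set"
  where "mq_ideal R n a = PIdl\<^bsub>UP R\<^esub> (UP_cring.monicpoly R n a)"

definition mq_ring :: "('a, 'x) ring_scheme \<Rightarrow> nat \<Rightarrow> (nat \<Rightarrow> 'a) \<Rightarrow> (nat \<Rightarrow> 'a) set ring"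
  where "mq_ring R n a = UP R Quot mq_ideal R n a"

definition mq_hom :: "('a, 'x) ring_scheme \<Rightarrow> nat \<Rightarrow> (nat \<Rightarrow> 'a) \<Rightarrow> 'a \<Rightarrow> (nat \<Rightarrow> 'a) set"
  where "mq_hom R n a b = mq_ideal R n a +>\<^bsub>UP R\<^esub> up_ring.monom (UP R) b 0"

definition mq_var :: "('a, 'x) ring_scheme \<Rightarrow> nat \<Rightarrow> (nat \<Rightarrow> 'a) \<Rightarrow> (nat \<Rightarrow> 'a) set"
  where "mq_var R n a = mq_ideal R n a +>\<^bsub>UP R\<^esub> up_ring.monom (UP R) \<one>\<^bsub>R\<^esub> 1"

context cring
begin

text \<open>Spanning is reduction by the relation; independence holds because no nonzero polynomial
  of degree below \<open>n\<close> is a multiple of the monic one.\<close>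

lemma mq_pring:
  assumes a: "\<And>i. i < n \<Longrightarrow> a i \<in> carrier R"
  shows "pring R (mq_ring R n a) (mq_hom R n a) (mq_var R n a)" (is ?t1)
    and "mq_var R n a [^]\<^bsub>mq_ring R n a\<^esub> n = lincomb (mq_ring R n a) (mq_hom R n a) (mq_var R n a) n a" (is ?t2)
    and "power_basis R (mq_ring R n a) (mq_hom R n a) (mq_var R n a) n" (is ?t3)
proof -
  note Rc = is_cring
  have z0: "\<zero>\<^bsub>mq_ring R n a\<^esub> = mq_ideal R n a" by (simp add: mq_ring_def FactRing_def)
  have surj: "\<exists>p\<in>carrier (UP R). y = mq_ideal R n a +>\<^bsub>UP R\<^esub> p" if "y \<in> carrier (mq_ring R n a)" for y
    using that by (auto simp: mq_ring_def FactRing_def A_RCOSETS_def')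
  interpret UP_cring R "UP R" by unfold_locales
  have Fc: "monicpoly n a \<in> carrier (UP R)" by (rule monicpoly_closed) (rule a)
  have I: "ideal (mq_ideal R n a) (UP R)" unfolding mq_ideal_def by (rule P.cgenideal_ideal[OF Fc])
  interpret I: ideal "mq_ideal R n a" "UP R" by (rule I)
  have Qc: "cring (mq_ring R n a)" unfolding mq_ring_def by (rule I.quotient_is_cring) (rule UP_cring)
  let ?pr = "\<lambda>p. mq_ideal R n a +>\<^bsub>UP R\<^esub> p"
  have pr: "ring_hom_cring (UP R) (mq_ring R n a) ?pr"
    by (rule ring_hom_cringI'[OF UP_cring Qc]) (unfold mq_ring_def, rule I.rcos_ring_hom)
  interpret pr: ring_hom_cring "UP R" "mq_ring R n a" ?pr by (rule pr)
  have const: "ring_hom_cring R (UP R) (\<lambda>b. up_ring.monom (UP R) b 0)"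
    by (rule ring_hom_cringI'[OF Rc UP_cring]) (rule const_ring_hom)
  have h: "ring_hom_cring R (mq_ring R n a) (mq_hom R n a)"
    using ring_hom_cring_compose[OF const pr] by (simp add: mq_hom_def[abs_def])
  show ?t1
    by (intro pring.intro pring_axioms.intro h) (simp add: mq_var_def)
  then interpret q: pring R "mq_ring R n a" "mq_hom R n a" "mq_var R n a" .
  \<comment> \<open>Evaluation at the class of the variable is the projection, so that
    \<open>reduce_ev\<close> and \<open>ev_lowpoly\<close> apply to classes.\<close>
  have evpr: "q.ev p = ?pr p" if p: "p \<in> carrier (UP R)" for p
  proof (rule q.U.UP_hom_unique[OF q.ev_hom _ _ pr _ _ p q.x_closed])
    show "q.ev (up_ring.monom (UP R) \<one> (Suc 0)) = mq_var R n a"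
      using q.U.eval_monom1[OF q.x_closed] by simp
    show "?pr (up_ring.monom (UP R) \<one> (Suc 0)) = mq_var R n a" by (simp add: mq_var_def)
    show "q.ev (up_ring.monom (UP R) r 0) = mq_hom R n a r" if "r \<in> carrier R" for r
      by (rule q.U.eval_const[OF q.x_closed that])
    show "?pr (up_ring.monom (UP R) r 0) = mq_hom R n a r" if "r \<in> carrier R" for r
      by (simp add: mq_hom_def)
  qed
  have Fz: "?pr (monicpoly n a) = \<zero>\<^bsub>mq_ring R n a\<^esub>"
  proof -
    have "monicpoly n a \<in> mq_ideal R n a" unfolding mq_ideal_def by (rule P.cgenideal_self[OF Fc])
    then show ?thesis unfolding z0 by (rule I.a_rcos_const)
  qed
  show xn: ?t2
  proof -
    have "mq_var R n a [^]\<^bsub>mq_ring R n a\<^esub> n \<ominus>\<^bsub>mq_ring R n a\<^esub> q.lin n a = q.ev (monicpoly n a)"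
      by (rule q.ev_monicpoly[symmetric]) (rule a)
    also have "\<dots> = \<zero>\<^bsub>mq_ring R n a\<^esub>" unfolding evpr[OF Fc] by (rule Fz)
    finally show ?thesis
      by (subst (asm) pr.S.r_right_minus_eq) (auto intro!: pr.S.nat_pow_closed q.lin_closed a)
  qed
  show ?t3 unfolding power_basis_def
  proof (intro conjI ballI impI allI)
    fix y assume "y \<in> carrier (mq_ring R n a)"
    then obtain p where p: "p \<in> carrier (UP R)" and y: "y = ?pr p"
      using surj by blast
    have y': "y = q.ev p" using evpr[OF p] y by simp
    show "\<exists>c\<in>{..<n} \<rightarrow> carrier R. y = q.lin n c"
      unfolding y' by (rule q.reduce_ev[OF a xn p])
  next
    fix c i assume c: "c \<in> {..<n} \<rightarrow> carrier R" and z: "q.lin n c = \<zero>\<^bsub>mq_ring R n a\<^esub>" and i: "i < n"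
    have ci: "c i \<in> carrier R" if "i < n" for i using c that by auto
    have lc: "lowpoly n c \<in> carrier (UP R)" by (rule lowpoly_closed) (rule ci)
    have "?pr (lowpoly n c) = q.ev (lowpoly n c)" by (rule evpr[OF lc, symmetric])
    also have "\<dots> = q.lin n c" by (rule q.ev_lowpoly) (rule ci)
    also note z
    finally have "?pr (lowpoly n c) = \<zero>\<^bsub>mq_ring R n a\<^esub>" .
    then have "?pr (lowpoly n c) = mq_ideal R n a" unfolding z0 .
    then have "lowpoly n c \<in> mq_ideal R n a" using I.rcos_const_imp_mem[OF lc] by simp
    then obtain r where r: "r \<in> carrier (UP R)" "lowpoly n c = r \<otimes>\<^bsub>UP R\<^esub> monicpoly n a"
      unfolding mq_ideal_def cgenideal_def by blast
    show "c i = \<zero>"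
      by (rule monicpoly_multiple_low[where a=a and n=n and c=c and q=r])
        (erule a, erule ci, rule r(1), rule r(2), rule i)
  qed
qed

lemma mq_universal:
  assumes a: "\<And>i. i < n \<Longrightarrow> a i \<in> carrier R"
    and k: "pring R C k y" and yn: "y [^]\<^bsub>C\<^esub> n = lincomb C k y n a"
  shows "\<exists>g. ring_hom_cring (mq_ring R n a) C g \<and> (\<forall>b\<in>carrier R. g (mq_hom R n a b) = k b) \<and> g (mq_var R n a) = y"
proof -
  interpret UP_cring R "UP R" by unfold_locales
  interpret k: pring R C k y by fact
  interpret ev: ring_hom_cring "UP R" C k.ev by (rule k.ev_hom)
  have Fc: "monicpoly n a \<in> carrier (UP R)" by (rule monicpoly_closed) (rule a)
  have I: "ideal (mq_ideal R n a) (UP R)" unfolding mq_ideal_def by (rule P.cgenideal_ideal[OF Fc])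
  have Fz: "k.ev (monicpoly n a) = \<zero>\<^bsub>C\<^esub>"
  proof -
    have "k.ev (monicpoly n a) = y [^]\<^bsub>C\<^esub> n \<ominus>\<^bsub>C\<^esub> k.lin n a" by (rule k.ev_monicpoly) (rule a)
    also have "\<dots> = \<zero>\<^bsub>C\<^esub>" unfolding yn by (subst k.S.r_right_minus_eq) (auto intro!: k.lin_closed a)
    finally show ?thesis .
  qed
  have "\<exists>g. ring_hom_cring (UP R Quot mq_ideal R n a) C g \<and> (\<forall>r\<in>carrier (UP R). g (mq_ideal R n a +>\<^bsub>UP R\<^esub> r) = k.ev r)"
  proof (rule P.quot_lift[OF I k.ev_hom])
    fix p assume "p \<in> mq_ideal R n a"
    then show "k.ev p = \<zero>\<^bsub>C\<^esub>" using Fz Fc unfolding mq_ideal_def cgenideal_def by auto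
  qed
  then obtain g where g: "ring_hom_cring (mq_ring R n a) C g"
    and gr: "\<And>r. r \<in> carrier (UP R) \<Longrightarrow> g (mq_ideal R n a +>\<^bsub>UP R\<^esub> r) = k.ev r"
    unfolding mq_ring_def by blast
  show ?thesis
  proof (intro exI[of _ g] conjI ballI g)
    show "g (mq_hom R n a b) = k b" if "b \<in> carrier R" for b
      using that k.U.eval_const[OF k.x_closed that] by (simp add: mq_hom_def gr)
    show "g (mq_var R n a) = y"
      using k.U.eval_monom1[OF k.x_closed] by (simp add: mq_var_def gr)
  qed
qed

end

text \<open>The resulting structure map is a separate \<open>k'\<close> tied to \<open>g\<close> and
  \<open>k\<close> on the carrier only, because the composites met later agree with the expected
  maps only there.\<close>

lemma eval_hom_comp:
  assumes k: "pring A C k y" and g: "ring_hom_cring C D g"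
    and k': "\<And>a. a \<in> carrier A \<Longrightarrow> k' a = g (k a)" and y': "y' = g y"
    and p: "p \<in> carrier (UP A)"
  shows "g (UnivPoly.eval A C k y p) = UnivPoly.eval A D k' y' p"
proof -
  interpret k: pring A C k y by fact
  interpret g: ring_hom_cring C D g by fact
  let ?c = "up_ring.coeff (UP A) p"
  have c: "?c i \<in> carrier A" for i using p by simp
  have "g (UnivPoly.eval A C k y p) = (\<Oplus>\<^bsub>D\<^esub>i\<in>{..deg A p}. g (k (?c i) \<otimes>\<^bsub>C\<^esub> y [^]\<^bsub>C\<^esub> i))"
    unfolding k.U.eval_on_carrier[OF p] by (subst g.hom_finsum) (use c in \<open>auto simp: comp_def\<close>)
  also have "\<dots> = (\<Oplus>\<^bsub>D\<^esub>i\<in>{..deg A p}. k' (?c i) \<otimes>\<^bsub>D\<^esub> y' [^]\<^bsub>D\<^esub> i)"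
    by (rule g.S.finsum_cong') (use c in \<open>auto simp: k' y' g.hom_pow\<close>)
  also have "\<dots> = UnivPoly.eval A D k' y' p" by (rule k.U.eval_on_carrier[OF p, symmetric])
  finally show ?thesis .
qed

section \<open>Generation of monoid rings\<close>

context mring
begin

interpretation KM: cring KM by (rule monoid_ring_cring)

lemma mterm_mult:
  assumes "x \<in> carrier M" "y \<in> carrier M" "a \<in> carrier K" "b \<in> carrier K"
  shows "mterm K x a \<otimes>\<^bsub>KM\<^esub> mterm K y b = mterm K (x \<otimes>\<^bsub>M\<^esub> y) (a \<otimes> b)"
proof (rule eqI)
  fix w assume w: "w \<in> carrier M \<rightarrow> carrier K"
  have wc: "w z \<in> carrier K" if "z \<in> carrier M" for z using w that by auto
  have "mr_eval K K (\<lambda>x. x) w (mterm K x a \<otimes>\<^bsub>KM\<^esub> mterm K y b)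
    = mr_eval K K (\<lambda>x. x) (\<lambda>u. mr_eval K K (\<lambda>x. x) (\<lambda>z. w (u \<otimes>\<^bsub>M\<^esub> z)) (mterm K y b)) (mterm K x a)"
    by (rule eval_mult[OF id_hom mterm_closed mterm_closed w]) (use assms in auto)
  also have "\<dots> = a \<otimes> mr_eval K K (\<lambda>x. x) (\<lambda>z. w (x \<otimes>\<^bsub>M\<^esub> z)) (mterm K y b)"
    by (rule eval_mterm[OF id_hom])
      (use assms wc in \<open>auto intro!: eval_closed[OF id_hom] mterm_closed\<close>)
  also have "mr_eval K K (\<lambda>x. x) (\<lambda>z. w (x \<otimes>\<^bsub>M\<^esub> z)) (mterm K y b) = b \<otimes> w (x \<otimes>\<^bsub>M\<^esub> y)"
    by (rule eval_mterm[OF id_hom]) (use assms wc in auto)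
  also have "a \<otimes> (b \<otimes> w (x \<otimes>\<^bsub>M\<^esub> y)) = mr_eval K K (\<lambda>x. x) w (mterm K (x \<otimes>\<^bsub>M\<^esub> y) (a \<otimes> b))"
    by (subst eval_mterm[OF id_hom]) (use assms w wc in \<open>auto simp: m_assoc\<close>)
  finally show "mr_eval K K (\<lambda>x. x) w (mterm K x a \<otimes>\<^bsub>KM\<^esub> mterm K y b)
    = mr_eval K K (\<lambda>x. x) w (mterm K (x \<otimes>\<^bsub>M\<^esub> y) (a \<otimes> b))" .
qed (use assms in \<open>auto intro!: KM.m_closed mterm_closed\<close>)

lemma mterm_add: "mterm K x a \<oplus>\<^bsub>KM\<^esub> mterm K x b = mterm K x (a \<oplus> b)"
  by (auto simp: fun_eq_iff add_apply mterm_def)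

lemma const_hom: "ring_hom_cring K KM (mterm K \<one>\<^bsub>M\<^esub>)"
  by (rule ring_hom_cringI'[OF is_cring monoid_ring_cring], rule ring_hom_memI)
    (auto simp: mterm_mult mterm_add one_eq mterm_closed)

lemma finsum_apply:
  assumes "finite I" "\<And>i. i \<in> I \<Longrightarrow> f i \<in> carrier KM"
  shows "(\<Oplus>\<^bsub>KM\<^esub>i\<in>I. f i) x = (\<Oplus>i\<in>I. f i x)"
  using assms
proof (induction I rule: finite_induct)
  case empty
  then show ?case by (simp add: zero_apply)
next
  case (insert i I)
  have "(\<Oplus>\<^bsub>KM\<^esub>i\<in>insert i I. f i) = f i \<oplus>\<^bsub>KM\<^esub> (\<Oplus>\<^bsub>KM\<^esub>i\<in>I. f i)"
    using insert by (intro KM.finsum_insert) auto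
  moreover have "(\<Oplus>i\<in>insert i I. f i x) = f i x \<oplus> (\<Oplus>i\<in>I. f i x)"
    using insert by (intro finsum_insert) (auto intro: carrierD(1))
  ultimately show ?case using insert by (simp add: add_apply)
qed

lemma decompose:
  assumes p: "p \<in> carrier KM"
  shows "p = (\<Oplus>\<^bsub>KM\<^esub>x\<in>{x. p x \<noteq> \<zero>}. mterm K x (p x))"
proof
  fix y
  have m: "mterm K x (p x) \<in> carrier KM" if "x \<in> {x. p x \<noteq> \<zero>}" for x
    using that carrierD[OF p] by (intro mterm_closed) auto
  have "(\<Oplus>\<^bsub>KM\<^esub>x\<in>{x. p x \<noteq> \<zero>}. mterm K x (p x)) y = (\<Oplus>x\<in>{x. p x \<noteq> \<zero>}. mterm K x (p x) y)"
    by (rule finsum_apply) (use carrierD[OF p] m in auto)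
  also have "\<dots> = p y"
  proof (cases "p y = \<zero>")
    case True
    have "(\<Oplus>x\<in>{x. p x \<noteq> \<zero>}. mterm K x (p x) y) = (\<Oplus>x\<in>{x. p x \<noteq> \<zero>}. \<zero>)"
      by (rule finsum_cong') (use True in \<open>auto simp: mterm_def\<close>)
    then show ?thesis using True by simp
  next
    case False
    then show ?thesis
      by (subst finsum_single[of _ y]) (use carrierD[OF p] in \<open>auto simp: mterm_def\<close>)
  qed
  finally show "p y = (\<Oplus>\<^bsub>KM\<^esub>x\<in>{x. p x \<noteq> \<zero>}. mterm K x (p x)) y" by simp
qed

lemma monoid_ring_induct [consumes 1, case_names zero mterm add]:
  assumes p: "p \<in> carrier KM" and zero: "P \<zero>\<^bsub>KM\<^esub>"
    and mt: "\<And>x a. \<lbrakk>x \<in> carrier M; a \<in> carrier K\<rbrakk> \<Longrightarrow> P (mterm K x a)"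
    and add: "\<And>p q. \<lbrakk>p \<in> carrier KM; q \<in> carrier KM; P p; P q\<rbrakk> \<Longrightarrow> P (p \<oplus>\<^bsub>KM\<^esub> q)"
  shows "P p"
proof -
  have "P (\<Oplus>\<^bsub>KM\<^esub>x\<in>I. mterm K x (p x))" if "finite I" "I \<subseteq> {x. p x \<noteq> \<zero>}" for I
    using that
  proof (induction I rule: finite_induct)
    case (insert x I)
    have m: "mterm K x (p x) \<in> carrier KM" if "x \<in> {x. p x \<noteq> \<zero>}" for x
      using that carrierD[OF p] by (intro mterm_closed) auto
    have "(\<Oplus>\<^bsub>KM\<^esub>x\<in>insert x I. mterm K x (p x)) = mterm K x (p x) \<oplus>\<^bsub>KM\<^esub> (\<Oplus>\<^bsub>KM\<^esub>x\<in>I. mterm K x (p x))"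
      using insert m by (intro KM.finsum_insert) auto
    moreover have "P (mterm K x (p x))" using insert carrierD[OF p] by (intro mt) auto
    moreover have "(\<Oplus>\<^bsub>KM\<^esub>x\<in>I. mterm K x (p x)) \<in> carrier KM"
      using insert m by (intro KM.finsum_closed) auto
    ultimately show ?case using insert m by (auto intro!: add)
  qed (use zero in simp)
  then show ?thesis using decompose[OF p] carrierD(2)[OF p] by (metis subset_refl)
qed

end

section \<open>Tensor products of algebras\<close>

lemma int_ring_hom:
  assumes "cring C"
  shows "ring_hom_cring \<Z> C (\<lambda>k. [k] \<cdot>\<^bsub>C\<^esub> \<one>\<^bsub>C\<^esub>)"
proof (rule ring_hom_cringI'[OF int_is_cring assms], rule ring_hom_memI)
  interpret C: cring C by fact
  fix k l :: int
  show "[k] \<cdot>\<^bsub>C\<^esub> \<one>\<^bsub>C\<^esub> \<in> carrier C" by simp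
  show "[(k \<oplus>\<^bsub>\<Z>\<^esub> l)] \<cdot>\<^bsub>C\<^esub> \<one>\<^bsub>C\<^esub> = [k] \<cdot>\<^bsub>C\<^esub> \<one>\<^bsub>C\<^esub> \<oplus>\<^bsub>C\<^esub> [l] \<cdot>\<^bsub>C\<^esub> \<one>\<^bsub>C\<^esub>"
    by (simp add: C.add.int_pow_mult)
  show "[(k \<otimes>\<^bsub>\<Z>\<^esub> l)] \<cdot>\<^bsub>C\<^esub> \<one>\<^bsub>C\<^esub> = [k] \<cdot>\<^bsub>C\<^esub> \<one>\<^bsub>C\<^esub> \<otimes>\<^bsub>C\<^esub> [l] \<cdot>\<^bsub>C\<^esub> \<one>\<^bsub>C\<^esub>"
    by (simp add: C.add_pow_ldistr_int C.add.int_pow_pow mult.commute)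
next
  interpret C: cring C by fact
  show "[\<one>\<^bsub>\<Z>\<^esub>] \<cdot>\<^bsub>C\<^esub> \<one>\<^bsub>C\<^esub> = \<one>\<^bsub>C\<^esub>" by simp
qed

locale tensor_alg = B: algebra A B + R: algebra A R
  for A :: "('a, 'x) ring_scheme" and B :: "('a, 'b, 'y) module_scheme" and R :: "('a, 'r, 'z) module_scheme"
begin

sublocale F: mring \<Z> "B \<times>\<times> R"
proof -
  have "comm_monoid (B \<times>\<times> R)"
    by (rule comm_monoidI) (auto simp: DirProd_def B.m_ac R.m_ac)
  then show "mring \<Z> (B \<times>\<times> R)"
    by (simp add: mring_def int_is_cring)
qed

abbreviation "Fr \<equiv> tensor_free B R"
abbreviation "J \<equiv> Idl\<^bsub>Fr\<^esub> (tensor_rels A B R)"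
abbreviation "T \<equiv> tensor A B R"
abbreviation "Q0 \<equiv> Fr Quot J"
abbreviation "e \<equiv> \<lambda>b r. mterm \<Z> (b, r) (1::int)"
abbreviation "tn \<equiv> tens A B R"

lemma Fr_cring: "cring Fr"
  using F.monoid_ring_cring by (simp add: tensor_free_def)

sublocale Fr: cring Fr by (rule Fr_cring)

lemma e_closed: "\<lbrakk>b \<in> carrier B; r \<in> carrier R\<rbrakk> \<Longrightarrow> e b r \<in> carrier Fr"
  unfolding tensor_free_def by (rule F.mterm_closed) (auto simp: DirProd_def)

lemma rels_closed: "tensor_rels A B R \<subseteq> carrier Fr"
  unfolding tensor_rels_def Let_def
  by (auto intro!: Fr.minus_closed Fr.a_closed e_closed)

lemma J_ideal: "ideal J Fr" by (rule Fr.genideal_ideal[OF rels_closed])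

lemma Q0_cring: "cring Q0"
  by (rule ideal.quotient_is_cring[OF J_ideal Fr_cring])

lemma pr_hom: "ring_hom_cring Fr Q0 (\<lambda>p. J +>\<^bsub>Fr\<^esub> p)"
  by (rule ring_hom_cringI'[OF Fr_cring Q0_cring]) (rule ideal.rcos_ring_hom[OF J_ideal])

lemma tens_eq: "tn b r = J +>\<^bsub>Fr\<^esub> e b r"
  by (simp add: tens_def)

lemma coset_eqI:
  assumes "p \<ominus>\<^bsub>Fr\<^esub> q \<in> tensor_rels A B R" "p \<in> carrier Fr" "q \<in> carrier Fr"
  shows "J +>\<^bsub>Fr\<^esub> p = J +>\<^bsub>Fr\<^esub> q"
  using Fr.genideal_self[OF rels_closed] assms Fr.quotient_eq_iff_same_a_r_cos[OF J_ideal assms(2,3)] by blast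

lemma T_simps:
  "carrier T = carrier Q0" "monoid.mult T = monoid.mult Q0" "monoid.one T = monoid.one Q0"
  "ring.zero T = ring.zero Q0" "ring.add T = ring.add Q0"
  "b \<odot>\<^bsub>T\<^esub> t = tn b \<one>\<^bsub>R\<^esub> \<otimes>\<^bsub>T\<^esub> t"
  by (simp_all add: tensor_def)

lemma T_cring: "cring T"
  unfolding tensor_def by (rule cring_algebra_via[OF Q0_cring])

sublocale T: cring T by (rule T_cring)

lemma hom_T_iff: "ring_hom T C = ring_hom Q0 C" "ring_hom C' T = ring_hom C' Q0"
  by (simp_all add: ring_hom_def T_simps)

lemma hom_T_cring_iff: "ring_hom_cring T C g \<longleftrightarrow> ring_hom_cring Q0 C g"
  by (simp add: ring_hom_cring_def ring_hom_cring_axioms_def hom_T_iff T_cring Q0_cring)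

lemma pr_hom': "ring_hom_cring Fr T (\<lambda>p. J +>\<^bsub>Fr\<^esub> p)"
  using pr_hom by (simp add: ring_hom_cring_def ring_hom_cring_axioms_def hom_T_iff T_cring)

sublocale pr: ring_hom_cring Fr T "\<lambda>p. J +>\<^bsub>Fr\<^esub> p" by (rule pr_hom')

lemma tens_closed [simp]: "\<lbrakk>b \<in> carrier B; r \<in> carrier R\<rbrakk> \<Longrightarrow> tn b r \<in> carrier T"
  unfolding tens_eq by (intro pr.hom_closed e_closed)

lemma T_surj: "t \<in> carrier T \<Longrightarrow> \<exists>p\<in>carrier Fr. t = J +>\<^bsub>Fr\<^esub> p"
  unfolding T_simps FactRing_def A_RCOSETS_def' by auto

lemma tens_add_left:
  assumes "b \<in> carrier B" "b' \<in> carrier B" "r \<in> carrier R"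
  shows "tn (b \<oplus>\<^bsub>B\<^esub> b') r = tn b r \<oplus>\<^bsub>T\<^esub> tn b' r"
proof -
  have "tn (b \<oplus>\<^bsub>B\<^esub> b') r = J +>\<^bsub>Fr\<^esub> (e b r \<oplus>\<^bsub>Fr\<^esub> e b' r)"
    unfolding tens_eq
  proof (rule coset_eqI)
    show "e (b \<oplus>\<^bsub>B\<^esub> b') r \<ominus>\<^bsub>Fr\<^esub> (e b r \<oplus>\<^bsub>Fr\<^esub> e b' r) \<in> tensor_rels A B R"
      unfolding tensor_rels_def Let_def using assms by blast
  qed (use assms e_closed in auto)
  also have "\<dots> = tn b r \<oplus>\<^bsub>T\<^esub> tn b' r"
    unfolding tens_eq by (rule pr.hom_add) (use assms e_closed in auto)
  finally show ?thesis .
qed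

lemma tens_add_right:
  assumes "b \<in> carrier B" "r \<in> carrier R" "r' \<in> carrier R"
  shows "tn b (r \<oplus>\<^bsub>R\<^esub> r') = tn b r \<oplus>\<^bsub>T\<^esub> tn b r'"
proof -
  have "tn b (r \<oplus>\<^bsub>R\<^esub> r') = J +>\<^bsub>Fr\<^esub> (e b r \<oplus>\<^bsub>Fr\<^esub> e b r')"
    unfolding tens_eq
  proof (rule coset_eqI)
    show "e b (r \<oplus>\<^bsub>R\<^esub> r') \<ominus>\<^bsub>Fr\<^esub> (e b r \<oplus>\<^bsub>Fr\<^esub> e b r') \<in> tensor_rels A B R"
      unfolding tensor_rels_def Let_def using assms by blast
  qed (use assms e_closed in auto)
  also have "\<dots> = tn b r \<oplus>\<^bsub>T\<^esub> tn b r'"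
    unfolding tens_eq by (rule pr.hom_add) (use assms e_closed in auto)
  finally show ?thesis .
qed

lemma tens_balanced:
  assumes "a \<in> carrier A" "b \<in> carrier B" "r \<in> carrier R"
  shows "tn (a \<odot>\<^bsub>B\<^esub> b) r = tn b (a \<odot>\<^bsub>R\<^esub> r)"
  unfolding tens_eq
proof (rule coset_eqI)
  show "e (a \<odot>\<^bsub>B\<^esub> b) r \<ominus>\<^bsub>Fr\<^esub> e b (a \<odot>\<^bsub>R\<^esub> r) \<in> tensor_rels A B R"
    unfolding tensor_rels_def Let_def using assms by blast
qed (use assms e_closed in auto)

lemma tens_mult:
  assumes "b \<in> carrier B" "r \<in> carrier R" "b' \<in> carrier B" "r' \<in> carrier R"
  shows "tn b r \<otimes>\<^bsub>T\<^esub> tn b' r' = tn (b \<otimes>\<^bsub>B\<^esub> b') (r \<otimes>\<^bsub>R\<^esub> r')"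
proof -
  have "e b r \<otimes>\<^bsub>Fr\<^esub> e b' r' = e (b \<otimes>\<^bsub>B\<^esub> b') (r \<otimes>\<^bsub>R\<^esub> r')"
    using F.mterm_mult[of "(b, r)" "(b', r')" 1 1] assms by (simp add: tensor_free_def)
  moreover have "(J +>\<^bsub>Fr\<^esub> e b r) \<otimes>\<^bsub>T\<^esub> (J +>\<^bsub>Fr\<^esub> e b' r') = J +>\<^bsub>Fr\<^esub> (e b r \<otimes>\<^bsub>Fr\<^esub> e b' r')"
    by (rule pr.hom_mult[symmetric]) (use assms e_closed in auto)
  ultimately show ?thesis unfolding tens_eq by simp
qed

lemma tens_one: "tn \<one>\<^bsub>B\<^esub> \<one>\<^bsub>R\<^esub> = \<one>\<^bsub>T\<^esub>"
proof -
  have "e \<one>\<^bsub>B\<^esub> \<one>\<^bsub>R\<^esub> = \<one>\<^bsub>Fr\<^esub>" using F.one_eq by (simp add: tensor_free_def)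
  then show ?thesis unfolding tens_eq using pr.hom_one by simp
qed

lemma left_hom: "ring_hom_cring B T (\<lambda>b. tn b \<one>\<^bsub>R\<^esub>)"
  by (rule ring_hom_cringI'[OF B.M_cring T_cring], rule ring_hom_memI)
    (auto simp: tens_mult tens_add_left tens_one)

lemma right_hom: "ring_hom_cring R T (\<lambda>r. tn \<one>\<^bsub>B\<^esub> r)"
  by (rule ring_hom_cringI'[OF R.M_cring T_cring], rule ring_hom_memI)
    (auto simp: tens_mult tens_add_right tens_one)

lemma tens_split: "\<lbrakk>b \<in> carrier B; r \<in> carrier R\<rbrakk> \<Longrightarrow> tn b r = tn b \<one>\<^bsub>R\<^esub> \<otimes>\<^bsub>T\<^esub> tn \<one>\<^bsub>B\<^esub> r"
  by (simp add: tens_mult)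

lemma T_algebra: "algebra B T"
  unfolding tensor_def
proof (rule algebra_algebra_via[OF B.M_cring Q0_cring])
  show "(\<lambda>b. tn b \<one>\<^bsub>R\<^esub>) \<in> ring_hom B Q0"
    using left_hom by (simp add: ring_hom_cring_def ring_hom_cring_axioms_def hom_T_iff)
qed

text \<open>The product of \<open>\<beta> b\<close> and \<open>\<rho> r\<close> is multiplicative in
  the pair, hence extends to the integral monoid ring of \<open>B \<times> R\<close>, and
  bilinearity puts the relations into the kernel. Balance is asked for at \<open>1\<close> and
  spreads to all elements by multiplicativity.\<close>

lemma tens_universal:
  assumes \<beta>: "ring_hom_cring B C \<beta>" and \<rho>: "ring_hom_cring R C \<rho>"
    and bal: "\<And>a. a \<in> carrier A \<Longrightarrow> \<beta> (a \<odot>\<^bsub>B\<^esub> \<one>\<^bsub>B\<^esub>) = \<rho> (a \<odot>\<^bsub>R\<^esub> \<one>\<^bsub>R\<^esub>)"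
  shows "\<exists>\<psi>. ring_hom_cring T C \<psi> \<and> (\<forall>b\<in>carrier B. \<forall>r\<in>carrier R. \<psi> (tn b r) = \<beta> b \<otimes>\<^bsub>C\<^esub> \<rho> r)"
proof -
  interpret \<beta>: ring_hom_cring B C \<beta> by fact
  interpret \<rho>: ring_hom_cring R C \<rho> by fact
  note ih = int_ring_hom[OF \<beta>.S.is_cring]
  interpret ih: ring_hom_cring \<Z> C "\<lambda>k. [k] \<cdot>\<^bsub>C\<^esub> \<one>\<^bsub>C\<^esub>" by (rule ih)
  define w where "w = (\<lambda>(b, r). \<beta> b \<otimes>\<^bsub>C\<^esub> \<rho> r)"
  define \<Psi> where "\<Psi> = mr_eval \<Z> C (\<lambda>k. [k] \<cdot>\<^bsub>C\<^esub> \<one>\<^bsub>C\<^esub>) w"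
  have w: "w \<in> carrier (B \<times>\<times> R) \<rightarrow> carrier C" by (auto simp: w_def)
  have "ring_hom_cring (monoid_ring \<Z> (B \<times>\<times> R)) C \<Psi>"
    unfolding \<Psi>_def by (rule F.eval_hom[OF ih w]) (auto simp: w_def \<beta>.S.m_ac)
  then have \<Psi>: "ring_hom_cring Fr C \<Psi>" by (simp add: tensor_free_def)
  interpret \<Psi>: ring_hom_cring Fr C \<Psi> by (rule \<Psi>)
  have \<Psi>e: "\<Psi> (e b r) = \<beta> b \<otimes>\<^bsub>C\<^esub> \<rho> r" if "b \<in> carrier B" "r \<in> carrier R" for b r
  proof -
    have "\<Psi> (e b r) = [(1::int)] \<cdot>\<^bsub>C\<^esub> \<one>\<^bsub>C\<^esub> \<otimes>\<^bsub>C\<^esub> w (b, r)"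
      unfolding \<Psi>_def by (rule F.eval_mterm[OF ih _ _ w]) (use that in auto)
    then show ?thesis using that by (simp add: w_def)
  qed
  have sm: "\<beta> (a \<odot>\<^bsub>B\<^esub> b) \<otimes>\<^bsub>C\<^esub> \<rho> r = \<beta> b \<otimes>\<^bsub>C\<^esub> \<rho> (a \<odot>\<^bsub>R\<^esub> r)"
    if "a \<in> carrier A" "b \<in> carrier B" "r \<in> carrier R" for a b r
  proof -
    have "a \<odot>\<^bsub>B\<^esub> b = (a \<odot>\<^bsub>B\<^esub> \<one>\<^bsub>B\<^esub>) \<otimes>\<^bsub>B\<^esub> b" "a \<odot>\<^bsub>R\<^esub> r = (a \<odot>\<^bsub>R\<^esub> \<one>\<^bsub>R\<^esub>) \<otimes>\<^bsub>R\<^esub> r"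
      using that by (simp_all add: B.smult_assoc2 R.smult_assoc2)
    then have "\<beta> (a \<odot>\<^bsub>B\<^esub> b) = \<beta> (a \<odot>\<^bsub>B\<^esub> \<one>\<^bsub>B\<^esub>) \<otimes>\<^bsub>C\<^esub> \<beta> b"
      "\<rho> (a \<odot>\<^bsub>R\<^esub> r) = \<rho> (a \<odot>\<^bsub>R\<^esub> \<one>\<^bsub>R\<^esub>) \<otimes>\<^bsub>C\<^esub> \<rho> r"
      using that by (metis \<beta>.hom_mult B.smult_closed B.one_closed, metis \<rho>.hom_mult R.smult_closed R.one_closed)
    then show ?thesis using that bal[OF that(1)] by (simp add: \<beta>.S.m_ac)
  qed
  have K: "ideal {p \<in> carrier Fr. \<Psi> p = \<zero>\<^bsub>C\<^esub>} Fr"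
    using \<Psi>.ring.kernel_is_ideal unfolding a_kernel_def' .
  have "tensor_rels A B R \<subseteq> {p \<in> carrier Fr. \<Psi> p = \<zero>\<^bsub>C\<^esub>}"
  proof
    fix p assume p: "p \<in> tensor_rels A B R"
    then have pc: "p \<in> carrier Fr" using rels_closed by blast
    from p consider
      (1) b b' r where "p = e (b \<oplus>\<^bsub>B\<^esub> b') r \<ominus>\<^bsub>Fr\<^esub> (e b r \<oplus>\<^bsub>Fr\<^esub> e b' r)" "b \<in> carrier B" "b' \<in> carrier B" "r \<in> carrier R"
    | (2) b r r' where "p = e b (r \<oplus>\<^bsub>R\<^esub> r') \<ominus>\<^bsub>Fr\<^esub> (e b r \<oplus>\<^bsub>Fr\<^esub> e b r')" "b \<in> carrier B" "r \<in> carrier R" "r' \<in> carrier R"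
    | (3) a b r where "p = e (a \<odot>\<^bsub>B\<^esub> b) r \<ominus>\<^bsub>Fr\<^esub> e b (a \<odot>\<^bsub>R\<^esub> r)" "a \<in> carrier A" "b \<in> carrier B" "r \<in> carrier R"
      unfolding tensor_rels_def Let_def by blast
    then have "\<Psi> p = \<zero>\<^bsub>C\<^esub>"
    proof cases
      case 1
      then show ?thesis using e_closed
        by (simp add: Fr.minus_eq \<Psi>e \<beta>.S.l_distr \<beta>.S.r_neg)
    next
      case 2
      then show ?thesis using e_closed
        by (simp add: Fr.minus_eq \<Psi>e \<beta>.S.r_distr \<beta>.S.r_neg)
    next
      case 3
      then show ?thesis using e_closed
        by (simp add: Fr.minus_eq \<Psi>e sm \<beta>.S.r_neg)
    qed
    then show "p \<in> {p \<in> carrier Fr. \<Psi> p = \<zero>\<^bsub>C\<^esub>}" using pc by simp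
  qed
  then have JK: "J \<subseteq> {p \<in> carrier Fr. \<Psi> p = \<zero>\<^bsub>C\<^esub>}" by (rule Fr.genideal_minimal[OF K])
  obtain g where g: "ring_hom_cring Q0 C g" "\<And>p. p \<in> carrier Fr \<Longrightarrow> g (J +>\<^bsub>Fr\<^esub> p) = \<Psi> p"
    using Fr.quot_lift[OF J_ideal \<Psi>] JK by blast
  then show ?thesis
    by (intro exI[of _ g]) (auto simp: hom_T_cring_iff tens_eq e_closed \<Psi>e)
qed

text \<open>Pure tensors generate additively with integer coefficients, hence the case of negatives.
  Zero needs no case of its own: it is a pure tensor minus itself.\<close>

lemma T_induct [consumes 1, case_names tens add minus]:
  assumes t: "t \<in> carrier T"
    and ten: "\<And>b r. \<lbrakk>b \<in> carrier B; r \<in> carrier R\<rbrakk> \<Longrightarrow> P (tn b r)"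
    and add: "\<And>t t'. \<lbrakk>t \<in> carrier T; t' \<in> carrier T; P t; P t'\<rbrakk> \<Longrightarrow> P (t \<oplus>\<^bsub>T\<^esub> t')"
    and minus: "\<And>t. \<lbrakk>t \<in> carrier T; P t\<rbrakk> \<Longrightarrow> P (\<ominus>\<^bsub>T\<^esub> t)"
  shows "P t"
proof -
  have zero: "P \<zero>\<^bsub>T\<^esub>"
    using add[OF _ _ ten minus[OF _ ten], of "\<zero>\<^bsub>B\<^esub>" "\<zero>\<^bsub>R\<^esub>" "\<zero>\<^bsub>B\<^esub>" "\<zero>\<^bsub>R\<^esub>"]
    by (simp add: T.r_neg)
  have mt: "P (J +>\<^bsub>Fr\<^esub> mterm \<Z> (b, r) k)" if br: "b \<in> carrier B" "r \<in> carrier R" for b r k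
  proof -
    have mc: "mterm \<Z> (b, r) k \<in> carrier Fr" for k
      unfolding tensor_free_def by (rule F.mterm_closed) (use br in auto)
    have madd: "mterm \<Z> (b, r) (k + l) = mterm \<Z> (b, r) k \<oplus>\<^bsub>Fr\<^esub> mterm \<Z> (b, r) l" for k l
      using F.mterm_add[of "(b, r)" k l] by (simp add: tensor_free_def)
    have m0: "mterm \<Z> (b, r) 0 = \<zero>\<^bsub>Fr\<^esub>"
      by (auto simp: tensor_free_def monoid_ring_def mterm_def fun_eq_iff)
    show ?thesis
    proof (induction k rule: int_induct[of _ 0])
      case base
      show ?case unfolding m0 using zero pr.hom_zero by simp
    next
      case (step1 k)
      then show ?case unfolding madd using mc ten[OF br] add[of "J +>\<^bsub>Fr\<^esub> mterm \<Z> (b, r) k" "tn b r"] br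
        by (simp add: tens_eq[symmetric])
    next
      case (step2 k)
      have "mterm \<Z> (b, r) k = mterm \<Z> (b, r) (k - 1) \<oplus>\<^bsub>Fr\<^esub> e b r" using madd[of "k - 1" 1] by simp
      then have "J +>\<^bsub>Fr\<^esub> mterm \<Z> (b, r) k = (J +>\<^bsub>Fr\<^esub> mterm \<Z> (b, r) (k - 1)) \<oplus>\<^bsub>T\<^esub> tn b r"
        unfolding tens_eq using pr.hom_add[OF mc[of "k - 1"] e_closed[OF br]] by simp
      then have "J +>\<^bsub>Fr\<^esub> mterm \<Z> (b, r) (k - 1) = (J +>\<^bsub>Fr\<^esub> mterm \<Z> (b, r) k) \<oplus>\<^bsub>T\<^esub> \<ominus>\<^bsub>T\<^esub> tn b r"
        using pr.hom_closed[OF mc[of "k - 1"]] br by (simp add: T.a_assoc T.r_neg)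
      then show ?case using step2 pr.hom_closed[OF mc[of k]] br minus[OF _ ten] add ten by simp
    qed
  qed
  obtain p where p: "p \<in> carrier Fr" "t = J +>\<^bsub>Fr\<^esub> p" using T_surj[OF t] by blast
  have "p \<in> carrier (monoid_ring \<Z> (B \<times>\<times> R))" using p by (simp add: tensor_free_def)
  then have "P (J +>\<^bsub>Fr\<^esub> p)"
  proof (induction rule: F.monoid_ring_induct)
    case zero
    show ?case using \<open>P \<zero>\<^bsub>T\<^esub>\<close> pr.hom_zero by (simp add: tensor_free_def)
  next
    case (mterm x a)
    then show ?case using mt[of "fst x" "snd x" a] by (auto simp: DirProd_def)
  next
    case (add p q)
    then have pq: "p \<in> carrier Fr" "q \<in> carrier Fr" by (simp_all add: tensor_free_def)
    have "P ((J +>\<^bsub>Fr\<^esub> p) \<oplus>\<^bsub>T\<^esub> (J +>\<^bsub>Fr\<^esub> q))"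
      by (rule assms(3)[OF pr.hom_closed[OF pq(1)] pr.hom_closed[OF pq(2)] add.IH])
    then have "P (J +>\<^bsub>Fr\<^esub> (p \<oplus>\<^bsub>Fr\<^esub> q))" using pr.hom_add[OF pq] by simp
    then show ?case by (simp only: tensor_free_def)
  qed
  then show ?thesis using p by simp
qed

lemma T_hom_unique:
  assumes "ring_hom_cring T C g" "ring_hom_cring T C g'"
    and eq: "\<And>b r. \<lbrakk>b \<in> carrier B; r \<in> carrier R\<rbrakk> \<Longrightarrow> g (tn b r) = g' (tn b r)"
    and t: "t \<in> carrier T"
  shows "g t = g' t"
proof -
  interpret g: ring_hom_cring T C g by fact
  interpret g': ring_hom_cring T C g' by fact
  show ?thesis using t by (induction rule: T_induct) (use eq in auto)
qed

end

section \<open>Leading monomials\<close>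

text \<open>The largest element with differing multiplicities decides the multiset order on natural
  numbers. Monomials are thus compared lexicographically with \<open>Z_n\<close> as the largest
  variable, and the order is linear and compatible with products.\<close>

lemma mset_lessI:
  fixes M N :: "nat multiset"
  assumes "M \<noteq> N" "\<And>y. count N y < count M y \<Longrightarrow> \<exists>x>y. count M x < count N x"
  shows "M < N"
proof -
  have "multp (<) M N"
    unfolding multp_eq_multp\<^sub>H\<^sub>O[OF asymp_on_less transp_on_less] multp\<^sub>H\<^sub>O_def using assms by auto
  then show ?thesis by (simp add: less_multiset_def)
qed

locale mpoly_ring = A?: cring A for A :: "('a, 'x) ring_scheme" (structure) +
  fixes n :: nat
begin

abbreviation "MP \<equiv> mpoly A n"
abbreviation "KA \<equiv> monoid_ring A (monomials n)"
abbreviation "cst \<equiv> mterm A {#}"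
abbreviation "Zv \<equiv> Z_var A"

sublocale M: mring A "monomials n"
proof -
  have "comm_monoid (monomials n)"
    by (rule comm_monoidI) (auto simp: monomials_def ac_simps)
  then show "mring A (monomials n)" by (simp add: mring_def A.is_cring)
qed

lemma MP_simps:
  "carrier MP = carrier KA" "monoid.mult MP = monoid.mult KA" "monoid.one MP = monoid.one KA"
  "ring.zero MP = ring.zero KA" "ring.add MP = ring.add KA"
  "a \<odot>\<^bsub>MP\<^esub> t = cst a \<otimes>\<^bsub>MP\<^esub> t"
  by (simp_all add: mpoly_def)

lemma MP_cring: "cring MP"
  unfolding mpoly_def by (rule cring_algebra_via[OF M.monoid_ring_cring])

sublocale MP: cring MP by (rule MP_cring)

lemma hom_MP_iff: "ring_hom_cring KA C g \<longleftrightarrow> ring_hom_cring MP C g"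
  by (simp add: ring_hom_cring_def ring_hom_cring_axioms_def ring_hom_def MP_simps MP_cring M.monoid_ring_cring)

lemma hom_MP_iff': "ring_hom_cring C KA g \<longleftrightarrow> ring_hom_cring C MP g"
  by (simp add: ring_hom_cring_def ring_hom_cring_axioms_def ring_hom_def MP_simps MP_cring M.monoid_ring_cring)

lemma mono_carrier: "m \<in> carrier (monomials n) \<longleftrightarrow> set_mset m \<subseteq> {1..n}"
  and mono_mult: "m \<otimes>\<^bsub>monomials n\<^esub> m' = m + m'"
  and mono_one: "\<one>\<^bsub>monomials n\<^esub> = {#}"
  by (simp_all add: monomials_def)

lemma cst_hom: "ring_hom_cring A MP cst"
  using M.const_hom by (simp add: mono_one hom_MP_iff')

sublocale cst: ring_hom_cring A MP cst by (rule cst_hom)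

lemma mterm_MP: "\<lbrakk>set_mset m \<subseteq> {1..n}; a \<in> carrier A\<rbrakk> \<Longrightarrow> mterm A m a \<in> carrier MP"
  unfolding MP_simps by (rule M.mterm_closed) (auto simp: mono_carrier)

lemma mterm_mult_MP:
  "\<lbrakk>set_mset m \<subseteq> {1..n}; set_mset m' \<subseteq> {1..n}; a \<in> carrier A; b \<in> carrier A\<rbrakk>
    \<Longrightarrow> mterm A m a \<otimes>\<^bsub>MP\<^esub> mterm A m' b = mterm A (m + m') (a \<otimes> b)"
  unfolding MP_simps using M.mterm_mult[of m m' a b] by (simp add: mono_carrier mono_mult)

lemma Zv_closed [simp]: "i \<in> {1..n} \<Longrightarrow> Zv i \<in> carrier MP"
  unfolding Z_var_def by (rule mterm_MP) auto

lemma MP_finsum_apply: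
  assumes "finite I" "\<And>i. i \<in> I \<Longrightarrow> f i \<in> carrier MP"
  shows "(\<Oplus>\<^bsub>MP\<^esub>i\<in>I. f i) m = (\<Oplus>i\<in>I. f i m)"
proof -
  have "finsum MP f I = finsum KA f I"
    by (simp add: finsum_def finprod_def MP_simps)
  then show ?thesis using M.finsum_apply[of I f m] assms by (simp add: MP_simps)
qed

text \<open>The coefficient \<open>a\<close> may be zero: the predicate only bounds the monomials of
  \<open>p\<close> and reads off one coefficient. In this form it passes to products over rings with
  zero divisors.\<close>

definition lead :: "(nat multiset \<Rightarrow> 'a) \<Rightarrow> nat multiset \<Rightarrow> 'a \<Rightarrow> bool"
  where "lead p m a \<longleftrightarrow> p \<in> carrier MP \<and> p m = a \<and> (\<forall>m'. m < m' \<longrightarrow> p m' = \<zero>)"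

text \<open>Addition of multisets is strictly monotone, so among the monomials up to
  \<open>m\<close> and up to \<open>m'\<close> only the pair \<open>(m, m')\<close> has a product
  that reaches \<open>m + m'\<close>.\<close>

lemma lead_mult:
  assumes p: "lead p m a" and q: "lead q m' b"
  shows "lead (p \<otimes>\<^bsub>MP\<^esub> q) (m + m') (a \<otimes> b)"
proof -
  have pc: "p \<in> carrier KA" and qc: "q \<in> carrier KA" using p q by (auto simp: lead_def MP_simps)
  have pl: "y \<le> m" if "p y \<noteq> \<zero>" for y using p that unfolding lead_def by (metis not_le)
  have ql: "y \<le> m'" if "q y \<noteq> \<zero>" for y using q that unfolding lead_def by (metis not_le)
  let ?S = "\<lambda>x. {yz \<in> {y. p y \<noteq> \<zero>} \<times> {z. q z \<noteq> \<zero>}. fst yz \<otimes>\<^bsub>monomials n\<^esub> snd yz = x}"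
  have key: "y = m \<and> z = m' \<and> x = m + m'"
    if "p y \<noteq> \<zero>" "q z \<noteq> \<zero>" "y + z = x" "m + m' \<le> x" for x y z
  proof -
    have "y \<le> m" "z \<le> m'" using pl ql that by auto
    moreover have "\<not> y < m" using add_less_le_mono[of y m z m'] that \<open>z \<le> m'\<close> by (metis not_le)
    moreover have "\<not> z < m'" using add_le_less_mono[of y m z m'] that \<open>y \<le> m\<close> by (metis not_le)
    ultimately show ?thesis using that(3) by auto
  qed
  have app: "(p \<otimes>\<^bsub>MP\<^esub> q) x = (\<Oplus>yz\<in>?S x. p (fst yz) \<otimes> q (snd yz))" for x
    unfolding MP_simps by (rule M.mult_apply[OF pc qc])
  have "(p \<otimes>\<^bsub>MP\<^esub> q) (m + m') = a \<otimes> b"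
  proof (cases "p m \<noteq> \<zero> \<and> q m' \<noteq> \<zero>")
    case True
    then have S1: "?S (m + m') = {(m, m')}" using key by (auto simp: mono_mult)
    have "(p \<otimes>\<^bsub>MP\<^esub> q) (m + m') = (\<Oplus>yz\<in>{(m, m')}. p (fst yz) \<otimes> q (snd yz))" unfolding app S1 ..
    also have "\<dots> = p m \<otimes> q m'"
      by (subst finsum_single[of _ "(m, m')"]) (use M.carrierD(1)[OF pc] M.carrierD(1)[OF qc] in auto)
    finally show ?thesis using p q by (simp add: lead_def)
  next
    case False
    then have S0: "?S (m + m') = {}" using key by (auto simp: mono_mult)
    have "(p \<otimes>\<^bsub>MP\<^esub> q) (m + m') = \<zero>" unfolding app S0 by (rule finsum_empty)
    moreover have "a \<otimes> b = \<zero>"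
      using False p q M.carrierD(1)[OF pc] M.carrierD(1)[OF qc] by (auto simp: lead_def)
    ultimately show ?thesis by simp
  qed
  moreover have "(p \<otimes>\<^bsub>MP\<^esub> q) x = \<zero>" if "m + m' < x" for x
  proof -
    have S0: "?S x = {}"
    proof (rule ccontr)
      assume "?S x \<noteq> {}"
      then obtain y z where yz: "p y \<noteq> \<zero>" "q z \<noteq> \<zero>" "y + z = x" by (auto simp: mono_mult)
      have "m + m' \<le> x" using that by simp
      then have "x = m + m'" using key[OF yz] by blast
      then show False using that by simp
    qed
    show ?thesis unfolding app S0 by (rule finsum_empty)
  qed
  moreover have "p \<otimes>\<^bsub>MP\<^esub> q \<in> carrier MP" using p q by (auto simp: lead_def)
  ultimately show ?thesis by (simp add: lead_def)
qed

lemma lead_mterm: "\<lbrakk>set_mset m \<subseteq> {1..n}; a \<in> carrier A\<rbrakk> \<Longrightarrow> lead (mterm A m a) m a"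
  unfolding lead_def by (intro conjI mterm_MP) (auto simp: mterm_def)

lemma one_MP: "\<one>\<^bsub>MP\<^esub> = mterm A {#} \<one>"
  unfolding MP_simps M.one_eq by (simp add: mono_one)

lemma lead_one: "lead \<one>\<^bsub>MP\<^esub> {#} \<one>"
  unfolding one_MP by (rule lead_mterm) auto

lemma lead_pow: "lead p m \<one> \<Longrightarrow> lead (p [^]\<^bsub>MP\<^esub> (k::nat)) (repeat_mset k m) \<one>"
proof (induction k)
  case 0 then show ?case using lead_one by simp
next
  case (Suc k)
  then show ?case using lead_mult[of "p [^]\<^bsub>MP\<^esub> k" "repeat_mset k m" \<one> p m \<one>]
    by (simp add: add.commute)
qed

lemma lead_finprod:
  assumes "finite I" "\<And>i. i \<in> I \<Longrightarrow> lead (f i) (m i) \<one>"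
  shows "lead (\<Otimes>\<^bsub>MP\<^esub>i\<in>I. f i) (\<Sum>i\<in>I. m i) \<one>"
  using assms
proof (induction I rule: finite_induct)
  case empty then show ?case using lead_one by simp
next
  case (insert i I)
  have "(\<Otimes>\<^bsub>MP\<^esub>i\<in>insert i I. f i) = f i \<otimes>\<^bsub>MP\<^esub> (\<Otimes>\<^bsub>MP\<^esub>i\<in>I. f i)"
    using insert by (intro MP.finprod_insert) (auto simp: lead_def)
  then show ?case using insert lead_mult[of "f i" "m i" \<one> "\<Otimes>\<^bsub>MP\<^esub>i\<in>I. f i" "\<Sum>i\<in>I. m i" \<one>] by simp
qed

lemma lead_exists:
  assumes p: "p \<in> carrier MP" "p \<noteq> \<zero>\<^bsub>MP\<^esub>"
  obtains m where "lead p m (p m)" "p m \<noteq> \<zero>"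
proof -
  let ?S = "{m. p m \<noteq> \<zero>}"
  have fin: "finite ?S" using M.carrierD(2) p by (simp add: MP_simps)
  have ne: "?S \<noteq> {}" using p by (auto simp: MP_simps fun_eq_iff M.zero_apply)
  have "Max ?S \<in> ?S" by (rule Max_in[OF fin ne])
  then have "p (Max ?S) \<noteq> \<zero>" by blast
  moreover have "p m' = \<zero>" if "Max ?S < m'" for m'
    using Max_ge[OF fin, of m'] that by (auto simp: not_le[symmetric])
  then have "lead p (Max ?S) (p (Max ?S))" unfolding lead_def using p(1) by blast
  ultimately show ?thesis by (intro that)
qed

text \<open>If \<open>p - q\<close> were nonzero, its leading coefficient would reappear in its
  product with \<open>v\<close>. So \<open>v\<close> is cancellable whatever \<open>A\<close>
  is.\<close>

lemma lead_one_cancel: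
  assumes v: "lead v m \<one>" and pq: "p \<in> carrier MP" "q \<in> carrier MP"
    and eq: "v \<otimes>\<^bsub>MP\<^esub> p = v \<otimes>\<^bsub>MP\<^esub> q"
  shows "p = q"
proof (rule ccontr)
  assume "p \<noteq> q"
  then have "p \<ominus>\<^bsub>MP\<^esub> q \<noteq> \<zero>\<^bsub>MP\<^esub>" using pq by (simp add: MP.r_right_minus_eq)
  then obtain m' where m': "lead (p \<ominus>\<^bsub>MP\<^esub> q) m' ((p \<ominus>\<^bsub>MP\<^esub> q) m')" and nz: "(p \<ominus>\<^bsub>MP\<^esub> q) m' \<noteq> \<zero>"
    using lead_exists[of "p \<ominus>\<^bsub>MP\<^esub> q"] pq by blast
  have vc: "v \<in> carrier MP" using v by (simp add: lead_def)
  have "(p \<ominus>\<^bsub>MP\<^esub> q) m' \<in> carrier A"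
    using M.carrierD(1)[of "p \<ominus>\<^bsub>MP\<^esub> q"] MP.minus_closed[OF pq] unfolding MP_simps(1) by blast
  then have "(v \<otimes>\<^bsub>MP\<^esub> (p \<ominus>\<^bsub>MP\<^esub> q)) (m + m') = (p \<ominus>\<^bsub>MP\<^esub> q) m'"
    using lead_mult[OF v m'] by (simp add: lead_def)
  moreover have "v \<otimes>\<^bsub>MP\<^esub> (p \<ominus>\<^bsub>MP\<^esub> q) = \<zero>\<^bsub>MP\<^esub>"
    using vc pq eq by (simp add: MP.minus_eq MP.r_distr MP.r_minus MP.r_neg)
  ultimately show False using nz by (simp add: MP_simps M.zero_apply)
qed

section \<open>Elementary symmetric polynomials\<close>

abbreviation "cs \<equiv> elem_sym A n"

lemma prod_Zv: "J \<subseteq> {1..n} \<Longrightarrow> (\<Otimes>\<^bsub>MP\<^esub>j\<in>J. Zv j) = mterm A (mset_set J) \<one>"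
proof -
  assume J: "J \<subseteq> {1..n}"
  have "finite J" using J finite_subset by blast
  then show ?thesis using J
  proof (induction J rule: finite_induct)
    case empty show ?case by (simp only: MP.finprod_empty mset_set.empty one_MP)
  next
    case (insert j J)
    have "(\<Otimes>\<^bsub>MP\<^esub>j\<in>insert j J. Zv j) = Zv j \<otimes>\<^bsub>MP\<^esub> (\<Otimes>\<^bsub>MP\<^esub>j\<in>J. Zv j)"
      using insert by (intro MP.finprod_insert) (auto intro!: Zv_closed)
    also have "\<dots> = mterm A {#j#} \<one> \<otimes>\<^bsub>MP\<^esub> mterm A (mset_set J) \<one>" using insert by (simp add: Z_var_def)
    also have "\<dots> = mterm A ({#j#} + mset_set J) (\<one> \<otimes> \<one>)"
      using insert by (intro mterm_mult_MP) auto
    finally show ?case using insert by simp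
  qed
qed

lemma prod_mono_closed: "J \<subseteq> {1..n} \<Longrightarrow> mterm A (mset_set J) \<one> \<in> carrier MP"
proof -
  assume J: "J \<subseteq> {1..n}"
  then have "finite J" by (rule finite_subset) simp
  then show ?thesis using J by (intro mterm_MP) auto
qed

lemma cs_alt: "cs i = (\<Oplus>\<^bsub>MP\<^esub>J\<in>{J. J \<subseteq> {1..n} \<and> card J = i}. mterm A (mset_set J) \<one>)"
  unfolding elem_sym_def
  by (rule MP.finsum_cong') (auto simp: prod_Zv intro!: prod_mono_closed)

lemma cs_closed [simp]: "cs i \<in> carrier MP"
  unfolding cs_alt by (rule MP.finsum_closed) (auto intro!: prod_mono_closed)

text \<open>Distinct sets of variables give distinct monomials with coefficient \<open>1\<close>,
  and the set of the \<open>i\<close> largest variables gives the largest of them.\<close>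

lemma cs_lead:
  assumes i: "i \<in> {1..n}"
  shows "lead (cs i) (mset_set {n - i + 1..n}) \<one>"
proof -
  let ?S = "{J. J \<subseteq> {1..n} \<and> card J = i}" and ?J0 = "{n - i + 1..n}"
  have finS: "finite ?S" by simp
  have app: "cs i m = (\<Oplus>J\<in>?S. mterm A (mset_set J) \<one> m)" for m
    unfolding cs_alt by (rule MP_finsum_apply) (auto intro!: prod_mono_closed)
  have J0: "?J0 \<in> ?S" using i by auto
  have less: "mset_set J < mset_set ?J0" if J: "J \<in> ?S" "J \<noteq> ?J0" for J
  proof (rule mset_lessI)
    have fJ: "finite J" using J finite_subset by blast
    show "mset_set J \<noteq> mset_set ?J0" using J fJ by (metis finite_atLeastAtMost finite_set_mset_mset_set)
    have cnt: "count (mset_set K) x = (if x \<in> K then 1 else 0)" if "finite K" for K :: "nat set" and x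
      using that by (simp add: count_mset_set')
    fix y assume "count (mset_set ?J0) y < count (mset_set J) y"
    then have "(if y \<in> ?J0 then 1 else 0 :: nat) < (if y \<in> J then 1 else 0)"
      by (simp only: cnt[OF fJ] cnt[OF finite_atLeastAtMost])
    then have y: "y \<in> J" "y \<notin> ?J0" by (simp_all only: split: if_split_asm) simp_all
    then have "y \<le> n" using J by auto
    \<comment> \<open>Both sets have \<open>i\<close> elements, so some \<open>x\<close> of the top
      segment is missing from \<open>J\<close>; it exceeds the given \<open>y\<close>, which lies
      below that segment.\<close>
    have "\<not> ?J0 \<subseteq> J"
    proof
      assume "?J0 \<subseteq> J"
      then have "?J0 = J" using card_subset_eq[OF fJ] J J0 by auto
      then show False using J by simp
    qed
    then obtain x where x: "x \<in> ?J0" "x \<notin> J" by blast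
    then have "y < x" using y \<open>y \<le> n\<close> by auto
    then show "\<exists>x>y. count (mset_set J) x < count (mset_set ?J0) x"
      using x by (intro exI[of _ x]) (simp only: cnt[OF fJ] cnt[OF finite_atLeastAtMost], simp)
  qed
  have "cs i (mset_set ?J0) = mterm A (mset_set ?J0) \<one> (mset_set ?J0)"
    unfolding app
  proof (rule finsum_single[OF finS J0])
    fix J assume "J \<in> ?S" "J \<noteq> ?J0"
    then have "mset_set J < mset_set ?J0" by (rule less)
    then have "mset_set ?J0 \<noteq> mset_set J" by (rule less_imp_neq[THEN not_sym])
    then show "mterm A (mset_set J) \<one> (mset_set ?J0) = \<zero>" by (simp only: mterm_def if_False)
  qed (simp add: mterm_def)
  moreover have "cs i m = \<zero>" if m: "mset_set ?J0 < m" for m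
    unfolding app
  proof (rule add.finprod_one_eqI)
    fix J assume J: "J \<in> ?S"
    have "mset_set J \<le> mset_set ?J0" using less[OF J] by (cases "J = ?J0") auto
    then have "mset_set J < m" using m by (rule le_less_trans)
    then have "m \<noteq> mset_set J" by (rule less_imp_neq[THEN not_sym])
    then show "mterm A (mset_set J) \<one> m = \<zero>" by (simp only: mterm_def if_False)
  qed
  ultimately show ?thesis by (simp add: lead_def mterm_def)
qed

definition cmono :: "nat multiset \<Rightarrow> (nat multiset \<Rightarrow> 'a)"
  where "cmono m = (\<Otimes>\<^bsub>MP\<^esub>i\<in>{1..n}. cs i [^]\<^bsub>MP\<^esub> count m i)"

text \<open>The leading monomial of \<open>cmono m\<close>: each factor \<open>c_i\<close>
  contributes the product of the \<open>i\<close> largest variables.\<close>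

definition lmono :: "nat multiset \<Rightarrow> nat multiset"
  where "lmono m = (\<Sum>i\<in>{1..n}. repeat_mset (count m i) (mset_set {n - i + 1..n}))"

lemma cmono_lead: "lead (cmono m) (lmono m) \<one>"
  unfolding cmono_def lmono_def by (intro lead_finprod lead_pow cs_lead) auto

lemma cmono_closed [simp]: "cmono m \<in> carrier MP"
  using cmono_lead by (simp add: lead_def)

text \<open>The exponent of \<open>Z_(n-j+1)\<close> in \<open>lmono m\<close> is the sum of the
  \<open>count m i\<close> with \<open>i \<ge> j\<close>, and successive differences of these tail
  sums recover \<open>m\<close>.\<close>

lemma lmono_inj:
  assumes "set_mset m \<subseteq> {1..n}" "set_mset m' \<subseteq> {1..n}" "lmono m = lmono m'"
  shows "m = m'"
proof (rule multiset_eqI)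
  have tail: "count (lmono m) (n - j + 1) = (\<Sum>i\<in>{j..n}. count m i)" if "j \<in> {1..n}" for m j
  proof -
    have "count (lmono m) (n - j + 1)
      = (\<Sum>i\<in>{1..n}. count m i * count (mset_set {n - i + 1..n}) (n - j + 1))"
      by (simp add: lmono_def count_sum)
    also have "\<dots> = (\<Sum>i\<in>{1..n}. if i \<in> {j..n} then count m i else 0)"
      by (rule sum.cong) (use that in \<open>auto simp: count_mset_set'\<close>)
    also have "\<dots> = (\<Sum>i\<in>{j..n}. count m i)"
      by (rule sum.mono_neutral_cong_right) (use that in auto)
    finally show ?thesis .
  qed
  have te: "(\<Sum>i\<in>{j..n}. count m i) = (\<Sum>i\<in>{j..n}. count m' i)" if "1 \<le> j" for j
    using tail[of j m] tail[of j m'] assms(3) that by (cases "j \<le> n") auto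
  fix i
  show "count m i = count m' i"
  proof (cases "i \<in> {1..n}")
    case True
    then have "{i..n} = insert i {Suc i..n}" by auto
    then have "(\<Sum>i\<in>{i..n}. count k i) = count k i + (\<Sum>i\<in>{Suc i..n}. count k i)" for k by simp
    then show ?thesis using te[of i] te[of "Suc i"] True by simp
  next
    case False
    then have "i \<notin># m" "i \<notin># m'" using assms by auto
    then show ?thesis by (simp add: not_in_iff)
  qed
qed

text \<open>Substitution of \<open>c_i(Z)\<close> for \<open>Z_i\<close>. The ring \<open>MP\<close>
  plays two roles, as the polynomial ring on free generators and as the ring that contains the
  \<open>c_i(Z)\<close>; \<open>theta\<close> identifies the first with the subalgebra generated by
  the \<open>c_i(Z)\<close> in the second.\<close>

definition theta :: "(nat multiset \<Rightarrow> 'a) \<Rightarrow> (nat multiset \<Rightarrow> 'a)"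
  where "theta = mr_eval A MP cst cmono"

lemma mono_eval_hom:
  assumes h: "ring_hom_cring A C h" and c: "\<And>i. i \<in> {1..n} \<Longrightarrow> c i \<in> carrier C"
  defines "w \<equiv> \<lambda>m. \<Otimes>\<^bsub>C\<^esub>i\<in>{1..n}. c i [^]\<^bsub>C\<^esub> count m i"
  shows "ring_hom_cring MP C (mr_eval A C h w)"
    and "\<And>a. a \<in> carrier A \<Longrightarrow> mr_eval A C h w (cst a) = h a"
    and "\<And>i. i \<in> {1..n} \<Longrightarrow> mr_eval A C h w (Zv i) = c i"
proof -
  interpret h: ring_hom_cring A C h by fact
  have wc: "w m \<in> carrier C" for m unfolding w_def using c by (intro h.S.finprod_closed) auto
  have w0: "w {#} = \<one>\<^bsub>C\<^esub>" unfolding w_def by (rule h.S.finprod_one_eqI) simp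
  have "ring_hom_cring KA C (mr_eval A C h w)"
  proof (rule M.eval_hom[OF h])
    show "w \<in> carrier (monomials n) \<rightarrow> carrier C" using wc by auto
    show "w \<one>\<^bsub>monomials n\<^esub> = \<one>\<^bsub>C\<^esub>" by (simp add: mono_one w0)
    fix m m' :: "nat multiset"
    have "w (m + m') = (\<Otimes>\<^bsub>C\<^esub>i\<in>{1..n}. c i [^]\<^bsub>C\<^esub> count m i \<otimes>\<^bsub>C\<^esub> c i [^]\<^bsub>C\<^esub> count m' i)"
      unfolding w_def by (rule h.S.finprod_cong') (use c in \<open>auto simp: h.S.nat_pow_mult\<close>)
    also have "\<dots> = w m \<otimes>\<^bsub>C\<^esub> w m'" unfolding w_def
      by (rule h.S.finprod_multf) (use c in auto)
    finally show "w (m \<otimes>\<^bsub>monomials n\<^esub> m') = w m \<otimes>\<^bsub>C\<^esub> w m'" by (simp add: mono_mult)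
  qed
  then show "ring_hom_cring MP C (mr_eval A C h w)" by (simp add: hom_MP_iff)
  show "mr_eval A C h w (cst a) = h a" if "a \<in> carrier A" for a
    by (subst M.eval_mterm[OF h]) (use that wc w0 in \<open>auto simp: mono_carrier\<close>)
  show "mr_eval A C h w (Zv i) = c i" if i: "i \<in> {1..n}" for i
  proof -
    have "w {#i#} = c i [^]\<^bsub>C\<^esub> count {#i#} i"
      unfolding w_def by (rule h.S.finprod_single) (use i c in auto)
    then have "w {#i#} = c i" using c[OF i] by simp
    then show ?thesis unfolding Z_var_def
      by (subst M.eval_mterm[OF h]) (use i c wc in \<open>auto simp: mono_carrier\<close>)
  qed
qed

lemma theta_hom: "ring_hom_cring MP MP theta"
  and theta_cst: "a \<in> carrier A \<Longrightarrow> theta (cst a) = cst a"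
  and theta_Zv: "i \<in> {1..n} \<Longrightarrow> theta (Zv i) = cs i"
proof -
  have c: "cs i \<in> carrier MP" for i by simp
  have w: "cmono = (\<lambda>m. \<Otimes>\<^bsub>MP\<^esub>i\<in>{1..n}. cs i [^]\<^bsub>MP\<^esub> count m i)" by (simp add: cmono_def fun_eq_iff)
  show "ring_hom_cring MP MP theta" unfolding theta_def w by (rule mono_eval_hom(1)[OF cst_hom c])
  show "theta (cst a) = cst a" if "a \<in> carrier A"
    unfolding theta_def w by (rule mono_eval_hom(2)[OF cst_hom c that])
  show "theta (Zv i) = cs i" if "i \<in> {1..n}"
    unfolding theta_def w by (rule mono_eval_hom(3)[OF cst_hom c that])
qed

sublocale theta: ring_hom_cring MP MP theta by (rule theta_hom)

text \<open>Distinct monomials have images with distinct leading monomials and leading coefficient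
  \<open>1\<close>. The largest of these cannot cancel, so it would show a nonzero coefficient of
  \<open>p\<close> in the image.\<close>

lemma theta_zero:
  assumes p: "p \<in> carrier MP" and z: "theta p = \<zero>\<^bsub>MP\<^esub>"
  shows "p = \<zero>\<^bsub>MP\<^esub>"
proof (rule ccontr)
  assume nz: "p \<noteq> \<zero>\<^bsub>MP\<^esub>"
  let ?S = "{m. p m \<noteq> \<zero>}"
  have pK: "p \<in> carrier KA" using p by (simp add: MP_simps)
  have fin: "finite ?S" and Sm: "\<And>m. m \<in> ?S \<Longrightarrow> set_mset m \<subseteq> {1..n}"
    using M.carrierD[OF pK] by (auto simp: mono_carrier)
  have pc: "p m \<in> carrier A" for m by (rule M.carrierD(1)[OF pK])
  have ne: "?S \<noteq> {}" using nz by (auto simp: MP_simps fun_eq_iff M.zero_apply)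
  have "Max (lmono ` ?S) \<in> lmono ` ?S" using fin ne by (intro Max_in) auto
  then obtain m0 where m0: "m0 \<in> ?S" "lmono m0 = Max (lmono ` ?S)" by auto
  have less: "lmono m < lmono m0" if "m \<in> ?S" "m \<noteq> m0" for m
  proof -
    have "lmono m \<le> lmono m0" unfolding m0(2) using fin that by (intro Max_ge) auto
    moreover have "lmono m \<noteq> lmono m0" using lmono_inj Sm that m0 by blast
    ultimately show ?thesis by simp
  qed
  have ld: "lead (cst (p m) \<otimes>\<^bsub>MP\<^esub> cmono m) (lmono m) (p m)" for m
    using lead_mult[OF lead_mterm[of "{#}" "p m"] cmono_lead[of m]] pc by simp
  have "theta p = (\<Oplus>\<^bsub>MP\<^esub>m\<in>?S. cst (p m) \<otimes>\<^bsub>MP\<^esub> cmono m)"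
    by (simp add: theta_def mr_eval_def)
  then have "theta p (lmono m0) = (\<Oplus>m\<in>?S. (cst (p m) \<otimes>\<^bsub>MP\<^esub> cmono m) (lmono m0))"
    using MP_finsum_apply[OF fin, of "\<lambda>m. cst (p m) \<otimes>\<^bsub>MP\<^esub> cmono m"] ld by (simp add: lead_def)
  also have "\<dots> = (cst (p m0) \<otimes>\<^bsub>MP\<^esub> cmono m0) (lmono m0)"
  proof (rule finsum_single[OF fin m0(1)])
    show "(cst (p m0) \<otimes>\<^bsub>MP\<^esub> cmono m0) (lmono m0) \<in> carrier A" using ld[of m0] pc by (simp add: lead_def)
    fix m assume "m \<in> ?S" "m \<noteq> m0"
    then show "(cst (p m) \<otimes>\<^bsub>MP\<^esub> cmono m) (lmono m0) = \<zero>" using ld[of m] less by (simp add: lead_def)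
  qed
  also have "\<dots> = p m0" using ld[of m0] by (simp add: lead_def)
  finally show False using m0(1) z by (simp add: MP_simps M.zero_apply)
qed

lemma theta_inj: "\<lbrakk>p \<in> carrier MP; q \<in> carrier MP; theta p = theta q\<rbrakk> \<Longrightarrow> p = q"
  using theta_zero[of "p \<ominus>\<^bsub>MP\<^esub> q"] by (simp add: MP.minus_eq MP.r_neg MP.r_right_minus_eq[unfolded MP.minus_eq])

section \<open>The algebra generated by the elementary symmetric polynomials\<close>

abbreviation "Es \<equiv> elem_sym_algebra A n"
abbreviation "gens \<equiv> cst ` carrier A \<union> cs ` {1..n}"

lemma gens_closed: "gens \<subseteq> carrier MP" by auto

lemma Es_simps:
  "carrier Es = generate_ring MP gens" "monoid.mult Es = monoid.mult MP" "monoid.one Es = monoid.one MP"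
  "ring.zero Es = ring.zero MP" "ring.add Es = ring.add MP" "a \<odot>\<^bsub>Es\<^esub> t = a \<odot>\<^bsub>MP\<^esub> t"
  by (simp_all add: elem_sym_algebra_def)

lemma Es_subring: "subring (carrier Es) MP"
  unfolding Es_simps by (rule MP.generate_ring_is_subring[OF gens_closed])

lemma Es_carrier: "p \<in> carrier Es \<Longrightarrow> p \<in> carrier MP"
  using subringE(1)[OF Es_subring] by blast

lemma cst_Es [simp]: "a \<in> carrier A \<Longrightarrow> cst a \<in> carrier Es"
  and cs_Es [simp]: "i \<in> {1..n} \<Longrightarrow> cs i \<in> carrier Es"
  unfolding Es_simps by (auto intro!: generate_ring.incl)

lemma Es_cring: "cring Es"
proof -
  have "cring (MP\<lparr>carrier := carrier Es\<rparr>)"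
    using MP.subcring_iff[of "carrier Es"] MP.subcringI'[OF Es_subring] Es_carrier by blast
  then show ?thesis by (simp add: elem_sym_algebra_def)
qed

sublocale Es: cring Es by (rule Es_cring)

lemma Es_incl: "ring_hom_cring Es MP (\<lambda>p. p)"
  by (rule ring_hom_cringI'[OF Es_cring MP_cring], rule ring_hom_memI) (auto simp: Es_simps(2-5) Es_carrier)

lemma cst_Es_hom: "ring_hom_cring A Es cst"
  by (rule ring_hom_cringI'[OF A.is_cring Es_cring], rule ring_hom_memI)
    (auto simp: Es_simps(2-5))

lemma Es_smult_one: "a \<in> carrier A \<Longrightarrow> a \<odot>\<^bsub>Es\<^esub> \<one>\<^bsub>Es\<^esub> = cst a"
  using MP.r_one[of "cst a"] by (simp add: Es_simps MP_simps(6))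

lemma theta_image: "theta ` carrier MP = carrier Es"
proof
  show "theta ` carrier MP \<subseteq> carrier Es"
  proof clarify
    fix p assume p: "p \<in> carrier MP"
    have pK: "p \<in> carrier KA" using p by (simp add: MP_simps)
    interpret i: ring_hom_cring Es MP "\<lambda>p. p" by (rule Es_incl)
    have ce: "(\<Otimes>\<^bsub>Es\<^esub>i\<in>{1..n}. cs i [^]\<^bsub>Es\<^esub> count m i) = cmono m" for m
    proof -
      have "(\<Otimes>\<^bsub>Es\<^esub>i\<in>{1..n}. cs i [^]\<^bsub>Es\<^esub> count m i) = (\<Otimes>\<^bsub>MP\<^esub>i\<in>{1..n}. cs i [^]\<^bsub>Es\<^esub> count m i)"
      proof -
        have "(\<lambda>i. cs i [^]\<^bsub>Es\<^esub> count m i) \<in> {1..n} \<rightarrow> carrier Es"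
          by (intro Pi_I Es.nat_pow_closed cs_Es)
        from i.hom_finprod[OF this] show ?thesis by (simp only: comp_def)
      qed
      also have "\<dots> = cmono m" unfolding cmono_def
        by (rule MP.finprod_cong') (auto simp: i.hom_pow)
      finally show ?thesis .
    qed
    have cE: "cmono m \<in> carrier Es" for m
      unfolding ce[symmetric] by (rule Es.finprod_closed) (auto intro!: Es.nat_pow_closed)
    have mc: "cst (p m) \<otimes>\<^bsub>Es\<^esub> cmono m \<in> carrier Es" for m
      using M.carrierD(1)[OF pK] cE by (intro Es.m_closed cst_Es) auto
    have "theta p = (\<Oplus>\<^bsub>MP\<^esub>m\<in>{m. p m \<noteq> \<zero>}. cst (p m) \<otimes>\<^bsub>MP\<^esub> cmono m)"
      by (simp add: theta_def mr_eval_def)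
    also have "\<dots> = (\<Oplus>\<^bsub>Es\<^esub>m\<in>{m. p m \<noteq> \<zero>}. cst (p m) \<otimes>\<^bsub>Es\<^esub> cmono m)"
    proof -
      have "(\<lambda>m. cst (p m) \<otimes>\<^bsub>Es\<^esub> cmono m) \<in> {m. p m \<noteq> \<zero>} \<rightarrow> carrier Es" using mc by auto
      from i.hom_finsum[OF this] show ?thesis by (simp only: comp_def Es_simps(2))
    qed
    also have "\<dots> \<in> carrier Es" using mc by (intro Es.finsum_closed) auto
    finally show "theta p \<in> carrier Es" .
  qed
  have "subring (theta ` carrier MP) MP"
    by (rule theta.ring.img_is_subring[OF MP.carrier_is_subring])
  moreover have "gens \<subseteq> theta ` carrier MP"
  proof
    fix g assume "g \<in> gens"
    then consider a where "a \<in> carrier A" "g = cst a" | i where "i \<in> {1..n}" "g = cs i" by blast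
    then show "g \<in> theta ` carrier MP"
    proof cases
      case 1 then show ?thesis using theta_cst cst.hom_closed by (metis imageI)
    next
      case 2 then show ?thesis using theta_Zv Zv_closed by (metis imageI)
    qed
  qed
  ultimately show "carrier Es \<subseteq> theta ` carrier MP"
    unfolding Es_simps by (rule MP.generate_ring_min_subring1[OF gens_closed])
qed

text \<open>The universal property of the polynomial ring is transported along the isomorphism
  \<open>theta\<close>: \<open>g\<close> is evaluation at the \<open>c i\<close> after the inverse
  of \<open>theta\<close>.\<close>

lemma Es_universal:
  assumes h: "ring_hom_cring A C h" and c: "\<And>i. i \<in> {1..n} \<Longrightarrow> c i \<in> carrier C"
  shows "\<exists>g. ring_hom_cring Es C g \<and> (\<forall>a\<in>carrier A. g (cst a) = h a) \<and> (\<forall>i\<in>{1..n}. g (cs i) = c i)"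
proof -
  define w where "w = (\<lambda>m. \<Otimes>\<^bsub>C\<^esub>i\<in>{1..n}. c i [^]\<^bsub>C\<^esub> count m i)"
  define f where "f = mr_eval A C h w"
  have f: "ring_hom_cring MP C f" "\<And>a. a \<in> carrier A \<Longrightarrow> f (cst a) = h a"
    "\<And>i. i \<in> {1..n} \<Longrightarrow> f (Zv i) = c i"
    unfolding f_def w_def using mono_eval_hom[OF h c] by auto
  interpret f: ring_hom_cring MP C f by (rule f(1))
  define g where "g = (\<lambda>y. f (inv_into (carrier MP) theta y))"
  have gt: "g (theta p) = f p" if "p \<in> carrier MP" for p
  proof -
    have "inj_on theta (carrier MP)" by (rule inj_onI) (rule theta_inj)
    then show ?thesis unfolding g_def using that by (simp only: inv_into_f_f)
  qed
  have ex: "\<exists>p\<in>carrier MP. y = theta p" if "y \<in> carrier Es" for y using theta_image that by blast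
  have "ring_hom_cring Es C g"
  proof (rule ring_hom_cringI'[OF Es_cring f.S.is_cring], rule ring_hom_memI)
    fix y z assume "y \<in> carrier Es" "z \<in> carrier Es"
    then obtain p q where pq: "p \<in> carrier MP" "y = theta p" "q \<in> carrier MP" "z = theta q" using ex by metis
    show "g (y \<otimes>\<^bsub>Es\<^esub> z) = g y \<otimes>\<^bsub>C\<^esub> g z"
    proof -
      have "y \<otimes>\<^bsub>Es\<^esub> z = theta (p \<otimes>\<^bsub>MP\<^esub> q)"
        unfolding pq(2,4) Es_simps(2) by (rule theta.hom_mult[OF pq(1,3), symmetric])
      then have "g (y \<otimes>\<^bsub>Es\<^esub> z) = f (p \<otimes>\<^bsub>MP\<^esub> q)" using pq by (simp only: gt MP.m_closed)
      also have "\<dots> = f p \<otimes>\<^bsub>C\<^esub> f q" by (rule f.hom_mult[OF pq(1,3)])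
      finally show ?thesis unfolding pq(2,4) gt[OF pq(1)] gt[OF pq(3)] .
    qed
    show "g (y \<oplus>\<^bsub>Es\<^esub> z) = g y \<oplus>\<^bsub>C\<^esub> g z"
    proof -
      have "y \<oplus>\<^bsub>Es\<^esub> z = theta (p \<oplus>\<^bsub>MP\<^esub> q)"
        unfolding pq(2,4) Es_simps(5) by (rule theta.hom_add[OF pq(1,3), symmetric])
      then have "g (y \<oplus>\<^bsub>Es\<^esub> z) = f (p \<oplus>\<^bsub>MP\<^esub> q)" using pq by (simp only: gt MP.a_closed)
      also have "\<dots> = f p \<oplus>\<^bsub>C\<^esub> f q" by (rule f.hom_add[OF pq(1,3)])
      finally show ?thesis unfolding pq(2,4) gt[OF pq(1)] gt[OF pq(3)] .
    qed
  next
    show "g y \<in> carrier C" if "y \<in> carrier Es" for y using ex[OF that] gt by auto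
    show "g \<one>\<^bsub>Es\<^esub> = \<one>\<^bsub>C\<^esub>"
      using gt[OF MP.one_closed] unfolding theta.hom_one f.hom_one Es_simps(3) .
  qed
  moreover have "g (cst a) = h a" if "a \<in> carrier A" for a
    using gt[OF cst.hom_closed[OF that]] theta_cst[OF that] f(2)[OF that] by simp
  moreover have "g (cs i) = c i" if "i \<in> {1..n}" for i
    using gt[OF Zv_closed[OF that]] theta_Zv[OF that] f(3)[OF that] by simp
  ultimately show ?thesis by blast
qed

lemma Es_hom_unique:
  assumes g: "ring_hom_cring Es C g" and g': "ring_hom_cring Es C g'"
    and a: "\<And>a. a \<in> carrier A \<Longrightarrow> g (cst a) = g' (cst a)"
    and c: "\<And>i. i \<in> {1..n} \<Longrightarrow> g (cs i) = g' (cs i)"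
    and y: "y \<in> carrier Es"
  shows "g y = g' y"
proof -
  interpret g: ring_hom_cring Es C g by fact
  interpret g': ring_hom_cring Es C g' by fact
  have "y \<in> generate_ring MP gens" using y by (simp add: Es_simps)
  then show ?thesis
  proof (induction rule: generate_ring.induct)
    case one
    show ?case using g.hom_one g'.hom_one by (simp add: Es_simps)
  next
    case (incl h) then show ?case using a c by blast
  next
    case (a_inv h)
    have hE: "h \<in> carrier Es" using a_inv by (simp add: Es_simps)
    interpret i: ring_hom_cring Es MP "\<lambda>p. p" by (rule Es_incl)
    have m: "\<ominus>\<^bsub>MP\<^esub> h = \<ominus>\<^bsub>Es\<^esub> h" by (rule i.hom_a_inv[OF hE, symmetric])
    show ?case by (simp only: m g.hom_a_inv[OF hE] g'.hom_a_inv[OF hE] a_inv.IH)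
  next
    case (eng_add h1 h2)
    then have "h1 \<in> carrier Es" "h2 \<in> carrier Es" by (simp_all add: Es_simps)
    then show ?case using eng_add g.hom_add g'.hom_add by (simp add: Es_simps(5))
  next
    case (eng_mult h1 h2)
    then have "h1 \<in> carrier Es" "h2 \<in> carrier Es" by (simp_all add: Es_simps)
    then show ?case using eng_mult g.hom_mult g'.hom_mult by (simp add: Es_simps(2))
  qed
qed

end

section \<open>Norms\<close>

text \<open>In the induction, subsets of \<open>insert x I\<close> without \<open>x\<close> and with
  \<open>x\<close> correspond to the two summands of \<open>y - z x\<close>.\<close>

lemma (in cring) finprod_diff_expand:
  assumes "finite I" "y \<in> carrier R" "\<And>j. j \<in> I \<Longrightarrow> z j \<in> carrier R"
  shows "(\<Otimes>j\<in>I. y \<ominus> z j)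
    = (\<Oplus>J\<in>Pow I. (\<ominus> \<one>) [^] card J \<otimes> (\<Otimes>j\<in>J. z j) \<otimes> y [^] (card I - card J))"
  using assms(1,3)
proof (induction I rule: finite_induct)
  case empty
  have "(\<Oplus>J\<in>{{}}. (\<ominus> \<one>) [^] card J \<otimes> (\<Otimes>j\<in>J. z j) \<otimes> y [^] (card ({}::'c set) - card J)) = \<one>"
    by (subst finsum_single[of _ "{}"]) auto
  then show ?case by simp
next
  case (insert x I)
  let ?t = "\<lambda>I J. (\<ominus> \<one>) [^] card J \<otimes> (\<Otimes>j\<in>J. z j) \<otimes> y [^] (card I - card J)"
  have zc: "z j \<in> carrier R" if "j \<in> insert x I" for j using insert that by blast
  have pc: "(\<Otimes>j\<in>J. z j) \<in> carrier R" if "J \<subseteq> insert x I" for J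
    using zc that by (intro finprod_closed) auto
  have tc: "?t I' J \<in> carrier R" if "J \<subseteq> insert x I" for I' J :: "'c set"
    using pc[OF that] assms(2) by simp
  have fin: "finite (Pow I)" "finite (insert x ` Pow I)" using insert by auto
  have "(\<Otimes>j\<in>insert x I. y \<ominus> z j) = (y \<ominus> z x) \<otimes> (\<Otimes>j\<in>I. y \<ominus> z j)"
    using insert zc assms(2) by (intro finprod_insert) auto
  also have "(\<Otimes>j\<in>I. y \<ominus> z j) = (\<Oplus>J\<in>Pow I. ?t I J)" using insert by auto
  also have "(y \<ominus> z x) \<otimes> (\<Oplus>J\<in>Pow I. ?t I J)
    = y \<otimes> (\<Oplus>J\<in>Pow I. ?t I J) \<oplus> (\<ominus> z x) \<otimes> (\<Oplus>J\<in>Pow I. ?t I J)"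
    unfolding minus_eq by (rule l_distr) (use assms(2) zc tc in \<open>auto intro!: finsum_closed\<close>)
  also have "y \<otimes> (\<Oplus>J\<in>Pow I. ?t I J) = (\<Oplus>J\<in>Pow I. y \<otimes> ?t I J)"
    by (rule finsum_rdistr) (use fin assms(2) tc in auto)
  also have "\<dots> = (\<Oplus>J\<in>Pow I. ?t (insert x I) J)"
  proof (rule finsum_cong')
    fix J assume J: "J \<in> Pow I"
    then have "card J \<le> card I" using insert by (simp add: card_mono)
    then have e: "card (insert x I) - card J = Suc (card I - card J)" using insert by simp
    have "?t (insert x I) J = (\<ominus> \<one>) [^] card J \<otimes> (\<Otimes>j\<in>J. z j) \<otimes> (y [^] (card I - card J) \<otimes> y)"
      unfolding e by simp
    moreover have "(\<Otimes>j\<in>J. z j) \<in> carrier R" using pc J by auto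
    ultimately show "y \<otimes> ?t I J = ?t (insert x I) J" using assms(2) by (simp add: m_ac)
  qed (use tc in auto)
  also have "(\<ominus> z x) \<otimes> (\<Oplus>J\<in>Pow I. ?t I J) = (\<Oplus>J\<in>Pow I. (\<ominus> z x) \<otimes> ?t I J)"
    by (rule finsum_rdistr) (use fin zc tc in auto)
  also have "\<dots> = (\<Oplus>J\<in>Pow I. ?t (insert x I) (insert x J))"
  proof (rule finsum_cong')
    fix J assume J: "J \<in> Pow I"
    then have fJ: "finite J" "x \<notin> J" using insert finite_subset by auto
    have e: "card (insert x I) - card (insert x J) = card I - card J" using insert fJ by simp
    have e': "(\<Otimes>j\<in>insert x J. z j) = z x \<otimes> (\<Otimes>j\<in>J. z j)"
      using fJ zc J by (intro finprod_insert) auto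
    have pJ: "(\<Otimes>j\<in>J. z j) \<in> carrier R" using pc J by auto
    have "?t (insert x I) (insert x J)
      = ((\<ominus> \<one>) [^] card J \<otimes> (\<ominus> \<one>)) \<otimes> (z x \<otimes> (\<Otimes>j\<in>J. z j)) \<otimes> y [^] (card I - card J)"
      unfolding e e' using fJ by simp
    also have "\<dots> = ((\<ominus> \<one>) \<otimes> z x) \<otimes> ?t I J"
      using pJ zc[of x] assms(2) by (simp add: m_ac del: l_minus r_minus)
    also have "(\<ominus> \<one>) \<otimes> z x = \<ominus> z x" using zc[of x] by (simp add: l_minus)
    finally show "(\<ominus> z x) \<otimes> ?t I J = ?t (insert x I) (insert x J)" by simp
  next
    show "(\<lambda>J. ?t (insert x I) (insert x J)) \<in> Pow I \<rightarrow> carrier R" by (intro Pi_I tc) auto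
  qed simp
  also have "\<dots> = (\<Oplus>J\<in>insert x ` Pow I. ?t (insert x I) J)"
  proof (rule finsum_reindex[symmetric])
    show "inj_on (insert x) (Pow I)" using insert(2) by (auto simp: inj_on_def)
    show "(\<lambda>J. ?t (insert x I) J) \<in> insert x ` Pow I \<rightarrow> carrier R"
      by (intro Pi_I tc) auto
  qed
  also have "(\<Oplus>J\<in>Pow I. ?t (insert x I) J) \<oplus> (\<Oplus>J\<in>insert x ` Pow I. ?t (insert x I) J)
    = (\<Oplus>J\<in>Pow I \<union> insert x ` Pow I. ?t (insert x I) J)"
  proof (rule finsum_Un_disjoint[symmetric])
    show "finite (Pow I)" "finite (insert x ` Pow I)" using fin by auto
    show "Pow I \<inter> insert x ` Pow I = {}" using insert(2) by auto
    show "(\<lambda>J. ?t (insert x I) J) \<in> Pow I \<rightarrow> carrier R" by (intro Pi_I tc) auto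
    show "(\<lambda>J. ?t (insert x I) J) \<in> insert x ` Pow I \<rightarrow> carrier R" by (intro Pi_I tc) auto
  qed
  also have "Pow I \<union> insert x ` Pow I = Pow (insert x I)" by (simp add: Pow_insert)
  finally show ?case .
qed

lemma hom_lincomb:
  assumes p: "pring R S h x" and g: "ring_hom_cring S C g"
    and k: "\<And>b. b \<in> carrier R \<Longrightarrow> g (h b) = k b" and y: "g x = y"
    and c: "\<And>i. i < n \<Longrightarrow> c i \<in> carrier R"
  shows "g (lincomb S h x n c) = lincomb C k y n c"
proof -
  interpret p: pring R S h x by fact
  interpret g: ring_hom_cring S C g by fact
  have "g (lincomb S h x n c) = (\<Oplus>\<^bsub>C\<^esub>i\<in>{..<n}. g (h (c i) \<otimes>\<^bsub>S\<^esub> x [^]\<^bsub>S\<^esub> i))"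
    unfolding lincomb_def by (subst g.hom_finsum) (use c in \<open>auto simp: comp_def\<close>)
  also have "\<dots> = lincomb C k y n c"
    unfolding lincomb_def
  proof (rule g.S.finsum_cong')
    fix i assume "i \<in> {..<n}"
    then have ci: "c i \<in> carrier R" using c by auto
    have "g (h (c i) \<otimes>\<^bsub>S\<^esub> x [^]\<^bsub>S\<^esub> i) = g (h (c i)) \<otimes>\<^bsub>C\<^esub> g (x [^]\<^bsub>S\<^esub> i)"
      using ci by (intro g.hom_mult) auto
    also have "\<dots> = k (c i) \<otimes>\<^bsub>C\<^esub> y [^]\<^bsub>C\<^esub> i" using ci by (simp add: k y[symmetric] g.hom_pow)
    finally show "g (h (c i) \<otimes>\<^bsub>S\<^esub> x [^]\<^bsub>S\<^esub> i) = k (c i) \<otimes>\<^bsub>C\<^esub> y [^]\<^bsub>C\<^esub> i" .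
    have "k (c i) \<in> carrier C" using k[OF ci, symmetric] ci by simp
  next
    show "(\<lambda>i. k (c i) \<otimes>\<^bsub>C\<^esub> y [^]\<^bsub>C\<^esub> i) \<in> {..<n} \<rightarrow> carrier C"
    proof
      fix i assume "i \<in> {..<n}"
      then have ci: "c i \<in> carrier R" using c by auto
      have "k (c i) \<in> carrier C" using k[OF ci, symmetric] ci by simp
      moreover have "y \<in> carrier C" using y by auto
      ultimately show "k (c i) \<otimes>\<^bsub>C\<^esub> y [^]\<^bsub>C\<^esub> i \<in> carrier C" by simp
    qed
  qed simp
  finally show ?thesis .
qed

context mpoly_ring
begin

text \<open>By Vieta, minus the coefficient of \<open>y^i\<close> in
  \<open>\<Prod>(y - Z_j)\<close>. The operations are those of \<open>Es\<close>, so that the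
  universal polynomial is defined over \<open>Es\<close> rather than over \<open>MP\<close>.\<close>

definition acoef :: "nat \<Rightarrow> (nat multiset \<Rightarrow> 'a)"
  where "acoef i = \<ominus>\<^bsub>Es\<^esub> ((\<ominus>\<^bsub>Es\<^esub> \<one>\<^bsub>Es\<^esub>) [^]\<^bsub>Es\<^esub> (n - i) \<otimes>\<^bsub>Es\<^esub> cs (n - i))"

lemma acoef_closed: "i < n \<Longrightarrow> acoef i \<in> carrier Es"
  unfolding acoef_def by (intro Es.a_inv_closed Es.m_closed Es.nat_pow_closed Es.one_closed cs_Es) auto

lemma cs_zero: "cs 0 = \<one>\<^bsub>MP\<^esub>"
proof -
  have S: "{J. J \<subseteq> {1..n} \<and> card J = 0} = {{}}" by (auto dest: finite_subset)
  have "(\<Oplus>\<^bsub>MP\<^esub>J\<in>{{}}. mterm A (mset_set J) \<one>) = mterm A (mset_set {}) \<one>"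
    by (rule MP.finsum_single) (use prod_mono_closed[of "{}"] in auto)
  then show ?thesis unfolding cs_alt S by (simp only: mset_set.empty one_MP)
qed

lemma vieta:
  assumes y: "y \<in> carrier MP"
  shows "(\<Otimes>\<^bsub>MP\<^esub>j\<in>{1..n}. y \<ominus>\<^bsub>MP\<^esub> Zv j)
    = (\<Oplus>\<^bsub>MP\<^esub>i\<in>{..n}. (\<ominus>\<^bsub>MP\<^esub> \<one>\<^bsub>MP\<^esub>) [^]\<^bsub>MP\<^esub> i \<otimes>\<^bsub>MP\<^esub> cs i \<otimes>\<^bsub>MP\<^esub> y [^]\<^bsub>MP\<^esub> (n - i))"
proof -
  let ?s = "\<lambda>i::nat. (\<ominus>\<^bsub>MP\<^esub> \<one>\<^bsub>MP\<^esub>) [^]\<^bsub>MP\<^esub> i"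
  let ?t = "\<lambda>J. ?s (card J) \<otimes>\<^bsub>MP\<^esub> (\<Otimes>\<^bsub>MP\<^esub>j\<in>J. Zv j) \<otimes>\<^bsub>MP\<^esub> y [^]\<^bsub>MP\<^esub> (n - card J)"
  have pc: "(\<Otimes>\<^bsub>MP\<^esub>j\<in>J. Zv j) \<in> carrier MP" if "J \<subseteq> {1..n}" for J
    unfolding prod_Zv[OF that] by (rule prod_mono_closed[OF that])
  have sc: "?s i \<in> carrier MP" for i by simp
  have "(\<Otimes>\<^bsub>MP\<^esub>j\<in>{1..n}. y \<ominus>\<^bsub>MP\<^esub> Zv j) = (\<Oplus>\<^bsub>MP\<^esub>J\<in>Pow {1..n}. ?t J)"
    using MP.finprod_diff_expand[OF finite_atLeastAtMost y Zv_closed, of 1 n] by simp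
  also have "\<dots> = (\<Oplus>\<^bsub>MP\<^esub>i\<in>card ` Pow {1..n}. \<Oplus>\<^bsub>MP\<^esub>J\<in>{J \<in> Pow {1..n}. card J = i}. ?t J)"
    by (rule MP.finsum_fibre) (use pc sc y in \<open>auto intro!: MP.m_closed\<close>)
  also have "card ` Pow {1..n} = {..n}"
  proof
    show "card ` Pow {1..n} \<subseteq> {..n}" using card_mono[of "{1..n}"] by auto
    show "{..n} \<subseteq> card ` Pow {1..n}"
    proof
      fix i assume "i \<in> {..n}"
      then have "i = card {1..i}" "{1..i} \<in> Pow {1..n}" by auto
      then show "i \<in> card ` Pow {1..n}" by blast
    qed
  qed
  also have "(\<Oplus>\<^bsub>MP\<^esub>i\<in>{..n}. \<Oplus>\<^bsub>MP\<^esub>J\<in>{J \<in> Pow {1..n}. card J = i}. ?t J)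
    = (\<Oplus>\<^bsub>MP\<^esub>i\<in>{..n}. ?s i \<otimes>\<^bsub>MP\<^esub> cs i \<otimes>\<^bsub>MP\<^esub> y [^]\<^bsub>MP\<^esub> (n - i))"
  proof (rule MP.finsum_cong')
    fix i assume "i \<in> {..n}"
    let ?S = "{J. J \<subseteq> {1..n} \<and> card J = i}"
    have S: "{J \<in> Pow {1..n}. card J = i} = ?S" by auto
    have finS: "finite ?S" by simp
    have pS: "(\<Otimes>\<^bsub>MP\<^esub>j\<in>J. Zv j) \<in> carrier MP" if "J \<in> ?S" for J using pc that by auto
    have "(\<Oplus>\<^bsub>MP\<^esub>J\<in>?S. ?t J) = (\<Oplus>\<^bsub>MP\<^esub>J\<in>?S. ?s i \<otimes>\<^bsub>MP\<^esub> (\<Otimes>\<^bsub>MP\<^esub>j\<in>J. Zv j) \<otimes>\<^bsub>MP\<^esub> y [^]\<^bsub>MP\<^esub> (n - i))"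
    proof (rule MP.finsum_cong')
      show "(\<lambda>J. ?s i \<otimes>\<^bsub>MP\<^esub> (\<Otimes>\<^bsub>MP\<^esub>j\<in>J. Zv j) \<otimes>\<^bsub>MP\<^esub> y [^]\<^bsub>MP\<^esub> (n - i)) \<in> ?S \<rightarrow> carrier MP"
        by (intro Pi_I MP.m_closed sc pS MP.nat_pow_closed y)
    qed auto
    also have "\<dots> = (\<Oplus>\<^bsub>MP\<^esub>J\<in>?S. ?s i \<otimes>\<^bsub>MP\<^esub> (\<Otimes>\<^bsub>MP\<^esub>j\<in>J. Zv j)) \<otimes>\<^bsub>MP\<^esub> y [^]\<^bsub>MP\<^esub> (n - i)"
      by (rule MP.finsum_ldistr[symmetric]) (intro Pi_I MP.m_closed sc pS MP.nat_pow_closed y finS | assumption)+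
    also have "(\<Oplus>\<^bsub>MP\<^esub>J\<in>?S. ?s i \<otimes>\<^bsub>MP\<^esub> (\<Otimes>\<^bsub>MP\<^esub>j\<in>J. Zv j)) = ?s i \<otimes>\<^bsub>MP\<^esub> cs i"
      unfolding elem_sym_def
      by (rule MP.finsum_rdistr[symmetric]) (intro Pi_I sc pS finS | assumption)+
    finally show "(\<Oplus>\<^bsub>MP\<^esub>J\<in>{J \<in> Pow {1..n}. card J = i}. ?t J) = ?s i \<otimes>\<^bsub>MP\<^esub> cs i \<otimes>\<^bsub>MP\<^esub> y [^]\<^bsub>MP\<^esub> (n - i)"
      unfolding S .
  qed (use sc y in auto)
  finally show ?thesis .
qed

text \<open>Vieta's expansion is taken at \<open>y = Z_l\<close>, where one of the factors
  vanishes.\<close>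

lemma Zv_root:
  assumes l: "l \<in> {1..n}"
  shows "Zv l [^]\<^bsub>MP\<^esub> n = lincomb MP (\<lambda>p. p) (Zv l) n acoef"
proof -
  interpret i: ring_hom_cring Es MP "\<lambda>p. p" by (rule Es_incl)
  let ?y = "Zv l"
  have y: "?y \<in> carrier MP" by (rule Zv_closed[OF l])
  let ?s = "\<lambda>i::nat. (\<ominus>\<^bsub>MP\<^esub> \<one>\<^bsub>MP\<^esub>) [^]\<^bsub>MP\<^esub> i"
  let ?u = "\<lambda>i. ?s i \<otimes>\<^bsub>MP\<^esub> cs i \<otimes>\<^bsub>MP\<^esub> ?y [^]\<^bsub>MP\<^esub> (n - i)"
  let ?v = "\<lambda>i. ?s (n - i) \<otimes>\<^bsub>MP\<^esub> cs (n - i) \<otimes>\<^bsub>MP\<^esub> ?y [^]\<^bsub>MP\<^esub> i"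
  have uc: "?u i \<in> carrier MP" for i by (intro MP.m_closed MP.nat_pow_closed MP.a_inv_closed MP.one_closed cs_closed y)
  have vc: "?v i \<in> carrier MP" for i by (intro MP.m_closed MP.nat_pow_closed MP.a_inv_closed MP.one_closed cs_closed y)
  have zc: "?y \<ominus>\<^bsub>MP\<^esub> Zv j \<in> carrier MP" if "j \<in> {1..n}" for j by (intro MP.minus_closed y Zv_closed that)
  have "(\<Otimes>\<^bsub>MP\<^esub>j\<in>{1..n}. ?y \<ominus>\<^bsub>MP\<^esub> Zv j) = (?y \<ominus>\<^bsub>MP\<^esub> Zv l) \<otimes>\<^bsub>MP\<^esub> (\<Otimes>\<^bsub>MP\<^esub>j\<in>{1..n} - {l}. ?y \<ominus>\<^bsub>MP\<^esub> Zv j)"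
    by (rule MP.prod_dvd_split(1)[OF finite_atLeastAtMost l zc])
  also have "\<dots> = \<zero>\<^bsub>MP\<^esub>"
    using MP.prod_dvd_split(2)[OF finite_atLeastAtMost l zc] y by (simp add: MP.minus_eq MP.r_neg)
  finally have "(\<Oplus>\<^bsub>MP\<^esub>i\<in>{..n}. ?u i) = \<zero>\<^bsub>MP\<^esub>" unfolding vieta[OF y] .
  \<comment> \<open>The order is reversed so that the index is the exponent of \<open>y\<close>; the
    last term is then \<open>y^n\<close>, as \<open>c_0 = 1\<close>.\<close>
  moreover have "(\<Oplus>\<^bsub>MP\<^esub>i\<in>{..n}. ?u i) = (\<Oplus>\<^bsub>MP\<^esub>i\<in>{..n}. ?v i)"
  proof -
    have im: "{..n} = (\<lambda>i. n - i) ` {..n}"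
    proof
      show "{..n} \<subseteq> (\<lambda>i. n - i) ` {..n}"
      proof
        fix i assume "i \<in> {..n}"
        then have "i = n - (n - i)" "n - i \<in> {..n}" by auto
        then show "i \<in> (\<lambda>i. n - i) ` {..n}" by blast
      qed
    qed auto
    have "(\<Oplus>\<^bsub>MP\<^esub>i\<in>(\<lambda>i. n - i) ` {..n}. ?u i) = (\<Oplus>\<^bsub>MP\<^esub>i\<in>{..n}. ?u (n - i))"
      by (rule MP.finsum_reindex) (use uc in \<open>auto simp: inj_on_def\<close>)
    also have "\<dots> = (\<Oplus>\<^bsub>MP\<^esub>i\<in>{..n}. ?v i)"
    proof (rule MP.finsum_cong')
      show "?v \<in> {..n} \<rightarrow> carrier MP" using vc by auto
      fix i assume "i \<in> {..n}"
      then show "?u (n - i) = ?v i" by simp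
    qed simp
    finally show ?thesis unfolding im[symmetric] .
  qed
  moreover have "(\<Oplus>\<^bsub>MP\<^esub>i\<in>{..n}. ?v i) = ?y [^]\<^bsub>MP\<^esub> n \<oplus>\<^bsub>MP\<^esub> (\<Oplus>\<^bsub>MP\<^esub>i\<in>{..<n}. ?v i)"
  proof -
    have "{..n} = insert n {..<n}" by auto
    moreover have "(\<Oplus>\<^bsub>MP\<^esub>i\<in>insert n {..<n}. ?v i) = ?v n \<oplus>\<^bsub>MP\<^esub> (\<Oplus>\<^bsub>MP\<^esub>i\<in>{..<n}. ?v i)"
      by (rule MP.finsum_insert) (simp, simp, intro Pi_I vc, rule vc)
    moreover have "?v n = ?y [^]\<^bsub>MP\<^esub> n" using y by (simp add: cs_zero)
    ultimately show ?thesis by simp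
  qed
  moreover have "(\<Oplus>\<^bsub>MP\<^esub>i\<in>{..<n}. ?v i) = \<ominus>\<^bsub>MP\<^esub> lincomb MP (\<lambda>p. p) ?y n acoef"
  proof -
    have ac: "acoef i = \<ominus>\<^bsub>MP\<^esub> (?s (n - i) \<otimes>\<^bsub>MP\<^esub> cs (n - i))" if "i < n" for i
    proof -
      have c: "cs (n - i) \<in> carrier Es" using that by (intro cs_Es) auto
      have m1: "\<ominus>\<^bsub>Es\<^esub> \<one>\<^bsub>Es\<^esub> \<in> carrier Es" by (intro Es.a_inv_closed Es.one_closed)
      have "(\<ominus>\<^bsub>Es\<^esub> \<one>\<^bsub>Es\<^esub>) [^]\<^bsub>Es\<^esub> (n - i) = ?s (n - i)"
        using i.hom_pow[OF m1, of "n - i"] i.hom_a_inv[OF Es.one_closed] i.hom_one by simp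
      moreover have "(\<ominus>\<^bsub>Es\<^esub> \<one>\<^bsub>Es\<^esub>) [^]\<^bsub>Es\<^esub> (n - i) \<otimes>\<^bsub>Es\<^esub> cs (n - i)
        = (\<ominus>\<^bsub>Es\<^esub> \<one>\<^bsub>Es\<^esub>) [^]\<^bsub>Es\<^esub> (n - i) \<otimes>\<^bsub>MP\<^esub> cs (n - i)"
        by (rule i.hom_mult) (intro Es.nat_pow_closed m1 c)+
      moreover have "acoef i = \<ominus>\<^bsub>MP\<^esub> ((\<ominus>\<^bsub>Es\<^esub> \<one>\<^bsub>Es\<^esub>) [^]\<^bsub>Es\<^esub> (n - i) \<otimes>\<^bsub>Es\<^esub> cs (n - i))"
        unfolding acoef_def by (rule i.hom_a_inv) (intro Es.m_closed Es.nat_pow_closed m1 c)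
      ultimately show ?thesis by simp
    qed
    have "lincomb MP (\<lambda>p. p) ?y n acoef = (\<Oplus>\<^bsub>MP\<^esub>i\<in>{..<n}. \<ominus>\<^bsub>MP\<^esub> ?v i)"
      unfolding lincomb_def
    proof (rule MP.finsum_cong')
      show "(\<lambda>i. \<ominus>\<^bsub>MP\<^esub> ?v i) \<in> {..<n} \<rightarrow> carrier MP" using vc by auto
      fix i assume "i \<in> {..<n}"
      then have "acoef i = \<ominus>\<^bsub>MP\<^esub> (?s (n - i) \<otimes>\<^bsub>MP\<^esub> cs (n - i))" using ac by simp
      then show "acoef i \<otimes>\<^bsub>MP\<^esub> ?y [^]\<^bsub>MP\<^esub> i = \<ominus>\<^bsub>MP\<^esub> ?v i"
        using MP.l_minus[of "?s (n - i) \<otimes>\<^bsub>MP\<^esub> cs (n - i)" "?y [^]\<^bsub>MP\<^esub> i"] y by simp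
    qed simp
    also have "\<dots> = \<ominus>\<^bsub>MP\<^esub> (\<Oplus>\<^bsub>MP\<^esub>i\<in>{..<n}. ?v i)"
      by (rule MP.finsum_minus) (use vc in auto)
    finally have "lincomb MP (\<lambda>p. p) ?y n acoef = \<ominus>\<^bsub>MP\<^esub> (\<Oplus>\<^bsub>MP\<^esub>i\<in>{..<n}. ?v i)" .
    moreover have "(\<Oplus>\<^bsub>MP\<^esub>i\<in>{..<n}. ?v i) \<in> carrier MP" by (intro MP.finsum_closed Pi_I vc)
    ultimately show ?thesis by (simp only: MP.minus_minus)
  qed
  ultimately have "?y [^]\<^bsub>MP\<^esub> n \<oplus>\<^bsub>MP\<^esub> \<ominus>\<^bsub>MP\<^esub> lincomb MP (\<lambda>p. p) ?y n acoef = \<zero>\<^bsub>MP\<^esub>" by (simp only:)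
  moreover have "lincomb MP (\<lambda>p. p) ?y n acoef \<in> carrier MP"
    unfolding lincomb_def
    by (intro MP.finsum_closed Pi_I MP.m_closed MP.nat_pow_closed y Es_carrier acoef_closed) simp
  ultimately show ?thesis
    using MP.r_right_minus_eq[OF MP.nat_pow_closed[OF y]] unfolding MP.minus_eq by blast
qed

section \<open>The universal monic polynomial and norms\<close>

abbreviation "Qe \<equiv> mq_ring Es n acoef"
abbreviation "he \<equiv> mq_hom Es n acoef"
abbreviation "xe \<equiv> mq_var Es n acoef"

definition ys :: "(nat \<Rightarrow> 'a) \<Rightarrow> (nat \<Rightarrow> nat multiset \<Rightarrow> 'a) set"
  where "ys s = UnivPoly.eval A Qe (\<lambda>a. he (cst a)) xe s"

text \<open>Multiplication by \<open>s(x)\<close> on the quotient by the universal polynomial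
  \<open>\<Prod>(x - Z_i)\<close>, as a matrix over \<open>Es\<close>. The matrices used over other
  rings are images of this one, which is how their determinants are compared.\<close>

definition nmat :: "(nat \<Rightarrow> 'a) \<Rightarrow> nat \<Rightarrow> nat \<Rightarrow> (nat multiset \<Rightarrow> 'a)"
  where "nmat s = (SOME K. (\<forall>l<n. \<forall>j<n. K l j \<in> carrier Es) \<and>
    (\<forall>j<n. ys s \<otimes>\<^bsub>Qe\<^esub> xe [^]\<^bsub>Qe\<^esub> j = lincomb Qe he xe n (\<lambda>l. K l j)))"

lemma Qe_pring: "pring Es Qe he xe"
  by (rule Es.mq_pring(1)[OF acoef_closed])

lemma A_Qe_pring: "pring A Qe (\<lambda>a. he (cst a)) xe"
proof -
  interpret q: pring Es Qe he xe by (rule Qe_pring)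
  show ?thesis
    by (intro pring.intro pring_axioms.intro ring_hom_cring_compose[OF cst_Es_hom]) (rule q.ring_hom_cring_axioms, rule q.x_closed)
qed

lemma nmat_props:
  assumes s: "s \<in> carrier (UP A)"
  shows "\<And>l j. \<lbrakk>l < n; j < n\<rbrakk> \<Longrightarrow> nmat s l j \<in> carrier Es"
    and "\<And>j. j < n \<Longrightarrow> ys s \<otimes>\<^bsub>Qe\<^esub> xe [^]\<^bsub>Qe\<^esub> j = lincomb Qe he xe n (\<lambda>l. nmat s l j)"
proof -
  interpret q: pring Es Qe he xe by (rule Qe_pring)
  interpret Aq: pring A Qe "\<lambda>a. he (cst a)" xe by (rule A_Qe_pring)
  have "ys s \<in> carrier Qe" unfolding ys_def by (rule Aq.ev_closed[OF s])
  from q.mult_matrix_exists[OF Es.mq_pring(3)[OF acoef_closed] this]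
  obtain K where "\<And>l j. \<lbrakk>l < n; j < n\<rbrakk> \<Longrightarrow> K l j \<in> carrier Es"
    "\<And>j. j < n \<Longrightarrow> ys s \<otimes>\<^bsub>Qe\<^esub> xe [^]\<^bsub>Qe\<^esub> j = lincomb Qe he xe n (\<lambda>l. K l j)" by blast
  then have "\<exists>K. (\<forall>l<n. \<forall>j<n. K l j \<in> carrier Es) \<and>
    (\<forall>j<n. ys s \<otimes>\<^bsub>Qe\<^esub> xe [^]\<^bsub>Qe\<^esub> j = lincomb Qe he xe n (\<lambda>l. K l j))" by blast
  from someI_ex[OF this, folded nmat_def]
  show "\<And>l j. \<lbrakk>l < n; j < n\<rbrakk> \<Longrightarrow> nmat s l j \<in> carrier Es"
    "\<And>j. j < n \<Longrightarrow> ys s \<otimes>\<^bsub>Qe\<^esub> xe [^]\<^bsub>Qe\<^esub> j = lincomb Qe he xe n (\<lambda>l. nmat s l j)" by blast+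
qed

text \<open>The relation \<open>xn\<close> yields a map from the universal quotient to
  \<open>Q\<close>, along which the matrix identity is pushed. Only a relation is asked of
  \<open>Q\<close>, so that besides quotients by monic polynomials also \<open>MP\<close> with
  \<open>x = Z_l\<close> qualifies.\<close>

lemma nmat_transfer:
  assumes g: "ring_hom_cring Es B g" and p: "pring B Q h x"
    and xn: "x [^]\<^bsub>Q\<^esub> n = lincomb Q h x n (\<lambda>i. g (acoef i))"
    and s: "s \<in> carrier (UP A)" and j: "j < n"
  shows "UnivPoly.eval A Q (\<lambda>a. h (g (cst a))) x s \<otimes>\<^bsub>Q\<^esub> x [^]\<^bsub>Q\<^esub> j = lincomb Q h x n (\<lambda>l. g (nmat s l j))"
proof -
  interpret p: pring B Q h x by fact
  interpret q: pring Es Qe he xe by (rule Qe_pring)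
  interpret Aq: pring A Qe "\<lambda>a. he (cst a)" xe by (rule A_Qe_pring)
  have hg: "ring_hom_cring Es Q (\<lambda>b. h (g b))"
    by (rule ring_hom_cring_compose[OF g p.ring_hom_cring_axioms])
  have pg: "pring Es Q (\<lambda>b. h (g b)) x"
    by (intro pring.intro pring_axioms.intro hg p.x_closed)
  have "x [^]\<^bsub>Q\<^esub> n = lincomb Q (\<lambda>b. h (g b)) x n acoef" unfolding xn by (simp add: lincomb_def)
  from Es.mq_universal[OF acoef_closed pg this]
  obtain \<gamma> where \<gamma>: "ring_hom_cring Qe Q \<gamma>" and \<gamma>h: "\<And>b. b \<in> carrier Es \<Longrightarrow> \<gamma> (he b) = h (g b)"
    and \<gamma>x: "\<gamma> xe = x" by blast
  interpret \<gamma>: ring_hom_cring Qe Q \<gamma> by (rule \<gamma>)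
  have ysc: "ys s \<in> carrier Qe" unfolding ys_def by (rule Aq.ev_closed[OF s])
  have "\<gamma> (ys s) = UnivPoly.eval A Q (\<lambda>a. h (g (cst a))) x s"
    unfolding ys_def by (rule eval_hom_comp[OF A_Qe_pring \<gamma> _ _ s]) (simp_all add: \<gamma>h \<gamma>x)
  moreover have "\<gamma> (ys s \<otimes>\<^bsub>Qe\<^esub> xe [^]\<^bsub>Qe\<^esub> j) = \<gamma> (ys s) \<otimes>\<^bsub>Q\<^esub> x [^]\<^bsub>Q\<^esub> j"
    using ysc by (simp add: \<gamma>.hom_pow \<gamma>x)
  moreover have "\<gamma> (ys s \<otimes>\<^bsub>Qe\<^esub> xe [^]\<^bsub>Qe\<^esub> j) = lincomb Q (\<lambda>b. h (g b)) x n (\<lambda>l. nmat s l j)"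
    unfolding nmat_props(2)[OF s j]
    by (rule hom_lincomb[OF Qe_pring \<gamma>]) (use nmat_props(1)[OF s _ j] \<gamma>h \<gamma>x in auto)
  ultimately show ?thesis by (simp add: lincomb_def)
qed

text \<open>The diagonal term \<open>\<Prod> Z_(l+1)^l\<close> dominates. At the largest index moved
  by another permutation \<open>p\<close> the exponent drops, and above that index the exponents
  agree.\<close>

lemma vandermonde_lead:
  "lead (mdet MP n (\<lambda>l j. Zv (Suc l) [^]\<^bsub>MP\<^esub> j)) (\<Sum>l<n. replicate_mset l (Suc l)) \<one>"
proof -
  let ?V = "\<lambda>l j. Zv (Suc l) [^]\<^bsub>MP\<^esub> (j::nat)"
  let ?P = "{p. p permutes {..<n}}"
  let ?m = "\<lambda>p. \<Sum>l<n. replicate_mset (p l) (Suc l)"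
  have Zl: "lead (Zv (Suc l)) {#Suc l#} \<one>" if "l < n" for l
    unfolding Z_var_def by (rule lead_mterm) (use that in auto)
  have tl: "lead (\<Otimes>\<^bsub>MP\<^esub>l\<in>{..<n}. ?V l (p l)) (?m p) \<one>" for p
  proof (rule lead_finprod)
    fix l assume "l \<in> {..<n}"
    then have "lead (?V l (p l)) (repeat_mset (p l) {#Suc l#}) \<one>" by (intro lead_pow Zl) simp
    moreover have "repeat_mset (p l) {#Suc l#} = replicate_mset (p l) (Suc l)"
      by (auto simp: multiset_eq_iff)
    ultimately show "lead (?V l (p l)) (replicate_mset (p l) (Suc l)) \<one>" by simp
  qed simp
  have pl: "lead (psign MP p) {#} (psign A p)" for p
  proof -
    have "psign MP p = cst (psign A p)" by (rule cst.hom_psign[symmetric])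
    then show ?thesis using lead_mterm[of "{#}" "psign A p"] by simp
  qed
  have pt: "lead (psign MP p \<otimes>\<^bsub>MP\<^esub> (\<Otimes>\<^bsub>MP\<^esub>l\<in>{..<n}. ?V l (p l))) (?m p) (psign A p)" for p
    using lead_mult[OF pl[of p] tl[of p]] by simp
  have cm: "count (?m p) (Suc l) = (if l < n then p l else 0)" for p l
  proof -
    have "count (?m p) (Suc l) = (\<Sum>k<n. if k = l then p k else 0)"
      by (simp add: count_sum)
    then show ?thesis by simp
  qed
  have less: "?m p < ?m id" if p: "p \<in> ?P" "p \<noteq> id" for p
  proof (rule mset_lessI)
    have out: "p l = l" if "n \<le> l" for l using p(1) that by (auto simp: permutes_def)
    from p(2) obtain l where l: "p l \<noteq> l" by (auto simp: fun_eq_iff)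
    have "l < n" using l out by (metis not_le)
    then have "count (?m p) (Suc l) \<noteq> count (?m id) (Suc l)" using l by (simp add: cm)
    then show "?m p \<noteq> ?m id" by metis
    fix y assume y: "count (?m id) y < count (?m p) y"
    have "y \<noteq> 0"
    proof
      assume "y = 0"
      then have "count (?m p) y = 0" by (simp add: count_sum)
      then show False using y by simp
    qed
    then obtain k where k: "y = Suc k" by (cases y) auto
    then have kn: "k < n" and kp: "k < p k" using y by (auto simp: cm split: if_splits)
    let ?F = "{l. l < n \<and> p l \<noteq> l}"
    have fin: "finite ?F" by simp
    have kF: "k \<in> ?F" using kn kp by simp
    \<comment> \<open>The largest index that \<open>p\<close> moves. Indices above \<open>u\<close>
      are fixed, so by injectivity \<open>p u\<close> cannot lie above \<open>u\<close>, and
      \<open>p u < u\<close> remains.\<close>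
    define u where "u = Max ?F"
    have uF: "u \<in> ?F" unfolding u_def using fin kF by (intro Max_in) auto
    have ku: "k \<le> u" unfolding u_def using fin kF by (intro Max_ge)
    have above: "p l = l" if "u < l" for l
    proof (rule ccontr)
      assume "p l \<noteq> l"
      then have "l \<in> ?F" using out by (metis (mono_tags, lifting) mem_Collect_eq not_le)
      then have "l \<le> u" unfolding u_def using fin by (intro Max_ge)
      then show False using that by simp
    qed
    have "\<not> u < p u"
    proof
      assume "u < p u"
      then have "p (p u) = p u" by (rule above)
      then have "p u = u" using permutes_inj[of p "{..<n}"] p(1) by (auto dest: injD)
      then show False using uF by simp
    qed
    then have "p u < u" using uF by simp
    moreover have "k \<noteq> u" using kp \<open>\<not> u < p u\<close> by metis
    then have "k < u" using ku by simp
    ultimately show "\<exists>z>y. count (?m p) z < count (?m id) z"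
      using uF k by (intro exI[of _ "Suc u"]) (simp add: cm)
  qed
  have Vc: "?V l j \<in> carrier MP" if "l < n" "j < n" for l j
    using Zl[OF that(1)] by (auto simp: lead_def)
  have fP: "finite ?P" by (simp add: finite_permutations)
  have app: "mdet MP n ?V m
    = (\<Oplus>p\<in>?P. (psign MP p \<otimes>\<^bsub>MP\<^esub> (\<Otimes>\<^bsub>MP\<^esub>l\<in>{..<n}. ?V l (p l))) m)" for m
    unfolding mdet_def by (rule MP_finsum_apply[OF fP]) (use pt in \<open>simp add: lead_def\<close>)
  have "mdet MP n ?V \<in> carrier MP" by (rule MP.mdet_closed[OF Vc])
  moreover have "mdet MP n ?V (?m id) = (psign MP id \<otimes>\<^bsub>MP\<^esub> (\<Otimes>\<^bsub>MP\<^esub>l\<in>{..<n}. ?V l (id l))) (?m id)"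
    unfolding app
  proof (rule finsum_single[OF fP])
    show "id \<in> ?P" by (simp add: permutes_id)
    show "(psign MP id \<otimes>\<^bsub>MP\<^esub> (\<Otimes>\<^bsub>MP\<^esub>l\<in>{..<n}. ?V l (id l))) (?m id) \<in> carrier A"
      using pt[of id] unfolding lead_def by (metis psign_closed)
    fix p assume "p \<in> ?P" "p \<noteq> id"
    then have "?m p < ?m id" by (rule less)
    then show "(psign MP p \<otimes>\<^bsub>MP\<^esub> (\<Otimes>\<^bsub>MP\<^esub>l\<in>{..<n}. ?V l (p l))) (?m id) = \<zero>"
      using pt[of p] unfolding lead_def by blast
  qed
  moreover have "(psign MP id \<otimes>\<^bsub>MP\<^esub> (\<Otimes>\<^bsub>MP\<^esub>l\<in>{..<n}. ?V l (id l))) (?m id) = \<one>"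
    using pt[of id] unfolding lead_def by (metis A.psign_id)
  moreover have "mdet MP n ?V m = \<zero>" if m: "?m id < m" for m
    unfolding app
  proof (rule A.add.finprod_one_eqI)
    fix p assume p: "p \<in> ?P"
    have "?m p \<le> ?m id" using less[OF p] by (cases "p = id") auto
    then have "?m p < m" using m by (rule le_less_trans)
    then show "(psign MP p \<otimes>\<^bsub>MP\<^esub> (\<Otimes>\<^bsub>MP\<^esub>l\<in>{..<n}. ?V l (p l))) m = \<zero>"
      using pt[of p] unfolding lead_def by blast
  qed
  ultimately show ?thesis unfolding lead_def by simp
qed

lemma Zv_pring: "i \<in> {1..n} \<Longrightarrow> pring A MP cst (Zv i)"
  by (intro pring.intro pring_axioms.intro cst_hom Zv_closed)

text \<open>The intertwining takes place in \<open>MP\<close>, where the roots \<open>Z_l\<close>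
  live, whereas the determinant has entries in \<open>Es\<close>; the inclusion carries it over. In
  particular the product lies in \<open>Es\<close>.\<close>

lemma prod_eval_det:
  assumes s: "s \<in> carrier (UP A)"
  shows "prod_eval A n s = mdet Es n (nmat s)"
proof -
  interpret i: ring_hom_cring Es MP "\<lambda>p. p" by (rule Es_incl)
  let ?s = "\<lambda>l. UnivPoly.eval A MP cst (Zv l) s"
  have sc: "?s l \<in> carrier MP" if "l \<in> {1..n}" for l
    using pring.ev_closed[OF Zv_pring[OF that] s] .
  have Kc: "nmat s l j \<in> carrier MP" if "l < n" "j < n" for l j
    by (rule Es_carrier[OF nmat_props(1)[OF s that]])
  have S: "{1..n} = Suc ` {..<n}" by (auto simp: image_iff) (metis Suc_le_D Suc_le_eq lessThan_iff)
  have pe: "prod_eval A n s = (\<Otimes>\<^bsub>MP\<^esub>l\<in>{..<n}. ?s (Suc l))"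
    unfolding prod_eval_def S by (rule MP.finprod_reindex) (use sc in auto)
  let ?V = "\<lambda>l j. Zv (Suc l) [^]\<^bsub>MP\<^esub> (j::nat)"
  have "mdet MP n ?V \<otimes>\<^bsub>MP\<^esub> mdet MP n (nmat s) = (\<Otimes>\<^bsub>MP\<^esub>l\<in>{..<n}. ?s (Suc l)) \<otimes>\<^bsub>MP\<^esub> mdet MP n ?V"
  proof (rule MP.vandermonde_intertwine[OF Kc])
    fix l j assume lj: "l < n" "j < n"
    then have l: "Suc l \<in> {1..n}" by simp
    have pE: "pring Es MP (\<lambda>p. p) (Zv (Suc l))"
      by (intro pring.intro pring_axioms.intro Es_incl Zv_closed l)
    have idE: "ring_hom_cring Es Es (\<lambda>p. p)"
      by (rule ring_hom_cringI'[OF Es_cring Es_cring]) (auto simp: ring_hom_def)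
    \<comment> \<open>Specialization along the identity of \<open>Es\<close>, with \<open>MP\<close>
      as target and the root \<open>Z_l\<close> as the image of \<open>x\<close>.\<close>
    have "?s (Suc l) \<otimes>\<^bsub>MP\<^esub> Zv (Suc l) [^]\<^bsub>MP\<^esub> j = lincomb MP (\<lambda>p. p) (Zv (Suc l)) n (\<lambda>l. nmat s l j)"
      by (rule nmat_transfer[OF idE pE _ s lj(2)]) (rule Zv_root[OF l])
    then show "?s (Suc l) \<otimes>\<^bsub>MP\<^esub> Zv (Suc l) [^]\<^bsub>MP\<^esub> j = (\<Oplus>\<^bsub>MP\<^esub>i\<in>{..<n}. nmat s i j \<otimes>\<^bsub>MP\<^esub> Zv (Suc l) [^]\<^bsub>MP\<^esub> i)"
      by (simp only: lincomb_def)
  qed (use sc in auto)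
  moreover have Vc: "mdet MP n ?V \<in> carrier MP" using vandermonde_lead by (simp add: lead_def)
  moreover have pc: "(\<Otimes>\<^bsub>MP\<^esub>l\<in>{..<n}. ?s (Suc l)) \<in> carrier MP" by (intro MP.finprod_closed Pi_I sc) auto
  moreover have dc: "mdet MP n (nmat s) \<in> carrier MP" by (rule MP.mdet_closed[OF Kc])
  ultimately have "mdet MP n (nmat s) = (\<Otimes>\<^bsub>MP\<^esub>l\<in>{..<n}. ?s (Suc l))"
    using lead_one_cancel[OF vandermonde_lead dc pc] by (simp add: MP.m_comm)
  moreover have "mdet Es n (nmat s) = mdet MP n (nmat s)"
    using i.hom_mdet[of n "nmat s"] nmat_props(1)[OF s] by simp
  ultimately show ?thesis using pe by simp
qed

lemma prod_eval_closed: "s \<in> carrier (UP A) \<Longrightarrow> prod_eval A n s \<in> carrier Es"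
  unfolding prod_eval_det by (rule Es.mdet_closed) (rule nmat_props(1))

lemma prod_eval_hom:
  assumes "ring_hom_cring Es B g" "s \<in> carrier (UP A)"
  shows "g (prod_eval A n s) = mdet B n (\<lambda>l j. g (nmat s l j))"
  unfolding prod_eval_det[OF assms(2)]
  by (rule ring_hom_cring.hom_mdet[OF assms(1)]) (rule nmat_props(1)[OF assms(2)])

text \<open>The norm is a multiple of \<open>s(x)\<close> by Cramer's rule, so an inverse of the
  norm provides one of \<open>s(x)\<close>.\<close>

lemma unit_if_norm_unit:
  assumes n: "0 < n" and g: "ring_hom_cring Es B g" and p: "pring B Q h x"
    and xn: "x [^]\<^bsub>Q\<^esub> n = lincomb Q h x n (\<lambda>i. g (acoef i))"
    and s: "s \<in> carrier (UP A)" and u: "g (prod_eval A n s) \<in> Units B"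
  shows "UnivPoly.eval A Q (\<lambda>a. h (g (cst a))) x s \<in> Units Q"
proof -
  interpret p: pring B Q h x by fact
  interpret g: ring_hom_cring Es B g by fact
  let ?y = "UnivPoly.eval A Q (\<lambda>a. h (g (cst a))) x s"
  have "pring A Q (\<lambda>a. h (g (cst a))) x"
    by (intro pring.intro pring_axioms.intro p.x_closed ring_hom_cring_compose[OF _ p.ring_hom_cring_axioms]
        ring_hom_cring_compose[OF cst_Es_hom g])
  then have yc: "?y \<in> carrier Q" using s by (rule pring.ev_closed)
  have "\<exists>z\<in>carrier Q. h (mdet B n (\<lambda>l j. g (nmat s l j))) = ?y \<otimes>\<^bsub>Q\<^esub> z"
    by (rule p.det_mult_matrix_dvd[OF _ n yc])
      (use nmat_props(1)[OF s] nmat_transfer[OF g p xn s] in auto)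
  then obtain z where z: "z \<in> carrier Q" "h (g (prod_eval A n s)) = ?y \<otimes>\<^bsub>Q\<^esub> z"
    unfolding prod_eval_hom[OF g s] by blast
  define v where "v = inv\<^bsub>B\<^esub> (g (prod_eval A n s))"
  have v: "v \<in> carrier B" "g (prod_eval A n s) \<otimes>\<^bsub>B\<^esub> v = \<one>\<^bsub>B\<^esub>" using u by (auto simp: v_def)
  have gc: "g (prod_eval A n s) \<in> carrier B" using u by auto
  have "?y \<otimes>\<^bsub>Q\<^esub> (z \<otimes>\<^bsub>Q\<^esub> h v) = ?y \<otimes>\<^bsub>Q\<^esub> z \<otimes>\<^bsub>Q\<^esub> h v"
    by (rule p.S.m_assoc[symmetric]) (use z(1) v yc in auto)
  also have "\<dots> = h (g (prod_eval A n s) \<otimes>\<^bsub>B\<^esub> v)"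
    unfolding z(2)[symmetric] by (rule p.hom_mult[OF gc v(1), symmetric])
  also have "\<dots> = \<one>\<^bsub>Q\<^esub>" unfolding v(2) by (rule p.hom_one)
  finally have "?y \<otimes>\<^bsub>Q\<^esub> (z \<otimes>\<^bsub>Q\<^esub> h v) = \<one>\<^bsub>Q\<^esub>" .
  moreover have zv: "z \<otimes>\<^bsub>Q\<^esub> h v \<in> carrier Q" using z v by simp
  ultimately show ?thesis unfolding Units_def using yc p.S.m_comm[OF yc zv] by auto
qed

text \<open>This direction rests on the power basis: the inverse of \<open>s(x)\<close> then has a
  matrix over \<open>B\<close>, whose determinant inverts the norm.\<close>

lemma norm_unit_if_unit:
  assumes g: "ring_hom_cring Es B g" and p: "pring B Q h x" and pb: "power_basis B Q h x n"
    and xn: "x [^]\<^bsub>Q\<^esub> n = lincomb Q h x n (\<lambda>i. g (acoef i))"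
    and s: "s \<in> carrier (UP A)" and u: "UnivPoly.eval A Q (\<lambda>a. h (g (cst a))) x s \<in> Units Q"
  shows "g (prod_eval A n s) \<in> Units B"
proof -
  interpret p: pring B Q h x by fact
  interpret g: ring_hom_cring Es B g by fact
  show ?thesis unfolding prod_eval_hom[OF g s]
    by (rule p.det_mult_matrix_unit[OF pb _ u]) (use nmat_props(1)[OF s] nmat_transfer[OF g p xn s] in auto)
qed

lemma prod_eval_submonoid:
  assumes S: "submonoid S (UP A)"
  shows "submonoid (prod_eval A n ` S) Es"
proof -
  interpret U: UP_cring A "UP A" by unfold_locales
  have SU: "s \<in> S \<Longrightarrow> s \<in> carrier (UP A)" for s using S by (auto simp: submonoid_def)
  have ev: "ring_hom_cring (UP A) MP (UnivPoly.eval A MP cst (Zv l))" if "l \<in> {1..n}" for l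
    using pring.ev_hom[OF Zv_pring[OF that]] .
  have mult: "prod_eval A n (s \<otimes>\<^bsub>UP A\<^esub> t) = prod_eval A n s \<otimes>\<^bsub>MP\<^esub> prod_eval A n t"
    if s: "s \<in> carrier (UP A)" and t: "t \<in> carrier (UP A)" for s t
  proof -
    have c: "UnivPoly.eval A MP cst (Zv l) r \<in> carrier MP" if "l \<in> {1..n}" "r \<in> carrier (UP A)" for l r
      using pring.ev_closed[OF Zv_pring[OF that(1)] that(2)] .
    have "prod_eval A n (s \<otimes>\<^bsub>UP A\<^esub> t)
      = (\<Otimes>\<^bsub>MP\<^esub>l\<in>{1..n}. UnivPoly.eval A MP cst (Zv l) s \<otimes>\<^bsub>MP\<^esub> UnivPoly.eval A MP cst (Zv l) t)"
      unfolding prod_eval_def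
    proof (rule MP.finprod_cong')
      fix l assume l: "l \<in> {1..n}"
      interpret e: ring_hom_cring "UP A" MP "UnivPoly.eval A MP cst (Zv l)" by (rule ev[OF l])
      show "UnivPoly.eval A MP cst (Zv l) (s \<otimes>\<^bsub>UP A\<^esub> t)
        = UnivPoly.eval A MP cst (Zv l) s \<otimes>\<^bsub>MP\<^esub> UnivPoly.eval A MP cst (Zv l) t"
        by (rule e.hom_mult[OF s t])
    qed (use c s t in auto)
    also have "\<dots> = prod_eval A n s \<otimes>\<^bsub>MP\<^esub> prod_eval A n t"
      unfolding prod_eval_def by (rule MP.finprod_multf) (use c s t in auto)
    finally show ?thesis .
  qed
  have one: "prod_eval A n \<one>\<^bsub>UP A\<^esub> = \<one>\<^bsub>MP\<^esub>"
    unfolding prod_eval_def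
  proof (rule MP.finprod_one_eqI)
    fix l assume l: "l \<in> {1..n}"
    interpret e: ring_hom_cring "UP A" MP "UnivPoly.eval A MP cst (Zv l)" by (rule ev[OF l])
    show "UnivPoly.eval A MP cst (Zv l) \<one>\<^bsub>UP A\<^esub> = \<one>\<^bsub>MP\<^esub>" by (rule e.hom_one)
  qed
  show ?thesis
  proof (rule submonoid.intro)
    show "prod_eval A n ` S \<subseteq> carrier Es" using prod_eval_closed SU by blast
    show "\<one>\<^bsub>Es\<^esub> \<in> prod_eval A n ` S"
      using one S unfolding Es_simps(3) submonoid_def by (metis imageI)
    fix y z assume "y \<in> prod_eval A n ` S" "z \<in> prod_eval A n ` S"
    then obtain s t where st: "s \<in> S" "t \<in> S" "y = prod_eval A n s" "z = prod_eval A n t" by blast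
    then have "y \<otimes>\<^bsub>Es\<^esub> z = prod_eval A n (s \<otimes>\<^bsub>UP A\<^esub> t)"
      using mult[OF SU SU] by (simp only: Es_simps(2))
    moreover have "s \<otimes>\<^bsub>UP A\<^esub> t \<in> S" using S st by (auto simp: submonoid_def)
    ultimately show "y \<otimes>\<^bsub>Es\<^esub> z \<in> prod_eval A n ` S" by blast
  qed
qed

end

section \<open>Localized polynomial algebras\<close>

text \<open>Ring homomorphisms do not see the scalar multiplication that \<open>algebra_via\<close>
  attaches, so facts about plain ring records carry over to algebras.\<close>

lemma hom_from_via:
  "cring R \<Longrightarrow> ring_hom_cring (algebra_via R h) C g \<longleftrightarrow> ring_hom_cring R C g"
  by (simp add: ring_hom_cring_def ring_hom_cring_axioms_def cring_algebra_via ring_hom_def)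

lemma hom_into_via:
  "cring R \<Longrightarrow> ring_hom_cring C (algebra_via R h) g \<longleftrightarrow> ring_hom_cring C R g"
  by (simp add: ring_hom_cring_def ring_hom_cring_axioms_def cring_algebra_via ring_hom_def)

lemma pringI: "\<lbrakk>ring_hom_cring R S h; x \<in> carrier S\<rbrakk> \<Longrightarrow> pring R S h x"
  by (simp add: pring_def pring_axioms_def)

lemma hom_Units: "\<lbrakk>ring_hom_cring R S h; u \<in> Units R\<rbrakk> \<Longrightarrow> h u \<in> Units S"
proof -
  assume h: "ring_hom_cring R S h" and u: "u \<in> Units R"
  interpret h: ring_hom_cring R S h by (rule h)
  from u obtain v where v: "v \<in> carrier R" "u \<otimes>\<^bsub>R\<^esub> v = \<one>\<^bsub>R\<^esub>" unfolding Units_def by auto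
  have uc: "u \<in> carrier R" using u by auto
  have c: "h u \<in> carrier S" "h v \<in> carrier S" using uc v(1) by auto
  have "h u \<otimes>\<^bsub>S\<^esub> h v = \<one>\<^bsub>S\<^esub>" using h.hom_mult[OF uc v(1)] v(2) by simp
  moreover from this have "h v \<otimes>\<^bsub>S\<^esub> h u = \<one>\<^bsub>S\<^esub>" using h.S.m_comm[OF c] by simp
  ultimately show "h u \<in> Units S"
    using c unfolding Units_def by blast
qed

text \<open>The structure map of an algebra. It replaces scalar multiplication wherever
  \<open>pring\<close> is used.\<close>

lemma algebra_unit_hom:
  assumes "algebra A B" shows "ring_hom_cring A B (\<lambda>a. a \<odot>\<^bsub>B\<^esub> \<one>\<^bsub>B\<^esub>)"
proof -
  interpret B: algebra A B by fact
  show ?thesis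
  proof (rule ring_hom_cringI'[OF B.R.is_cring B.M_cring ring_hom_memI])
    fix a b assume ab: "a \<in> carrier A" "b \<in> carrier A"
    show "(a \<otimes>\<^bsub>A\<^esub> b) \<odot>\<^bsub>B\<^esub> \<one>\<^bsub>B\<^esub> = (a \<odot>\<^bsub>B\<^esub> \<one>\<^bsub>B\<^esub>) \<otimes>\<^bsub>B\<^esub> (b \<odot>\<^bsub>B\<^esub> \<one>\<^bsub>B\<^esub>)"
      using ab by (simp add: B.smult_assoc1 B.smult_assoc2)
    show "(a \<oplus>\<^bsub>A\<^esub> b) \<odot>\<^bsub>B\<^esub> \<one>\<^bsub>B\<^esub> = (a \<odot>\<^bsub>B\<^esub> \<one>\<^bsub>B\<^esub>) \<oplus>\<^bsub>B\<^esub> (b \<odot>\<^bsub>B\<^esub> \<one>\<^bsub>B\<^esub>)"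
      using ab by (simp add: B.smult_l_distr)
  qed auto
qed

lemma algebra_smult_eq:
  assumes "algebra A B" "a \<in> carrier A" "b \<in> carrier B"
  shows "a \<odot>\<^bsub>B\<^esub> b = (a \<odot>\<^bsub>B\<^esub> \<one>\<^bsub>B\<^esub>) \<otimes>\<^bsub>B\<^esub> b"
proof -
  interpret B: algebra A B by fact
  show ?thesis using assms by (simp add: B.smult_assoc2)
qed

lemma eval_cong:
  assumes k: "pring A C k y" and eq: "\<And>a. a \<in> carrier A \<Longrightarrow> k' a = k a" and p: "p \<in> carrier (UP A)"
  shows "UnivPoly.eval A C k y p = UnivPoly.eval A C k' y p"
proof -
  interpret k: pring A C k y by (rule k)
  have "ring_hom_cring C C (\<lambda>x. x)"
    by (rule ring_hom_cringI'[OF k.S.is_cring k.S.is_cring]) (auto simp: ring_hom_def)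
  from eval_hom_comp[OF k this eq refl p] show ?thesis by simp
qed

locale hilb_poly = A?: cring A for A :: "('a, 'x) ring_scheme" (structure) +
  fixes S :: "(nat \<Rightarrow> 'a) set"
  assumes S: "submonoid S (UP A)"
begin

sublocale U: UP_cring A "UP A" by unfold_locales
sublocale L: locring "UP A" S
  by (simp add: locring_def locring_axioms_def U.UP_cring S)

abbreviation "RR \<equiv> loc_algebra (UP A) S"
abbreviation "fL \<equiv> \<lambda>p. L.f0 p \<one>\<^bsub>UP A\<^esub>"
abbreviation "kR \<equiv> \<lambda>a. fL (up_ring.monom (UP A) a 0)"
abbreviation "xR \<equiv> fL (up_ring.monom (UP A) \<one> (Suc 0))"

lemma S_carrier [simp]: "s \<in> S \<Longrightarrow> s \<in> carrier (UP A)"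
  using S by (auto simp: submonoid_def)

lemma RR_simps:
  "carrier RR = carrier L.L" "monoid.mult RR = monoid.mult L.L" "monoid.one RR = monoid.one L.L"
  "ring.zero RR = ring.zero L.L" "ring.add RR = ring.add L.L"
  by (simp_all add: loc_algebra_def)

lemma hom_RR_iff: "ring_hom_cring RR C g \<longleftrightarrow> ring_hom_cring L.L C g"
  unfolding loc_algebra_def by (rule hom_from_via[OF L.L_cring])

lemma UP_smult_one: "a \<in> carrier A \<Longrightarrow> a \<odot>\<^bsub>UP A\<^esub> \<one>\<^bsub>UP A\<^esub> = up_ring.monom (UP A) a 0"
  using U.monom_mult_is_smult[of a "\<one>\<^bsub>UP A\<^esub>"] by simp

lemma kR_hom: "ring_hom_cring A L.L kR"
proof -
  have "ring_hom_cring A (UP A) (\<lambda>a. up_ring.monom (UP A) a 0)"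
    by (rule ring_hom_cringI'[OF A.is_cring U.UP_cring ring_hom_memI])
      (auto simp: U.monom_mult[of _ _ 0 0, simplified])
  then show ?thesis by (rule ring_hom_cring_compose[OF _ L.L_hom])
qed

lemma RR_smult: "a \<in> carrier A \<Longrightarrow> a \<odot>\<^bsub>RR\<^esub> t = kR a \<otimes>\<^bsub>L.L\<^esub> t"
  by (simp add: loc_algebra_def UP_smult_one)

lemma RR_algebra: "algebra A RR"
  unfolding loc_algebra_def
proof (rule algebra_algebra_via[OF A.is_cring L.L_cring])
  interpret k: ring_hom_cring A L.L kR by (rule kR_hom)
  have "kR \<in> ring_hom A L.L" by (rule k.homh)
  then show "(\<lambda>a. L.f0 (a \<odot>\<^bsub>UP A\<^esub> \<one>\<^bsub>UP A\<^esub>) \<one>\<^bsub>UP A\<^esub>) \<in> ring_hom A L.L"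
    by (simp add: ring_hom_def UP_smult_one Pi_def)
qed

lemma RR_smult_one: "a \<in> carrier A \<Longrightarrow> a \<odot>\<^bsub>RR\<^esub> \<one>\<^bsub>RR\<^esub> = kR a"
proof -
  assume a: "a \<in> carrier A"
  interpret k: ring_hom_cring A L.L kR by (rule kR_hom)
  show ?thesis using RR_smult[OF a] a by (simp add: RR_simps)
qed

lemma fL_closed: "p \<in> carrier (UP A) \<Longrightarrow> fL p \<in> carrier RR"
  unfolding RR_simps by (rule L.L_closed) (use S in \<open>auto simp: submonoid_def\<close>)

lemma xR_closed: "xR \<in> carrier RR"
  by (rule fL_closed) simp

lemma hom_fL:
  assumes \<rho>: "ring_hom_cring RR C \<rho>" and p: "p \<in> carrier (UP A)"
  shows "\<rho> (fL p) = UnivPoly.eval A C (\<lambda>a. \<rho> (kR a)) (\<rho> xR) p"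
proof -
  have \<rho>': "ring_hom_cring L.L C \<rho>" using \<rho> by (simp only: hom_RR_iff)
  interpret r: ring_hom_cring L.L C \<rho> by (rule \<rho>')
  have h: "ring_hom_cring (UP A) C (\<lambda>p. \<rho> (fL p))" by (rule ring_hom_cring_compose[OF L.L_hom \<rho>'])
  interpret q: pring A C "\<lambda>a. \<rho> (kR a)" "\<rho> xR"
    by (rule pringI[OF ring_hom_cring_compose[OF kR_hom \<rho>']]) (use xR_closed in \<open>simp add: RR_simps\<close>)
  show ?thesis
    by (rule q.U.UP_hom_unique[OF h _ _ q.ev_hom _ _ p q.x_closed])
      (use q.U.eval_const q.U.eval_monom1[OF q.x_closed] in auto)
qed

text \<open>Combines the universal properties of \<open>A[X]\<close> and of localization: evaluation
  at \<open>y\<close> extends as soon as every \<open>s\<close> takes a unit value there.\<close>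

lemma RR_universal:
  assumes k: "pring A C k y"
    and u: "\<And>s. s \<in> S \<Longrightarrow> UnivPoly.eval A C k y s \<in> Units C"
  shows "\<exists>\<rho>. ring_hom_cring RR C \<rho> \<and> (\<forall>a\<in>carrier A. \<rho> (kR a) = k a) \<and> \<rho> xR = y"
proof -
  interpret k: pring A C k y by (rule k)
  obtain \<rho> where r: "ring_hom_cring L.L C \<rho>" "\<And>p. p \<in> carrier (UP A) \<Longrightarrow> \<rho> (fL p) = k.ev p"
    using L.L_universal[OF k.ev_hom u] by blast
  have "\<rho> (kR a) = k a" if "a \<in> carrier A" for a
    using that r(2)[of "up_ring.monom (UP A) a 0"] k.U.eval_const[of y a] by simp
  moreover have "\<rho> xR = y"
    using r(2)[of "up_ring.monom (UP A) \<one> (Suc 0)"] k.U.eval_monom1[of y] by simp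
  ultimately show ?thesis using r(1) hom_RR_iff by blast
qed

lemma RR_hom_unique:
  assumes \<rho>: "ring_hom_cring RR C \<rho>" "ring_hom_cring RR C \<rho>'"
    and k: "\<And>a. a \<in> carrier A \<Longrightarrow> \<rho> (kR a) = \<rho>' (kR a)" and y: "\<rho> xR = \<rho>' xR"
    and r: "r \<in> carrier RR"
  shows "\<rho> r = \<rho>' r"
proof (rule L.L_hom_unique)
  show \<rho>2: "ring_hom_cring L.L C \<rho>" "ring_hom_cring L.L C \<rho>'" using \<rho> by (simp_all only: hom_RR_iff)
  show "r \<in> carrier L.L" using r by (simp add: RR_simps)
  fix p assume p: "p \<in> carrier (UP A)"
  interpret r: ring_hom_cring L.L C \<rho> by (rule \<rho>2)
  have pr: "pring A C (\<lambda>a. \<rho> (kR a)) (\<rho> xR)"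
    by (rule pringI[OF ring_hom_cring_compose[OF kR_hom \<rho>2(1)]]) (use xR_closed in \<open>simp add: RR_simps\<close>)
  have "\<rho> (fL p) = UnivPoly.eval A C (\<lambda>a. \<rho> (kR a)) (\<rho> xR) p" by (rule hom_fL[OF \<rho>(1) p])
  also have "\<dots> = UnivPoly.eval A C (\<lambda>a. \<rho>' (kR a)) (\<rho>' xR) p"
    unfolding y[symmetric] by (rule eval_cong[OF pr]) (use k p in auto)
  also have "\<dots> = \<rho>' (fL p)" by (rule hom_fL[OF \<rho>(2) p, symmetric])
  finally show "\<rho> (fL p) = \<rho>' (fL p)" .
qed

end

section \<open>The localized polynomial algebra over a base algebra\<close>

locale hilb_tensor = hilb_poly A S + tensor_alg A B "loc_algebra (UP A) S"
  for A :: "('a, 'x) ring_scheme" (structure) and B :: "('a, 'b) module"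
    and S :: "(nat \<Rightarrow> 'a) set"
begin

abbreviation "\<iota> \<equiv> \<lambda>b. tn b \<one>\<^bsub>RR\<^esub>"
abbreviation "xT \<equiv> tn \<one>\<^bsub>B\<^esub> xR"

lemma B_unit_hom: "ring_hom_cring A B (\<lambda>a. a \<odot>\<^bsub>B\<^esub> \<one>\<^bsub>B\<^esub>)"
  by (rule algebra_unit_hom) unfold_locales

lemma \<iota>_smult_one: "a \<in> carrier A \<Longrightarrow> \<iota> (a \<odot>\<^bsub>B\<^esub> \<one>\<^bsub>B\<^esub>) = tn \<one>\<^bsub>B\<^esub> (kR a)"
  by (subst tens_balanced) (simp_all add: RR_smult_one)

lemma xT_closed: "xT \<in> carrier T"
  by (rule tens_closed) (use xR_closed in auto)

lemma T_pring: "pring B T \<iota> xT"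
  by (rule pringI[OF left_hom xT_closed])

text \<open>Puts the image of a polynomial over \<open>A\<close> into the form in which
  \<open>good\<close> will state its unit condition, evaluation along the structure map of
  \<open>B\<close>.\<close>

lemma hom_T_eval:
  assumes \<psi>: "ring_hom_cring T C \<psi>" and p: "p \<in> carrier (UP A)"
  shows "\<psi> (tn \<one>\<^bsub>B\<^esub> (fL p)) = UnivPoly.eval A C (\<lambda>a. \<psi> (\<iota> (a \<odot>\<^bsub>B\<^esub> \<one>\<^bsub>B\<^esub>))) (\<psi> xT) p"
proof -
  have h: "ring_hom_cring RR C (\<lambda>r. \<psi> (tn \<one>\<^bsub>B\<^esub> r))"
    by (rule ring_hom_cring_compose[OF right_hom \<psi>])
  interpret \<psi>: ring_hom_cring T C \<psi> by (rule \<psi>)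
  have kh: "ring_hom_cring A RR kR"
    using kR_hom unfolding loc_algebra_def by (simp only: hom_into_via[OF L.L_cring])
  have "pring A C (\<lambda>a. \<psi> (tn \<one>\<^bsub>B\<^esub> (kR a))) (\<psi> xT)"
    by (rule pringI[OF ring_hom_cring_compose[OF kh h] \<psi>.hom_closed[OF xT_closed]])
  then show ?thesis
    using hom_fL[OF h p] eval_cong[of A C "\<lambda>a. \<psi> (tn \<one>\<^bsub>B\<^esub> (kR a))" "\<psi> xT"
      "\<lambda>a. \<psi> (\<iota> (a \<odot>\<^bsub>B\<^esub> \<one>\<^bsub>B\<^esub>))" p] p by (simp add: \<iota>_smult_one)
qed

lemma T_id_hom: "ring_hom_cring T T (\<lambda>t. t)"
  by (rule ring_hom_cringI'[OF T_cring T_cring]) (auto simp: ring_hom_def)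

lemma S_unit_T: "s \<in> S \<Longrightarrow> tn \<one>\<^bsub>B\<^esub> (fL s) \<in> Units T"
proof (rule hom_Units[OF right_hom])
  assume "s \<in> S"
  then have "fL s \<in> Units L.L" by (rule L.L_Units)
  then show "fL s \<in> Units RR" by (simp add: Units_def RR_simps)
qed

lemma hom_T_unit:
  assumes \<psi>: "ring_hom_cring T C \<psi>" and s: "s \<in> S"
  shows "UnivPoly.eval A C (\<lambda>a. \<psi> (\<iota> (a \<odot>\<^bsub>B\<^esub> \<one>\<^bsub>B\<^esub>))) (\<psi> xT) s \<in> Units C"
  using hom_Units[OF \<psi> S_unit_T[OF s]] hom_T_eval[OF \<psi>, of s] s by simp

text \<open>The tensor product behaves as \<open>S^{-1}B[x]\<close>: the universal properties of the
  two tensor factors combine, and balance on scalars is the choice of structure map in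
  \<open>RR_universal\<close>.\<close>

lemma T_universal:
  assumes q: "pring B C \<beta> y"
    and u: "\<And>s. s \<in> S \<Longrightarrow> UnivPoly.eval A C (\<lambda>a. \<beta> (a \<odot>\<^bsub>B\<^esub> \<one>\<^bsub>B\<^esub>)) y s \<in> Units C"
  shows "\<exists>\<psi>. ring_hom_cring T C \<psi> \<and> (\<forall>b\<in>carrier B. \<psi> (\<iota> b) = \<beta> b) \<and> \<psi> xT = y"
proof -
  interpret q: pring B C \<beta> y by (rule q)
  have \<beta>: "ring_hom_cring B C \<beta>" by unfold_locales
  have "pring A C (\<lambda>a. \<beta> (a \<odot>\<^bsub>B\<^esub> \<one>\<^bsub>B\<^esub>)) y"
    by (rule pringI[OF ring_hom_cring_compose[OF B_unit_hom \<beta>] q.x_closed])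
  from RR_universal[OF this u] obtain \<rho> where r: "ring_hom_cring RR C \<rho>"
    "\<And>a. a \<in> carrier A \<Longrightarrow> \<rho> (kR a) = \<beta> (a \<odot>\<^bsub>B\<^esub> \<one>\<^bsub>B\<^esub>)" "\<rho> xR = y" by blast
  interpret r: ring_hom_cring RR C \<rho> by (rule r)
  obtain \<psi> where p: "ring_hom_cring T C \<psi>"
    "\<And>b r. \<lbrakk>b \<in> carrier B; r \<in> carrier RR\<rbrakk> \<Longrightarrow> \<psi> (tn b r) = \<beta> b \<otimes>\<^bsub>C\<^esub> \<rho> r"
    using tens_universal[OF \<beta> r(1)] r(2) RR_smult_one by metis
  have "\<psi> (\<iota> b) = \<beta> b" if "b \<in> carrier B" for b using that p(2)[of b "\<one>\<^bsub>RR\<^esub>"] by simp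
  moreover have "\<psi> xT = y" using p(2)[of "\<one>\<^bsub>B\<^esub>" xR] xR_closed r(3) by simp
  ultimately show ?thesis using p(1) by blast
qed

lemma T_unique:
  assumes g: "ring_hom_cring T C g" and g': "ring_hom_cring T C g'"
    and b: "\<And>b. b \<in> carrier B \<Longrightarrow> g (\<iota> b) = g' (\<iota> b)" and y: "g xT = g' xT" and t: "t \<in> carrier T"
  shows "g t = g' t"
proof (rule T_hom_unique[OF g g' _ t])
  fix b r assume br: "b \<in> carrier B" "r \<in> carrier RR"
  interpret g: ring_hom_cring T C g by (rule g)
  interpret g': ring_hom_cring T C g' by (rule g')
  have r: "g (tn \<one>\<^bsub>B\<^esub> r) = g' (tn \<one>\<^bsub>B\<^esub> r)"
  proof (rule RR_hom_unique[OF ring_hom_cring_compose[OF right_hom g] ring_hom_cring_compose[OF right_hom g'] _ y br(2)])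
    fix a assume a: "a \<in> carrier A"
    show "g (tn \<one>\<^bsub>B\<^esub> (kR a)) = g' (tn \<one>\<^bsub>B\<^esub> (kR a))"
      using a b[of "a \<odot>\<^bsub>B\<^esub> \<one>\<^bsub>B\<^esub>"] by (simp add: \<iota>_smult_one)
  qed
  have c: "\<iota> b \<in> carrier T" "tn \<one>\<^bsub>B\<^esub> r \<in> carrier T" using br by simp_all
  show "g (tn b r) = g' (tn b r)"
    unfolding tens_split[OF br] g.hom_mult[OF c] g'.hom_mult[OF c] b[OF br(1)] r by (rule refl)
qed

text \<open>A pure tensor has a denominator from \<open>S\<close>, and a sum gets the product of the
  denominators. Pushed forward along a surjection, this becomes the assumption \<open>gen\<close> of
  \<open>local_power_basis\<close>.\<close>

lemma T_fractions:
  assumes t: "t \<in> carrier T"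
  shows "\<exists>p\<in>carrier (UP B). \<exists>w\<in>carrier (UP B). UnivPoly.eval B T \<iota> xT w \<in> Units T \<and>
    UnivPoly.eval B T \<iota> xT w \<otimes>\<^bsub>T\<^esub> t = UnivPoly.eval B T \<iota> xT p"
proof -
  interpret p: pring B T \<iota> xT by (rule T_pring)
  interpret ev: ring_hom_cring "UP B" T p.ev by (rule p.ev_hom)
  \<comment> \<open>Base change of polynomials from \<open>A\<close> to \<open>B\<close>. It makes
    the denominators \<open>s\<close> values of polynomials over \<open>B\<close> at
    \<open>xT\<close>.\<close>
  define \<mu> where "\<mu> = UnivPoly.eval A (UP B) (\<lambda>a. up_ring.monom (UP B) (a \<odot>\<^bsub>B\<^esub> \<one>\<^bsub>B\<^esub>) 0) (up_ring.monom (UP B) \<one>\<^bsub>B\<^esub> (Suc 0))"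
  have "ring_hom_cring B (UP B) (\<lambda>a. up_ring.monom (UP B) a 0)"
    by (rule ring_hom_cringI'[OF B.M_cring p.U.UP_cring ring_hom_memI])
      (auto simp: p.U.monom_mult[of _ _ 0 0, simplified])
  then have mp: "pring A (UP B) (\<lambda>a. up_ring.monom (UP B) (a \<odot>\<^bsub>B\<^esub> \<one>\<^bsub>B\<^esub>) 0) (up_ring.monom (UP B) \<one>\<^bsub>B\<^esub> (Suc 0))"
    by (intro pringI ring_hom_cring_compose[OF B_unit_hom]) auto
  interpret m: pring A "UP B" "\<lambda>a. up_ring.monom (UP B) (a \<odot>\<^bsub>B\<^esub> \<one>\<^bsub>B\<^esub>) 0" "up_ring.monom (UP B) \<one>\<^bsub>B\<^esub> (Suc 0)" by (rule mp)
  have \<mu>c: "\<mu> q \<in> carrier (UP B)" if "q \<in> carrier (UP A)" for q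
    unfolding \<mu>_def by (rule m.ev_closed[OF that])
  have ev\<mu>: "p.ev (\<mu> q) = tn \<one>\<^bsub>B\<^esub> (fL q)" if q: "q \<in> carrier (UP A)" for q
    unfolding \<mu>_def hom_T_eval[OF T_id_hom q]
    by (rule eval_hom_comp[OF mp p.ev_hom _ _ q])
      (use p.U.eval_const[of xT] p.U.eval_monom1[of xT] xT_closed in auto)
  show ?thesis using t
  proof (induction rule: T_induct)
    case (tens b r)
    from tens(2) obtain m s where r: "r = L.f0 m s" "m \<in> carrier (UP A)" "s \<in> S"
      unfolding RR_simps by (auto elim: L.L_cases)
    have s: "s \<in> carrier (UP A)" using r(3) by simp
    have c: "fL m \<in> carrier RR" "fL s \<in> carrier RR" "L.f0 \<one>\<^bsub>UP A\<^esub> s \<in> carrier RR"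
      using fL_closed r s L.L_closed[of "\<one>\<^bsub>UP A\<^esub>" s] by (auto simp: RR_simps)
    have sm: "fL s \<otimes>\<^bsub>RR\<^esub> r = fL m"
    proof -
      have "fL s \<otimes>\<^bsub>RR\<^esub> r = fL s \<otimes>\<^bsub>RR\<^esub> (fL m \<otimes>\<^bsub>RR\<^esub> L.f0 \<one>\<^bsub>UP A\<^esub> s)"
        unfolding r(1) L.L_split[OF r(2,3)] by (simp add: RR_simps)
      also have "\<dots> = fL m \<otimes>\<^bsub>RR\<^esub> (fL s \<otimes>\<^bsub>RR\<^esub> L.f0 \<one>\<^bsub>UP A\<^esub> s)"
        using c by (simp only: R.m_lcomm)
      also have "fL s \<otimes>\<^bsub>RR\<^esub> L.f0 \<one>\<^bsub>UP A\<^esub> s = \<one>\<^bsub>RR\<^esub>" using L.L_inverse[OF r(3)] by (simp add: RR_simps)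
      finally show ?thesis using c by simp
    qed
    have "p.ev (\<mu> s) \<otimes>\<^bsub>T\<^esub> tn b r = tn b (fL m)"
      unfolding ev\<mu>[OF s] using tens c sm by (simp add: tens_mult)
    also have "\<dots> = \<iota> b \<otimes>\<^bsub>T\<^esub> p.ev (\<mu> m)"
      unfolding ev\<mu>[OF r(2)] by (rule tens_split[OF tens(1) c(1)])
    also have "\<dots> = p.ev (up_ring.monom (UP B) b 0 \<otimes>\<^bsub>UP B\<^esub> \<mu> m)"
      unfolding ev.hom_mult[OF p.U.monom_closed[OF tens(1)] \<mu>c[OF r(2)]]
        p.U.eval_const[OF xT_closed tens(1)] by (rule refl)
    finally have "p.ev (\<mu> s) \<otimes>\<^bsub>T\<^esub> tn b r = p.ev (up_ring.monom (UP B) b 0 \<otimes>\<^bsub>UP B\<^esub> \<mu> m)" .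
    moreover have "p.ev (\<mu> s) \<in> Units T" unfolding ev\<mu>[OF s] by (rule S_unit_T[OF r(3)])
    moreover have "up_ring.monom (UP B) b 0 \<otimes>\<^bsub>UP B\<^esub> \<mu> m \<in> carrier (UP B)"
      by (rule p.U.P.m_closed[OF p.U.monom_closed[OF tens(1)] \<mu>c[OF r(2)]])
    ultimately show ?case using \<mu>c[OF s] by blast
  next
    case (add t t')
    then obtain p w p' w' where *: "p \<in> carrier (UP B)" "w \<in> carrier (UP B)" "p.ev w \<in> Units T" "p.ev w \<otimes>\<^bsub>T\<^esub> t = p.ev p"
      "p' \<in> carrier (UP B)" "w' \<in> carrier (UP B)" "p.ev w' \<in> Units T" "p.ev w' \<otimes>\<^bsub>T\<^esub> t' = p.ev p'" by blast
    have "p.ev (w \<otimes>\<^bsub>UP B\<^esub> w') \<otimes>\<^bsub>T\<^esub> (t \<oplus>\<^bsub>T\<^esub> t')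
      = p.ev w' \<otimes>\<^bsub>T\<^esub> (p.ev w \<otimes>\<^bsub>T\<^esub> t) \<oplus>\<^bsub>T\<^esub> p.ev w \<otimes>\<^bsub>T\<^esub> (p.ev w' \<otimes>\<^bsub>T\<^esub> t')"
      unfolding ev.hom_mult[OF *(2,6)]
      using p.ev_closed[OF *(2)] p.ev_closed[OF *(6)] add(1,2) by (simp add: T.l_distr T.r_distr T.m_ac)
    also have "\<dots> = p.ev (w' \<otimes>\<^bsub>UP B\<^esub> p \<oplus>\<^bsub>UP B\<^esub> w \<otimes>\<^bsub>UP B\<^esub> p')"
      unfolding *(4,8) using *(1,2,5,6) by simp
    finally have "p.ev (w \<otimes>\<^bsub>UP B\<^esub> w') \<otimes>\<^bsub>T\<^esub> (t \<oplus>\<^bsub>T\<^esub> t') = p.ev (w' \<otimes>\<^bsub>UP B\<^esub> p \<oplus>\<^bsub>UP B\<^esub> w \<otimes>\<^bsub>UP B\<^esub> p')" .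
    moreover have "p.ev (w \<otimes>\<^bsub>UP B\<^esub> w') \<in> Units T"
      unfolding ev.hom_mult[OF *(2,6)] by (rule T.Units_m_closed[OF *(3,7)])
    moreover have "w' \<otimes>\<^bsub>UP B\<^esub> p \<oplus>\<^bsub>UP B\<^esub> w \<otimes>\<^bsub>UP B\<^esub> p' \<in> carrier (UP B)" "w \<otimes>\<^bsub>UP B\<^esub> w' \<in> carrier (UP B)"
      using *(1,2,5,6) by simp_all
    ultimately show ?case by blast
  next
    case (minus t)
    then obtain p w where *: "p \<in> carrier (UP B)" "w \<in> carrier (UP B)" "p.ev w \<in> Units T" "p.ev w \<otimes>\<^bsub>T\<^esub> t = p.ev p" by blast
    have "p.ev w \<otimes>\<^bsub>T\<^esub> (\<ominus>\<^bsub>T\<^esub> t) = p.ev (\<ominus>\<^bsub>UP B\<^esub> p)"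
      using *(1,4) p.ev_closed[OF *(2)] minus(1) by (simp add: T.r_minus)
    moreover have "\<ominus>\<^bsub>UP B\<^esub> p \<in> carrier (UP B)" using *(1) by simp
    ultimately show ?case using *(2,3) by blast
  qed
qed

end

text \<open>An element of the quotient is a combination of powers below \<open>n\<close>, and its
  image is the same combination of powers of \<open>y\<close>, which vanishes only with its
  coefficients.\<close>

lemma (in cring) mq_inj:
  assumes a: "\<And>i. i < n \<Longrightarrow> a i \<in> carrier R"
    and j: "ring_hom_cring (mq_ring R n a) C j" "\<And>b. b \<in> carrier R \<Longrightarrow> j (mq_hom R n a b) = k b"
      "j (mq_var R n a) = y"
    and ind: "\<And>c. \<lbrakk>c \<in> {..<n} \<rightarrow> carrier R; lincomb C k y n c = \<zero>\<^bsub>C\<^esub>\<rbrakk> \<Longrightarrow> \<forall>i<n. c i = \<zero>"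
    and z: "z \<in> carrier (mq_ring R n a)" "j z = \<zero>\<^bsub>C\<^esub>"
  shows "z = \<zero>\<^bsub>mq_ring R n a\<^esub>"
proof -
  have mp: "pring R (mq_ring R n a) (mq_hom R n a) (mq_var R n a)" by (rule mq_pring(1)) (rule a)
  have pb: "power_basis R (mq_ring R n a) (mq_hom R n a) (mq_var R n a) n" by (rule mq_pring(3)) (rule a)
  interpret m: pring R "mq_ring R n a" "mq_hom R n a" "mq_var R n a" by (rule mp)
  obtain c where c: "c \<in> {..<n} \<rightarrow> carrier R" "z = m.lin n c"
    using pb z(1) unfolding power_basis_def by blast
  have "lincomb C k y n c = j (m.lin n c)"
    by (rule hom_lincomb[OF mp j, symmetric]) (use c in auto)
  then have "\<forall>i<n. c i = \<zero>" using ind[OF c(1)] z(2) c(2) by simp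
  then have "m.lin n c = m.lin n (\<lambda>i. \<zero>)" by (intro m.lin_cong) auto
  then show ?thesis unfolding c(2) by (simp only: m.lin_zero)
qed

text \<open>The inverse of \<open>j u\<close> is a combination of powers of \<open>y\<close>, hence
  lifts along \<open>j\<close>; injectivity makes the lift an inverse of \<open>u\<close>.\<close>

lemma (in cring) mq_unit_reflect:
  assumes a: "\<And>i. i < n \<Longrightarrow> a i \<in> carrier R"
    and j: "ring_hom_cring (mq_ring R n a) C j" "\<And>b. b \<in> carrier R \<Longrightarrow> j (mq_hom R n a b) = k b"
      "j (mq_var R n a) = y"
    and pb: "power_basis R C k y n"
    and u: "u \<in> carrier (mq_ring R n a)" "j u \<in> Units C"
  shows "u \<in> Units (mq_ring R n a)"
proof -
  have mp: "pring R (mq_ring R n a) (mq_hom R n a) (mq_var R n a)" by (rule mq_pring(1)) (rule a)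
  interpret m: pring R "mq_ring R n a" "mq_hom R n a" "mq_var R n a" by (rule mp)
  interpret j: ring_hom_cring "mq_ring R n a" C j by (rule j(1))
  obtain v where v: "v \<in> carrier C" "j u \<otimes>\<^bsub>C\<^esub> v = \<one>\<^bsub>C\<^esub>"
    using u(2) unfolding Units_def using j.S.m_comm by auto
  obtain c where c: "c \<in> {..<n} \<rightarrow> carrier R" "v = lincomb C k y n c"
    using pb v(1) unfolding power_basis_def by blast
  have cc: "\<And>i. i < n \<Longrightarrow> c i \<in> carrier R" using c(1) by auto
  define w where "w = m.lin n c"
  have w: "w \<in> carrier (mq_ring R n a)" unfolding w_def using cc by simp
  have jw: "j w = v" unfolding w_def c(2) by (rule hom_lincomb[OF mp j]) (use cc in auto)
  have ind: "\<forall>i<n. d i = \<zero>" if "d \<in> {..<n} \<rightarrow> carrier R" "lincomb C k y n d = \<zero>\<^bsub>C\<^esub>" for d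
    using pb that unfolding power_basis_def by blast
  have uw: "u \<otimes>\<^bsub>mq_ring R n a\<^esub> w \<in> carrier (mq_ring R n a)" using u w by simp
  have "u \<otimes>\<^bsub>mq_ring R n a\<^esub> w \<ominus>\<^bsub>mq_ring R n a\<^esub> \<one>\<^bsub>mq_ring R n a\<^esub> = \<zero>\<^bsub>mq_ring R n a\<^esub>"
  proof (rule mq_inj[OF a j ind])
    show "u \<otimes>\<^bsub>mq_ring R n a\<^esub> w \<ominus>\<^bsub>mq_ring R n a\<^esub> \<one>\<^bsub>mq_ring R n a\<^esub> \<in> carrier (mq_ring R n a)"
      using uw by simp
    show "j (u \<otimes>\<^bsub>mq_ring R n a\<^esub> w \<ominus>\<^bsub>mq_ring R n a\<^esub> \<one>\<^bsub>mq_ring R n a\<^esub>) = \<zero>\<^bsub>C\<^esub>"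
      using uw u(1) w v jw by (simp add: a_minus_def j.S.r_neg)
  qed
  then have 1: "u \<otimes>\<^bsub>mq_ring R n a\<^esub> w = \<one>\<^bsub>mq_ring R n a\<^esub>" using uw by simp
  then have "w \<otimes>\<^bsub>mq_ring R n a\<^esub> u = \<one>\<^bsub>mq_ring R n a\<^esub>" using m.S.m_comm[OF w u(1)] by simp
  then show ?thesis using 1 u(1) w unfolding Units_def by blast
qed

lemma quot_surj: "q \<in> carrier (R Quot I) \<Longrightarrow> \<exists>t\<in>carrier R. q = I +>\<^bsub>R\<^esub> t"
  unfolding FactRing_def A_RCOSETS_def' by auto

lemma quot_zero: "ideal I R \<Longrightarrow> \<zero>\<^bsub>R Quot I\<^esub> = I"
  by (simp add: FactRing_def)

lemma (in cring) quot_hom: "ideal I R \<Longrightarrow> ring_hom_cring R (R Quot I) (\<lambda>t. I +> t)"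
  by (rule ring_hom_cringI'[OF is_cring ideal.quotient_is_cring[OF _ is_cring] ideal.rcos_ring_hom])

lemma (in cring) quot_eq_zero_iff:
  assumes I: "ideal I R" and t: "t \<in> carrier R"
  shows "I +> t = \<zero>\<^bsub>R Quot I\<^esub> \<longleftrightarrow> t \<in> I"
proof -
  interpret I: ideal I R by fact
  show ?thesis
    unfolding quot_zero[OF I]
    using I.a_rcos_const I.a_rcos_self[OF t] t by auto
qed

section \<open>Points cut out by monic polynomials\<close>

context hilb_tensor
begin

text \<open>Here \<open>a\<close> stands for the monic polynomial \<open>x\<^sup>n - (\<Sum>i<n. a i * x\<^sup>i)\<close>.\<close>

definition good :: "nat \<Rightarrow> (nat \<Rightarrow> 'b) \<Rightarrow> bool"
  where "good n a \<longleftrightarrow> (\<forall>i<n. a i \<in> carrier B) \<and>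
    (\<forall>s\<in>S. UnivPoly.eval A (mq_ring B n a) (\<lambda>b. mq_hom B n a (b \<odot>\<^bsub>B\<^esub> \<one>\<^bsub>B\<^esub>)) (mq_var B n a) s
      \<in> Units (mq_ring B n a))"

definition proj :: "nat \<Rightarrow> (nat \<Rightarrow> 'b) \<Rightarrow> ('b \<times> ((nat \<Rightarrow> 'a) \<times> (nat \<Rightarrow> 'a)) set \<Rightarrow> int) set \<Rightarrow> (nat \<Rightarrow> 'b) set"
  where "proj n a = (SOME \<psi>. ring_hom_cring T (mq_ring B n a) \<psi> \<and>
    (\<forall>b\<in>carrier B. \<psi> (\<iota> b) = mq_hom B n a b) \<and> \<psi> xT = mq_var B n a)"

text \<open>The point that belongs to the polynomial \<open>a\<close>. As an ideal of
  \<open>T\<close> it can be compared with the kernels of maps to quite different rings.\<close>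

definition cut :: "nat \<Rightarrow> (nat \<Rightarrow> 'b) \<Rightarrow> ('b \<times> ((nat \<Rightarrow> 'a) \<times> (nat \<Rightarrow> 'a)) set \<Rightarrow> int) set set"
  where "cut n a = a_kernel T (mq_ring B n a) (proj n a)"

lemma goodD: "good n a \<Longrightarrow> i < n \<Longrightarrow> a i \<in> carrier B"
  by (simp add: good_def)

lemma proj_props:
  assumes g: "good n a"
  shows "ring_hom_cring T (mq_ring B n a) (proj n a)"
    "\<And>b. b \<in> carrier B \<Longrightarrow> proj n a (\<iota> b) = mq_hom B n a b" "proj n a xT = mq_var B n a"
proof -
  have "\<exists>\<psi>. ring_hom_cring T (mq_ring B n a) \<psi> \<and>
    (\<forall>b\<in>carrier B. \<psi> (\<iota> b) = mq_hom B n a b) \<and> \<psi> xT = mq_var B n a"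
    by (rule T_universal[OF B.mq_pring(1)]) (use g in \<open>auto simp: good_def\<close>)
  from someI_ex[OF this, folded proj_def]
  show "ring_hom_cring T (mq_ring B n a) (proj n a)"
    "\<And>b. b \<in> carrier B \<Longrightarrow> proj n a (\<iota> b) = mq_hom B n a b" "proj n a xT = mq_var B n a" by blast+
qed

lemma proj_lin:
  assumes g: "good n a" and c: "\<And>i. i < n \<Longrightarrow> c i \<in> carrier B"
  shows "proj n a (lincomb T \<iota> xT n c) = lincomb (mq_ring B n a) (mq_hom B n a) (mq_var B n a) n c"
  by (rule hom_lincomb[OF T_pring proj_props(1)[OF g]]) (use proj_props[OF g] c in auto)

lemma good_mq:
  assumes "good n a"
  shows "pring B (mq_ring B n a) (mq_hom B n a) (mq_var B n a)"
    and "mq_var B n a [^]\<^bsub>mq_ring B n a\<^esub> n = lincomb (mq_ring B n a) (mq_hom B n a) (mq_var B n a) n a"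
    and "power_basis B (mq_ring B n a) (mq_hom B n a) (mq_var B n a) n"
  by (rule B.mq_pring; rule goodD[OF assms]; assumption)+

lemma cut_ideal:
  assumes g: "good n a"
  shows "ideal (cut n a) T"
proof -
  interpret p: ring_hom_cring T "mq_ring B n a" "proj n a" by (rule proj_props(1)[OF g])
  show ?thesis unfolding cut_def by (rule p.ring.kernel_is_ideal)
qed

lemma proj_surj_lin:
  assumes g: "good n a" and t: "t \<in> carrier T"
  shows "\<exists>c\<in>{..<n} \<rightarrow> carrier B. proj n a t = proj n a (lincomb T \<iota> xT n c)"
proof -
  interpret p: ring_hom_cring T "mq_ring B n a" "proj n a" by (rule proj_props(1)[OF g])
  have pb: "power_basis B (mq_ring B n a) (mq_hom B n a) (mq_var B n a) n"
    by (rule good_mq(3)[OF g])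
  obtain c where c: "c \<in> {..<n} \<rightarrow> carrier B"
    "proj n a t = lincomb (mq_ring B n a) (mq_hom B n a) (mq_var B n a) n c"
    using pb p.hom_closed[OF t] unfolding power_basis_def by blast
  have "proj n a t = proj n a (lincomb T \<iota> xT n c)"
    unfolding c(2) by (rule proj_lin[OF g, symmetric]) (use c in auto)
  then show ?thesis using c(1) by blast
qed

text \<open>A hom out of \<open>T\<close> for which the powers of the image of \<open>xT\<close> below \<open>n\<close> are independent and
  that kills a monic polynomial of degree \<open>n\<close> factors injectively through the quotient by it.\<close>

lemma kernel_eq_cut:
  assumes g: "good n a" and q: "pring B C k y" and \<psi>: "ring_hom_cring T C \<psi>"
    and b: "\<And>b. b \<in> carrier B \<Longrightarrow> \<psi> (\<iota> b) = k b" and x: "\<psi> xT = y"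
    and yn: "y [^]\<^bsub>C\<^esub> n = lincomb C k y n a"
    and ind: "\<And>c. \<lbrakk>c \<in> {..<n} \<rightarrow> carrier B; lincomb C k y n c = \<zero>\<^bsub>C\<^esub>\<rbrakk> \<Longrightarrow> \<forall>i<n. c i = \<zero>\<^bsub>B\<^esub>"
  shows "a_kernel T C \<psi> = cut n a"
proof -
  have ac: "\<And>i. i < n \<Longrightarrow> a i \<in> carrier B" by (rule goodD[OF g])
  interpret \<psi>: ring_hom_cring T C \<psi> by (rule \<psi>)
  interpret p: ring_hom_cring T "mq_ring B n a" "proj n a" by (rule proj_props(1)[OF g])
  have mp: "pring B (mq_ring B n a) (mq_hom B n a) (mq_var B n a)" by (rule good_mq(1)[OF g])
  interpret m: pring B "mq_ring B n a" "mq_hom B n a" "mq_var B n a" by (rule mp)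
  obtain j where j: "ring_hom_cring (mq_ring B n a) C j"
    "\<And>b. b \<in> carrier B \<Longrightarrow> j (mq_hom B n a b) = k b" "j (mq_var B n a) = y"
    using B.mq_universal[OF ac q yn] by blast
  interpret j: ring_hom_cring "mq_ring B n a" C j by (rule j(1))
  \<comment> \<open>\<open>\<psi>\<close> is \<open>j\<close> after \<open>proj n a\<close>, as both
    agree on \<open>B\<close> and on \<open>xT\<close>. Injectivity of \<open>j\<close> then
    identifies the kernels.\<close>
  have eq: "\<psi> t = j (proj n a t)" if "t \<in> carrier T" for t
    by (rule T_unique[OF \<psi> ring_hom_cring_compose[OF proj_props(1)[OF g] j(1)] _ _ that])
      (use b x j proj_props[OF g] in auto)
  have "proj n a t = \<zero>\<^bsub>mq_ring B n a\<^esub>" if t: "t \<in> carrier T" "j (proj n a t) = \<zero>\<^bsub>C\<^esub>" for t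
    by (rule B.mq_inj[OF _ j ind p.hom_closed[OF t(1)] t(2)]) (use ac in auto)
  moreover have "j \<zero>\<^bsub>mq_ring B n a\<^esub> = \<zero>\<^bsub>C\<^esub>" by (rule j.hom_zero)
  ultimately have "\<psi> t = \<zero>\<^bsub>C\<^esub> \<longleftrightarrow> proj n a t = \<zero>\<^bsub>mq_ring B n a\<^esub>" if "t \<in> carrier T" for t
    using eq[OF that] that by metis
  then show ?thesis unfolding cut_def a_kernel_def' by blast
qed

text \<open>\<open>a\<close> is a total function of which only the values below \<open>n\<close>
  carry meaning. The criterion \<open>kernel_eq_cut\<close> for \<open>a'\<close> is applied to the
  projection that belongs to \<open>a\<close>.\<close>

lemma cut_cong:
  assumes "good n a" "good n a'" "\<And>i. i < n \<Longrightarrow> a i = a' i"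
  shows "cut n a = cut n a'"
proof -
  have ac: "\<And>i. i < n \<Longrightarrow> a i \<in> carrier B" by (rule goodD[OF assms(1)])
  interpret m: pring B "mq_ring B n a" "mq_hom B n a" "mq_var B n a" by (rule good_mq(1)[OF assms(1)])
  have "mq_var B n a [^]\<^bsub>mq_ring B n a\<^esub> n = m.lin n a'"
    unfolding good_mq(2)[OF assms(1)] by (rule m.lin_cong) (use assms ac in auto)
  then have "a_kernel T (mq_ring B n a) (proj n a) = cut n a'"
    by (intro kernel_eq_cut[OF assms(2) m.pring_axioms proj_props[OF assms(1)]])
      (use good_mq(3)[OF assms(1)] in \<open>auto simp: power_basis_def\<close>)
  then show ?thesis by (simp add: cut_def)
qed

lemma relation_in_cut:
  assumes g: "good n a"
  shows "xT [^]\<^bsub>T\<^esub> n \<ominus>\<^bsub>T\<^esub> lincomb T \<iota> xT n a \<in> cut n a"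
proof -
  have ac: "\<And>i. i < n \<Longrightarrow> a i \<in> carrier B" by (rule goodD[OF g])
  interpret t: pring B T \<iota> xT by (rule T_pring)
  interpret p: ring_hom_cring T "mq_ring B n a" "proj n a" by (rule proj_props(1)[OF g])
  have c: "t.lin n a \<in> carrier T" "xT [^]\<^bsub>T\<^esub> n \<in> carrier T" using ac xT_closed by auto
  have l: "proj n a (t.lin n a) = lincomb (mq_ring B n a) (mq_hom B n a) (mq_var B n a) n a"
    by (rule proj_lin[OF g]) (rule ac)
  have "proj n a (xT [^]\<^bsub>T\<^esub> n) = proj n a (t.lin n a)"
    unfolding l p.hom_pow[OF xT_closed] proj_props(3)[OF g] good_mq(2)[OF g] by (rule refl)
  then show ?thesis
    unfolding cut_def a_kernel_def' using c by (simp add: a_minus_def p.S.r_neg)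
qed

lemma lin_in_cut:
  assumes g: "good n a" and c: "c \<in> {..<n} \<rightarrow> carrier B" and l: "lincomb T \<iota> xT n c \<in> cut n a"
  shows "\<forall>i<n. c i = \<zero>\<^bsub>B\<^esub>"
proof -
  have "lincomb (mq_ring B n a) (mq_hom B n a) (mq_var B n a) n c = \<zero>\<^bsub>mq_ring B n a\<^esub>"
  proof -
    have "proj n a (lincomb T \<iota> xT n c) = lincomb (mq_ring B n a) (mq_hom B n a) (mq_var B n a) n c"
      by (rule proj_lin[OF g]) (use c in auto)
    then show ?thesis using l unfolding cut_def a_kernel_def' by simp
  qed
  then show ?thesis using good_mq(3)[OF g] c unfolding power_basis_def by blast
qed

text \<open>Both monic relations lie in the common ideal. Their difference is a combination of
  powers below \<open>n\<close> in it, so its coefficients vanish.\<close>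

lemma cut_inj:
  assumes g: "good n a" "good n a'" and eq: "cut n a = cut n a'" and i: "i < n"
  shows "a i = a' i"
proof -
  interpret t: pring B T \<iota> xT by (rule T_pring)
  interpret I: ideal "cut n a" T by (rule cut_ideal[OF g(1)])
  have ac: "\<And>i. i < n \<Longrightarrow> a i \<in> carrier B" and ac': "\<And>i. i < n \<Longrightarrow> a' i \<in> carrier B"
    using goodD[OF g(1)] goodD[OF g(2)] by auto
  let ?x = "xT [^]\<^bsub>T\<^esub> n"
  have x: "?x \<in> carrier T" using xT_closed by simp
  have la: "t.lin n a \<in> carrier T" "t.lin n a' \<in> carrier T" using ac ac' by auto
  have "(?x \<ominus>\<^bsub>T\<^esub> t.lin n a') \<ominus>\<^bsub>T\<^esub> (?x \<ominus>\<^bsub>T\<^esub> t.lin n a) \<in> cut n a"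
    unfolding a_minus_def[of _ _ "_ \<ominus>\<^bsub>T\<^esub> _"]
    by (rule I.a_closed[OF relation_in_cut[OF g(2), folded eq] I.a_inv_closed[OF relation_in_cut[OF g(1)]]])
  also have "(?x \<ominus>\<^bsub>T\<^esub> t.lin n a') \<ominus>\<^bsub>T\<^esub> (?x \<ominus>\<^bsub>T\<^esub> t.lin n a) = t.lin n a \<ominus>\<^bsub>T\<^esub> t.lin n a'"
  proof -
    have "(p \<oplus>\<^bsub>T\<^esub> q) \<oplus>\<^bsub>T\<^esub> (r \<oplus>\<^bsub>T\<^esub> s) = (p \<oplus>\<^bsub>T\<^esub> r) \<oplus>\<^bsub>T\<^esub> (s \<oplus>\<^bsub>T\<^esub> q)"
      if "p \<in> carrier T" "q \<in> carrier T" "r \<in> carrier T" "s \<in> carrier T" for p q r s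
      using that by (simp add: T.a_ac)
    from this[of ?x "\<ominus>\<^bsub>T\<^esub> t.lin n a'" "\<ominus>\<^bsub>T\<^esub> ?x" "t.lin n a"]
    show ?thesis using x la by (simp add: a_minus_def T.minus_add T.r_neg)
  qed
  also have "\<dots> = t.lin n (\<lambda>i. a i \<ominus>\<^bsub>B\<^esub> a' i)" by (rule t.lin_diff[OF ac ac', symmetric])
  finally have "\<forall>i<n. a i \<ominus>\<^bsub>B\<^esub> a' i = \<zero>\<^bsub>B\<^esub>"
    by (intro lin_in_cut[OF g(1)]) (use ac ac' in auto)
  then have "a i \<ominus>\<^bsub>B\<^esub> a' i = \<zero>\<^bsub>B\<^esub>" using i by blast
  then show ?thesis
    using ring.r_right_minus_eq[OF cring.axioms(1)[OF B.M_cring] ac[OF i] ac'[OF i]] by simp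
qed

end

text \<open>Universal properties deliver total functions, whereas \<open>alg_hom\<close> asks for
  extensional ones; restriction bridges the two.\<close>

lemma alg_hom_restrictI:
  assumes B: "algebra A B" and g: "ring_hom_cring B C g"
    and sm: "\<And>a x. \<lbrakk>a \<in> carrier A; x \<in> carrier B\<rbrakk> \<Longrightarrow> g (a \<odot>\<^bsub>B\<^esub> x) = a \<odot>\<^bsub>C\<^esub> g x"
  shows "restrict g (carrier B) \<in> alg_hom A B C"
proof -
  interpret B: algebra A B by (rule B)
  interpret g: ring_hom_cring B C g by (rule g)
  show ?thesis
    unfolding alg_hom_def
  proof (intro CollectI conjI IntI ballI)
    show "restrict g (carrier B) \<in> ring_hom B C"
      by (rule ring_hom_memI) auto
    show "restrict g (carrier B) (a \<odot>\<^bsub>B\<^esub> x) = a \<odot>\<^bsub>C\<^esub> restrict g (carrier B) x"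
      if "a \<in> carrier A" "x \<in> carrier B" for a x
      using that sm[OF that] by simp
  qed simp
qed

section \<open>The points of the Hilbert functor\<close>

context hilb_tensor
begin

text \<open>Of the quotient \<open>Q\<close> only its power basis is retained. Through it
  \<open>B[x]/(F)\<close> maps to \<open>Q\<close> injectively, so the kernel depends on
  \<open>F\<close> alone.\<close>

lemma hilb_imp_cut:
  assumes I: "I \<in> hilb A RR n B"
  shows "\<exists>a. good n a \<and> I = cut n a"
proof -
  obtain Q :: "('b, ('b \<times> ((nat \<Rightarrow> 'a) \<times> (nat \<Rightarrow> 'a)) set \<Rightarrow> int) set set) module" and \<phi>
    where I: "I = a_kernel T Q \<phi>" and Q: "algebra B Q" and lf: "locally_free_of_rank B Q n"
      and \<phi>: "\<phi> \<in> alg_hom B T Q" and sur: "\<phi> ` carrier T = carrier Q"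
    using I unfolding hilb_def by blast
  interpret Q: algebra B Q by (rule Q)
  have hom: "ring_hom_cring T Q \<phi>"
    using \<phi> by (intro ring_hom_cringI' T_cring Q.M_cring) (simp add: alg_hom_def)
  interpret \<phi>: ring_hom_cring T Q \<phi> by (rule hom)
  define k where "k = (\<lambda>b. b \<odot>\<^bsub>Q\<^esub> \<one>\<^bsub>Q\<^esub>)"
  define y where "y = \<phi> xT"
  have kh: "ring_hom_cring B Q k" unfolding k_def by (rule algebra_unit_hom[OF Q])
  have y: "y \<in> carrier Q" unfolding y_def by (rule \<phi>.hom_closed[OF xT_closed])
  have q: "pring B Q k y" by (rule pringI[OF kh y])
  interpret q: pring B Q k y by (rule q)
  have \<phi>\<iota>: "\<phi> (\<iota> b) = k b" if b: "b \<in> carrier B" for b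
  proof -
    have "\<phi> (b \<odot>\<^bsub>T\<^esub> \<one>\<^bsub>T\<^esub>) = b \<odot>\<^bsub>Q\<^esub> \<phi> \<one>\<^bsub>T\<^esub>"
      using \<phi> b T.one_closed unfolding alg_hom_def by blast
    moreover have "b \<odot>\<^bsub>T\<^esub> \<one>\<^bsub>T\<^esub> = \<iota> b"
    proof -
      have "b \<odot>\<^bsub>T\<^esub> \<one>\<^bsub>T\<^esub> = \<iota> b \<otimes>\<^bsub>T\<^esub> \<one>\<^bsub>T\<^esub>" by (rule T_simps(6))
      then show ?thesis using b by simp
    qed
    ultimately show ?thesis unfolding k_def by simp
  qed
  have \<phi>ev: "\<phi> (UnivPoly.eval B T \<iota> xT p) = q.ev p" if "p \<in> carrier (UP B)" for p
    by (rule eval_hom_comp[OF T_pring hom _ y_def that]) (rule \<phi>\<iota>[symmetric])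
  \<comment> \<open>Fractions in \<open>T\<close> are carried to fractions in \<open>Q\<close>:
    \<open>\<phi>\<close> is onto and preserves units.\<close>
  have gen: "\<exists>p\<in>carrier (UP B). \<exists>w\<in>carrier (UP B). q.ev w \<in> Units Q \<and> q.ev w \<otimes>\<^bsub>Q\<^esub> z = q.ev p"
    if "z \<in> carrier Q" for z
  proof -
    have "z \<in> \<phi> ` carrier T" using that unfolding sur .
    then obtain t where t: "t \<in> carrier T" "z = \<phi> t" by (elim imageE) auto
    obtain p w where pw: "p \<in> carrier (UP B)" "w \<in> carrier (UP B)"
      "UnivPoly.eval B T \<iota> xT w \<in> Units T"
      "UnivPoly.eval B T \<iota> xT w \<otimes>\<^bsub>T\<^esub> t = UnivPoly.eval B T \<iota> xT p"
      using T_fractions[OF t(1)] by blast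
    have "q.ev w \<otimes>\<^bsub>Q\<^esub> z = \<phi> (UnivPoly.eval B T \<iota> xT w \<otimes>\<^bsub>T\<^esub> t)"
      unfolding t(2) \<phi>ev[OF pw(2), symmetric] by (rule \<phi>.hom_mult[symmetric, OF pring.ev_closed[OF T_pring pw(2)] t(1)])
    then have "q.ev w \<otimes>\<^bsub>Q\<^esub> z = q.ev p" unfolding pw(4) \<phi>ev[OF pw(1)] .
    moreover have "q.ev w \<in> Units Q" using hom_Units[OF hom pw(3)] unfolding \<phi>ev[OF pw(2)] .
    ultimately show ?thesis using pw(1,2) by blast
  qed
  have sm: "b \<odot>\<^bsub>Q\<^esub> z = k b \<otimes>\<^bsub>Q\<^esub> z" if "b \<in> carrier B" "z \<in> carrier Q" for b z
    unfolding k_def by (rule algebra_smult_eq[OF Q that])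
  have pb: "power_basis B Q k y n"
  proof (rule q.power_basis_from_local)
    fix P assume "primeideal P B"
    then obtain f where f: "f \<in> carrier B - P"
      and fr: "free_of_rank (loc_ring B (range (\<lambda>k::nat. f [^]\<^bsub>B\<^esub> k)))
        (loc_module B (range (\<lambda>k::nat. f [^]\<^bsub>B\<^esub> k)) Q) n"
      using lf unfolding locally_free_of_rank_def Let_def by blast
    let ?F = "range (\<lambda>k::nat. f [^]\<^bsub>B\<^esub> k)"
    have Fs: "submonoid ?F B" using f by (intro cring.powers_submonoid[OF B.M_cring]) auto
    interpret F: frac B Q ?F using Fs by (simp add: frac_def frac_axioms_def Q.module_axioms)
    obtain v where v: "\<And>i. i < n \<Longrightarrow> v i \<in> carrier Q"
      and sp: "\<And>m. m \<in> carrier Q \<Longrightarrow>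
        \<exists>t\<in>?F. \<exists>c\<in>{..<n} \<rightarrow> carrier B. t \<odot>\<^bsub>Q\<^esub> m = (\<Oplus>\<^bsub>Q\<^esub>i\<in>{..<n}. c i \<odot>\<^bsub>Q\<^esub> v i)"
      and ind: "\<And>c. \<lbrakk>c \<in> {..<n} \<rightarrow> carrier B; (\<Oplus>\<^bsub>Q\<^esub>i\<in>{..<n}. c i \<odot>\<^bsub>Q\<^esub> v i) = \<zero>\<^bsub>Q\<^esub>\<rbrakk>
        \<Longrightarrow> \<exists>t\<in>?F. \<forall>i<n. t \<otimes>\<^bsub>B\<^esub> c i = \<zero>\<^bsub>B\<^esub>"
      using F.free_of_rank_locD[OF fr] by blast
    have sums: "(\<Oplus>\<^bsub>Q\<^esub>i\<in>{..<n}. k (c i) \<otimes>\<^bsub>Q\<^esub> v i) = (\<Oplus>\<^bsub>Q\<^esub>i\<in>{..<n}. c i \<odot>\<^bsub>Q\<^esub> v i)"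
      if "c \<in> {..<n} \<rightarrow> carrier B" for c
      by (rule Q.finsum_cong') (use that v sm in \<open>auto simp: Pi_iff\<close>)
    have sp': "\<exists>t\<in>?F. \<exists>c\<in>{..<n} \<rightarrow> carrier B. k t \<otimes>\<^bsub>Q\<^esub> m = (\<Oplus>\<^bsub>Q\<^esub>i\<in>{..<n}. k (c i) \<otimes>\<^bsub>Q\<^esub> v i)"
      if m: "m \<in> carrier Q" for m
    proof -
      obtain t c where tc: "t \<in> ?F" "c \<in> {..<n} \<rightarrow> carrier B" "t \<odot>\<^bsub>Q\<^esub> m = (\<Oplus>\<^bsub>Q\<^esub>i\<in>{..<n}. c i \<odot>\<^bsub>Q\<^esub> v i)"
        using sp[OF m] by blast
      have "k t \<otimes>\<^bsub>Q\<^esub> m = (\<Oplus>\<^bsub>Q\<^esub>i\<in>{..<n}. k (c i) \<otimes>\<^bsub>Q\<^esub> v i)"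
        unfolding sums[OF tc(2)] tc(3)[symmetric] by (rule sm[symmetric, OF F.T_carr[OF tc(1)] m])
      then show ?thesis using tc(1,2) by blast
    qed
    have ind': "\<exists>t\<in>?F. \<forall>i<n. t \<otimes>\<^bsub>B\<^esub> c i = \<zero>\<^bsub>B\<^esub>"
      if "c \<in> {..<n} \<rightarrow> carrier B" "(\<Oplus>\<^bsub>Q\<^esub>i\<in>{..<n}. k (c i) \<otimes>\<^bsub>Q\<^esub> v i) = \<zero>\<^bsub>Q\<^esub>" for c
      by (rule ind[OF that(1)]) (use that(2) sums[OF that(1)] in simp)
    note lp = q.local_power_basis[OF Fs v sp' ind' gen]
    have "(\<forall>z\<in>carrier Q. \<exists>t\<in>?F. \<exists>c\<in>{..<n} \<rightarrow> carrier B. k t \<otimes>\<^bsub>Q\<^esub> z = q.lin n c) \<and>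
      (\<forall>c\<in>{..<n} \<rightarrow> carrier B. q.lin n c = \<zero>\<^bsub>Q\<^esub> \<longrightarrow> (\<exists>t\<in>?F. \<forall>i<n. t \<otimes>\<^bsub>B\<^esub> c i = \<zero>\<^bsub>B\<^esub>))"
      using lp by blast
    then show "\<exists>f\<in>carrier B - P.
      (\<forall>z\<in>carrier Q. \<exists>t\<in>range (\<lambda>k::nat. f [^]\<^bsub>B\<^esub> k). \<exists>c\<in>{..<n} \<rightarrow> carrier B. k t \<otimes>\<^bsub>Q\<^esub> z = q.lin n c) \<and>
      (\<forall>c\<in>{..<n} \<rightarrow> carrier B. q.lin n c = \<zero>\<^bsub>Q\<^esub> \<longrightarrow>
        (\<exists>t\<in>range (\<lambda>k::nat. f [^]\<^bsub>B\<^esub> k). \<forall>i<n. t \<otimes>\<^bsub>B\<^esub> c i = \<zero>\<^bsub>B\<^esub>))"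
      using f by blast
  qed
  \<comment> \<open>The polynomial is read off from the coordinates of \<open>y^n\<close>.\<close>
  obtain a where a: "a \<in> {..<n} \<rightarrow> carrier B" and yn: "y [^]\<^bsub>Q\<^esub> n = q.lin n a"
    using pb Q.nat_pow_closed[OF y] unfolding power_basis_def by blast
  have ac: "\<And>i. i < n \<Longrightarrow> a i \<in> carrier B" using a by auto
  have mp: "pring B (mq_ring B n a) (mq_hom B n a) (mq_var B n a)" by (rule B.mq_pring(1)) (rule ac)
  interpret m: pring B "mq_ring B n a" "mq_hom B n a" "mq_var B n a" by (rule mp)
  have "\<exists>j. ring_hom_cring (mq_ring B n a) Q j \<and> (\<forall>b\<in>carrier B. j (mq_hom B n a b) = k b) \<and> j (mq_var B n a) = y"
    by (rule B.mq_universal[OF _ q yn]) (rule ac)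
  then obtain j where j: "ring_hom_cring (mq_ring B n a) Q j"
    "\<And>b. b \<in> carrier B \<Longrightarrow> j (mq_hom B n a b) = k b" "j (mq_var B n a) = y" by blast
  have good: "good n a"
    unfolding good_def
  proof (intro conjI ballI allI impI)
    fix s assume s: "s \<in> S"
    have sc: "s \<in> carrier (UP A)" using s by simp
    have Am: "pring A (mq_ring B n a) (\<lambda>b. mq_hom B n a (b \<odot>\<^bsub>B\<^esub> \<one>\<^bsub>B\<^esub>)) (mq_var B n a)"
      by (rule pringI[OF ring_hom_cring_compose[OF B_unit_hom m.ring_hom_cring_axioms] m.x_closed])
    have Bc: "b \<odot>\<^bsub>B\<^esub> \<one>\<^bsub>B\<^esub> \<in> carrier B" if "b \<in> carrier A" for b using that by simp
    show "UnivPoly.eval A (mq_ring B n a) (\<lambda>b. mq_hom B n a (b \<odot>\<^bsub>B\<^esub> \<one>\<^bsub>B\<^esub>)) (mq_var B n a) s \<in> Units (mq_ring B n a)"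
    proof (rule B.mq_unit_reflect[OF _ j pb])
      show "UnivPoly.eval A (mq_ring B n a) (\<lambda>b. mq_hom B n a (b \<odot>\<^bsub>B\<^esub> \<one>\<^bsub>B\<^esub>)) (mq_var B n a) s \<in> carrier (mq_ring B n a)"
        by (rule pring.ev_closed[OF Am sc])
      \<comment> \<open>The value of \<open>s\<close> at \<open>y\<close> is a unit of
        \<open>Q\<close>, being the image of a unit of \<open>T\<close>; along \<open>j\<close> it
        comes from the value of \<open>s\<close> in the polynomial quotient.\<close>
      have "j (UnivPoly.eval A (mq_ring B n a) (\<lambda>b. mq_hom B n a (b \<odot>\<^bsub>B\<^esub> \<one>\<^bsub>B\<^esub>)) (mq_var B n a) s)
        = UnivPoly.eval A Q (\<lambda>a. \<phi> (\<iota> (a \<odot>\<^bsub>B\<^esub> \<one>\<^bsub>B\<^esub>))) (\<phi> xT) s"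
      proof (rule eval_hom_comp[OF Am j(1) _ _ sc])
        show "\<phi> xT = j (mq_var B n a)" by (simp only: j(3) y_def)
        show "\<phi> (\<iota> (b \<odot>\<^bsub>B\<^esub> \<one>\<^bsub>B\<^esub>)) = j (mq_hom B n a (b \<odot>\<^bsub>B\<^esub> \<one>\<^bsub>B\<^esub>))" if "b \<in> carrier A" for b
          unfolding j(2)[OF Bc[OF that]] \<phi>\<iota>[OF Bc[OF that]] by (rule refl)
      qed
      then show "j (UnivPoly.eval A (mq_ring B n a) (\<lambda>b. mq_hom B n a (b \<odot>\<^bsub>B\<^esub> \<one>\<^bsub>B\<^esub>)) (mq_var B n a) s) \<in> Units Q"
        using hom_T_unit[OF hom s] by simp
    qed (rule ac)
  qed (rule ac)
  have "a_kernel T Q \<phi> = cut n a"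
    by (rule kernel_eq_cut[OF good q hom \<phi>\<iota> y_def[symmetric] yn])
      (use pb in \<open>auto simp: power_basis_def\<close>)
  then show ?thesis using good I by blast
qed

text \<open>This is the representative \<open>Q\<close> that \<open>hilb_map\<close> forms for the
  point \<open>cut n a\<close>, and it has the type that \<open>hilb\<close> demands.\<close>

abbreviation "cutQ n a \<equiv> algebra_via (T Quot cut n a) (\<lambda>b. cut n a +>\<^bsub>T\<^esub> \<iota> b)"

abbreviation "cutx n a \<equiv> cut n a +>\<^bsub>T\<^esub> xT"

abbreviation "cuth n a \<equiv> (\<lambda>b. cut n a +>\<^bsub>T\<^esub> \<iota> b)"

lemma cut_quotient:
  assumes g: "good n a"
  shows "cring (T Quot cut n a)"
    and "ring_hom_cring T (cutQ n a) (\<lambda>t. cut n a +>\<^bsub>T\<^esub> t)"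
    and "pring B (cutQ n a) (cuth n a) (cutx n a)"
    and "algebra B (cutQ n a)"
    and "\<And>t. t \<in> carrier T \<Longrightarrow> cut n a +>\<^bsub>T\<^esub> t = \<zero>\<^bsub>cutQ n a\<^esub> \<longleftrightarrow> t \<in> cut n a"
    and "\<And>z. z \<in> carrier (cutQ n a) \<Longrightarrow> \<exists>t\<in>carrier T. z = cut n a +>\<^bsub>T\<^esub> t"
proof -
  have I: "ideal (cut n a) T" by (rule cut_ideal[OF g])
  show Q: "cring (T Quot cut n a)" by (rule ideal.quotient_is_cring[OF I T_cring])
  show \<pi>: "ring_hom_cring T (cutQ n a) (\<lambda>t. cut n a +>\<^bsub>T\<^esub> t)"
    unfolding hom_into_via[OF Q] by (rule T.quot_hom[OF I])
  have "ring_hom_cring B (T Quot cut n a) (cuth n a)"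
    by (rule ring_hom_cring_compose[OF left_hom T.quot_hom[OF I]])
  then show "algebra B (cutQ n a)"
    by (intro algebra_algebra_via B.M_cring Q) (simp add: ring_hom_cring_def ring_hom_cring_axioms_def)
  show "cut n a +>\<^bsub>T\<^esub> t = \<zero>\<^bsub>cutQ n a\<^esub> \<longleftrightarrow> t \<in> cut n a" if "t \<in> carrier T" for t
    using T.quot_eq_zero_iff[OF I that] by simp
  show "\<exists>t\<in>carrier T. z = cut n a +>\<^bsub>T\<^esub> t" if "z \<in> carrier (cutQ n a)" for z
    using that quot_surj[of z T "cut n a"] by simp
  interpret \<pi>: ring_hom_cring T "cutQ n a" "\<lambda>t. cut n a +>\<^bsub>T\<^esub> t" by (rule \<pi>)
  show "pring B (cutQ n a) (cuth n a) (cutx n a)"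
    by (rule pringI[OF ring_hom_cring_compose[OF left_hom \<pi>] \<pi>.hom_closed[OF xT_closed]])
qed

lemma cutQ_lin:
  assumes g: "good n a" and c: "c \<in> {..<m} \<rightarrow> carrier B"
  shows "lincomb (cutQ n a) (cuth n a) (cutx n a) m c = cut n a +>\<^bsub>T\<^esub> lincomb T \<iota> xT m c"
  by (rule hom_lincomb[OF T_pring cut_quotient(2)[OF g] _ _, symmetric]) (use c in auto)

text \<open>Equality modulo the kernel of \<open>proj n a\<close> is tested in
  \<open>B[x]/(F)\<close>, where the power basis is already known.\<close>

lemma cutQ_eqI:
  assumes g: "good n a" and t: "t \<in> carrier T" "t' \<in> carrier T" and e: "proj n a t = proj n a t'"
  shows "cut n a +>\<^bsub>T\<^esub> t = cut n a +>\<^bsub>T\<^esub> t'"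
proof -
  interpret \<pi>: ring_hom_cring T "cutQ n a" "\<lambda>t. cut n a +>\<^bsub>T\<^esub> t" by (rule cut_quotient(2)[OF g])
  interpret p: ring_hom_cring T "mq_ring B n a" "proj n a" by (rule proj_props(1)[OF g])
  have d: "t \<ominus>\<^bsub>T\<^esub> t' \<in> carrier T" using t by simp
  have "proj n a (t \<ominus>\<^bsub>T\<^esub> t') = \<zero>\<^bsub>mq_ring B n a\<^esub>"
    using t e by (simp add: a_minus_def p.S.r_neg)
  then have "t \<ominus>\<^bsub>T\<^esub> t' \<in> cut n a" using d unfolding cut_def a_kernel_def' by blast
  then have e1: "cut n a +>\<^bsub>T\<^esub> (t \<ominus>\<^bsub>T\<^esub> t') = \<zero>\<^bsub>cutQ n a\<^esub>" using cut_quotient(5)[OF g d] by blast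
  have e2: "cut n a +>\<^bsub>T\<^esub> (t \<ominus>\<^bsub>T\<^esub> t') = (cut n a +>\<^bsub>T\<^esub> t) \<ominus>\<^bsub>cutQ n a\<^esub> (cut n a +>\<^bsub>T\<^esub> t')"
    unfolding a_minus_def \<pi>.hom_add[OF t(1) T.a_inv_closed[OF t(2)]] \<pi>.hom_a_inv[OF t(2)] by (rule refl)
  have "(cut n a +>\<^bsub>T\<^esub> t) \<ominus>\<^bsub>cutQ n a\<^esub> (cut n a +>\<^bsub>T\<^esub> t') = \<zero>\<^bsub>cutQ n a\<^esub>" by (rule trans[OF e2[symmetric] e1])
  then show ?thesis
    using \<pi>.S.r_right_minus_eq[OF \<pi>.hom_closed[OF t(1)] \<pi>.hom_closed[OF t(2)]] by blast
qed

lemma cutQ_basis: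
  assumes g: "good n a"
  shows "power_basis B (cutQ n a) (cuth n a) (cutx n a) n"
    and "cutx n a [^]\<^bsub>cutQ n a\<^esub> n = lincomb (cutQ n a) (cuth n a) (cutx n a) n a"
proof -
  interpret t: pring B T \<iota> xT by (rule T_pring)
  have lc: "t.lin n c \<in> carrier T" if "c \<in> {..<n} \<rightarrow> carrier B" for c using that by (intro t.lin_closed) auto
  have ac: "a \<in> {..<n} \<rightarrow> carrier B" using goodD[OF g] by auto
  show "power_basis B (cutQ n a) (cuth n a) (cutx n a) n"
    unfolding power_basis_def
  proof (intro conjI ballI impI)
    fix z assume "z \<in> carrier (cutQ n a)"
    then obtain t where t: "t \<in> carrier T" "z = cut n a +>\<^bsub>T\<^esub> t" using cut_quotient(6)[OF g] by blast
    obtain c where c: "c \<in> {..<n} \<rightarrow> carrier B" "proj n a t = proj n a (t.lin n c)"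
      using proj_surj_lin[OF g t(1)] by blast
    have "z = lincomb (cutQ n a) (cuth n a) (cutx n a) n c"
      unfolding t(2) cutQ_lin[OF g c(1)] by (rule cutQ_eqI[OF g t(1) lc[OF c(1)] c(2)])
    then show "\<exists>c\<in>{..<n} \<rightarrow> carrier B. z = lincomb (cutQ n a) (cuth n a) (cutx n a) n c" using c(1) by blast
  next
    fix c assume c: "c \<in> {..<n} \<rightarrow> carrier B"
      and z: "lincomb (cutQ n a) (cuth n a) (cutx n a) n c = \<zero>\<^bsub>cutQ n a\<^esub>"
    show "\<forall>i<n. c i = \<zero>\<^bsub>B\<^esub>"
      using lin_in_cut[OF g c] cut_quotient(5)[OF g lc[OF c]] z cutQ_lin[OF g c] by simp
  qed
  interpret \<pi>: ring_hom_cring T "cutQ n a" "\<lambda>t. cut n a +>\<^bsub>T\<^esub> t" by (rule cut_quotient(2)[OF g])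
  interpret p: ring_hom_cring T "mq_ring B n a" "proj n a" by (rule proj_props(1)[OF g])
  have xc: "xT [^]\<^bsub>T\<^esub> n \<in> carrier T" using xT_closed by simp
  have l: "proj n a (t.lin n a) = lincomb (mq_ring B n a) (mq_hom B n a) (mq_var B n a) n a"
    by (rule proj_lin[OF g]) (use ac in auto)
  have "proj n a (xT [^]\<^bsub>T\<^esub> n) = proj n a (t.lin n a)"
    unfolding l p.hom_pow[OF xT_closed] proj_props(3)[OF g] good_mq(2)[OF g] by (rule refl)
  then have "cut n a +>\<^bsub>T\<^esub> (xT [^]\<^bsub>T\<^esub> n) = cut n a +>\<^bsub>T\<^esub> t.lin n a"
    by (rule cutQ_eqI[OF g xc lc[OF ac]])
  then show "cutx n a [^]\<^bsub>cutQ n a\<^esub> n = lincomb (cutQ n a) (cuth n a) (cutx n a) n a"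
    unfolding cutQ_lin[OF g ac] \<pi>.hom_pow[OF xT_closed] .
qed

lemma cut_in_hilb:
  assumes g: "good n a"
  shows "cut n a \<in> hilb A RR n B"
proof -
  let ?Q = "cutQ n a"
  interpret Q: algebra B ?Q by (rule cut_quotient(4)[OF g])
  interpret q: pring B ?Q "cuth n a" "cutx n a" by (rule cut_quotient(3)[OF g])
  have I: "ideal (cut n a) T" by (rule cut_ideal[OF g])
  have sub: "t \<in> carrier T" if "t \<in> cut n a" for t
    using that unfolding cut_def a_kernel_def' by blast
  have sm: "b \<odot>\<^bsub>?Q\<^esub> z = cuth n a b \<otimes>\<^bsub>?Q\<^esub> z" for b z by simp
  \<comment> \<open>Restriction supplies the extensionality required by
    \<open>alg_hom\<close>.\<close>
  define \<phi> where "\<phi> = restrict (\<lambda>t. cut n a +>\<^bsub>T\<^esub> t) (carrier T)"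
  interpret \<pi>: ring_hom_cring T ?Q "\<lambda>t. cut n a +>\<^bsub>T\<^esub> t" by (rule cut_quotient(2)[OF g])
  have "\<phi> \<in> alg_hom B T ?Q"
    unfolding \<phi>_def
  proof (rule alg_hom_restrictI[OF T_algebra cut_quotient(2)[OF g]])
    fix b t assume bt: "b \<in> carrier B" "t \<in> carrier T"
    have \<iota>b: "\<iota> b \<in> carrier T" using bt by simp
    have e: "b \<odot>\<^bsub>T\<^esub> t = \<iota> b \<otimes>\<^bsub>T\<^esub> t" by (rule T_simps(6))
    show "cut n a +>\<^bsub>T\<^esub> (b \<odot>\<^bsub>T\<^esub> t) = b \<odot>\<^bsub>?Q\<^esub> (cut n a +>\<^bsub>T\<^esub> t)"
      unfolding e sm by (rule \<pi>.hom_mult[OF \<iota>b bt(2)])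
  qed
  moreover have "\<phi> ` carrier T = carrier ?Q"
  proof
    show "\<phi> ` carrier T \<subseteq> carrier ?Q"
    proof
      fix z assume "z \<in> \<phi> ` carrier T"
      then obtain t where t: "z = \<phi> t" "t \<in> carrier T" by (rule imageE)
      show "z \<in> carrier ?Q"
        unfolding t(1) \<phi>_def using t(2) \<pi>.hom_closed[OF t(2)] by (simp only: restrict_apply if_True)
    qed
    show "carrier ?Q \<subseteq> \<phi> ` carrier T"
    proof
      fix z assume "z \<in> carrier ?Q"
      then obtain t where t: "t \<in> carrier T" "z = cut n a +>\<^bsub>T\<^esub> t" using cut_quotient(6)[OF g] by blast
      then show "z \<in> \<phi> ` carrier T" unfolding \<phi>_def by (intro image_eqI[of _ _ t]) auto
    qed
  qed
  moreover have "a_kernel T ?Q \<phi> = cut n a"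
    unfolding a_kernel_def' \<phi>_def using cut_quotient(5)[OF g] sub by auto
  moreover have "locally_free_of_rank B ?Q n"
    unfolding locally_free_of_rank_def Let_def
  proof (intro allI impI)
    fix P assume P: "primeideal P B"
    \<comment> \<open>The quotient is free over all of \<open>B\<close>, so \<open>f = 1\<close>
      serves at every prime.\<close>
    have "\<one>\<^bsub>B\<^esub> \<notin> P"
      using primeideal.I_notcarr[OF P] ideal.one_imp_carrier[OF primeideal.axioms(1)[OF P]] by blast
    moreover have "range (\<lambda>k::nat. \<one>\<^bsub>B\<^esub> [^]\<^bsub>B\<^esub> k) = {\<one>\<^bsub>B\<^esub>}"
      by (auto simp: B.nat_pow_one)
    moreover have "free_of_rank (loc_ring B {\<one>\<^bsub>B\<^esub>}) (loc_module B {\<one>\<^bsub>B\<^esub>} ?Q) n"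
    proof (rule Q.free_of_rank_loc_one)
      show vc: "cutx n a [^]\<^bsub>?Q\<^esub> i \<in> carrier ?Q" for i :: nat by (rule Q.nat_pow_closed[OF q.x_closed])
      fix m assume m: "m \<in> carrier ?Q"
      have sums: "(\<Oplus>\<^bsub>?Q\<^esub>i\<in>{..<n}. c i \<odot>\<^bsub>?Q\<^esub> cutx n a [^]\<^bsub>?Q\<^esub> i) = q.lin n c" for c
        unfolding lincomb_def sm by (rule refl)
      show "\<exists>!c. c \<in> {..<n} \<rightarrow>\<^sub>E carrier B \<and> m = (\<Oplus>\<^bsub>?Q\<^esub>i\<in>{..<n}. c i \<odot>\<^bsub>?Q\<^esub> cutx n a [^]\<^bsub>?Q\<^esub> i)"
        unfolding sums
      proof (rule ex_ex1I)
        obtain c where c: "c \<in> {..<n} \<rightarrow> carrier B" "m = q.lin n c"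
          using cutQ_basis(1)[OF g] m unfolding power_basis_def by blast
        have "q.lin n (restrict c {..<n}) = q.lin n c" by (rule q.lin_cong) (use c(1) in auto)
        then have "m = q.lin n (restrict c {..<n})" unfolding c(2) by (rule sym)
        moreover have "restrict c {..<n} \<in> {..<n} \<rightarrow>\<^sub>E carrier B" using c(1) by auto
        ultimately show "\<exists>c. c \<in> {..<n} \<rightarrow>\<^sub>E carrier B \<and> m = q.lin n c" by blast
        fix c d assume cd: "c \<in> {..<n} \<rightarrow>\<^sub>E carrier B \<and> m = q.lin n c" "d \<in> {..<n} \<rightarrow>\<^sub>E carrier B \<and> m = q.lin n d"
        show "c = d"
        proof (rule PiE_ext[OF conjunct1[OF cd(1)] conjunct1[OF cd(2)]])
          fix i assume i: "i \<in> {..<n}"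
          show "c i = d i"
          proof (rule q.power_basis_unique[OF cutQ_basis(1)[OF g]])
            show "q.lin n c = q.lin n d"
              by (rule trans[OF conjunct2[OF cd(1), symmetric] conjunct2[OF cd(2)]])
            show "c j \<in> carrier B" if "j < n" for j
              by (rule PiE_mem[OF conjunct1[OF cd(1)]]) (use that in simp)
            show "d j \<in> carrier B" if "j < n" for j
              by (rule PiE_mem[OF conjunct1[OF cd(2)]]) (use that in simp)
            show "i < n" using i by simp
          qed
        qed
      qed
    qed
    ultimately show "\<exists>f\<in>carrier B - P.
      free_of_rank (loc_ring B (range (\<lambda>k::nat. f [^]\<^bsub>B\<^esub> k))) (loc_module B (range (\<lambda>k::nat. f [^]\<^bsub>B\<^esub> k)) ?Q) n"
      by (intro bexI[of _ "\<one>\<^bsub>B\<^esub>"] DiffI B.one_closed) (simp_all only: not_False_eq_True)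
  qed
  ultimately show ?thesis
    unfolding hilb_def
    by (intro CollectI exI[of _ ?Q] exI[of _ \<phi>] conjI cut_quotient(4)[OF g]) simp_all
qed

lemma hilb_eq_cuts: "hilb A RR n B = {cut n a | a. good n a}"
  using hilb_imp_cut cut_in_hilb by blast

end

lemma hom_closed':
  assumes "ring_hom_cring R S h" "x \<in> carrier R" shows "h x \<in> carrier S"
proof -
  interpret h: ring_hom_cring R S h by fact
  show ?thesis using assms(2) by simp
qed

section \<open>Homomorphisms out of the representing algebra\<close>

locale hilb_repr = hilb_poly A S + mpoly_ring A n
  for A :: "('a, 'x) ring_scheme" (structure) and S :: "(nat \<Rightarrow> 'a) set" and n :: nat +
  assumes n_pos: "0 < n"
begin

abbreviation "D \<equiv> prod_eval A n ` S"

sublocale LE: locring Es D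
  by (simp add: locring_def locring_axioms_def Es_cring prod_eval_submonoid[OF S])

abbreviation "H \<equiv> loc_algebra Es D"
abbreviation "eH \<equiv> \<lambda>p. LE.f0 p \<one>\<^bsub>Es\<^esub>"

lemma H_simps:
  "carrier H = carrier LE.L" "monoid.mult H = monoid.mult LE.L" "monoid.one H = monoid.one LE.L"
  "ring.zero H = ring.zero LE.L" "ring.add H = ring.add LE.L"
  by (simp_all add: loc_algebra_def)

lemma H_smult: "a \<in> carrier A \<Longrightarrow> a \<odot>\<^bsub>H\<^esub> t = eH (cst a) \<otimes>\<^bsub>LE.L\<^esub> t"
  by (simp add: loc_algebra_def Es_smult_one)

lemma H_algebra: "algebra A H"
  unfolding loc_algebra_def
proof (rule algebra_algebra_via[OF A.is_cring LE.L_cring])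
  interpret k: ring_hom_cring A LE.L "\<lambda>a. eH (cst a)"
    by (rule ring_hom_cring_compose[OF cst_Es_hom LE.L_hom])
  have "(\<lambda>a. eH (cst a)) \<in> ring_hom A LE.L" by (rule k.homh)
  then show "(\<lambda>a. LE.f0 (a \<odot>\<^bsub>Es\<^esub> \<one>\<^bsub>Es\<^esub>) \<one>\<^bsub>Es\<^esub>) \<in> ring_hom A LE.L"
    by (simp add: ring_hom_def Es_smult_one Pi_def)
qed

text \<open>The coefficients of the image under \<open>g\<close> of the universal polynomial
  \<open>\<Prod>(X - Z_j)\<close>, in the sign convention of \<open>monicpoly\<close>.\<close>

definition coefs :: "(((nat multiset \<Rightarrow> 'a) \<times> (nat multiset \<Rightarrow> 'a)) set \<Rightarrow> 'b) \<Rightarrow> nat \<Rightarrow> 'b"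
  where "coefs g i = g (eH (acoef i))"

lemma H_hom:
  assumes B: "algebra A B" and g: "g \<in> alg_hom A H B"
  shows "ring_hom_cring LE.L B g" "ring_hom_cring Es B (\<lambda>p. g (eH p))"
    "\<And>a. a \<in> carrier A \<Longrightarrow> g (eH (cst a)) = a \<odot>\<^bsub>B\<^esub> \<one>\<^bsub>B\<^esub>"
proof -
  interpret B: algebra A B by (rule B)
  interpret H: algebra A H by (rule H_algebra)
  have "ring_hom_cring H B g"
    using g by (intro ring_hom_cringI' H.M_cring B.M_cring) (simp add: alg_hom_def)
  then show 1: "ring_hom_cring LE.L B g"
    unfolding loc_algebra_def hom_from_via[OF LE.L_cring] .
  then show "ring_hom_cring Es B (\<lambda>p. g (eH p))" by (rule ring_hom_cring_compose[OF LE.L_hom])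
  interpret g: ring_hom_cring LE.L B g by (rule 1)
  show "g (eH (cst a)) = a \<odot>\<^bsub>B\<^esub> \<one>\<^bsub>B\<^esub>" if a: "a \<in> carrier A" for a
  proof -
    have "g (a \<odot>\<^bsub>H\<^esub> \<one>\<^bsub>H\<^esub>) = a \<odot>\<^bsub>B\<^esub> g \<one>\<^bsub>H\<^esub>"
      using g a H.one_closed unfolding alg_hom_def by blast
    moreover have "a \<odot>\<^bsub>H\<^esub> \<one>\<^bsub>H\<^esub> = eH (cst a)"
    proof -
      have "eH (cst a) \<in> carrier LE.L" using a by simp
      then show ?thesis unfolding H_smult[OF a] H_simps by simp
    qed
    moreover have "g \<one>\<^bsub>H\<^esub> = \<one>\<^bsub>B\<^esub>" unfolding H_simps by (rule g.hom_one)
    ultimately show ?thesis by simp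
  qed
qed

lemma tensor_locale: "algebra A B \<Longrightarrow> hilb_tensor A B S"
  by (simp add: hilb_tensor_def tensor_alg_def RR_algebra hilb_poly_axioms)

text \<open>The norm of each \<open>s\<close> is inverted in \<open>H\<close>, so its image in
  \<open>B\<close> is a unit, and hence so is \<open>s(x)\<close> modulo the image
  polynomial.\<close>

lemma coefs_good:
  assumes B: "algebra A B" and g: "g \<in> alg_hom A H B"
  shows "hilb_tensor.good A B S n (coefs g)"
proof -
  interpret t: hilb_tensor A B S by (rule tensor_locale[OF B])
  have \<gamma>: "ring_hom_cring Es B (\<lambda>p. g (eH p))" by (rule H_hom(2)[OF B g])
  interpret \<gamma>: ring_hom_cring Es B "\<lambda>p. g (eH p)" by (rule \<gamma>)
  have c: "coefs g i \<in> carrier B" if "i < n" for i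
    unfolding coefs_def by (rule \<gamma>.hom_closed[OF acoef_closed[OF that]])
  let ?M = "mq_ring B n (coefs g)" and ?h = "mq_hom B n (coefs g)" and ?x = "mq_var B n (coefs g)"
  have mp: "pring B ?M ?h ?x" by (rule t.B.mq_pring(1)) (rule c)
  interpret m: pring B ?M ?h ?x by (rule mp)
  have xn: "?x [^]\<^bsub>?M\<^esub> n = lincomb ?M ?h ?x n (\<lambda>i. g (eH (acoef i)))"
    unfolding coefs_def[symmetric] by (rule t.B.mq_pring(2)) (rule c)
  have Am: "pring A ?M (\<lambda>b. ?h (b \<odot>\<^bsub>B\<^esub> \<one>\<^bsub>B\<^esub>)) ?x"
    by (rule pringI[OF ring_hom_cring_compose[OF t.B_unit_hom m.ring_hom_cring_axioms] m.x_closed])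
  have "UnivPoly.eval A ?M (\<lambda>b. ?h (b \<odot>\<^bsub>B\<^esub> \<one>\<^bsub>B\<^esub>)) ?x s \<in> Units ?M" if s: "s \<in> S" for s
  proof -
    have sc: "s \<in> carrier (UP A)" using s by simp
    have "g (eH (prod_eval A n s)) \<in> Units B"
      by (rule hom_Units[OF H_hom(1)[OF B g] LE.L_Units]) (use s in blast)
    from unit_if_norm_unit[OF n_pos \<gamma> mp xn sc this]
    show ?thesis
      using eval_cong[OF Am _ sc, of "\<lambda>a. ?h (g (eH (cst a)))"] H_hom(3)[OF B g] by simp
  qed
  then show ?thesis unfolding t.good_def using c by blast
qed

lemma sign_square:
  assumes "cring B" shows "(\<ominus>\<^bsub>B\<^esub> \<one>\<^bsub>B\<^esub>) [^]\<^bsub>B\<^esub> (j::nat) \<otimes>\<^bsub>B\<^esub> (\<ominus>\<^bsub>B\<^esub> \<one>\<^bsub>B\<^esub>) [^]\<^bsub>B\<^esub> j = \<one>\<^bsub>B\<^esub>"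
proof -
  interpret B: cring B by fact
  have "(\<ominus>\<^bsub>B\<^esub> \<one>\<^bsub>B\<^esub>) [^]\<^bsub>B\<^esub> j \<otimes>\<^bsub>B\<^esub> (\<ominus>\<^bsub>B\<^esub> \<one>\<^bsub>B\<^esub>) [^]\<^bsub>B\<^esub> j = ((\<ominus>\<^bsub>B\<^esub> \<one>\<^bsub>B\<^esub>) \<otimes>\<^bsub>B\<^esub> (\<ominus>\<^bsub>B\<^esub> \<one>\<^bsub>B\<^esub>)) [^]\<^bsub>B\<^esub> j"
    by (rule B.nat_pow_distrib[symmetric]) auto
  also have "(\<ominus>\<^bsub>B\<^esub> \<one>\<^bsub>B\<^esub>) \<otimes>\<^bsub>B\<^esub> (\<ominus>\<^bsub>B\<^esub> \<one>\<^bsub>B\<^esub>) = \<one>\<^bsub>B\<^esub>" by (simp add: B.l_minus)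
  finally show ?thesis by (simp add: B.nat_pow_one)
qed

text \<open>\<open>c\<^sub>j\<close> and the coefficient of \<open>x\<^bsup>n-j\<^esup>\<close> are obtained from each other by this same formula.\<close>

lemma sign_involution:
  assumes B: "cring B" and b: "b \<in> carrier B"
  shows "\<ominus>\<^bsub>B\<^esub> ((\<ominus>\<^bsub>B\<^esub> \<one>\<^bsub>B\<^esub>) [^]\<^bsub>B\<^esub> (j::nat) \<otimes>\<^bsub>B\<^esub> (\<ominus>\<^bsub>B\<^esub> ((\<ominus>\<^bsub>B\<^esub> \<one>\<^bsub>B\<^esub>) [^]\<^bsub>B\<^esub> j \<otimes>\<^bsub>B\<^esub> b))) = b"
proof -
  interpret B: cring B by fact
  define u where "u = (\<ominus>\<^bsub>B\<^esub> \<one>\<^bsub>B\<^esub>) [^]\<^bsub>B\<^esub> j"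
  have u: "u \<in> carrier B" "u \<otimes>\<^bsub>B\<^esub> u = \<one>\<^bsub>B\<^esub>"
    unfolding u_def using sign_square[OF B] by auto
  have "\<ominus>\<^bsub>B\<^esub> (u \<otimes>\<^bsub>B\<^esub> (\<ominus>\<^bsub>B\<^esub> (u \<otimes>\<^bsub>B\<^esub> b))) = u \<otimes>\<^bsub>B\<^esub> (u \<otimes>\<^bsub>B\<^esub> b)" using u b by (simp add: B.r_minus)
  also have "\<dots> = b" using u b by (simp add: B.m_assoc[symmetric])
  finally show ?thesis unfolding u_def .
qed

lemma hom_acoef:
  assumes \<gamma>: "ring_hom_cring Es B \<gamma>" and j: "j \<in> {1..n}"
  shows "\<gamma> (acoef (n - j)) = \<ominus>\<^bsub>B\<^esub> ((\<ominus>\<^bsub>B\<^esub> \<one>\<^bsub>B\<^esub>) [^]\<^bsub>B\<^esub> j \<otimes>\<^bsub>B\<^esub> \<gamma> (cs j))"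
proof -
  interpret \<gamma>: ring_hom_cring Es B \<gamma> by (rule \<gamma>)
  have e: "n - (n - j) = j" using j by auto
  have c: "cs j \<in> carrier Es" by (rule cs_Es[OF j])
  have m: "\<ominus>\<^bsub>Es\<^esub> \<one>\<^bsub>Es\<^esub> \<in> carrier Es" "(\<ominus>\<^bsub>Es\<^esub> \<one>\<^bsub>Es\<^esub>) [^]\<^bsub>Es\<^esub> j \<in> carrier Es" by auto
  show ?thesis
    unfolding acoef_def e \<gamma>.hom_a_inv[OF Es.m_closed[OF m(2) c]] \<gamma>.hom_mult[OF m(2) c]
      \<gamma>.hom_pow[OF m(1)] \<gamma>.hom_a_inv[OF Es.one_closed] \<gamma>.hom_one by (rule refl)
qed

text \<open>Scalars and the \<open>c_j\<close> generate \<open>Es\<close>, the \<open>c_j\<close>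
  are recovered from the coefficients, and a homomorphism on the localization is determined by its
  values on \<open>Es\<close>.\<close>

lemma coefs_inj:
  assumes B: "algebra A B" and g: "g \<in> alg_hom A H B" "g' \<in> alg_hom A H B"
    and eq: "\<And>i. i < n \<Longrightarrow> coefs g i = coefs g' i"
  shows "g = g'"
proof (rule extensionalityI)
  interpret B: algebra A B by (rule B)
  show "g \<in> extensional (carrier H)" "g' \<in> extensional (carrier H)" using g by (simp_all add: alg_hom_def)
  have cs: "\<gamma> (cs j) = \<ominus>\<^bsub>B\<^esub> ((\<ominus>\<^bsub>B\<^esub> \<one>\<^bsub>B\<^esub>) [^]\<^bsub>B\<^esub> j \<otimes>\<^bsub>B\<^esub> \<gamma> (acoef (n - j)))"
    if \<gamma>: "ring_hom_cring Es B \<gamma>" and j: "j \<in> {1..n}" for \<gamma> j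
    unfolding hom_acoef[OF that]
    by (rule sign_involution[symmetric, OF B.M_cring ring_hom_closed[OF _ cs_Es[OF j]]])
      (use \<gamma> in \<open>simp add: ring_hom_cring_def ring_hom_cring_axioms_def\<close>)
  fix x assume x: "x \<in> carrier H"
  show "g x = g' x"
  proof (rule LE.L_hom_unique[OF H_hom(1)[OF B g(1)] H_hom(1)[OF B g(2)]])
    show "x \<in> carrier LE.L" using x by (simp add: H_simps)
    fix p assume p: "p \<in> carrier Es"
    show "g (eH p) = g' (eH p)"
    proof (rule Es_hom_unique[OF H_hom(2)[OF B g(1)] H_hom(2)[OF B g(2)] _ _ p])
      show "g (eH (cst a)) = g' (eH (cst a))" if "a \<in> carrier A" for a
        using H_hom(3)[OF B g(1) that] H_hom(3)[OF B g(2) that] by simp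
      fix j assume j: "j \<in> {1..n}"
      have "g (eH (acoef (n - j))) = g' (eH (acoef (n - j)))"
        using eq[of "n - j"] j n_pos unfolding coefs_def by auto
      then show "g (eH (cs j)) = g' (eH (cs j))"
        unfolding cs[OF H_hom(2)[OF B g(1)] j] cs[OF H_hom(2)[OF B g(2)] j] by simp
    qed
  qed
qed

lemma coefs_surj:
  assumes B: "algebra A B" and a: "hilb_tensor.good A B S n a"
  shows "\<exists>g\<in>alg_hom A H B. \<forall>i<n. coefs g i = a i"
proof -
  interpret t: hilb_tensor A B S by (rule tensor_locale[OF B])
  have Bc: "cring B" by (rule t.B.M_cring)
  have ac: "a i \<in> carrier B" if "i < n" for i by (rule t.goodD[OF a that])
  \<comment> \<open>The values prescribed for the \<open>c_j\<close>; by
    \<open>sign_involution\<close> they are the ones that send \<open>acoef i\<close> to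
    \<open>a i\<close>.\<close>
  define c where "c = (\<lambda>j. \<ominus>\<^bsub>B\<^esub> ((\<ominus>\<^bsub>B\<^esub> \<one>\<^bsub>B\<^esub>) [^]\<^bsub>B\<^esub> j \<otimes>\<^bsub>B\<^esub> a (n - j)))"
  have cc: "c j \<in> carrier B" if "j \<in> {1..n}" for j
  proof -
    have "n - j < n" using that by auto
    then show ?thesis unfolding c_def using ac by simp
  qed
  obtain \<gamma> where \<gamma>: "ring_hom_cring Es B \<gamma>"
    "\<And>r. r \<in> carrier A \<Longrightarrow> \<gamma> (cst r) = r \<odot>\<^bsub>B\<^esub> \<one>\<^bsub>B\<^esub>" "\<And>j. j \<in> {1..n} \<Longrightarrow> \<gamma> (cs j) = c j"
    using Es_universal[OF t.B_unit_hom, of c] cc by blast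
  have \<gamma>a: "\<gamma> (acoef i) = a i" if i: "i < n" for i
  proof -
    have j: "n - i \<in> {1..n}" and e: "n - (n - i) = i" using i by auto
    show ?thesis
      using hom_acoef[OF \<gamma>(1) j] sign_involution[OF Bc ac[OF i]] unfolding \<gamma>(3)[OF j] c_def e by simp
  qed
  let ?M = "mq_ring B n a" and ?h = "mq_hom B n a" and ?x = "mq_var B n a"
  have mp: "pring B ?M ?h ?x" by (rule t.good_mq(1)[OF a])
  interpret m: pring B ?M ?h ?x by (rule mp)
  have xn: "?x [^]\<^bsub>?M\<^esub> n = lincomb ?M ?h ?x n (\<lambda>i. \<gamma> (acoef i))"
    unfolding t.good_mq(2)[OF a] by (rule m.lin_cong) (use ac \<gamma>a in auto)
  have Am: "pring A ?M (\<lambda>b. ?h (b \<odot>\<^bsub>B\<^esub> \<one>\<^bsub>B\<^esub>)) ?x"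
    by (rule pringI[OF ring_hom_cring_compose[OF t.B_unit_hom m.ring_hom_cring_axioms] m.x_closed])
  \<comment> \<open>By \<open>good\<close>, \<open>s(x)\<close> is a unit modulo the polynomial, so
    its norm is a unit of \<open>B\<close>. That norm is the image of
    \<open>prod_eval A n s\<close>, which lets \<open>\<gamma>\<close> extend to the
    localization.\<close>
  have u: "\<gamma> d \<in> Units B" if d: "d \<in> D" for d
  proof -
    obtain s where s: "d = prod_eval A n s" "s \<in> S" using d by blast
    have sc: "s \<in> carrier (UP A)" using s by simp
    have "UnivPoly.eval A ?M (\<lambda>b. ?h (b \<odot>\<^bsub>B\<^esub> \<one>\<^bsub>B\<^esub>)) ?x s = UnivPoly.eval A ?M (\<lambda>r. ?h (\<gamma> (cst r))) ?x s"
      by (rule eval_cong[OF Am _ sc]) (simp add: \<gamma>(2))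
    then have "UnivPoly.eval A ?M (\<lambda>r. ?h (\<gamma> (cst r))) ?x s \<in> Units ?M"
      using a s(2) unfolding t.good_def by metis
    then show ?thesis
      unfolding s(1) by (rule norm_unit_if_unit[OF \<gamma>(1) mp t.good_mq(3)[OF a] xn sc])
  qed
  obtain g where g: "ring_hom_cring LE.L B g" "\<And>p. p \<in> carrier Es \<Longrightarrow> g (eH p) = \<gamma> p"
    using LE.L_universal[OF \<gamma>(1) u] by blast
  interpret g: ring_hom_cring LE.L B g by (rule g(1))
  have gH: "ring_hom_cring H B g"
    unfolding loc_algebra_def hom_from_via[OF LE.L_cring] by (rule g(1))
  have "restrict g (carrier H) \<in> alg_hom A H B"
  proof (rule alg_hom_restrictI[OF H_algebra gH])
    fix r x assume rx: "r \<in> carrier A" "x \<in> carrier H"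
    have xL: "x \<in> carrier LE.L" using rx(2) unfolding H_simps .
    have eL: "eH (cst r) \<in> carrier LE.L" using rx(1) by simp
    have "g (r \<odot>\<^bsub>H\<^esub> x) = g (eH (cst r)) \<otimes>\<^bsub>B\<^esub> g x"
      unfolding H_smult[OF rx(1)] by (rule g.hom_mult[OF eL xL])
    also have "\<dots> = (r \<odot>\<^bsub>B\<^esub> \<one>\<^bsub>B\<^esub>) \<otimes>\<^bsub>B\<^esub> g x" unfolding g(2)[OF cst_Es[OF rx(1)]] \<gamma>(2)[OF rx(1)] by (rule refl)
    also have "\<dots> = r \<odot>\<^bsub>B\<^esub> g x"
      by (rule algebra_smult_eq[symmetric, OF B rx(1) g.hom_closed[OF xL]])
    finally show "g (r \<odot>\<^bsub>H\<^esub> x) = r \<odot>\<^bsub>B\<^esub> g x" .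
  qed
  moreover have "coefs (restrict g (carrier H)) i = a i" if i: "i < n" for i
  proof -
    have "eH (acoef i) \<in> carrier H" unfolding H_simps by (rule LE.L_closed[OF acoef_closed[OF i]]) auto
    then show ?thesis unfolding coefs_def using g(2)[OF acoef_closed[OF i]] \<gamma>a[OF i] by simp
  qed
  ultimately show ?thesis by blast
qed

end

section \<open>Base change of points\<close>

context hilb_poly
begin

text \<open>Base change: the kernel on \<open>B' \<otimes> Q\<close> is again cut out by the polynomial, since \<open>B' \<otimes> Q\<close> maps
  back to the quotient of \<open>B'[x]\<close> by the image polynomial.\<close>

lemma hilb_map_cut:
  assumes B: "algebra A B" and B': "algebra A B'" and f: "f \<in> alg_hom A B B'"
    and a: "hilb_tensor.good A B S n a" and a': "hilb_tensor.good A B' S n a'"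
    and eq: "\<And>i. i < n \<Longrightarrow> a' i = f (a i)"
  shows "hilb_map A RR B B' f (hilb_tensor.cut A B S n a) = hilb_tensor.cut A B' S n a'"
proof -
  interpret t: hilb_tensor A B S by (simp add: hilb_tensor_def tensor_alg_def RR_algebra hilb_poly_axioms B)
  interpret t': hilb_tensor A B' S by (simp add: hilb_tensor_def tensor_alg_def RR_algebra hilb_poly_axioms B')
  let ?fB = "algebra_via B' f" and ?Q = "t.cutQ n a"
  have fr: "f \<in> ring_hom B B'" using f by (simp add: alg_hom_def)
  have fh: "ring_hom_cring B B' f" by (rule ring_hom_cringI'[OF t.B.M_cring t'.B.M_cring fr])
  have fA: "algebra B ?fB" by (rule algebra_algebra_via[OF t.B.M_cring t'.B.M_cring fr])
  have Qa: "algebra B ?Q" by (rule t.cut_quotient(4)[OF a])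
  interpret q: tensor_alg B ?fB ?Q using fA Qa by (simp add: tensor_alg_def)
  interpret f: ring_hom_cring B B' f by (rule fh)
  have fu: "f (r \<odot>\<^bsub>B\<^esub> \<one>\<^bsub>B\<^esub>) = r \<odot>\<^bsub>B'\<^esub> \<one>\<^bsub>B'\<^esub>" if "r \<in> carrier A" for r
  proof -
    have "f (r \<odot>\<^bsub>B\<^esub> \<one>\<^bsub>B\<^esub>) = r \<odot>\<^bsub>B'\<^esub> f \<one>\<^bsub>B\<^esub>"
      using f that t.B.one_closed unfolding alg_hom_def by blast
    then show ?thesis by simp
  qed
  have ac: "a i \<in> carrier B" if "i < n" for i by (rule t.goodD[OF a that])
  have ac': "a' i \<in> carrier B'" if "i < n" for i by (rule t'.goodD[OF a' that])
  \<comment> \<open>The two sides of \<open>B' \<otimes> Q\<close>: \<open>k\<close> is the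
    structure map from \<open>B'\<close>, and \<open>\<chi>\<close> passes from \<open>T\<close>
    through the quotient \<open>Q\<close>.\<close>
  define k where "k = (\<lambda>b. q.tn b \<one>\<^bsub>?Q\<^esub>)"
  define \<chi> where "\<chi> = (\<lambda>t. q.tn \<one>\<^bsub>?fB\<^esub> (t.cut n a +>\<^bsub>t.T\<^esub> t))"
  have kh: "ring_hom_cring B' q.T k"
    using q.left_hom unfolding k_def hom_from_via[OF t'.B.M_cring] .
  have \<chi>: "ring_hom_cring t.T q.T \<chi>"
    unfolding \<chi>_def by (rule ring_hom_cring_compose[OF t.cut_quotient(2)[OF a] q.right_hom])
  interpret k: ring_hom_cring B' q.T k by (rule kh)
  interpret \<chi>: ring_hom_cring t.T q.T \<chi> by (rule \<chi>)
  have fB1: "b \<odot>\<^bsub>?fB\<^esub> \<one>\<^bsub>?fB\<^esub> = f b" if b: "b \<in> carrier B" for b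
    using f.hom_closed[OF b] by simp
  have Q1: "b \<odot>\<^bsub>?Q\<^esub> \<one>\<^bsub>?Q\<^esub> = t.cut n a +>\<^bsub>t.T\<^esub> t.\<iota> b" if b: "b \<in> carrier B" for b
  proof -
    have z: "t.cut n a +>\<^bsub>t.T\<^esub> t.\<iota> b \<in> carrier ?Q"
      by (rule hom_closed'[OF t.cut_quotient(2)[OF a]]) (use b in simp)
    have "b \<odot>\<^bsub>?Q\<^esub> \<one>\<^bsub>?Q\<^esub> = (t.cut n a +>\<^bsub>t.T\<^esub> t.\<iota> b) \<otimes>\<^bsub>?Q\<^esub> \<one>\<^bsub>?Q\<^esub>" by simp
    also have "\<dots> = t.cut n a +>\<^bsub>t.T\<^esub> t.\<iota> b" by (rule q.R.r_one[OF z])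
    finally show ?thesis .
  qed
  \<comment> \<open>The two routes from \<open>B\<close> into \<open>B' \<otimes> Q\<close> agree,
    by the balance of the tensor product at \<open>1\<close>.\<close>
  have kf: "k (f b) = \<chi> (t.\<iota> b)" if b: "b \<in> carrier B" for b
  proof -
    have "q.tn (b \<odot>\<^bsub>?fB\<^esub> \<one>\<^bsub>?fB\<^esub>) \<one>\<^bsub>?Q\<^esub> = q.tn \<one>\<^bsub>?fB\<^esub> (b \<odot>\<^bsub>?Q\<^esub> \<one>\<^bsub>?Q\<^esub>)"
      by (rule q.tens_balanced[OF b q.B.one_closed q.R.one_closed])
    then show ?thesis unfolding fB1[OF b] Q1[OF b] k_def \<chi>_def .
  qed
  have k\<iota>: "k (r \<odot>\<^bsub>B'\<^esub> \<one>\<^bsub>B'\<^esub>) = \<chi> (t.\<iota> (r \<odot>\<^bsub>B\<^esub> \<one>\<^bsub>B\<^esub>))" if r: "r \<in> carrier A" for r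
    using kf[of "r \<odot>\<^bsub>B\<^esub> \<one>\<^bsub>B\<^esub>"] fu[OF r] r by simp
  define y where "y = \<chi> t.xT"
  have y: "y \<in> carrier q.T" unfolding y_def by (rule \<chi>.hom_closed[OF t.xT_closed])
  have ky: "pring B' q.T k y" by (rule pringI[OF kh y])
  have Aky: "pring A q.T (\<lambda>r. k (r \<odot>\<^bsub>B'\<^esub> \<one>\<^bsub>B'\<^esub>)) y"
    by (rule pringI[OF ring_hom_cring_compose[OF t'.B_unit_hom kh] y])
  have u: "UnivPoly.eval A q.T (\<lambda>r. k (r \<odot>\<^bsub>B'\<^esub> \<one>\<^bsub>B'\<^esub>)) y s \<in> Units q.T" if s: "s \<in> S" for s
  proof -
    have "UnivPoly.eval A q.T (\<lambda>r. k (r \<odot>\<^bsub>B'\<^esub> \<one>\<^bsub>B'\<^esub>)) y s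
      = UnivPoly.eval A q.T (\<lambda>r. \<chi> (t.\<iota> (r \<odot>\<^bsub>B\<^esub> \<one>\<^bsub>B\<^esub>))) y s"
      by (rule eval_cong[OF Aky k\<iota>[symmetric] S_carrier[OF s]])
    then show ?thesis using t.hom_T_unit[OF \<chi> s] unfolding y_def by (simp only:)
  qed
  \<comment> \<open>\<open>\<psi>\<close> is obtained from the values on \<open>B'\<close> and on
    the variable; its values on all pure tensors, which \<open>hilb_map\<close> prescribes, are
    derived afterwards.\<close>
  obtain \<psi> where \<psi>: "ring_hom_cring t'.T q.T \<psi>" "\<And>b. b \<in> carrier B' \<Longrightarrow> \<psi> (t'.\<iota> b) = k b" "\<psi> t'.xT = y"
    using t'.T_universal[OF ky u] by blast
  interpret \<psi>: ring_hom_cring t'.T q.T \<psi> by (rule \<psi>(1))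
  have \<psi>R: "\<psi> (t'.tn \<one>\<^bsub>B'\<^esub> r) = \<chi> (t.tn \<one>\<^bsub>B\<^esub> r)" if r: "r \<in> carrier RR" for r
  proof (rule RR_hom_unique[OF ring_hom_cring_compose[OF t'.right_hom \<psi>(1)] ring_hom_cring_compose[OF t.right_hom \<chi>] _ _ r])
    show "\<psi> t'.xT = \<chi> t.xT" unfolding \<psi>(3) y_def by (rule refl)
    fix b assume b: "b \<in> carrier A"
    have "\<psi> (t'.tn \<one>\<^bsub>B'\<^esub> (kR b)) = k (b \<odot>\<^bsub>B'\<^esub> \<one>\<^bsub>B'\<^esub>)"
      unfolding t'.\<iota>_smult_one[OF b, symmetric] by (rule \<psi>(2)) (use b in simp)
    also have "\<dots> = \<chi> (t.tn \<one>\<^bsub>B\<^esub> (kR b))"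
      unfolding k\<iota>[OF b] t.\<iota>_smult_one[OF b] by (rule refl)
    finally show "\<psi> (t'.tn \<one>\<^bsub>B'\<^esub> (kR b)) = \<chi> (t.tn \<one>\<^bsub>B\<^esub> (kR b))" .
  qed
  have \<psi>tn: "\<psi> (t'.tn b r) = q.tn b (t.cut n a +>\<^bsub>t.T\<^esub> t.tn \<one>\<^bsub>B\<^esub> r)"
    if br: "b \<in> carrier B'" "r \<in> carrier RR" for b r
  proof -
    have c: "t'.\<iota> b \<in> carrier t'.T" "t'.tn \<one>\<^bsub>B'\<^esub> r \<in> carrier t'.T" using br by simp_all
    have bf: "b \<in> carrier ?fB" using br by simp
    have z: "t.cut n a +>\<^bsub>t.T\<^esub> t.tn \<one>\<^bsub>B\<^esub> r \<in> carrier ?Q"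
      by (rule hom_closed'[OF t.cut_quotient(2)[OF a]]) (use br in simp)
    have "\<psi> (t'.tn b r) = k b \<otimes>\<^bsub>q.T\<^esub> \<chi> (t.tn \<one>\<^bsub>B\<^esub> r)"
      unfolding t'.tens_split[OF br] \<psi>.hom_mult[OF c] \<psi>(2)[OF br(1)] \<psi>R[OF br(2)] by (rule refl)
    then show ?thesis unfolding q.tens_split[OF bf z] unfolding k_def \<chi>_def .
  qed
  \<comment> \<open>Pure tensors determine a homomorphism on the carrier and extensionality
    determines it elsewhere, so the description has a unique solution.\<close>
  have the: "(THE \<psi>. \<psi> \<in> alg_hom B' t'.T q.T \<and>
      (\<forall>b'\<in>carrier B'. \<forall>r\<in>carrier RR. \<psi> (t'.tn b' r) = q.tn b' (t.cut n a +>\<^bsub>t.T\<^esub> t.tn \<one>\<^bsub>B\<^esub> r)))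
    = restrict \<psi> (carrier t'.T)"
  proof (rule the_equality, intro conjI ballI)
    show "restrict \<psi> (carrier t'.T) \<in> alg_hom B' t'.T q.T"
    proof (rule alg_hom_restrictI[OF t'.T_algebra \<psi>(1)])
      fix b t assume bt: "b \<in> carrier B'" "t \<in> carrier t'.T"
      have c: "t'.\<iota> b \<in> carrier t'.T" using bt by simp
      have "\<psi> (b \<odot>\<^bsub>t'.T\<^esub> t) = \<psi> (t'.\<iota> b) \<otimes>\<^bsub>q.T\<^esub> \<psi> t"
        unfolding t'.T_simps(6) by (rule \<psi>.hom_mult[OF c bt(2)])
      also have "\<dots> = b \<odot>\<^bsub>q.T\<^esub> \<psi> t" unfolding q.T_simps(6) \<psi>(2)[OF bt(1)] k_def by (rule refl)
      finally show "\<psi> (b \<odot>\<^bsub>t'.T\<^esub> t) = b \<odot>\<^bsub>q.T\<^esub> \<psi> t" .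
    qed
    show "restrict \<psi> (carrier t'.T) (t'.tn b r) = q.tn b (t.cut n a +>\<^bsub>t.T\<^esub> t.tn \<one>\<^bsub>B\<^esub> r)"
      if "b \<in> carrier B'" "r \<in> carrier RR" for b r
      unfolding restrict_apply using \<psi>tn[OF that] t'.tens_closed[OF that] by (simp only: if_True)
    fix \<psi>1 assume \<psi>1: "\<psi>1 \<in> alg_hom B' t'.T q.T \<and>
      (\<forall>b'\<in>carrier B'. \<forall>r\<in>carrier RR. \<psi>1 (t'.tn b' r) = q.tn b' (t.cut n a +>\<^bsub>t.T\<^esub> t.tn \<one>\<^bsub>B\<^esub> r))"
    have h1: "ring_hom_cring t'.T q.T \<psi>1"
      using \<psi>1 by (intro ring_hom_cringI' t'.T_cring q.T_cring) (simp add: alg_hom_def)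
    show "\<psi>1 = restrict \<psi> (carrier t'.T)"
    proof (rule extensionalityI)
      show "\<psi>1 \<in> extensional (carrier t'.T)" using \<psi>1 by (simp add: alg_hom_def)
      fix t assume t: "t \<in> carrier t'.T"
      have "\<psi>1 t = \<psi> t"
        by (rule t'.T_hom_unique[OF h1 \<psi>(1) _ t]) (use \<psi>1 \<psi>tn in metis)
      then show "\<psi>1 t = restrict \<psi> (carrier t'.T) t" using t by simp
    qed simp
  qed
  have "hilb_map A RR B B' f (t.cut n a) = a_kernel t'.T q.T (restrict \<psi> (carrier t'.T))"
    unfolding hilb_map_def Let_def the by (rule refl)
  also have "\<dots> = a_kernel t'.T q.T \<psi>" unfolding a_kernel_def' by auto
  also have "\<dots> = t'.cut n a'"
  proof (rule t'.kernel_eq_cut[OF a' ky \<psi>(1,2,3)])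
    have cqp: "pring B ?Q (t.cuth n a) (t.cutx n a)" by (rule t.cut_quotient(3)[OF a])
    interpret p: pring B ?Q "t.cuth n a" "t.cutx n a" by (rule cqp)
    interpret ky: pring B' q.T k y by (rule ky)
    interpret rh: ring_hom_cring ?Q q.T "\<lambda>z. q.tn \<one>\<^bsub>?fB\<^esub> z" by (rule q.right_hom)
    \<comment> \<open>The relation in \<open>Q\<close> is carried to \<open>B' \<otimes> Q\<close>,
      where balance turns the coefficients \<open>a i\<close> into \<open>f (a i)\<close>.\<close>
    have "y [^]\<^bsub>q.T\<^esub> n = q.tn \<one>\<^bsub>?fB\<^esub> (t.cutx n a [^]\<^bsub>?Q\<^esub> n)"
      unfolding rh.hom_pow[OF p.x_closed] y_def \<chi>_def by (rule refl)
    also have "\<dots> = lincomb q.T (\<lambda>b. k (f b)) y n a"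
      unfolding t.cutQ_basis(2)[OF a]
      by (rule hom_lincomb[OF cqp q.right_hom]) (use kf ac in \<open>simp_all add: \<chi>_def y_def\<close>)
    also have "\<dots> = lincomb q.T k y n (\<lambda>i. f (a i))" unfolding lincomb_def by (rule refl)
    also have "\<dots> = lincomb q.T k y n a'"
      by (rule ky.lin_cong) (use eq ac' in auto)
    finally show "y [^]\<^bsub>q.T\<^esub> n = lincomb q.T k y n a'" .
  next
    fix c assume c: "c \<in> {..<n} \<rightarrow> carrier B'" and z: "lincomb q.T k y n c = \<zero>\<^bsub>q.T\<^esub>"
    let ?M = "mq_ring B n a" and ?M' = "mq_ring B' n a'" and ?h' = "mq_hom B' n a'" and ?x' = "mq_var B' n a'"
    have mp': "pring B' ?M' ?h' ?x'" by (rule t'.good_mq(1)[OF a'])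
    interpret m': pring B' ?M' ?h' ?x' by (rule mp')
    have hf: "pring B ?M' (\<lambda>b. ?h' (f b)) ?x'"
      by (rule pringI[OF ring_hom_cring_compose[OF fh m'.ring_hom_cring_axioms] m'.x_closed])
    have "?x' [^]\<^bsub>?M'\<^esub> n = lincomb ?M' ?h' ?x' n (\<lambda>i. f (a i))"
      unfolding t'.good_mq(2)[OF a'] by (rule m'.lin_cong) (use eq ac' in auto)
    then have xn: "?x' [^]\<^bsub>?M'\<^esub> n = lincomb ?M' (\<lambda>b. ?h' (f b)) ?x' n a" unfolding lincomb_def .
    \<comment> \<open>\<open>m\<close> applies \<open>f\<close> to coefficients and lets
      \<open>Q\<close> act as the second factor; with the structure map of \<open>B'\<close> it
      induces \<open>\<sigma>\<close> from \<open>B' \<otimes> Q\<close> to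
      \<open>B'[x]/(F')\<close>. A vanishing combination of powers of \<open>y\<close> goes to one
      in the target, whose basis is known.\<close>
    obtain m where m: "ring_hom_cring ?M ?M' m" "\<And>b. b \<in> carrier B \<Longrightarrow> m (mq_hom B n a b) = ?h' (f b)"
      "m (mq_var B n a) = ?x'"
      using t.B.mq_universal[OF _ hf xn] ac by blast
    interpret m: ring_hom_cring ?M ?M' m by (rule m(1))
    have mp: "ring_hom_cring t.T ?M' (\<lambda>t. m (t.proj n a t))"
      by (rule ring_hom_cring_compose[OF t.proj_props(1)[OF a] m(1)])
    have "m (t.proj n a i) = \<zero>\<^bsub>?M'\<^esub>" if "i \<in> t.cut n a" for i
      using that unfolding t.cut_def a_kernel_def' by simp
    then obtain \<rho> where \<rho>: "ring_hom_cring (t.T Quot t.cut n a) ?M' \<rho>"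
      "\<And>t. t \<in> carrier t.T \<Longrightarrow> \<rho> (t.cut n a +>\<^bsub>t.T\<^esub> t) = m (t.proj n a t)"
      using t.T.quot_lift[OF t.cut_ideal[OF a] mp] by blast
    have \<rho>Q: "ring_hom_cring ?Q ?M' \<rho>" unfolding hom_from_via[OF t.cut_quotient(1)[OF a]] by (rule \<rho>(1))
    interpret \<rho>Q: ring_hom_cring ?Q ?M' \<rho> by (rule \<rho>Q)
    have \<beta>: "ring_hom_cring ?fB ?M' ?h'"
      unfolding hom_from_via[OF t'.B.M_cring] by (rule m'.ring_hom_cring_axioms)
    have "?h' (b \<odot>\<^bsub>?fB\<^esub> \<one>\<^bsub>?fB\<^esub>) = \<rho> (b \<odot>\<^bsub>?Q\<^esub> \<one>\<^bsub>?Q\<^esub>)" if b: "b \<in> carrier B" for b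
    proof -
      have \<iota>b: "t.\<iota> b \<in> carrier t.T" using b by simp
      show ?thesis unfolding fB1[OF b] Q1[OF b] \<rho>(2)[OF \<iota>b] t.proj_props(2)[OF a b] m(2)[OF b] by (rule refl)
    qed
    from q.tens_universal[OF \<beta> \<rho>Q this] obtain \<sigma> where \<sigma>: "ring_hom_cring q.T ?M' \<sigma>"
      "\<And>b z. \<lbrakk>b \<in> carrier ?fB; z \<in> carrier ?Q\<rbrakk> \<Longrightarrow> \<sigma> (q.tn b z) = ?h' b \<otimes>\<^bsub>?M'\<^esub> \<rho> z" by blast
    interpret \<sigma>: ring_hom_cring q.T ?M' \<sigma> by (rule \<sigma>(1))
    have \<sigma>k: "\<sigma> (k b) = ?h' b" if b: "b \<in> carrier B'" for b
    proof -
      have bf: "b \<in> carrier ?fB" using b by simp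
      have hb: "?h' b \<in> carrier ?M'" by (rule m'.hom_closed[OF b])
      show ?thesis unfolding k_def \<sigma>(2)[OF bf q.R.one_closed] \<rho>Q.hom_one by (rule m'.S.r_one[OF hb])
    qed
    have \<sigma>y: "\<sigma> y = ?x'"
    proof -
      have zc: "t.cutx n a \<in> carrier ?Q"
        by (rule hom_closed'[OF t.cut_quotient(2)[OF a] t.xT_closed])
      have h1: "?h' \<one>\<^bsub>?fB\<^esub> = \<one>\<^bsub>?M'\<^esub>" using m'.hom_one by simp
      show ?thesis
        unfolding y_def \<chi>_def \<sigma>(2)[OF q.B.one_closed zc] h1 \<rho>(2)[OF t.xT_closed] t.proj_props(3)[OF a] m(3)
        by (rule m'.S.l_one[OF m'.x_closed])
    qed
    have "lincomb ?M' ?h' ?x' n c = \<sigma> (lincomb q.T k y n c)"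
      by (rule hom_lincomb[OF ky \<sigma>(1) \<sigma>k \<sigma>y, symmetric]) (use c in auto)
    also have "\<dots> = \<zero>\<^bsub>?M'\<^esub>" unfolding z by (rule \<sigma>.hom_zero)
    finally show "\<forall>i<n. c i = \<zero>\<^bsub>B'\<^esub>"
      using t'.good_mq(3)[OF a'] c unfolding power_basis_def by blast
  qed
  finally show ?thesis .
qed

end

theorem mainTheorem5:
  fixes A :: "('a, 'x) ring_scheme" and n :: nat and S :: "(nat \<Rightarrow> 'a) set"
  assumes "cring A" and "n \<ge> 1" and "submonoid S (UP A)"
  shows "represented_by A
    (hilb A (loc_algebra (UP A) S) n ::
       ('a, 'b) module \<Rightarrow> ('b \<times> ((nat \<Rightarrow> 'a) \<times> (nat \<Rightarrow> 'a)) set \<Rightarrow> int) set set set)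
    (hilb_map A (loc_algebra (UP A) S))
    (loc_algebra (elem_sym_algebra A n) (prod_eval A n ` S))"
proof -
  interpret hilb_repr A S n
    using assms by (simp add: hilb_repr_def hilb_repr_axioms_def hilb_poly_def hilb_poly_axioms_def mpoly_ring_def)
  \<comment> \<open>The bijection sends a homomorphism to the point cut out by the image of the
    universal polynomial.\<close>
  define \<Phi> where "\<Phi> = (\<lambda>(B :: ('a, 'b) module) g. hilb_tensor.cut A B S n (coefs g))"
  show ?thesis
    unfolding represented_by_def
  proof (intro conjI H_algebra exI[of _ \<Phi>] allI impI)
    fix B :: "('a, 'b) module" assume B: "algebra A B"
    interpret t: hilb_tensor A B S by (rule tensor_locale[OF B])
    show "bij_betw (\<Phi> B) (alg_hom A H B) (hilb A RR n B)"
      unfolding t.hilb_eq_cuts bij_betw_def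
    proof
      show "inj_on (\<Phi> B) (alg_hom A H B)"
      proof (rule inj_onI)
        fix g g' assume g: "g \<in> alg_hom A H B" "g' \<in> alg_hom A H B" and eq: "\<Phi> B g = \<Phi> B g'"
        show "g = g'"
          by (rule coefs_inj[OF B g], rule t.cut_inj[OF coefs_good[OF B g(1)] coefs_good[OF B g(2)]])
            (use eq in \<open>simp_all add: \<Phi>_def\<close>)
      qed
      show "\<Phi> B ` alg_hom A H B = {t.cut n a | a. t.good n a}"
      proof (intro equalityI subsetI)
        fix I assume "I \<in> \<Phi> B ` alg_hom A H B"
        then obtain g where "I = \<Phi> B g" "g \<in> alg_hom A H B" by (rule imageE)
        then show "I \<in> {t.cut n a | a. t.good n a}" using coefs_good[OF B] unfolding \<Phi>_def by blast
      next
        fix I assume "I \<in> {t.cut n a | a. t.good n a}"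
        then obtain a where a: "I = t.cut n a" "t.good n a" by blast
        obtain g where g: "g \<in> alg_hom A H B" "\<And>i. i < n \<Longrightarrow> coefs g i = a i"
          using coefs_surj[OF B a(2)] by blast
        have "I = \<Phi> B g"
          unfolding a(1) \<Phi>_def by (rule t.cut_cong[OF a(2) coefs_good[OF B g(1)] g(2)[symmetric]])
        then show "I \<in> \<Phi> B ` alg_hom A H B" using g(1) by (rule image_eqI)
      qed
    qed
  next
    fix B B' :: "('a, 'b) module" and f g
    assume B: "algebra A B" and B': "algebra A B'" and f: "f \<in> alg_hom A B B'" and g: "g \<in> alg_hom A H B"
    have fg: "compose (carrier H) f g \<in> alg_hom A H B'"
    proof -
      interpret B: algebra A B by (rule B)
      interpret B': algebra A B' by (rule B')
      interpret H: algebra A H by (rule H_algebra)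
      have hg: "ring_hom_cring H B g"
        using g by (intro ring_hom_cringI' H.M_cring B.M_cring) (simp add: alg_hom_def)
      interpret g: ring_hom_cring H B g by (rule hg)
      have hf: "ring_hom_cring B B' f"
        using f by (intro ring_hom_cringI' B.M_cring B'.M_cring) (simp add: alg_hom_def)
      show ?thesis
        unfolding compose_def
        by (rule alg_hom_restrictI[OF H_algebra ring_hom_cring_compose[OF hg hf]])
          (use f g g.hom_closed in \<open>simp add: alg_hom_def\<close>)
    qed
    show "\<Phi> B' (compose (carrier H) f g) = hilb_map A RR B B' f (\<Phi> B g)"
      unfolding \<Phi>_def
    proof (rule hilb_map_cut[OF B B' f coefs_good[OF B g] coefs_good[OF B' fg], symmetric])
      fix i assume i: "i < n"
      \<comment> \<open>\<open>compose\<close> is restricted to the carrier of \<open>H\<close>;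
        since \<open>acoef i\<close> lies there, composing with \<open>f\<close> applies
        \<open>f\<close> to the coefficients.\<close>
      have "eH (acoef i) \<in> carrier H" unfolding H_simps by (rule LE.L_closed[OF acoef_closed[OF i]]) auto
      then show "coefs (compose (carrier H) f g) i = f (coefs g i)" by (simp add: coefs_def compose_def)
    qed
  qed
qed

end
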